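(* Let $(X,d)$ be a complete and separable metric space, $I=[0,1]$, and let $(\mu_t)_{t\in I}\subset P(X)$ with $\mu_0\in P_1(X)$. Consider the following conditions on a measure $\pi\in P(D(I:X))$: (i) $\pi$ is concentrated on the set of $\mathcal{BV}$-geodesics; (ii) $(e_t)_\#\pi=\mu_t$ for all $t\in I$; (iii) $W_1(\mu_0,\mu_1)=\int d(\gamma_0,\gamma_1)\,\mathrm{d}\pi(\gamma)<\infty$; (iv) for all $t\in I$, $\int|D\gamma|(\{t\})\,\mathrm{d}\pi(\gamma)=0$; (v) for $\mathcal L^1$-a.e. $t\in I$, $\lim_{h\to0}\int\frac{d(\gamma_t,\gamma_{t+h})}{|h|}\,\mathrm{d}\pi(\gamma)=W_1(\mu_0,\mu_1)$. Then: - $(\mu_t)$ is a $\mathcal{BV}$-geodesic with respect to the distance $W_1$ if and only if there exists $\pi\in P(D(I:X))$ satisfying (i)–(iii); - $(\mu_t)$ is continuous and length minimising if and only if there exists $\pi\in P(D(I:X))$ satisfying (i)–(iii) and, in addition, (iv); - $(\mu_t)$ is a constant-speed geodesic if and only if there exists $\pi\in P(D(I:X))$ satisfying (i)–(iii) and, in addition, (v).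
   Context: $I=[0,1]$; $\mathcal L^1$ is Lebesgue measure. $P(\cdot)$ denotes the set of Borel probability measures; $P_1(X)\subset P(X)$ is the subset of those with finite first moment, endowed with the $1$-Wasserstein distance $W_1$ (a complete separable metric space). For a complete separable metric space $(Y,d)$ (below $Y=X$ or $Y=(P_1(X),W_1)$): - For $J\subset I$, $\mathrm{Var}(u;J)=\sup\{\sum_{i=0}^k d(u(t_i),u(t_{i+1})): t_0<\dots<t_{k+1},\ t_j\in J\}$ and $\mathrm{ess\,Var}(u;J)=\inf\{\mathrm{Var}(v;J): v=u \text{ a.e. on } J\}$. - $D(I:Y)$ is the set of càdlàg curves (right-continuous with left limits), equipped with the Skorokhod metric $d_{Sk}(\gamma,\tilde\gamma)=\inf_\lambda\max\{\|\lambda\|_B,\sup_{t}d(\gamma(t),\tilde\gamma(\lambda(t)))\}$, the infimum over increasing homeomorphisms $\lambda:I\to I$, with $\|\lambda\|_B=\sup_{0\le s<t\le1}|\log\frac{\lambda(t)-\lambda(s)}{t-s}|$. $\mathcal{BV}(I:Y)\subset D(I:Y)$ is the set of càdlàg curves with $\mathrm{ess\,Var}(u;I)<\infty$. - For $u$ with $\mathrm{ess\,Var}(u;I)<\infty$, the variation measure $|Du|$ is the Lebesgue–Stieltjes measure on $I$ induced by the non-decreasing function $V(t)=\mathrm{ess\,Var}(u;(0,t))$, where the Lebesgue–Stieltjes measure $|Df|$ of a non-decreasing $f:I\to\mathbb R$ is given by $|Df|((a,b))=f(b^-)-f(a^+)$. (Since $V$ does not involve the value $u(1)$, a jump of $u$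 at $t=1$ is not counted by $|Du|$.) - A curve $\gamma\in D([0,1]:Y)$ is a $\mathcal{BV}$-geodesic with respect to $d$ if $d(\gamma_0,\gamma_1)=|D\gamma|([0,1])$. - As usual, a continuous curve is length minimising if its length $\mathrm{Var}(\gamma;I)$ equals $d(\gamma_0,\gamma_1)$, and a curve is a constant-speed geodesic if $d(\gamma_s,\gamma_t)=|t-s|\,d(\gamma_0,\gamma_1)$ for all $s,t\in I$; for $(\mu_t)$ these notions are taken in $(P_1(X),W_1)$. $e_t(\gamma)=\gamma_t=\gamma(t)$ is the evaluation map on $D(I:X)$ and $\#$ denotes push-forward.
   Formalization: Càdlàg curves (in X and in P_1(X)) are also required to have no jump at t=1, since |Du| ignores such a jump and the claim then fails: on R, γ_t=t for t<1, γ_1=-1, π=δ_γ satisfies (i)–(v), but μ_t=δ_{γ_t} is discontinuous at 1. *)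

theory Defs
  imports "HOL-Probability.Probability" "HOL-Real_Asymp.Real_Asymp"
begin

section \<open>Variation of curves in a metric space\<close>

text \<open>
  Metric spaces \<open>(Y, d)\<close> are given by a carrier \<open>M\<close> and a distance \<open>d\<close>, as in the locale
  \<^locale>\<open>Metric_space\<close>, because both a type and the Wasserstein space below occur as \<open>Y\<close>.
  Curves are functions on the reals; only their values on \<open>I = {0..1}\<close> matter.
\<close>

definition variation :: "('b \<Rightarrow> 'b \<Rightarrow> real) \<Rightarrow> (real \<Rightarrow> 'b) \<Rightarrow> real set \<Rightarrow> ennreal" where
  "variation d u J =
     Sup {\<Sum>i\<le>k. ennreal (d (u (t i)) (u (t (Suc i)))) | (k::nat) t.
            strict_mono_on {..Suc k} t \<and> t ` {..Suc k} \<subseteq> J}"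

definition ess_variation ::
    "'b set \<Rightarrow> ('b \<Rightarrow> 'b \<Rightarrow> real) \<Rightarrow> (real \<Rightarrow> 'b) \<Rightarrow> real set \<Rightarrow> ennreal" where
  "ess_variation M d u J =
     Inf {variation d v J | v. v \<in> J \<rightarrow> M \<and> (AE t in lborel. t \<in> J \<longrightarrow> v t = u t)}"

text \<open>
  The Lebesgue--Stieltjes measure on \<open>I\<close> of a non-decreasing \<open>f : I \<rightarrow> \<real>\<close>. The function \<open>f\<close> is extended
  by constants outside \<open>I\<close> and, since \<^const>\<open>interval_measure\<close> expects a right-continuous
  function, replaced by its right limits, which does not change \<open>f(b-) - f(a+)\<close>.
\<close>

definition stieltjes :: "(real \<Rightarrow> real) \<Rightarrow> real measure" where
  "stieltjes f =
     restrict_space (interval_measure (\<lambda>x. Lim (at_right x) (\<lambda>s. f (max 0 (min 1 s))))) {0..1}"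

definition variation_measure ::
    "'b set \<Rightarrow> ('b \<Rightarrow> 'b \<Rightarrow> real) \<Rightarrow> (real \<Rightarrow> 'b) \<Rightarrow> real measure" where
  "variation_measure M d u = stieltjes (\<lambda>t. enn2real (ess_variation M d u {0<..<t}))"

lemma mono_tendsto_at_right:
  fixes g :: "real \<Rightarrow> real"
  assumes "mono g"
  shows "(g \<longlongrightarrow> (INF s\<in>{x<..}. g s)) (at_right x)"
proof (rule order_tendstoI)
  have bdd: "bdd_below (g ` {x<..})"
    using assms by (auto simp: bdd_below_def mono_def intro!: exI[of _ "g x"])
  fix a assume "a < (INF s\<in>{x<..}. g s)"
  then have "a < g s" if "x < s" for s
    using cINF_lower[OF bdd, of s] that by auto
  then show "\<forall>\<^sub>F s in at_right x. a < g s"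
    by (simp add: eventually_at_filter)
next
  have bdd: "bdd_below (g ` {x<..})"
    using assms by (auto simp: bdd_below_def mono_def intro!: exI[of _ "g x"])
  fix a assume "(INF s\<in>{x<..}. g s) < a"
  then obtain y where y: "x < y" "g y < a"
    using cINF_less_iff[OF _ bdd] by auto
  then have "g s < a" if "s < y" for s
    using that assms by (meson less_imp_le monoD order.strict_trans1)
  then show "\<forall>\<^sub>F s in at_right x. g s < a"
    using y(1) by (auto simp: eventually_at_right_field)
qed

lemma emeasure_stieltjes_Ioo:
  fixes f :: "real \<Rightarrow> real"
  assumes f: "mono_on {0..1} f" and ab: "0 \<le> a" "a < b" "b \<le> 1"
  shows "emeasure (stieltjes f) {a<..<b} = ennreal (Lim (at_left b) f - Lim (at_right a) f)"
proof -
  define g where "g = (\<lambda>s. f (max 0 (min 1 s)))"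
  define F where "F = (\<lambda>x. Lim (at_right x) g)"
  have g: "mono g"
    using f by (auto simp: g_def mono_def mono_on_def)
  have F_lim: "(g \<longlongrightarrow> F x) (at_right x)" for x
    unfolding F_def using tendsto_Lim[OF _ mono_tendsto_at_right[OF g, of x]]
      mono_tendsto_at_right[OF g, of x] by simp
  have F_le: "F x \<le> g y" if "x < y" for x y
    by (rule tendsto_upperbound[OF F_lim]) (use that g in \<open>auto simp: eventually_at_right_field mono_def intro!: exI[of _ y]\<close>)
  have g_le: "g x \<le> F x" for x
    by (rule tendsto_lowerbound[OF F_lim]) (use g in \<open>auto simp: eventually_at_filter mono_def\<close>)
  have F_mono: "F x \<le> F y" if "x \<le> y" for x y
    using that F_le[of x y] g_le[of y] by (cases "x = y") auto
  have F_cont: "continuous (at_right x) F" for x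
    unfolding continuous_within
  proof (rule order_tendstoI)
    fix c assume "c < F x"
    then show "\<forall>\<^sub>F s in at_right x. c < F s"
      using F_mono by (auto simp: eventually_at_filter intro!: always_eventually less_le_trans[of c "F x"])
  next
    fix c assume "F x < c"
    then have "\<forall>\<^sub>F s in at_right x. g s < c"
      using F_lim order_tendstoD(2) by blast
    then obtain y where y: "x < y" "\<And>s. x < s \<Longrightarrow> s < y \<Longrightarrow> g s < c"
      by (auto simp: eventually_at_right_field)
    have "F s < c" if "x < s" "s < y" for s
    proof -
      obtain r where "s < r" "r < y" using dense \<open>s < y\<close> by blast
      then show ?thesis using F_le[of s r] y(2)[of r] that by simp
    qed
    then show "\<forall>\<^sub>F s in at_right x. F s < c"
      using y(1) by (auto simp: eventually_at_right_field)
  qed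
  have F_a: "Lim (at_right a) f = F a"
  proof (rule tendsto_Lim)
    have "\<forall>\<^sub>F s in at_right a. g s = f s"
      using ab by (auto simp: eventually_at_right_field g_def intro!: exI[of _ b])
    then show "(f \<longlongrightarrow> F a) (at_right a)"
      using F_lim[of a] tendsto_cong by fast
  qed simp
  define c where "c = (\<lambda>n::nat. b - (b - a) / (real n + 2))"
  have c: "a < c n" "c n < b" "a \<le> c n" for n
  proof -
    have "(b - a) / (real n + 2) < b - a"
      using ab(2) by (simp add: divide_less_eq)
    then show "a < c n" "a \<le> c n" by (auto simp: c_def)
    show "c n < b" using ab(2) by (simp add: c_def)
  qed
  have c_inc: "incseq c"
    using ab(2) by (auto simp: c_def incseq_def intro!: divide_left_mono)
  have c_lim: "c \<longlonglongrightarrow> b"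
    unfolding c_def by real_asymp
  have bdd: "bdd_above (range (\<lambda>n. F (c n)))"
    using F_le c(2) by (auto simp: bdd_above_def)
  define L where "L = (SUP n. F (c n))"
  have L: "(\<lambda>n. F (c n)) \<longlonglongrightarrow> L"
    unfolding L_def using bdd c_inc F_mono
    by (intro LIMSEQ_incseq_SUP) (auto simp: incseq_def)
  have gL: "g s \<le> L" if "s < b" for s
  proof -
    have "\<forall>\<^sub>F n in sequentially. s < c n"
      using c_lim that order_tendstoD(1) by blast
    then obtain n where "s < c n" by (auto simp: eventually_sequentially)
    then have "g s \<le> F (c n)" using g_le[of s] F_mono[of s "c n"] by simp
    also have "\<dots> \<le> L" unfolding L_def by (rule cSUP_upper[OF _ bdd]) simp
    finally show ?thesis .
  qed
  have L_b: "Lim (at_left b) f = L"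
  proof (rule tendsto_Lim)
    have "(g \<longlongrightarrow> L) (at_left b)"
    proof (rule order_tendstoI)
      fix z assume "z < L"
      then have "\<forall>\<^sub>F n in sequentially. z < F (c n)"
        using L order_tendstoD(1) by blast
      then obtain n where n: "z < F (c n)" by (auto simp: eventually_sequentially)
      have "z < g s" if "c n < s" for s
        using F_le[OF that] n by simp
      then show "\<forall>\<^sub>F s in at_left b. z < g s"
        using c(2)[of n] by (auto simp: eventually_at_left_field)
    next
      fix z assume "L < z"
      then have "g s < z" if "s < b" for s using gL[OF that] by simp
      then show "\<forall>\<^sub>F s in at_left b. g s < z"
        by (simp add: eventually_at_filter)
    qed
    moreover have "\<forall>\<^sub>F s in at_left b. g s = f s"
      using ab by (auto simp: eventually_at_left_field g_def intro!: exI[of _ a])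
    ultimately show "(f \<longlongrightarrow> L) (at_left b)"
      using tendsto_cong by fast
  qed simp
  have Un: "(\<Union>n. {a<..c n}) = {a<..<b}"
  proof (intro equalityI subsetI)
    fix s assume s: "s \<in> {a<..<b}"
    then have "\<forall>\<^sub>F n in sequentially. s < c n"
      using c_lim order_tendstoD(1)[of c b sequentially s] by simp
    then obtain n where "s < c n" by (auto simp: eventually_sequentially)
    then show "s \<in> (\<Union>n. {a<..c n})" using s by (auto intro!: exI[of _ n])
  next
    fix s assume "s \<in> (\<Union>n. {a<..c n})"
    then obtain n where "a < s" "s \<le> c n" by auto
    then show "s \<in> {a<..<b}" using c(2)[of n] by simp
  qed
  have "(\<lambda>n. emeasure (interval_measure F) {a<..c n}) \<longlonglongrightarrow>
      emeasure (interval_measure F) (\<Union>n. {a<..c n})"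
    using c_inc by (intro Lim_emeasure_incseq) (auto simp: incseq_def, meson order_trans)
  moreover have "emeasure (interval_measure F) {a<..c n} = ennreal (F (c n) - F a)" for n
    by (rule emeasure_interval_measure_Ioc[OF c(3) F_mono F_cont])
  ultimately have "(\<lambda>n. ennreal (F (c n) - F a)) \<longlonglongrightarrow> emeasure (interval_measure F) {a<..<b}"
    by (simp add: Un)
  moreover have "(\<lambda>n. ennreal (F (c n) - F a)) \<longlonglongrightarrow> ennreal (L - F a)"
    by (intro tendsto_ennrealI tendsto_diff L tendsto_const)
  ultimately have "emeasure (interval_measure F) {a<..<b} = ennreal (L - F a)"
    using LIMSEQ_unique by blast
  moreover have "emeasure (stieltjes f) {a<..<b} = emeasure (interval_measure F) {a<..<b}"
    unfolding stieltjes_def F_def g_def using ab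
    by (intro emeasure_restrict_space) auto
  ultimately show ?thesis using F_a L_b by simp
qed


section \<open>Cadlag curves, the Skorokhod distance, BV-geodesics\<close>

text \<open>
  Curves in \<open>D(I:Y)\<close> are normalised as functions that are \<^term>\<open>undefined\<close> outside \<open>I\<close>.

  Endpoint convention: a cadlag curve on the closed interval \<open>I\<close> is understood to have no jump at the
  terminal time, i.e. \<open>\<gamma> 1\<close> is the left limit of \<open>\<gamma>\<close> at \<open>1\<close>. The measure \<open>|D\<gamma>|\<close> depends only on
  \<open>\<gamma>\<close> on \<open>(0,1)\<close> and does not see such a jump. If it were allowed, the curve \<open>\<gamma> t = t\<close> for \<open>t < 1\<close>,
  \<open>\<gamma> 1 = -1\<close> in \<open>\<real>\<close> would satisfy \<open>d(\<gamma> 0, \<gamma> 1) = |D\<gamma>|(I)\<close>.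
\<close>

definition cadlag :: "'b set \<Rightarrow> ('b \<Rightarrow> 'b \<Rightarrow> real) \<Rightarrow> (real \<Rightarrow> 'b) set" where
  "cadlag M d = {\<gamma> \<in> {0..1} \<rightarrow>\<^sub>E M.
     (\<forall>t\<in>{0..<1}. ((\<lambda>s. d (\<gamma> s) (\<gamma> t)) \<longlongrightarrow> 0) (at_right t)) \<and>
     (\<forall>t\<in>{0<..1}. \<exists>l\<in>M. ((\<lambda>s. d (\<gamma> s) l) \<longlongrightarrow> 0) (at_left t)) \<and>
     ((\<lambda>s. d (\<gamma> s) (\<gamma> 1)) \<longlongrightarrow> 0) (at_left 1)}"

definition time_changes :: "(real \<Rightarrow> real) set" where
  "time_changes = {\<theta>. strict_mono_on {0..1} \<theta> \<and> (\<exists>\<kappa>. homeomorphism {0..1} {0..1} \<theta> \<kappa>)}"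

definition log_slope :: "(real \<Rightarrow> real) \<Rightarrow> ennreal" where
  "log_slope \<theta> = Sup {ennreal \<bar>ln ((\<theta> t - \<theta> s) / (t - s))\<bar> | s t. 0 \<le> s \<and> s < t \<and> t \<le> 1}"

definition skorokhod_dist ::
    "('b \<Rightarrow> 'b \<Rightarrow> real) \<Rightarrow> (real \<Rightarrow> 'b) \<Rightarrow> (real \<Rightarrow> 'b) \<Rightarrow> real" where
  "skorokhod_dist d \<gamma> \<gamma>' = enn2real
     (INF \<theta>\<in>time_changes. max (log_slope \<theta>) (SUP t\<in>{0..1}. ennreal (d (\<gamma> t) (\<gamma>' (\<theta> t)))))"

definition skorokhod_borel :: "'b set \<Rightarrow> ('b \<Rightarrow> 'b \<Rightarrow> real) \<Rightarrow> (real \<Rightarrow> 'b) measure" where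
  "skorokhod_borel M d = sigma (cadlag M d)
     {U. openin (Metric_space.mtopology (cadlag M d) (skorokhod_dist d)) U}"

definition BV_curves :: "'b set \<Rightarrow> ('b \<Rightarrow> 'b \<Rightarrow> real) \<Rightarrow> (real \<Rightarrow> 'b) set" where
  "BV_curves M d = {\<gamma> \<in> cadlag M d. ess_variation M d \<gamma> {0..1} < \<infinity>}"

definition BV_geodesic :: "'b set \<Rightarrow> ('b \<Rightarrow> 'b \<Rightarrow> real) \<Rightarrow> (real \<Rightarrow> 'b) \<Rightarrow> bool" where
  "BV_geodesic M d \<gamma> \<longleftrightarrow> \<gamma> \<in> BV_curves M d \<and>
     ennreal (d (\<gamma> 0) (\<gamma> 1)) = emeasure (variation_measure M d \<gamma>) {0..1}"

definition continuous_curve :: "'b set \<Rightarrow> ('b \<Rightarrow> 'b \<Rightarrow> real) \<Rightarrow> (real \<Rightarrow> 'b) \<Rightarrow> bool" where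
  "continuous_curve M d \<gamma> \<longleftrightarrow> \<gamma> \<in> {0..1} \<rightarrow> M \<and>
     (\<forall>t\<in>{0..1}. ((\<lambda>s. d (\<gamma> s) (\<gamma> t)) \<longlongrightarrow> 0) (at t within {0..1}))"

definition length_minimising :: "('b \<Rightarrow> 'b \<Rightarrow> real) \<Rightarrow> (real \<Rightarrow> 'b) \<Rightarrow> bool" where
  "length_minimising d \<gamma> \<longleftrightarrow> variation d \<gamma> {0..1} = ennreal (d (\<gamma> 0) (\<gamma> 1))"

definition constant_speed_geodesic ::
    "'b set \<Rightarrow> ('b \<Rightarrow> 'b \<Rightarrow> real) \<Rightarrow> (real \<Rightarrow> 'b) \<Rightarrow> bool" where
  "constant_speed_geodesic M d \<gamma> \<longleftrightarrow> \<gamma> \<in> {0..1} \<rightarrow> M \<and>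
     (\<forall>s\<in>{0..1}. \<forall>t\<in>{0..1}. d (\<gamma> s) (\<gamma> t) = \<bar>t - s\<bar> * d (\<gamma> 0) (\<gamma> 1))"


section \<open>The 1-Wasserstein space\<close>

definition couplings ::
    "'a::polish_space measure \<Rightarrow> 'a measure \<Rightarrow> ('a \<times> 'a) measure set" where
  "couplings \<mu> \<nu> = {p \<in> space (prob_algebra borel).
     distr p borel fst = \<mu> \<and> distr p borel snd = \<nu>}"

text \<open>Extended-valued, hence meaningful on all Borel probability measures.\<close>

definition W1 :: "'a::polish_space measure \<Rightarrow> 'a measure \<Rightarrow> ennreal" where
  "W1 \<mu> \<nu> = (INF p\<in>couplings \<mu> \<nu>. \<integral>\<^sup>+ z. ennreal (dist (fst z) (snd z)) \<partial>p)"

definition P1 :: "'a::polish_space measure set" where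
  "P1 = {\<mu> \<in> space (prob_algebra borel). \<exists>x\<^sub>0. (\<integral>\<^sup>+ x. ennreal (dist x x\<^sub>0) \<partial>\<mu>) < \<infinity>}"

definition W1_dist :: "'a::polish_space measure \<Rightarrow> 'a measure \<Rightarrow> real" where
  "W1_dist \<mu> \<nu> = enn2real (W1 \<mu> \<nu>)"


section \<open>Lifts of curves of measures\<close>

abbreviation path_borel :: "(real \<Rightarrow> 'a::polish_space) measure" where
  "path_borel \<equiv> skorokhod_borel UNIV dist"

abbreviation curve_measure :: "(real \<Rightarrow> 'a::polish_space) \<Rightarrow> real measure" where
  "curve_measure \<equiv> variation_measure UNIV dist"

definition geodesic_lift ::
    "(real \<Rightarrow> 'a::polish_space measure) \<Rightarrow> (real \<Rightarrow> 'a) measure \<Rightarrow> bool" where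
  "geodesic_lift \<mu> \<pi> \<longleftrightarrow>
     (AE \<gamma> in \<pi>. BV_geodesic UNIV dist \<gamma>) \<and>
     (\<forall>t\<in>{0..1}. distr \<pi> borel (\<lambda>\<gamma>. \<gamma> t) = \<mu> t) \<and>
     W1 (\<mu> 0) (\<mu> 1) = (\<integral>\<^sup>+ \<gamma>. ennreal (dist (\<gamma> 0) (\<gamma> 1)) \<partial>\<pi>) \<and>
     (\<integral>\<^sup>+ \<gamma>. ennreal (dist (\<gamma> 0) (\<gamma> 1)) \<partial>\<pi>) < \<infinity>"

end

(* A curve u in a metric space is a BV-geodesic iff it is cadlag and "aligned":
   d(u s, u t) + d(u t, u r) = d(u s, u r) for all s <= t <= r. If pi is a lift of (mu_t), then the
   cost E(s,t), the integral of d(gamma_s, gamma_t), is additive in time and dominates W_1(mu_s, mu_t),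
   and the two agree for (s,t) = (0,1); the triangle inequality then forces E = W_1 throughout.
   So alignment, regularity and speed pass from the paths to (mu_t), the limits being justified by
   dominated convergence with the majorant d(gamma_0, gamma_1).
   Conversely, for an aligned curve (mu_t), optimal couplings between consecutive dyadic times of a
   fixed level are glued along a Markov chain; alignment makes the chain optimal between any two of
   these times. A limit of such laws over all levels gives random points on the dyadic times whose
   distances realise W_1. Equality in the integrated triangle inequality makes almost every sample
   aligned, hence of finite length, so it has right limits, which form the desired cadlag path. *)
theory Submission
  imports Defs "HOL-Library.Diagonal_Subsequence"
begin

section \<open>BV-geodesics are aligned curves\<close>

text \<open>At a fixed dyadic time the one-time marginal is the same from some level on, so its code
  by a countable partition is tight for free. Joint probabilities of codes then converge along a
  diagonal subsequence, and the limit is realised on the unit interval. Only upper bounds on mean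
  distances have to survive the limit. Exact optimality is recovered afterwards, because W_1 is an
  infimum over couplings; so couplings may be nearly optimal and glued approximately.

  Two obstacles shape the rest. The lift must be a measure on the Borel sets of the Skorokhod
  metric, so a path-valued map has to be shown measurable from its evaluations; each path is
  approximated by step paths for this. And |D gamma| sees only the open interval, so the ends must
  be recovered from right continuity at 0 and left continuity at 1; for the constructed paths the
  latter is an additional almost sure event.

  For constant speed, a monotone function increases on each interval at least by the integral of its
  a.e. derivative. Equality over the whole of I then forces equality on every subinterval.\<close>

lemma tendsto_clamp_at_right:
  fixes f :: "real \<Rightarrow> real"
  assumes f: "mono_on {0..1} f" and F: "F = (\<lambda>x. Lim (at_right x) (\<lambda>s. f (max 0 (min 1 s))))"
  shows "((\<lambda>s. f (max 0 (min 1 s))) \<longlongrightarrow> F x) (at_right x)"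
proof -
  have "mono (\<lambda>s. f (max 0 (min 1 s)))"
    using f by (auto simp: mono_def mono_on_def)
  from mono_tendsto_at_right[OF this, of x] show ?thesis
    unfolding F using tendsto_Lim[OF _ mono_tendsto_at_right[OF \<open>mono _\<close>, of x]] by simp
qed

text \<open>\<open>{a..b}\<close> is the decreasing intersection of half-open intervals that start
  at a - 1/(n+1), so continuity from above applies. For a = 0 these start outside I, where the
  clamped f is constant; hence the mass f(0+) - f(0) of the point 0 is counted.\<close>

lemma emeasure_stieltjes_Icc:
  fixes f :: "real \<Rightarrow> real"
  assumes f: "mono_on {0..1} f" and F: "F = (\<lambda>x. Lim (at_right x) (\<lambda>s. f (max 0 (min 1 s))))"
    and ab: "0 \<le> a" "a \<le> b" "b \<le> 1"
  shows "(\<lambda>n. ennreal (F b - F (a - 1 / (real n + 1)))) \<longlonglongrightarrow> emeasure (stieltjes f) {a..b}"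
proof -
  define g where "g = (\<lambda>s. f (max 0 (min 1 s)))"
  have g: "mono g" using f by (auto simp: g_def mono_def mono_on_def)
  have F_lim: "(g \<longlongrightarrow> F x) (at_right x)" for x
    unfolding g_def using tendsto_clamp_at_right[OF f F] .
  have F_le: "F x \<le> g y" if "x < y" for x y
    by (rule tendsto_upperbound[OF F_lim])
      (use that g in \<open>auto simp: eventually_at_right_field mono_def intro!: exI[of _ y]\<close>)
  have g_le: "g x \<le> F x" for x
    by (rule tendsto_lowerbound[OF F_lim]) (use g in \<open>auto simp: eventually_at_filter mono_def\<close>)
  have F_mono: "F x \<le> F y" if "x \<le> y" for x y
    using that F_le[of x y] g_le[of y] by (cases "x = y") auto
  have F_cont: "continuous (at_right x) F" for x
    unfolding continuous_within
  proof (rule order_tendstoI)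
    fix c assume "c < F x"
    then show "\<forall>\<^sub>F s in at_right x. c < F s"
      using F_mono by (auto simp: eventually_at_filter intro!: always_eventually less_le_trans[of c "F x"])
  next
    fix c assume "F x < c"
    then have "\<forall>\<^sub>F s in at_right x. g s < c"
      using F_lim order_tendstoD(2) by blast
    then obtain y where y: "x < y" "\<And>s. x < s \<Longrightarrow> s < y \<Longrightarrow> g s < c"
      by (auto simp: eventually_at_right_field)
    have "F s < c" if "x < s" "s < y" for s
    proof -
      obtain r where "s < r" "r < y" using dense \<open>s < y\<close> by blast
      then show ?thesis using F_le[of s r] y(2)[of r] that by simp
    qed
    then show "\<forall>\<^sub>F s in at_right x. F s < c"
      using y(1) by (auto simp: eventually_at_right_field)
  qed
  define c where "c = (\<lambda>n::nat. a - 1 / (real n + 1))"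
  have c: "c n < a" "c n \<le> b" for n
    using ab by (auto simp: c_def intro: order_trans[of _ a])
  have c_inc: "incseq c"
    by (auto simp: c_def incseq_def intro!: divide_left_mono)
  have c_lim: "c \<longlonglongrightarrow> a"
    unfolding c_def by real_asymp
  have Int: "(\<Inter>n. {c n<..b}) = {a..b}"
  proof (intro equalityI subsetI)
    fix s assume s: "s \<in> (\<Inter>n. {c n<..b})"
    then have "a \<le> s" by (intro LIMSEQ_le_const2[OF c_lim]) (auto intro: less_imp_le)
    then show "s \<in> {a..b}" using s by simp
  next
    fix s assume "s \<in> {a..b}"
    then show "s \<in> (\<Inter>n. {c n<..b})" using c(1) by (auto intro: less_le_trans)
  qed
  have e: "emeasure (interval_measure F) {c n<..b} = ennreal (F b - F (c n))" for n
    by (rule emeasure_interval_measure_Ioc[OF c(2) F_mono F_cont])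
  have "(\<lambda>n. emeasure (interval_measure F) {c n<..b}) \<longlonglongrightarrow>
      emeasure (interval_measure F) (\<Inter>n. {c n<..b})"
    using c_inc by (intro Lim_emeasure_decseq) (auto simp: decseq_def incseq_def e, meson order_le_less_trans)
  then have "(\<lambda>n. ennreal (F b - F (c n))) \<longlonglongrightarrow> emeasure (interval_measure F) {a..b}"
    unfolding e Int .
  moreover have "emeasure (stieltjes f) {a..b} = emeasure (interval_measure F) {a..b}"
    unfolding stieltjes_def F using ab
    by (intro emeasure_restrict_space) auto
  ultimately show ?thesis by (simp add: c_def)
qed

section \<open>Essential variation of cadlag curves\<close>

lemma AE_lborel_obtain_Ioo:
  assumes "AE t in lborel. P t" "a < (b::real)"
  obtains t where "a < t" "t < b" "P t"
proof -
  have "\<exists>t\<in>{a<..<b}. P t"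
  proof (rule ccontr)
    assume "\<not> ?thesis"
    then have nP: "\<not> P t" if "t \<in> {a<..<b}" for t using that by blast
    have "AE t in lborel. t \<notin> {a<..<b}"
      using assms(1) by eventually_elim (use nP in blast)
    then have "emeasure lborel {a<..<b} = 0"
      by (subst (asm) AE_iff_measurable[of "{a<..<b}"]) auto
    then show False using assms(2) by simp
  qed
  then show ?thesis using that by auto
qed

lemma variation_mono: "J \<subseteq> J' \<Longrightarrow> variation d u J \<le> variation d u J'"
  unfolding variation_def by (intro Sup_subset_mono) blast

lemma variation_geI:
  assumes "strict_mono_on {..Suc k} t" "t ` {..Suc k} \<subseteq> J"
  shows "(\<Sum>i\<le>k. ennreal (d (u (t i)) (u (t (Suc i))))) \<le> variation d u J"
  unfolding variation_def by (intro Sup_upper) (use assms in blast)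

lemma variation_ge2:
  assumes "s < t" "s \<in> J" "t \<in> J"
  shows "ennreal (d (u s) (u t)) \<le> variation d u J"
  using variation_geI[of 0 "\<lambda>i. if i = 0 then s else t" J d u] assms
  by (auto simp: strict_mono_on_def)

lemma ess_variation_mono:
  assumes "J \<subseteq> J'"
  shows "ess_variation M d u J \<le> ess_variation M d u J'"
  unfolding ess_variation_def
proof (rule Inf_mono)
  fix x assume "x \<in> {variation d v J' | v. v \<in> J' \<rightarrow> M \<and> (AE t in lborel. t \<in> J' \<longrightarrow> v t = u t)}"
  then obtain v where v: "x = variation d v J'" "v \<in> J' \<rightarrow> M" "AE t in lborel. t \<in> J' \<longrightarrow> v t = u t"
    by auto
  have "AE t in lborel. t \<in> J \<longrightarrow> v t = u t"
    using v(3) by eventually_elim (use assms in auto)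
  then show "\<exists>a\<in>{variation d v J | v. v \<in> J \<rightarrow> M \<and> (AE t in lborel. t \<in> J \<longrightarrow> v t = u t)}. a \<le> x"
    using v assms by (intro bexI[of _ "variation d v J"] CollectI exI[of _ v]) (auto intro: variation_mono)
qed

lemma cadlagD:
  assumes "u \<in> cadlag M d"
  shows "\<And>t. t \<in> {0..1} \<Longrightarrow> u t \<in> M"
    "\<And>t. 0 \<le> t \<Longrightarrow> t < 1 \<Longrightarrow> ((\<lambda>s. d (u s) (u t)) \<longlongrightarrow> 0) (at_right t)"
    "\<And>t. 0 < t \<Longrightarrow> t \<le> 1 \<Longrightarrow> \<exists>l\<in>M. ((\<lambda>s. d (u s) l) \<longlongrightarrow> 0) (at_left t)"
    "((\<lambda>s. d (u s) (u 1)) \<longlongrightarrow> 0) (at_left 1)"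
  using assms by (auto simp: cadlag_def)

section \<open>Aligned curves and their variation measure\<close>

text \<open>The triangle inequality is an equality along the order of time: the curve has minimal
  length between any two of its points, with jumps and pauses allowed. Only distances enter, so the
  notion passes to limits and to integrals.\<close>

definition aligned :: "('b \<Rightarrow> 'b \<Rightarrow> real) \<Rightarrow> (real \<Rightarrow> 'b) \<Rightarrow> bool" where
  "aligned d u \<longleftrightarrow> (\<forall>s t r. 0 \<le> s \<longrightarrow> s \<le> t \<longrightarrow> t \<le> r \<longrightarrow> r \<le> 1 \<longrightarrow>
     d (u s) (u t) + d (u t) (u r) = d (u s) (u r))"

lemma alignedD:
  "aligned d u \<Longrightarrow> 0 \<le> s \<Longrightarrow> s \<le> t \<Longrightarrow> t \<le> r \<Longrightarrow> r \<le> 1 \<Longrightarrow>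
    d (u s) (u t) + d (u t) (u r) = d (u s) (u r)"
  by (auto simp: aligned_def)

context Metric_space
begin

lemma tendsto_dist2:
  assumes "\<forall>\<^sub>F n in F. x n \<in> M" "\<forall>\<^sub>F n in F. y n \<in> M" "a \<in> M" "b \<in> M"
    and "((\<lambda>n. d (x n) a) \<longlongrightarrow> 0) F" "((\<lambda>n. d (y n) b) \<longlongrightarrow> 0) F"
  shows "((\<lambda>n. d (x n) (y n)) \<longlongrightarrow> d a b) F"
proof (rule LIM_zero_cancel, rule tendsto_0_le[where K = 1 and f = "\<lambda>n. d (x n) a + d (y n) b"])
  show "((\<lambda>n. d (x n) a + d (y n) b) \<longlongrightarrow> 0) F"
    using tendsto_add[OF assms(5,6)] by simp
  show "\<forall>\<^sub>F n in F. norm (d (x n) (y n) - d a b) \<le> norm (d (x n) a + d (y n) b) * 1"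
    using assms(1,2)
  proof eventually_elim
    case (elim n)
    then show ?case
      using triangle[of "x n" a "y n"] triangle[of a b "y n"] triangle[of a "x n" b] triangle[of "x n" "y n" b]
        assms(3,4) commute[of a "x n"] commute[of b "y n"]
      by (simp add: abs_le_iff)
  qed
qed

text \<open>Every partition point can be moved slightly to the right, to a time where the
  modification \<open>v\<close> agrees with \<open>u\<close>; by right continuity the sums over the
  moved points converge to the original sum. The interval is open at \<open>b\<close>, so the last
  point also has room to move.\<close>

lemma ess_variation_cadlag:
  assumes u: "u \<in> cadlag M d" and t: "b \<le> 1"
  shows "ess_variation M d u {0<..<b} = variation d u {0<..<b}"
proof (rule antisym)
  let ?J = "{0<..<b}"
  show "ess_variation M d u ?J \<le> variation d u ?J"
    unfolding ess_variation_def using cadlagD(1)[OF u] t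
    by (intro Inf_lower CollectI exI[of _ u]) auto
  show "variation d u ?J \<le> ess_variation M d u ?J"
    unfolding ess_variation_def
  proof (rule Inf_greatest, clarify)
    fix v assume v: "v \<in> ?J \<rightarrow> M" and vu: "AE t in lborel. t \<in> ?J \<longrightarrow> v t = u t"
    show "variation d u ?J \<le> variation d v ?J"
      unfolding variation_def[of d u]
    proof (rule Sup_least, clarify)
      fix k :: nat and \<tau> :: "nat \<Rightarrow> real"
      assume \<tau>: "strict_mono_on {..Suc k} \<tau>" "\<tau> ` {..Suc k} \<subseteq> ?J"
      \<comment> \<open>The room to the right of point i: up to the next point, and up to
        \<open>b\<close> for the last one. Staying below it keeps the moved points in order and
        inside the interval.\<close>
      define c where "c i = (if i \<le> k then \<tau> (Suc i) else b)" for i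
      have \<tau>J: "0 < \<tau> i" "\<tau> i < b" if "i \<le> Suc k" for i using \<tau>(2) that by auto
      have c: "\<tau> i < c i" "c i \<le> b" if "i \<le> Suc k" for i
        using \<tau>(1) that \<tau>J[of i] \<tau>J[of "Suc i"] by (auto simp: c_def strict_mono_on_def)
      have "\<exists>s. i \<le> Suc k \<longrightarrow> \<tau> i < s \<and> s < min (c i) (\<tau> i + 1 / (real n + 1)) \<and> v s = u s" for i n
      proof (cases "i \<le> Suc k")
        case True
        have "\<tau> i < min (c i) (\<tau> i + 1 / (real n + 1))" using c(1)[OF True] by simp
        from AE_lborel_obtain_Ioo[OF vu this] obtain s
          where s: "\<tau> i < s" "s < min (c i) (\<tau> i + 1 / (real n + 1))" "s \<in> ?J \<longrightarrow> v s = u s" .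
        moreover have "s \<in> ?J" using s \<tau>J[OF True] c(2)[OF True] by auto
        ultimately show ?thesis by auto
      qed auto
      then obtain s where s: "\<And>i n. i \<le> Suc k \<Longrightarrow> \<tau> i < s i n"
        "\<And>i n. i \<le> Suc k \<Longrightarrow> s i n < min (c i) (\<tau> i + 1 / (real n + 1))"
        "\<And>i n. i \<le> Suc k \<Longrightarrow> v (s i n) = u (s i n)"
        by metis
      have sJ: "s i n \<in> ?J" if "i \<le> Suc k" for i n
        using s(1,2)[OF that, of n] \<tau>J[OF that] c(2)[OF that] by auto
      have le: "(\<Sum>i\<le>k. ennreal (d (u (s i n)) (u (s (Suc i) n)))) \<le> variation d v ?J" for n
      proof -
        have "strict_mono_on {..Suc k} (\<lambda>i. s i n)"
          unfolding strict_mono_on_def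
        proof (intro allI impI)
          fix i j assume ij: "i \<in> {..Suc k} \<and> j \<in> {..Suc k} \<and> i < j"
          then have "s i n < \<tau> (Suc i)" using s(2)[of i n] by (auto simp: c_def)
          also have "\<tau> (Suc i) \<le> \<tau> j"
            using ij \<tau>(1) by (cases "Suc i = j") (auto simp: strict_mono_on_def intro!: less_imp_le)
          also have "\<tau> j < s j n" using s(1)[of j n] ij by auto
          finally show "s i n < s j n" .
        qed
        then have "(\<Sum>i\<le>k. ennreal (d (v (s i n)) (v (s (Suc i) n)))) \<le> variation d v ?J"
          using sJ by (intro variation_geI) auto
        moreover have "(\<Sum>i\<le>k. ennreal (d (v (s i n)) (v (s (Suc i) n)))) =
            (\<Sum>i\<le>k. ennreal (d (u (s i n)) (u (s (Suc i) n))))"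
          using s(3) by (intro sum.cong) auto
        ultimately show ?thesis by simp
      qed
      have lim: "(\<lambda>n. d (u (s i n)) (u (\<tau> i))) \<longlonglongrightarrow> 0" if "i \<le> Suc k" for i
      proof -
        have "(\<lambda>n. s i n) \<longlonglongrightarrow> \<tau> i"
        proof (rule tendsto_sandwich[of "\<lambda>_. \<tau> i" _ _ "\<lambda>n. \<tau> i + 1 / (real n + 1)"])
          show "(\<lambda>n. \<tau> i + 1 / (real n + 1)) \<longlonglongrightarrow> \<tau> i" by real_asymp
        qed (use s(1,2)[OF that] in \<open>auto intro: less_imp_le intro!: always_eventually\<close>)
        then have "filterlim (\<lambda>n. s i n) (at_right (\<tau> i)) sequentially"
          using s(1)[OF that] by (auto simp: filterlim_at less_imp_neq[THEN not_sym] intro!: always_eventually)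
        then show ?thesis
          using filterlim_compose[OF cadlagD(2)[OF u, of "\<tau> i"]] \<tau>J[OF that] t by auto
      qed
      have "(\<lambda>n. \<Sum>i\<le>k. ennreal (d (u (s i n)) (u (s (Suc i) n)))) \<longlonglongrightarrow>
          (\<Sum>i\<le>k. ennreal (d (u (\<tau> i)) (u (\<tau> (Suc i)))))"
      proof (intro tendsto_sum tendsto_ennrealI tendsto_dist2 lim)
        fix i assume i: "i \<in> {..k}"
        have "u (s j n) \<in> M" if "j \<le> Suc k" for j n
        proof (rule cadlagD(1)[OF u])
          show "s j n \<in> {0..1}" using sJ[OF that, of n] t by simp
        qed
        then show "\<forall>\<^sub>F n in sequentially. u (s i n) \<in> M" "\<forall>\<^sub>F n in sequentially. u (s (Suc i) n) \<in> M"
          using i by (auto intro!: always_eventually)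
        show "u (\<tau> i) \<in> M" "u (\<tau> (Suc i)) \<in> M"
          using \<tau>J[of i] \<tau>J[of "Suc i"] i t by (auto intro!: cadlagD(1)[OF u])
      qed auto
      then show "(\<Sum>i\<le>k. ennreal (d (u (\<tau> i)) (u (\<tau> (Suc i))))) \<le> variation d v ?J"
        by (rule LIMSEQ_le_const2) (use le in auto)
    qed
  qed
qed

lemma aligned_sum:
  assumes "aligned d u" "u \<in> {0..1} \<rightarrow> M" "strict_mono_on {..Suc k} \<tau>" "\<tau> ` {..Suc k} \<subseteq> {0..1}"
  shows "(\<Sum>i\<le>k. d (u (\<tau> i)) (u (\<tau> (Suc i)))) = d (u (\<tau> 0)) (u (\<tau> (Suc k)))"
  using assms(3,4)
proof (induction k)
  case (Suc k)
  have "(\<Sum>i\<le>k. d (u (\<tau> i)) (u (\<tau> (Suc i)))) = d (u (\<tau> 0)) (u (\<tau> (Suc k)))"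
    using Suc.prems by (intro Suc.IH) (auto simp: strict_mono_on_def)
  moreover have "\<tau> 0 \<le> \<tau> (Suc k)" "\<tau> (Suc k) \<le> \<tau> (Suc (Suc k))"
    using Suc.prems(1) by (auto simp: strict_mono_on_def intro!: less_imp_le)
  moreover have "0 \<le> \<tau> 0" "\<tau> (Suc (Suc k)) \<le> 1" using Suc.prems(2) by auto
  ultimately show ?case
    using alignedD[OF assms(1), of "\<tau> 0" "\<tau> (Suc k)" "\<tau> (Suc (Suc k))"] by simp
qed simp

lemma aligned_mono:
  assumes "aligned d u" "0 \<le> s'" "s' \<le> s" "s \<le> t" "t \<le> t'" "t' \<le> 1"
  shows "d (u s) (u t) \<le> d (u s') (u t')"
  using alignedD[OF assms(1), of s' s t'] alignedD[OF assms(1), of s t t'] assms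
    nonneg[of "u s'" "u s"] nonneg[of "u t" "u t'"] by linarith

lemma aligned_variation_le:
  assumes "aligned d u" "u \<in> {0..1} \<rightarrow> M" "J \<subseteq> {0..b}" "0 \<le> b" "b \<le> 1"
  shows "variation d u J \<le> ennreal (d (u 0) (u b))"
  unfolding variation_def
proof (rule Sup_least, clarify)
  fix k :: nat and \<tau> :: "nat \<Rightarrow> real"
  assume \<tau>: "strict_mono_on {..Suc k} \<tau>" "\<tau> ` {..Suc k} \<subseteq> J"
  have "\<tau> ` {..Suc k} \<subseteq> {0..b}" using \<tau> assms(3) by blast
  then have "\<tau> ` {..Suc k} \<subseteq> {0..1}" "0 \<le> \<tau> 0" "\<tau> (Suc k) \<le> b" using assms(5) by auto
  moreover have "\<tau> 0 \<le> \<tau> (Suc k)" using \<tau>(1) by (auto simp: strict_mono_on_def intro!: less_imp_le)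
  ultimately have "(\<Sum>i\<le>k. d (u (\<tau> i)) (u (\<tau> (Suc i)))) \<le> d (u 0) (u b)"
    using aligned_sum[OF assms(1,2) \<tau>(1)] aligned_mono[OF assms(1), of 0 "\<tau> 0" "\<tau> (Suc k)" b] assms(5)
    by simp
  then show "(\<Sum>i\<le>k. ennreal (d (u (\<tau> i)) (u (\<tau> (Suc i))))) \<le> ennreal (d (u 0) (u b))"
    by (simp add: ennreal_leI)
qed

text \<open>Partitions with at most two interior points suffice. They force d(u s, u t) = d(u 0, u
  t) - d(u 0, u s), and differences of a single function are additive.\<close>

lemma length_minimising_iff_aligned:
  assumes u: "u \<in> {0..1} \<rightarrow> M"
  shows "length_minimising d u \<longleftrightarrow> aligned d u"
proof
  assume al: "aligned d u"
  show "length_minimising d u"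
    unfolding length_minimising_def
    using aligned_variation_le[OF al u, of "{0..1}" 1] variation_ge2[of 0 1 "{0..1}" d u]
    by (auto intro!: antisym)
next
  assume "length_minimising d u"
  then have le: "variation d u {0..1} = ennreal (d (u 0) (u 1))" by (simp add: length_minimising_def)
  have um: "u x \<in> M" if "0 \<le> x" "x \<le> 1" for x using u that by auto
  have le3: "d (u 0) (u s) + d (u s) (u 1) \<le> d (u 0) (u 1)" if s: "0 \<le> s" "s \<le> 1" for s
  \<comment> \<open>Partitions are strictly increasing, so coinciding times are separate cases with
    fewer points.\<close>
  proof (cases "0 < s \<and> s < 1")
    case True
    define \<tau> :: "nat \<Rightarrow> real" where "\<tau> i = (if i = 0 then 0 else if i = 1 then s else 1)" for i
    have "(\<Sum>i\<le>1. ennreal (d (u (\<tau> i)) (u (\<tau> (Suc i))))) \<le> variation d u {0..1}"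
      using True by (intro variation_geI) (auto simp: \<tau>_def strict_mono_on_def)
    then show ?thesis by (simp add: \<tau>_def le flip: ennreal_plus)
  qed (use s um in auto)
  have le4: "d (u 0) (u s) + d (u s) (u t) + d (u t) (u 1) \<le> d (u 0) (u 1)"
    if s: "0 \<le> s" "s \<le> t" "t \<le> 1" for s t
  proof (cases "0 < s \<and> s < t \<and> t < 1")
    case True
    define \<tau> :: "nat \<Rightarrow> real" where "\<tau> i = (if i = 0 then 0 else if i = 1 then s else if i = 2 then t else 1)" for i
    have "(\<Sum>i\<le>2. ennreal (d (u (\<tau> i)) (u (\<tau> (Suc i))))) \<le> variation d u {0..1}"
      using True by (intro variation_geI) (auto simp: \<tau>_def strict_mono_on_def)
    then show ?thesis by (simp add: \<tau>_def le numeral_2_eq_2 flip: ennreal_plus)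
  next
    case False
    then show ?thesis using s um le3[of s] le3[of t] by (auto simp: not_less)
  qed
  show "aligned d u"
    unfolding aligned_def
  proof (intro allI impI)
    fix s t r :: real assume str: "0 \<le> s" "s \<le> t" "t \<le> r" "r \<le> 1"
    have m: "u 0 \<in> M" "u s \<in> M" "u t \<in> M" "u r \<in> M" "u 1 \<in> M" using um str by auto
    show "d (u s) (u t) + d (u t) (u r) = d (u s) (u r)"
      using le4[of s t] le4[of s r] le4[of t r] le3[of r] le3[of s] le3[of t] str
        triangle[OF m(2,3,4)] triangle[OF m(1,2,5)] triangle[OF m(2,4,5)] triangle[OF m(1,2,4)] 
        triangle[OF m(1,3,5)] triangle[OF m(1,2,3)] triangle[OF m(3,4,5)]
      by linarith
  qed
qed

text \<open>Times are pushed into the open interval, which is all that the variation measure sees.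
  Right continuity at 0 and the absence of a jump at 1 make the push harmless in the limit.\<close>

lemma cadlag_clamp_tendsto:
  assumes u: "u \<in> cadlag M d" and x: "0 \<le> x" "x \<le> 1"
  shows "(\<lambda>n. d (u (max (1 / (real n + 2)) (min (1 - 1 / (real n + 2)) x))) (u x)) \<longlonglongrightarrow> 0"
    (is "(\<lambda>n. d (u (?c n)) (u x)) \<longlonglongrightarrow> 0")
proof -
  consider "x = 0" | "x = 1" | "0 < x" "x < 1" using x by linarith
  then show ?thesis
  proof cases
    case 1
    have "?c n = 1 / (real n + 2)" for n using 1 by (auto simp: max_def min_def field_simps)
    moreover have "filterlim (\<lambda>n. 1 / (real n + 2)) (at_right 0) sequentially" by real_asymp
    ultimately show ?thesis using filterlim_compose[OF cadlagD(2)[OF u, of 0]] 1 by simp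
  next
    case 2
    have "?c n = 1 - 1 / (real n + 2)" for n using 2 by (auto simp: max_def min_def field_simps)
    moreover have "filterlim (\<lambda>n. 1 - 1 / (real n + 2)) (at_left 1) sequentially" by real_asymp
    ultimately show ?thesis using filterlim_compose[OF cadlagD(4)[OF u]] 2 by simp
  next
    case 3
    have "(\<lambda>n. 1 / (real n + 2)) \<longlonglongrightarrow> 0" by real_asymp
    then have "\<forall>\<^sub>F n in sequentially. 1 / (real n + 2) < min x (1 - x)"
      by (rule order_tendstoD) (use 3 in auto)
    then have "\<forall>\<^sub>F n in sequentially. d (u (?c n)) (u x) = 0"
      
    proof eventually_elim
      case (elim n)
      then have "?c n = x" by simp
      then show ?case using cadlagD(1)[OF u, of x] 3 by simp
    qed
    then show ?thesis by (rule tendsto_eventually)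
  qed
qed

text \<open>The hypothesis controls only partitions of the open interval. Chains from 0 to 1 through
  three interior times are bounded after pushing 0 and 1 inside and passing to the limit. Interior
  triples are then aligned, and a second push carries this to triples that touch the ends.\<close>

lemma variation_Ioo_imp_aligned:
  assumes u: "u \<in> cadlag M d" and le: "variation d u {0<..<1} \<le> ennreal (d (u 0) (u 1))"
  shows "aligned d u"
proof -
  have um: "u x \<in> M" if "0 \<le> x" "x \<le> 1" for x using cadlagD(1)[OF u] that by auto
  define c where "c n x = max (1 / (real n + 2)) (min (1 - 1 / (real n + 2)) x)" for n x
  have c_lim: "(\<lambda>n. d (u (c n x)) (u x)) \<longlonglongrightarrow> 0" if "0 \<le> x" "x \<le> 1" for x
    unfolding c_def by (rule cadlag_clamp_tendsto[OF u that])
  have c01: "0 < c n x" "c n x < 1" "0 \<le> c n x" "c n x \<le> 1" for n x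
  proof -
    have "1 / (real n + 2) \<le> 1 / 2" "0 < 1 / (real n + 2)" by (intro divide_left_mono; simp)+ simp
    then show "0 < c n x" "c n x < 1" "0 \<le> c n x" "c n x \<le> 1"
      unfolding c_def by linarith+
  qed
  have dc: "(\<lambda>n. d (u (c n x)) (u (c n y))) \<longlonglongrightarrow> d (u x) (u y)" 
    if "0 \<le> x" "x \<le> 1" "0 \<le> y" "y \<le> 1" for x y
    using that c01 by (intro tendsto_dist2 c_lim always_eventually allI um) auto
  have dc': "(\<lambda>n. d (u (c n x)) (u y)) \<longlonglongrightarrow> d (u x) (u y)" "(\<lambda>n. d (u y) (u (c n x))) \<longlonglongrightarrow> d (u y) (u x)"
    if "0 \<le> x" "x \<le> 1" "0 \<le> y" "y \<le> 1" for x y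
    using that c01 by (auto intro!: tendsto_dist2 c_lim always_eventually um simp: um)
  have 3: "d (u 0) (u s) + d (u s) (u t) + d (u t) (u r) + d (u r) (u 1) \<le> d (u 0) (u 1)"
    if str: "0 < s" "s < t" "t < r" "r < 1" for s t r
  proof -
    have "(\<lambda>n. d (u (c n 0)) (u s) + d (u s) (u t) + d (u t) (u r) + d (u r) (u (c n 1))) \<longlonglongrightarrow>
        d (u 0) (u s) + d (u s) (u t) + d (u t) (u r) + d (u r) (u 1)"
      using str by (intro tendsto_add dc' tendsto_const) auto
    moreover have "\<forall>\<^sub>F n in sequentially. 1 / (real n + 2) < min s (1 - r)"
    proof (rule order_tendstoD)
      show "(\<lambda>n. 1 / (real n + 2)) \<longlonglongrightarrow> 0" by real_asymp
    qed (use str in auto)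
    then have "\<forall>\<^sub>F n in sequentially. d (u (c n 0)) (u s) + d (u s) (u t) + d (u t) (u r) + d (u r) (u (c n 1))
        \<le> d (u 0) (u 1)"
    proof eventually_elim
      case (elim n)
      define \<tau> :: "nat \<Rightarrow> real" where "\<tau> i = (if i = 0 then c n 0 else if i = 1 then s else if i = 2 then t
        else if i = 3 then r else c n 1)" for i
      have "c n 0 < s" "r < c n 1"
        using elim by (auto simp: c_def)
      then have "(\<Sum>i\<le>3. ennreal (d (u (\<tau> i)) (u (\<tau> (Suc i))))) \<le> variation d u {0<..<1}"
        using str c01(1,2)[of n] by (intro variation_geI) (auto simp: \<tau>_def strict_mono_on_def)
      also note le
      finally show ?case by (simp add: \<tau>_def numeral_3_eq_3 flip: ennreal_plus)
    qed
    ultimately show ?thesis by (intro tendsto_upperbound) auto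
  qed
  have 4: "d (u s) (u t) + d (u t) (u r) = d (u s) (u r)" if str: "0 < s" "s \<le> t" "t \<le> r" "r < 1" for s t r
  proof (cases "s < t \<and> t < r")
    case True
    then show ?thesis
      using 3[of s t r] str triangle[OF um um um, of s t r] triangle[OF um um um, of 0 s 1]
        triangle[OF um um um, of s r 1] by simp
  next
    case False
    then show ?thesis using str um[of t] by (cases "s = t") auto
  qed
  show ?thesis
    unfolding aligned_def
  proof (intro allI impI)
    fix s t r :: real assume str: "0 \<le> s" "s \<le> t" "t \<le> r" "r \<le> 1"
    have "(\<lambda>n. d (u (c n s)) (u (c n t)) + d (u (c n t)) (u (c n r))) \<longlonglongrightarrow> d (u s) (u t) + d (u t) (u r)"
      using str by (intro tendsto_add dc) auto
    moreover have "d (u (c n s)) (u (c n t)) + d (u (c n t)) (u (c n r)) = d (u (c n s)) (u (c n r))" for n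
      using c01 str by (intro 4) (auto simp: c_def intro: max.mono min.mono)
    ultimately have "(\<lambda>n. d (u (c n s)) (u (c n r))) \<longlonglongrightarrow> d (u s) (u t) + d (u t) (u r)" by simp
    moreover have "(\<lambda>n. d (u (c n s)) (u (c n r))) \<longlonglongrightarrow> d (u s) (u r)" using str by (intro dc) auto
    ultimately show "d (u s) (u t) + d (u t) (u r) = d (u s) (u r)" using LIMSEQ_unique by blast
  qed
qed

context
  fixes u assumes u: "u \<in> cadlag M d" and al: "aligned d u"
begin

text \<open>A jump at \<open>s\<close> is not seen by the open interval, so the variation up to
  \<open>s\<close> is only squeezed between two distances. The bounds meet in the limit from the
  right, which is all that the Stieltjes measure uses.\<close>

lemma aligned_variation_Ioo_bounds:
  assumes "0 \<le> x" "x < s" "s \<le> 1"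
  shows "d (u 0) (u x) \<le> enn2real (ess_variation M d u {0<..<s})"
    and "enn2real (ess_variation M d u {0<..<s}) \<le> d (u 0) (u s)"
    and "ess_variation M d u {0<..<s} < \<infinity>"
proof -
  have um: "u x \<in> M" if "0 \<le> x" "x \<le> 1" for x using cadlagD(1)[OF u] that by auto
  have e: "ess_variation M d u {0<..<s} = variation d u {0<..<s}"
    using ess_variation_cadlag[OF u] assms by simp
  have upper: "variation d u {0<..<s} \<le> ennreal (d (u 0) (u s))"
    using assms um by (intro aligned_variation_le[OF al]) auto
  then show "enn2real (ess_variation M d u {0<..<s}) \<le> d (u 0) (u s)"
    unfolding e by (rule enn2real_leI[rotated]) auto
  show fin: "ess_variation M d u {0<..<s} < \<infinity>"
    unfolding e using upper by (auto simp: top.not_eq_extremum intro: le_less_trans)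
  show "d (u 0) (u x) \<le> enn2real (ess_variation M d u {0<..<s})"
  proof (cases "x = 0")
    case False
    \<comment> \<open>The time 0 lies outside the open interval and cannot be a partition point, so
      it is approached from the right.\<close>
    have "(\<lambda>n. d (u (x / (real n + 2))) (u x)) \<longlonglongrightarrow> d (u 0) (u x)"
    proof (intro tendsto_dist2)
      have "filterlim (\<lambda>n. x / (real n + 2)) (at_right 0) sequentially"
        using False assms by real_asymp
      then show "(\<lambda>n. d (u (x / (real n + 2))) (u 0)) \<longlonglongrightarrow> 0"
        using filterlim_compose[OF cadlagD(2)[OF u, of 0]] by simp
      have "x / (real n + 2) \<le> x / 1" for n
        using assms by (intro divide_left_mono) auto
      then have "x / (real n + 2) \<le> 1" for n
        using assms by (smt (verit) div_by_1)
      then show "\<forall>\<^sub>F n in sequentially. u (x / (real n + 2)) \<in> M"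
        using assms by (intro always_eventually allI um) auto
    qed (use assms um in auto)
    moreover have "d (u (x / (real n + 2))) (u x) \<le> enn2real (ess_variation M d u {0<..<s})" for n
    proof -
      have "x / (real n + 2) < x / 1" using assms False by (intro divide_strict_left_mono) auto
      then have "ennreal (d (u (x / (real n + 2))) (u x)) \<le> variation d u {0<..<s}"
        using False assms by (intro variation_ge2) auto
      then show ?thesis unfolding e[symmetric] using enn2real_mono[OF _ fin[unfolded infinity_ennreal_def e], of "ennreal (d (u (x / (real n + 2))) (u x))"]
        by (simp add: e)
    qed
    ultimately show ?thesis by (intro LIMSEQ_le_const2) auto
  qed (use um[of 0] in auto)
qed

text \<open>At the terminal time the two bounds meet because the curve has no jump there.\<close>

lemma aligned_ess_variation_1: "enn2real (ess_variation M d u {0<..<1}) = d (u 0) (u 1)"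
proof (rule antisym)
  have um: "u x \<in> M" if "0 \<le> x" "x \<le> 1" for x using cadlagD(1)[OF u] that by auto
  show "enn2real (ess_variation M d u {0<..<1}) \<le> d (u 0) (u 1)"
    using aligned_variation_Ioo_bounds[of 0 1] by simp
  have "(\<lambda>n. d (u 0) (u (1 - 1 / (real n + 2)))) \<longlonglongrightarrow> d (u 0) (u 1)"
  proof (intro tendsto_dist2)
    have "filterlim (\<lambda>n. 1 - 1 / (real n + 2)) (at_left (1::real)) sequentially" by real_asymp
    then show "(\<lambda>n. d (u (1 - 1 / (real n + 2))) (u 1)) \<longlonglongrightarrow> 0"
      by (rule filterlim_compose[OF cadlagD(4)[OF u]])
    show "\<forall>\<^sub>F n in sequentially. u (1 - 1 / (real n + 2)) \<in> M"
      by (intro always_eventually allI um) (auto simp: field_simps)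
  qed (use um in auto)
  then show "d (u 0) (u 1) \<le> enn2real (ess_variation M d u {0<..<1})"
    by (rule LIMSEQ_le_const2)
      (auto intro!: exI[of _ 0] aligned_variation_Ioo_bounds(1) simp: field_simps)
qed

lemma ess_variation_aligned_mono_on: "mono_on {0..1} (\<lambda>t. enn2real (ess_variation M d u {0<..<t}))"
proof (rule mono_onI)
  fix s t :: real assume "s \<in> {0..1}" "t \<in> {0..1}" "s \<le> t"
  then show "enn2real (ess_variation M d u {0<..<s}) \<le> enn2real (ess_variation M d u {0<..<t})"
  proof (cases "t = 0")
    case False
    then show ?thesis
      using \<open>t \<in> _\<close> \<open>s \<le> t\<close> aligned_variation_Ioo_bounds(3)[of 0 t]
      by (intro enn2real_mono ess_variation_mono) auto
  qed auto
qed

text \<open>As s decreases to x, the variation function lies between d(u 0, u x) and d(u 0, u s);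
  right continuity closes the gap. Outside I the clamping makes it constant.\<close>

lemma aligned_right_limit:
  "Lim (at_right x) (\<lambda>s. enn2real (ess_variation M d u {0<..<max 0 (min 1 s)})) =
    d (u 0) (u (max 0 (min 1 x)))"
proof (rule tendsto_Lim)
  have um: "u x \<in> M" if "0 \<le> x" "x \<le> 1" for x using cadlagD(1)[OF u] that by auto
  let ?V = "\<lambda>t. enn2real (ess_variation M d u {0<..<t})"
  consider "x < 0" | "x \<ge> 1" | "0 \<le> x" "x < 1" by linarith
  then show "((\<lambda>s. ?V (max 0 (min 1 s))) \<longlongrightarrow> d (u 0) (u (max 0 (min 1 x)))) (at_right x)"
  proof cases
    case 1
    have "variation d u {} = 0"
      unfolding variation_def by (auto simp: bot_ennreal)
    then have "?V 0 = 0" using ess_variation_cadlag[OF u, of 0] by simp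
    have "\<forall>\<^sub>F s in at_right x. ?V (max 0 (min 1 s)) = 0"
      using 1 \<open>?V 0 = 0\<close> by (auto simp: eventually_at_right_field intro!: exI[of _ 0])
    then show ?thesis using 1 um[of 0] by (auto intro: tendsto_eventually)
  next
    case 2
    then have "\<forall>\<^sub>F s in at_right x. ?V (max 0 (min 1 s)) = ?V 1"
      by (auto simp: eventually_at_right_field intro!: exI[of _ "x + 1"])
    then show ?thesis using 2 aligned_ess_variation_1 by (auto intro: tendsto_eventually)
  next
    case 3
    have "((\<lambda>s. d (u 0) (u s)) \<longlongrightarrow> d (u 0) (u x)) (at_right x)"
    proof (rule tendsto_dist2)
      show "\<forall>\<^sub>F s in at_right x. u s \<in> M"
        using 3 by (auto simp: eventually_at_right_field intro!: exI[of _ 1] um)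
    qed (use 3 um cadlagD(2)[OF u, of x] in auto)
    note lim = this
    have "max 0 (min 1 x) = x" using 3 by simp
    show ?thesis unfolding \<open>max 0 (min 1 x) = x\<close>
    proof (rule tendsto_sandwich[OF _ _ tendsto_const lim])
      show "\<forall>\<^sub>F s in at_right x. ?V (max 0 (min 1 s)) \<le> d (u 0) (u s)"
        using 3 aligned_variation_Ioo_bounds(2) by (auto simp: eventually_at_right_field intro!: exI[of _ 1])
      show "\<forall>\<^sub>F s in at_right x. d (u 0) (u x) \<le> ?V (max 0 (min 1 s))"
        using 3 aligned_variation_Ioo_bounds(1) by (auto simp: eventually_at_right_field intro!: exI[of _ 1])
    qed
  qed
qed simp

text \<open>The distribution function of |Du| is the distance from \<open>u 0\<close>, and by
  alignment its increments are distances again. The case a = b yields the size of the jump at a, the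
  case a = 0, b = 1 the total mass.\<close>

lemma aligned_variation_measure_Icc:
  assumes "0 \<le> a" "a \<le> b" "b \<le> 1"
  shows "(\<lambda>n. ennreal (d (u (max 0 (a - 1 / (real n + 1)))) (u b))) \<longlonglongrightarrow>
    emeasure (variation_measure M d u) {a..b}"
proof -
  have *: "d (u 0) (u (max 0 (min 1 b))) - d (u 0) (u (max 0 (min 1 (a - 1 / (real n + 1))))) =
      d (u (max 0 (a - 1 / (real n + 1)))) (u b)" for n
  proof -
    have "a - 1 / (real n + 1) \<le> a" by simp
    then have "a - 1 / (real n + 1) \<le> 1" "a - 1 / (real n + 1) \<le> b" using assms by linarith+
    then show ?thesis
      using alignedD[OF al, of 0 "max 0 (a - 1 / (real n + 1))" b] assms by (simp add: min_absorb2)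
  qed
  show ?thesis
    unfolding variation_measure_def *[symmetric]
    using emeasure_stieltjes_Icc[OF ess_variation_aligned_mono_on refl assms]
    unfolding aligned_right_limit .
qed

end

text \<open>The total mass of |Du| is V(1), the variation over the open interval, so the geodesic
  equation supplies the hypothesis of \<open>variation_Ioo_imp_aligned\<close>. Conversely, for a =
  0 the sequence in \<open>aligned_variation_measure_Icc\<close> is constantly d(u 0, u 1).\<close>

lemma BV_geodesic_iff_aligned:
  "BV_geodesic M d u \<longleftrightarrow> u \<in> cadlag M d \<and> aligned d u"
proof safe
  assume "BV_geodesic M d u"
  then have u: "u \<in> cadlag M d" and fin: "ess_variation M d u {0..1} < \<infinity>"
    and eq: "ennreal (d (u 0) (u 1)) = emeasure (variation_measure M d u) {0..1}"
    by (auto simp: BV_geodesic_def BV_curves_def)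
  show "u \<in> cadlag M d" by fact
  define V where "V t = enn2real (ess_variation M d u {0<..<t})" for t
  define F where "F x = Lim (at_right x) (\<lambda>s. V (max 0 (min 1 s)))" for x
  have fin1: "ess_variation M d u {0<..<t} < \<infinity>" if "t \<le> 1" for t
    using le_less_trans[OF ess_variation_mono fin] that by (simp add: subset_eq)
  have V: "mono_on {0..1} V"
    unfolding V_def using fin1 by (intro mono_onI enn2real_mono ess_variation_mono) auto
  have lim: "((\<lambda>s. V (max 0 (min 1 s))) \<longlongrightarrow> F x) (at_right x)" for x
    by (rule tendsto_clamp_at_right[OF V]) (simp add: F_def fun_eq_iff)
  have "F 1 = V 1"
  proof (rule tendsto_unique[OF _ lim])
    show "((\<lambda>s. V (max 0 (min 1 s))) \<longlongrightarrow> V 1) (at_right 1)"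
      by (rule tendsto_eventually) (auto simp: eventually_at_right_field intro!: exI[of _ 2])
  qed simp
  moreover have "F x = 0" if "x < 0" for x
  proof (rule tendsto_unique[OF _ lim])
    have "variation d u {} = 0"
      unfolding variation_def by (auto simp: bot_ennreal)
    then have "V 0 = 0" using ess_variation_cadlag[OF u, of 0] by (simp add: V_def)
    then show "((\<lambda>s. V (max 0 (min 1 s))) \<longlongrightarrow> 0) (at_right x)"
      using that by (intro tendsto_eventually) (auto simp: eventually_at_right_field intro!: exI[of _ 0])
  qed simp
  moreover have "(\<lambda>n. ennreal (F 1 - F (0 - 1 / (real n + 1)))) \<longlonglongrightarrow> emeasure (stieltjes V) {0..1}"
    by (rule emeasure_stieltjes_Icc[OF V]) (auto simp: F_def)
  ultimately have "(\<lambda>n. ennreal (V 1)) \<longlonglongrightarrow> emeasure (stieltjes V) {0..1}" by simp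
  then have "emeasure (stieltjes V) {0..1} = ennreal (V 1)"
    by (rule LIMSEQ_unique[OF _ tendsto_const])
  also have "\<dots> = ess_variation M d u {0<..<1}"
    unfolding V_def using fin1[of 1] by simp
  also have "\<dots> = variation d u {0<..<1}" using ess_variation_cadlag[OF u] by simp
  finally have "variation d u {0<..<1} = ennreal (d (u 0) (u 1))"
    using eq by (simp add: variation_measure_def V_def[abs_def])
  then show "aligned d u" by (intro variation_Ioo_imp_aligned[OF u]) simp
next
  assume u: "u \<in> cadlag M d" and al: "aligned d u"
  have um: "u \<in> {0..1} \<rightarrow> M" using cadlagD(1)[OF u] by auto
  have "ess_variation M d u {0..1} \<le> variation d u {0..1}"
    unfolding ess_variation_def using um by (intro Inf_lower CollectI exI[of _ u]) auto
  also have "\<dots> \<le> ennreal (d (u 0) (u 1))" by (rule aligned_variation_le[OF al um]) auto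
  finally have "ess_variation M d u {0..1} < \<infinity>"
    by (auto simp: top.not_eq_extremum intro: le_less_trans)
  moreover have "(\<lambda>n. ennreal (d (u (max 0 (0 - 1 / (real n + 1)))) (u 1))) \<longlonglongrightarrow>
    emeasure (variation_measure M d u) {0..1}"
    by (rule aligned_variation_measure_Icc[OF u al]) auto
  then have "emeasure (variation_measure M d u) {0..1} = ennreal (d (u 0) (u 1))"
    using LIMSEQ_unique[OF tendsto_const] by fastforce
  ultimately show "BV_geodesic M d u"
    using u by (auto simp: BV_geodesic_def BV_curves_def)
qed

end

section \<open>The Borel sets of the Skorokhod space\<close>

text \<open>Compactness of I in the form of \<open>Bolzano\<close>. Near each x the one-sided limits
  make the oscillation small on either side of x, so F = {x} works locally, and the point sets of
  adjacent intervals are joined by adding the common endpoint.\<close>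

lemma cadlag_finite_partition:
  fixes \<gamma> :: "real \<Rightarrow> 'a::metric_space"
  assumes \<gamma>: "\<gamma> \<in> cadlag UNIV dist" and e: "0 < e"
  obtains F where "finite F" "F \<subseteq> {0..<1}" "0 \<in> F"
    "\<And>s t. 0 \<le> s \<Longrightarrow> s \<le> t \<Longrightarrow> t \<le> 1 \<Longrightarrow> F \<inter> {s<..t} = {} \<Longrightarrow> dist (\<gamma> s) (\<gamma> t) \<le> e"
proof -
  \<comment> \<open>The right end is excluded by t < b, so two adjacent intervals join once
    \<open>b\<close> itself is put into F.\<close>
  define P where "P a b \<longleftrightarrow> (0 \<le> a \<and> b \<le> 1 \<longrightarrow> (\<exists>F. finite F \<and>
    (\<forall>s t. a \<le> s \<and> s \<le> t \<and> t < b \<and> F \<inter> {s<..t} = {} \<longrightarrow> dist (\<gamma> s) (\<gamma> t) \<le> e)))" for a b :: real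
  have "P 0 1"
  proof (rule Bolzano[of 0 1 P])
    fix a b c assume ab: "P a b" "P b c" "a \<le> b" "b \<le> c"
    show "P a c"
      unfolding P_def
    proof
      assume ac: "0 \<le> a \<and> c \<le> 1"
      then obtain F where F: "finite F"
        "\<And>s t. a \<le> s \<Longrightarrow> s \<le> t \<Longrightarrow> t < b \<Longrightarrow> F \<inter> {s<..t} = {} \<Longrightarrow> dist (\<gamma> s) (\<gamma> t) \<le> e"
        using ab unfolding P_def by (meson order_trans)
      obtain G where G: "finite G"
        "\<And>s t. b \<le> s \<Longrightarrow> s \<le> t \<Longrightarrow> t < c \<Longrightarrow> G \<inter> {s<..t} = {} \<Longrightarrow> dist (\<gamma> s) (\<gamma> t) \<le> e"
        using ab ac unfolding P_def by (meson order_trans)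
      have "dist (\<gamma> s) (\<gamma> t) \<le> e"
        if "a \<le> s" "s \<le> t" "t < c" "insert b (F \<union> G) \<inter> {s<..t} = {}" for s t
      proof (cases "t < b")
        case True
        then show ?thesis using that by (intro F) auto
      next
        case False
        then have "b \<le> s" using that by auto
        then show ?thesis using that by (intro G) auto
      qed
      then show "\<exists>F. finite F \<and> (\<forall>s t. a \<le> s \<and> s \<le> t \<and> t < c \<and> F \<inter> {s<..t} = {} \<longrightarrow> dist (\<gamma> s) (\<gamma> t) \<le> e)"
        using F(1) G(1) by (intro exI[of _ "insert b (F \<union> G)"]) blast
    qed
  next
    fix x :: real assume x: "0 \<le> x" "x \<le> 1"
    have "\<exists>\<delta>>0. \<forall>s\<in>{x<..<x+\<delta>}. x < 1 \<longrightarrow> dist (\<gamma> s) (\<gamma> x) < e / 2"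
    proof (cases "x < 1")
      case True
      have "\<forall>\<^sub>F s in at_right x. dist (\<gamma> s) (\<gamma> x) < e / 2"
        using cadlagD(2)[OF \<gamma>, of x] x True e by (intro order_tendstoD(2)[where y = 0]) auto
      then obtain b where "b > x" "\<And>s. x < s \<Longrightarrow> s < b \<Longrightarrow> dist (\<gamma> s) (\<gamma> x) < e / 2"
        by (auto simp: eventually_at_right_field)
      then show ?thesis by (intro exI[of _ "b - x"]) auto
    qed (auto intro: exI[of _ 1])
    then obtain \<delta>1 where \<delta>1: "\<delta>1 > 0" "\<And>s. x < s \<Longrightarrow> s < x + \<delta>1 \<Longrightarrow> x < 1 \<Longrightarrow> dist (\<gamma> s) (\<gamma> x) < e / 2"
      by auto
    have "\<exists>\<delta>>0. \<exists>l. \<forall>s\<in>{x-\<delta><..<x}. 0 < x \<longrightarrow> dist (\<gamma> s) l < e / 2"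
    proof (cases "0 < x")
      case True
      then obtain l where "((\<lambda>s. dist (\<gamma> s) l) \<longlongrightarrow> 0) (at_left x)"
        using cadlagD(3)[OF \<gamma>, of x] x by auto
      then have "\<forall>\<^sub>F s in at_left x. dist (\<gamma> s) l < e / 2"
        using e by (intro order_tendstoD(2)[where y = 0]) auto
      then obtain b where "b < x" "\<And>s. b < s \<Longrightarrow> s < x \<Longrightarrow> dist (\<gamma> s) l < e / 2"
        by (auto simp: eventually_at_left_field)
      then show ?thesis by (intro exI[of _ "x - b"] exI[of _ l] conjI) auto
    qed (auto intro: exI[of _ 1])
    then obtain \<delta>2 l where \<delta>2: "\<delta>2 > 0" "\<And>s. x - \<delta>2 < s \<Longrightarrow> s < x \<Longrightarrow> 0 < x \<Longrightarrow> dist (\<gamma> s) l < e / 2"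
      by (metis greaterThanLessThan_iff)
    have "P a b" if ab: "a \<le> x" "x \<le> b" "b - a < min \<delta>1 \<delta>2" for a b
      unfolding P_def
    proof (intro impI exI[of _ "{x}"] conjI allI)
      fix s t assume a: "0 \<le> a \<and> b \<le> 1" and st: "a \<le> s \<and> s \<le> t \<and> t < b \<and> {x} \<inter> {s<..t} = {}"
      then consider "t < x" | "x \<le> s" by force
      then show "dist (\<gamma> s) (\<gamma> t) \<le> e"
      proof cases
        case 1
        then show ?thesis
          using dist_triangle_less_add[OF \<delta>2(2)[of s] \<delta>2(2)[of t]] a st ab by auto
      next
        case 2
        have "dist (\<gamma> y) (\<gamma> x) < e / 2" if "y = s \<or> y = t" for y
          using \<delta>1(2)[of y] that 2 a st ab e by (cases "y = x") auto
        from dist_triangle_less_add[OF this this, of s t] show ?thesis by simp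
      qed
    qed simp
    then show "\<exists>d>0. \<forall>a b. a \<le> x \<and> x \<le> b \<and> b - a < d \<longrightarrow> P a b"
      using \<delta>1(1) \<delta>2(1) by (intro exI[of _ "min \<delta>1 \<delta>2"]) auto
  qed simp
  then obtain F where F: "finite F"
    "\<And>s t. 0 \<le> s \<Longrightarrow> s \<le> t \<Longrightarrow> t < 1 \<Longrightarrow> F \<inter> {s<..t} = {} \<Longrightarrow> dist (\<gamma> s) (\<gamma> t) \<le> e"
    unfolding P_def by auto
  have "\<forall>\<^sub>F s in at_left 1. dist (\<gamma> s) (\<gamma> 1) < e"
    using cadlagD(4)[OF \<gamma>] e by (intro order_tendstoD(2)[where y = 0]) auto
  then obtain b where b: "b < 1" "\<And>s. b < s \<Longrightarrow> s < 1 \<Longrightarrow> dist (\<gamma> s) (\<gamma> 1) < e"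
    by (auto simp: eventually_at_left_field)
  \<comment> \<open>F must avoid the time 1, so that its points can later be rounded up to grid
    points before 1. The last piece therefore starts at p and is controlled by left continuity at
    1.\<close>
  define p where "p = max 0 ((1 + b) / 2)"
  have "b < (1 + b) / 2" "(1 + b) / 2 < 1" using b(1) by (auto simp: field_simps)
  then have p: "0 \<le> p" "p < 1" "b < p" unfolding p_def by linarith+
  show ?thesis
  proof (rule that[of "insert p (insert 0 (F \<inter> {0..<1}))"])
    fix s t :: real assume st: "0 \<le> s" "s \<le> t" "t \<le> 1" "insert p (insert 0 (F \<inter> {0..<1})) \<inter> {s<..t} = {}"
    show "dist (\<gamma> s) (\<gamma> t) \<le> e"
    proof (cases "t = 1")
      case True
      then have "b < s" using st p by auto
      then show ?thesis using b(2)[of s] st True e by (cases "s = 1") auto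
    next
      case False
      then show ?thesis using st by (intro F) auto
    qed
  qed (use F p in auto)
qed

text \<open>Each value is within 1 of the value at the last partition point before it.\<close>

lemma cadlag_bounded:
  fixes \<gamma> :: "real \<Rightarrow> 'a::metric_space"
  assumes \<gamma>: "\<gamma> \<in> cadlag UNIV dist"
  shows "bounded (\<gamma> ` {0..1})"
proof -
  obtain F where F: "finite F" "F \<subseteq> {0..<1}" "0 \<in> F"
    "\<And>s t. 0 \<le> s \<Longrightarrow> s \<le> t \<Longrightarrow> t \<le> 1 \<Longrightarrow> F \<inter> {s<..t} = {} \<Longrightarrow> dist (\<gamma> s) (\<gamma> t) \<le> 1"
    using cadlag_finite_partition[OF \<gamma>, of 1] by auto
  have "\<gamma> ` {0..1} \<subseteq> (\<Union>p\<in>F. cball (\<gamma> p) 1)"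
  proof clarify
    fix t :: real assume t: "t \<in> {0..1}"
    define p where "p = Max (F \<inter> {..t})"
    have fin: "finite (F \<inter> {..t})" using F(1) by simp
    have "p \<in> F \<inter> {..t}" unfolding p_def by (rule Max_in[OF fin]) (use F t in auto)
    moreover have "F \<inter> {p<..t} = {}"
      using Max_ge[OF fin] by (fastforce simp: p_def)
    ultimately have "dist (\<gamma> p) (\<gamma> t) \<le> 1" using t F(2) by (intro F(4)) auto
    then show "\<gamma> t \<in> (\<Union>p\<in>F. cball (\<gamma> p) 1)" using \<open>p \<in> _\<close> by auto
  qed
  moreover have "bounded (\<Union>p\<in>F. cball (\<gamma> p) 1)" using F(1) by auto
  ultimately show ?thesis by (rule bounded_subset[rotated])
qed

section \<open>Time changes and the Skorokhod metric\<close>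

lemma time_changesD:
  assumes "\<theta> \<in> time_changes"
  shows "strict_mono_on {0..1} \<theta>" "\<theta> ` {0..1} = {0..1}" "\<theta> 0 = 0" "\<theta> 1 = 1"
    "\<And>t. t \<in> {0..1} \<Longrightarrow> \<theta> t \<in> {0..1}"
proof -
  show m: "strict_mono_on {0..1} \<theta>" using assms by (simp add: time_changes_def)
  show i: "\<theta> ` {0..1} = {0..1}" using assms by (auto simp: time_changes_def homeomorphism_def)
  then show *: "\<theta> t \<in> {0..1}" if "t \<in> {0..1}" for t using that by blast
  have mono: "\<theta> s \<le> \<theta> t" if "0 \<le> s" "s \<le> t" "t \<le> 1" for s t
    using m that by (cases "s = t") (auto simp: strict_mono_on_def intro!: less_imp_le)
  obtain x where "x \<in> {0..1}" "\<theta> x = 0" using i by (metis atLeastAtMost_iff imageE order_refl zero_le_one)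
  then show "\<theta> 0 = 0" using mono[of 0 x] *[of 0] by auto
  obtain y where "y \<in> {0..1}" "\<theta> y = 1" using i by (metis atLeastAtMost_iff imageE order_refl zero_le_one)
  then show "\<theta> 1 = 1" using mono[of y 1] *[of 1] by auto
qed

lemma log_slope_le_iff:
  assumes "0 \<le> e"
  shows "log_slope \<theta> \<le> ennreal e \<longleftrightarrow>
    (\<forall>s t. 0 \<le> s \<and> s < t \<and> t \<le> 1 \<longrightarrow> \<bar>ln ((\<theta> t - \<theta> s) / (t - s))\<bar> \<le> e)"
  proof -
  have "log_slope \<theta> \<le> ennreal e \<longleftrightarrow>
      (\<forall>s t. 0 \<le> s \<and> s < t \<and> t \<le> 1 \<longrightarrow> ennreal \<bar>ln ((\<theta> t - \<theta> s) / (t - s))\<bar> \<le> ennreal e)"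
    unfolding log_slope_def Sup_le_iff by blast
  then show ?thesis using assms by simp
qed

text \<open>A version with an explicit time change instead of the infimum in \<open>ennreal\<close>.
  Nonnegativity of \<open>e\<close> is recorded because \<open>ennreal\<close> sends negative
  numbers to 0.\<close>

definition skorokhod_close :: "(real \<Rightarrow> 'a::metric_space) \<Rightarrow> (real \<Rightarrow> 'a) \<Rightarrow> real \<Rightarrow> bool" where
  "skorokhod_close \<gamma> \<gamma>' e \<longleftrightarrow> 0 \<le> e \<and>
     (\<exists>\<theta>\<in>time_changes. log_slope \<theta> \<le> ennreal e \<and> (\<forall>t\<in>{0..1}. dist (\<gamma> t) (\<gamma>' (\<theta> t)) \<le> e))"

lemma skorokhod_dist_le:
  assumes "skorokhod_close \<gamma> \<gamma>' e"
  shows "skorokhod_dist dist \<gamma> \<gamma>' \<le> e"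
proof -
  obtain \<theta> where \<theta>: "0 \<le> e" "\<theta> \<in> time_changes" "log_slope \<theta> \<le> ennreal e"
    "\<And>t. t \<in> {0..1} \<Longrightarrow> dist (\<gamma> t) (\<gamma>' (\<theta> t)) \<le> e"
    using assms by (auto simp: skorokhod_close_def)
  have "(INF \<theta>\<in>time_changes. max (log_slope \<theta>) (SUP t\<in>{0..1}. ennreal (dist (\<gamma> t) (\<gamma>' (\<theta> t))))) \<le> ennreal e"
    using \<theta> by (intro INF_lower2[OF \<theta>(2)] max.boundedI SUP_least ennreal_leI) auto
  then show ?thesis
    unfolding skorokhod_dist_def using \<theta>(1) by (intro enn2real_leI)
qed

lemma id_in_time_changes: "(\<lambda>x. x) \<in> time_changes"
  by (auto simp: time_changes_def strict_mono_on_def intro!: exI[of _ "\<lambda>x. x"] homeomorphism_ident)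

text \<open>\<open>enn2real\<close> sends infinity to 0, so a small \<open>skorokhod_dist\<close>
  means closeness only once the infimum is known to be finite. The identity time change and the
  boundedness of cadlag paths ensure this.\<close>

lemma skorokhod_dist_less:
  fixes \<gamma> \<gamma>' :: "real \<Rightarrow> 'a::metric_space"
  assumes \<gamma>: "\<gamma> \<in> cadlag UNIV dist" "\<gamma>' \<in> cadlag UNIV dist" and less: "skorokhod_dist dist \<gamma> \<gamma>' < e"
  obtains e' where "e' < e" "skorokhod_close \<gamma> \<gamma>' e'"
proof -
  let ?g = "\<lambda>\<theta>. max (log_slope \<theta>) (SUP t\<in>{0..1}. ennreal (dist (\<gamma> t) (\<gamma>' (\<theta> t))))"
  define I where "I = (INF \<theta>\<in>time_changes. ?g \<theta>)"
  have "bounded (\<gamma> ` {0..1} \<union> \<gamma>' ` {0..1})" using cadlag_bounded[OF \<gamma>(1)] cadlag_bounded[OF \<gamma>(2)] by simp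
  then obtain B where B: "\<And>x y. x \<in> \<gamma> ` {0..1} \<union> \<gamma>' ` {0..1} \<Longrightarrow> y \<in> \<gamma> ` {0..1} \<union> \<gamma>' ` {0..1} \<Longrightarrow> dist x y \<le> B"
    unfolding bounded_two_points by blast
  have "log_slope (\<lambda>x. x) \<le> ennreal 0" by (subst log_slope_le_iff) auto
  then have "?g (\<lambda>x. x) \<le> ennreal (max 0 B)"
    using B by (intro max.boundedI SUP_least ennreal_leI) (auto intro: order_trans simp: le_max_iff_disj)
  moreover have "I \<le> ?g (\<lambda>x. x)" unfolding I_def using INF_lower[OF id_in_time_changes, of ?g] .
  ultimately have "I \<le> ennreal (max 0 B)" by (rule order_trans[rotated])
  then have fin: "I < \<top>" by (rule le_less_trans[OF _ ennreal_less_top])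
  have "enn2real I < e" using less unfolding skorokhod_dist_def I_def .
  then obtain e' where e': "enn2real I < e'" "e' < e" using dense by blast
  have "0 < e'" by (rule le_less_trans[OF enn2real_nonneg e'(1)])
  have "ennreal (enn2real I) < ennreal e'" using e'(1) \<open>0 < e'\<close> by (intro ennreal_lessI)
  then have "I < ennreal e'" using fin by simp
  then have "\<exists>\<theta>\<in>time_changes. ?g \<theta> < ennreal e'" unfolding I_def INF_less_iff .
  then obtain \<theta> where \<theta>: "\<theta> \<in> time_changes" "?g \<theta> < ennreal e'" ..
  have "dist (\<gamma> t) (\<gamma>' (\<theta> t)) \<le> e'" if "t \<in> {0..1}" for t
  proof -
    have "ennreal (dist (\<gamma> t) (\<gamma>' (\<theta> t))) \<le> (SUP t\<in>{0..1}. ennreal (dist (\<gamma> t) (\<gamma>' (\<theta> t))))"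
      using that by (intro SUP_upper)
    also have "\<dots> \<le> ennreal e'" using less_imp_le[OF \<theta>(2)] by (rule order_trans[OF max.cobounded2])
    finally show ?thesis using \<open>0 < e'\<close> by simp
  qed
  moreover have "log_slope \<theta> \<le> ennreal e'"
    using less_imp_le[OF \<theta>(2)] by (rule order_trans[OF max.cobounded1])
  ultimately have "skorokhod_close \<gamma> \<gamma>' e'"
    unfolding skorokhod_close_def using \<theta>(1) \<open>0 < e'\<close> by (auto intro!: bexI[of _ \<theta>])
  then show ?thesis using e'(2) that by blast
qed

text \<open>Slopes multiply under composition of time changes, so their logarithms add.\<close>

lemma skorokhod_close_triangle:
  assumes "skorokhod_close \<gamma> \<gamma>' e" "skorokhod_close \<gamma>' \<gamma>'' e'"
  shows "skorokhod_close \<gamma> \<gamma>'' (e + e')"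
proof -
  obtain \<theta> where \<theta>: "0 \<le> e" "\<theta> \<in> time_changes" "log_slope \<theta> \<le> ennreal e"
    "\<And>t. t \<in> {0..1} \<Longrightarrow> dist (\<gamma> t) (\<gamma>' (\<theta> t)) \<le> e"
    using assms(1) by (auto simp: skorokhod_close_def)
  obtain \<theta>' where \<theta>': "0 \<le> e'" "\<theta>' \<in> time_changes" "log_slope \<theta>' \<le> ennreal e'"
    "\<And>t. t \<in> {0..1} \<Longrightarrow> dist (\<gamma>' t) (\<gamma>'' (\<theta>' t)) \<le> e'"
    using assms(2) by (auto simp: skorokhod_close_def)
  note T = time_changesD[OF \<theta>(2)] and T' = time_changesD[OF \<theta>'(2)]
  show ?thesis
    unfolding skorokhod_close_def
  proof (intro conjI bexI[of _ "\<theta>' \<circ> \<theta>"] ballI)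
    obtain \<kappa> \<kappa>' where "homeomorphism {0..1} {0..1} \<theta> \<kappa>" "homeomorphism {0..1} {0..1} \<theta>' \<kappa>'"
      using \<theta>(2) \<theta>'(2) by (auto simp: time_changes_def)
    then have "\<exists>\<kappa>. homeomorphism {0..1} {0..1} (\<theta>' \<circ> \<theta>) \<kappa>" using homeomorphism_compose by blast
    moreover have "strict_mono_on {0..1} (\<theta>' \<circ> \<theta>)"
      using T(1,5) T'(1) by (simp add: strict_mono_on_def)
    ultimately show "\<theta>' \<circ> \<theta> \<in> time_changes" by (simp add: time_changes_def)
    show "log_slope (\<theta>' \<circ> \<theta>) \<le> ennreal (e + e')"
    proof (subst log_slope_le_iff; (intro allI impI)?)
      fix s t :: real assume st: "0 \<le> s \<and> s < t \<and> t \<le> 1"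
      have lt: "\<theta> s < \<theta> t" using T(1) st by (auto simp: strict_mono_on_def)
      have 01: "0 \<le> \<theta> s" "\<theta> t \<le> 1" using T(5)[of s] T(5)[of t] st by auto
      have lt': "\<theta>' (\<theta> s) < \<theta>' (\<theta> t)" using T'(1) 01 lt by (auto simp: strict_mono_on_def)
      have "ln (((\<theta>' \<circ> \<theta>) t - (\<theta>' \<circ> \<theta>) s) / (t - s)) =
          ln ((\<theta>' (\<theta> t) - \<theta>' (\<theta> s)) / (\<theta> t - \<theta> s) * ((\<theta> t - \<theta> s) / (t - s)))"
        using lt by simp
      also have "\<dots> = ln ((\<theta>' (\<theta> t) - \<theta>' (\<theta> s)) / (\<theta> t - \<theta> s)) + ln ((\<theta> t - \<theta> s) / (t - s))"
        using lt lt' st by (intro ln_mult_pos) auto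
      moreover have "\<bar>ln ((\<theta> t - \<theta> s) / (t - s))\<bar> \<le> e"
        using \<theta>(3) st unfolding log_slope_le_iff[OF \<theta>(1)] by auto
      moreover have "\<bar>ln ((\<theta>' (\<theta> t) - \<theta>' (\<theta> s)) / (\<theta> t - \<theta> s))\<bar> \<le> e'"
        using \<theta>'(3) 01 lt unfolding log_slope_le_iff[OF \<theta>'(1)] by auto
      ultimately show "\<bar>ln (((\<theta>' \<circ> \<theta>) t - (\<theta>' \<circ> \<theta>) s) / (t - s))\<bar> \<le> e + e'"
        by linarith
    qed (use \<theta>(1) \<theta>'(1) in auto)
    fix t :: real assume t: "t \<in> {0..1}"
    show "dist (\<gamma> t) (\<gamma>'' ((\<theta>' \<circ> \<theta>) t)) \<le> e + e'"
      using dist_triangle[of "\<gamma> t" "\<gamma>'' ((\<theta>' \<circ> \<theta>) t)" "\<gamma>' (\<theta> t)"] \<theta>(4)[OF t] \<theta>'(4)[OF T(5)[OF t]] by simp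
  qed (use \<theta>(1) \<theta>'(1) in simp)
qed

text \<open>Slopes of the inverse are reciprocals of slopes of \<theta> at the corresponding times,
  with the same absolute logarithm. This yields the symmetry of
  \<open>skorokhod_dist\<close>.\<close>

lemma time_change_inverse:
  assumes \<theta>: "\<theta> \<in> time_changes"
  obtains \<kappa> where "\<kappa> \<in> time_changes" "log_slope \<kappa> \<le> log_slope \<theta>"
    "\<And>t. t \<in> {0..1} \<Longrightarrow> \<kappa> t \<in> {0..1}" "\<And>t. t \<in> {0..1} \<Longrightarrow> \<theta> (\<kappa> t) = t"
proof -
  note T = time_changesD[OF \<theta>]
  obtain \<kappa> where h: "homeomorphism {0..1} {0..1} \<theta> \<kappa>" using \<theta> by (auto simp: time_changes_def)
  have \<kappa>: "\<kappa> t \<in> {0..1}" "\<theta> (\<kappa> t) = t" if "t \<in> {0..1}" for t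
    using h that by (auto simp: homeomorphism_def)
  have \<kappa>m: "\<kappa> s < \<kappa> t" if "0 \<le> s" "s < t" "t \<le> 1" for s t
  proof (rule ccontr)
    assume "\<not> \<kappa> s < \<kappa> t"
    then have "\<theta> (\<kappa> t) \<le> \<theta> (\<kappa> s)"
      using T(1) \<kappa>(1)[of s] \<kappa>(1)[of t] that
      by (cases "\<kappa> t = \<kappa> s") (auto simp: strict_mono_on_def intro!: less_imp_le)
    then show False using \<kappa>(2)[of s] \<kappa>(2)[of t] that by auto
  qed
  show ?thesis
  proof (rule that[OF _ _ \<kappa>])
    show "\<kappa> \<in> time_changes"
      using homeomorphism_symD[OF h] \<kappa>m by (auto simp: time_changes_def strict_mono_on_def)
    show "log_slope \<kappa> \<le> log_slope \<theta>"
      unfolding log_slope_def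
    proof (rule Sup_least, clarify)
      fix s t :: real assume st: "0 \<le> s" "s < t" "t \<le> 1"
      have "ln ((\<kappa> t - \<kappa> s) / (t - s)) = - ln ((\<theta> (\<kappa> t) - \<theta> (\<kappa> s)) / (\<kappa> t - \<kappa> s))"
        using \<kappa>(2)[of s] \<kappa>(2)[of t] st \<kappa>m[of s t] by (subst ln_inverse[symmetric]) auto
      then have "ennreal \<bar>ln ((\<kappa> t - \<kappa> s) / (t - s))\<bar> = ennreal \<bar>ln ((\<theta> (\<kappa> t) - \<theta> (\<kappa> s)) / (\<kappa> t - \<kappa> s))\<bar>"
        by simp
      moreover have "0 \<le> \<kappa> s" "\<kappa> t \<le> 1" using \<kappa>(1)[of s] \<kappa>(1)[of t] st by auto
      ultimately show "ennreal \<bar>ln ((\<kappa> t - \<kappa> s) / (t - s))\<bar> \<le>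
          Sup {ennreal \<bar>ln ((\<theta> t - \<theta> s) / (t - s))\<bar> | s t. 0 \<le> s \<and> s < t \<and> t \<le> 1}"
        using \<kappa>m[OF st] by (intro Sup_upper) auto
    qed
  qed
qed

lemma skorokhod_dist_commute:
  "skorokhod_dist dist \<gamma> \<gamma>' = skorokhod_dist (dist :: 'a::metric_space \<Rightarrow> _) \<gamma>' \<gamma>"
proof -
  have "(INF \<theta>\<in>time_changes. max (log_slope \<theta>) (SUP t\<in>{0..1}. ennreal (dist (\<gamma> t) (\<gamma>' (\<theta> t))))) \<le>
      (INF \<theta>\<in>time_changes. max (log_slope \<theta>) (SUP t\<in>{0..1}. ennreal (dist (\<gamma>' t) (\<gamma> (\<theta> t)))))"
    for \<gamma> \<gamma>' :: "real \<Rightarrow> 'a"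
  proof (rule INF_mono)
    fix \<theta> assume "\<theta> \<in> time_changes"
    then obtain \<kappa> where \<kappa>: "\<kappa> \<in> time_changes" "log_slope \<kappa> \<le> log_slope \<theta>"
      "\<And>t. t \<in> {0..1} \<Longrightarrow> \<kappa> t \<in> {0..1}" "\<And>t. t \<in> {0..1} \<Longrightarrow> \<theta> (\<kappa> t) = t"
      using time_change_inverse by blast
    have "(SUP t\<in>{0..1}. ennreal (dist (\<gamma> t) (\<gamma>' (\<kappa> t)))) \<le> (SUP t\<in>{0..1}. ennreal (dist (\<gamma>' t) (\<gamma> (\<theta> t))))"
    proof (rule SUP_mono)
      fix t :: real assume "t \<in> {0..1}"
      then show "\<exists>s\<in>{0..1}. ennreal (dist (\<gamma> t) (\<gamma>' (\<kappa> t))) \<le> ennreal (dist (\<gamma>' s) (\<gamma> (\<theta> s)))"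
        using \<kappa>(3,4)[of t] by (intro bexI[of _ "\<kappa> t"]) (auto simp: dist_commute)
    qed
    then show "\<exists>\<kappa>\<in>time_changes. max (log_slope \<kappa>) (SUP t\<in>{0..1}. ennreal (dist (\<gamma> t) (\<gamma>' (\<kappa> t)))) \<le>
        max (log_slope \<theta>) (SUP t\<in>{0..1}. ennreal (dist (\<gamma>' t) (\<gamma> (\<theta> t))))"
      using \<kappa>(1,2) by (intro bexI[of _ \<kappa>] max.mono)
  qed
  then show ?thesis
    unfolding skorokhod_dist_def by (intro arg_cong[where f = enn2real] antisym)
qed

text \<open>A time change fixes 0, so its slope over [0, t] is \<theta> t / t, which lies between
  exp (-e) and exp e.\<close>

lemma time_change_displacement:
  assumes \<theta>: "\<theta> \<in> time_changes" "log_slope \<theta> \<le> ennreal e" and e: "0 \<le> e" and t: "t \<in> {0..1}"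
  shows "\<bar>\<theta> t - t\<bar> \<le> exp e - 1"
proof (cases "t = 0")
  case False
  then have t: "0 < t" "t \<le> 1" using t by auto
  have pos: "0 < \<theta> t"
    using strict_mono_onD[OF time_changesD(1)[OF \<theta>(1)], of 0 t] time_changesD(3)[OF \<theta>(1)] t by simp
  have "\<bar>ln (\<theta> t / t)\<bar> \<le> e"
    using \<theta>(2) t time_changesD(3)[OF \<theta>(1)] unfolding log_slope_le_iff[OF e]
    by (metis diff_zero order_refl)
  then have "\<theta> t / t \<le> exp e" "exp (- e) \<le> \<theta> t / t"
    using pos t ln_le_cancel_iff[of "\<theta> t / t" "exp e"] ln_le_cancel_iff[of "exp (- e)" "\<theta> t / t"]
    by (auto simp: abs_le_iff)
  then have *: "\<theta> t \<le> exp e * t" "exp (- e) * t \<le> \<theta> t" using t by (auto simp: field_simps)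
  have "(exp e - 1) * t \<le> exp e - 1" using t e by (intro mult_left_le) auto
  moreover have "(1 - exp (- e)) * t \<le> 1 - exp (- e)" using t e by (intro mult_left_le) auto
  moreover have "1 - exp (- e) \<le> exp e - 1"
    using exp_ge_add_one_self[of e] exp_ge_add_one_self[of "- e"] by linarith
  ultimately show ?thesis using * by (auto simp: abs_le_iff algebra_simps)
qed (use time_changesD(3)[OF \<theta>(1)] e in simp)

lemma skorokhod_close_imp_eq:
  fixes \<gamma> \<gamma>' :: "real \<Rightarrow> 'a::metric_space"
  assumes \<gamma>: "\<gamma> \<in> cadlag UNIV dist" "\<gamma>' \<in> cadlag UNIV dist"
    and close: "\<And>e. e > 0 \<Longrightarrow> skorokhod_close \<gamma> \<gamma>' e"
  shows "\<gamma> = \<gamma>'"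
proof (rule extensionalityI[where A = "{0..1}"])
  fix t :: real assume t: "t \<in> {0..1}"
  have "dist (\<gamma> t) (\<gamma>' t) \<le> 0 + e" if e: "e > 0" for e
  proof (cases "t = 1")
    case True
    obtain \<theta> where \<theta>: "\<theta> \<in> time_changes" "\<And>t. t \<in> {0..1} \<Longrightarrow> dist (\<gamma> t) (\<gamma>' (\<theta> t)) \<le> e"
      using close[OF e] by (auto simp: skorokhod_close_def)
    show ?thesis using \<theta>(2)[of 1] time_changesD(4)[OF \<theta>(1)] True by simp
  next
    case False
    then have t: "0 \<le> t" "t < 1" using t by auto
    have "\<forall>\<^sub>F s in at_right t. dist (\<gamma> s) (\<gamma> t) < e / 3" "\<forall>\<^sub>F s in at_right t. dist (\<gamma>' s) (\<gamma>' t) < e / 3"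
      using e by (intro order_tendstoD(2)[OF cadlagD(2)[OF \<gamma>(1) t]] order_tendstoD(2)[OF cadlagD(2)[OF \<gamma>(2) t]]; simp)+
    then have "\<forall>\<^sub>F s in at_right t. dist (\<gamma> s) (\<gamma> t) < e / 3 \<and> dist (\<gamma>' s) (\<gamma>' t) < e / 3"
      by (rule eventually_conj)
    then obtain b where b: "t < b" "\<And>s. t < s \<Longrightarrow> s < b \<Longrightarrow> dist (\<gamma> s) (\<gamma> t) < e / 3 \<and> dist (\<gamma>' s) (\<gamma>' t) < e / 3"
      by (auto simp: eventually_at_right_field)
    define c where "c = min b 1"
    \<comment> \<open>The midpoint s moves by at most exp e' - 1, and e' is chosen so that this is
      at most (c - t)/4. The image of s thus stays to the right of t and below b, where both paths
      are close to their values at t.\<close>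
    define s where "s = (t + c) / 2"
    define e' where "e' = min (e / 3) (ln (1 + (c - t) / 4))"
    have c: "t < c" "c \<le> 1" "c \<le> b" using b(1) t by (auto simp: c_def)
    then have "0 < ln (1 + (c - t) / 4)" by (intro ln_gt_zero) simp
    then have e': "0 < e'" "e' \<le> e / 3" using e by (auto simp: e'_def)
    have "exp e' \<le> exp (ln (1 + (c - t) / 4))" unfolding exp_le_cancel_iff by (simp add: e'_def)
    also have "exp (ln (1 + (c - t) / 4)) = 1 + (c - t) / 4" using c by (intro exp_ln) (simp add: field_simps)
    finally have "exp e' - 1 \<le> (c - t) / 4" by linarith
    obtain \<theta> where \<theta>: "\<theta> \<in> time_changes" "log_slope \<theta> \<le> ennreal e'"
      "\<And>t. t \<in> {0..1} \<Longrightarrow> dist (\<gamma> t) (\<gamma>' (\<theta> t)) \<le> e'"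
      using close[OF e'(1)] by (auto simp: skorokhod_close_def)
    have s: "t < s" "s < c" "s \<in> {0..1}" using c t by (auto simp: s_def)
    have "\<bar>\<theta> s - s\<bar> \<le> (c - t) / 4"
      using time_change_displacement[OF \<theta>(1,2) less_imp_le[OF e'(1)] s(3)] \<open>exp e' - 1 \<le> _\<close> by simp
    moreover have "t = s - (c - t) / 2" "c = s + (c - t) / 2" by (auto simp: s_def field_simps)
    ultimately have "t < \<theta> s" "\<theta> s < b" using c by linarith+
    then have "dist (\<gamma>' (\<theta> s)) (\<gamma>' t) < e / 3" "dist (\<gamma> s) (\<gamma> t) < e / 3"
      using b(2)[of s] b(2)[of "\<theta> s"] s c by auto
    moreover have "dist (\<gamma> s) (\<gamma>' (\<theta> s)) \<le> e / 3" using \<theta>(3)[OF s(3)] e'(2) by linarith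
    moreover have "dist (\<gamma> t) (\<gamma>' t) \<le> dist (\<gamma> s) (\<gamma> t) + dist (\<gamma> s) (\<gamma>' (\<theta> s)) + dist (\<gamma>' (\<theta> s)) (\<gamma>' t)"
      using dist_triangle[of "\<gamma> t" "\<gamma>' t" "\<gamma> s"] dist_triangle[of "\<gamma> s" "\<gamma>' t" "\<gamma>' (\<theta> s)"]
      by (simp add: dist_commute)
    ultimately show ?thesis by linarith
  qed
  then have "dist (\<gamma> t) (\<gamma>' t) \<le> 0" by (rule field_le_epsilon)
  then show "\<gamma> t = \<gamma>' t" by simp
qed (use \<gamma> in \<open>auto simp: cadlag_def PiE_def\<close>)

lemma Metric_space_skorokhod:
  "Metric_space (cadlag UNIV dist) (skorokhod_dist (dist :: 'a::metric_space \<Rightarrow> _))"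
proof
  fix \<gamma> \<gamma>' \<gamma>'' :: "real \<Rightarrow> 'a"
  show "0 \<le> skorokhod_dist dist \<gamma> \<gamma>'" by (simp add: skorokhod_dist_def)
  show "skorokhod_dist dist \<gamma> \<gamma>' = skorokhod_dist dist \<gamma>' \<gamma>" by (rule skorokhod_dist_commute)
  assume \<gamma>: "\<gamma> \<in> cadlag UNIV dist" "\<gamma>' \<in> cadlag UNIV dist"
  show "skorokhod_dist dist \<gamma> \<gamma>' = 0 \<longleftrightarrow> \<gamma> = \<gamma>'"
  proof
    assume z: "skorokhod_dist dist \<gamma> \<gamma>' = 0"
    show "\<gamma> = \<gamma>'"
    proof (rule skorokhod_close_imp_eq[OF \<gamma>])
      fix e :: real assume "e > 0"
      then obtain e' where "e' < e" "skorokhod_close \<gamma> \<gamma>' e'" using skorokhod_dist_less[OF \<gamma>, of e] z by auto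
      then show "skorokhod_close \<gamma> \<gamma>' e"
        unfolding skorokhod_close_def by (meson ennreal_leI less_imp_le order_trans)
    qed
  next
    assume "\<gamma> = \<gamma>'"
    have "log_slope (\<lambda>x. x) \<le> ennreal 0" by (subst log_slope_le_iff) auto
    then have "skorokhod_close \<gamma> \<gamma>' 0"
      unfolding skorokhod_close_def \<open>\<gamma> = \<gamma>'\<close> using id_in_time_changes by (intro conjI bexI) auto
    then have "skorokhod_dist dist \<gamma> \<gamma>' \<le> 0" by (rule skorokhod_dist_le)
    then show "skorokhod_dist dist \<gamma> \<gamma>' = 0" by (simp add: skorokhod_dist_def order_antisym)
  qed
  assume \<gamma>'': "\<gamma>'' \<in> cadlag UNIV dist"
  show "skorokhod_dist dist \<gamma> \<gamma>'' \<le> skorokhod_dist dist \<gamma> \<gamma>' + skorokhod_dist dist \<gamma>' \<gamma>''"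
  proof (rule field_le_epsilon)
    fix e :: real assume "e > 0"
    then have less: "skorokhod_dist dist \<gamma> \<gamma>' < skorokhod_dist dist \<gamma> \<gamma>' + e / 2"
      "skorokhod_dist dist \<gamma>' \<gamma>'' < skorokhod_dist dist \<gamma>' \<gamma>'' + e / 2" by simp_all
    obtain a where a: "a < skorokhod_dist dist \<gamma> \<gamma>' + e / 2" "skorokhod_close \<gamma> \<gamma>' a"
      by (rule skorokhod_dist_less[OF \<gamma> less(1)])
    obtain b where b: "b < skorokhod_dist dist \<gamma>' \<gamma>'' + e / 2" "skorokhod_close \<gamma>' \<gamma>'' b"
      by (rule skorokhod_dist_less[OF \<gamma>(2) \<gamma>'' less(2)])
    have "skorokhod_dist dist \<gamma> \<gamma>'' \<le> a + b"
      using a(2) b(2) by (intro skorokhod_dist_le skorokhod_close_triangle)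
    then show "skorokhod_dist dist \<gamma> \<gamma>'' \<le> skorokhod_dist dist \<gamma> \<gamma>' + skorokhod_dist dist \<gamma>' \<gamma>'' + e"
      using a(1) b(1) by linarith
  qed
qed

interpretation skorokhod: Metric_space "cadlag UNIV dist" "skorokhod_dist (dist :: 'a::metric_space \<Rightarrow> _)"
  by (rule Metric_space_skorokhod)

section \<open>Evaluations are Borel on the path space\<close>

lemma space_path_borel [simp]: "space (path_borel :: (real \<Rightarrow> 'a::polish_space) measure) = cadlag UNIV dist"
  unfolding skorokhod_borel_def
  by (intro space_measure_of) (use openin_subset[of skorokhod.mtopology] in auto)

lemma sets_path_borel:
  "sets (path_borel :: (real \<Rightarrow> 'a::polish_space) measure) =
    sigma_sets (cadlag UNIV dist) {U. openin skorokhod.mtopology U}"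
  unfolding skorokhod_borel_def
  by (intro sets_measure_of) (use openin_subset[of skorokhod.mtopology] in auto)

text \<open>Evaluation at an interior time is not Skorokhod continuous. By right continuity,
  however, \<gamma> t lies in the open set S iff \<gamma> stays in some closed \<open>C m\<close>
  throughout a short window to the right of t, and the paths with this property form a Skorokhod
  closed set.\<close>

lemma measurable_path_borel_eval [measurable]:
  assumes t: "t \<in> {0..1}"
  shows "(\<lambda>\<gamma>. \<gamma> t) \<in> borel_measurable (path_borel :: (real \<Rightarrow> 'a::polish_space) measure)"
proof (rule borel_measurableI)
  fix S :: "'a set" assume S: "open S"
  let ?D = "cadlag UNIV dist :: (real \<Rightarrow> 'a) set"
  \<comment> \<open>Points at distance at least 1/(m+1) from the complement of S: closed sets that
    exhaust S.\<close>
  define C where "C m = - (\<Union>y\<in>-S. ball y (1 / (real m + 1)))" for m :: nat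
  define A where "A n m = {\<gamma>\<in>?D. \<forall>s\<in>{0..1}. t \<le> s \<and> s < t + 1 / (real n + 1) \<longrightarrow> \<gamma> s \<in> C m}" for n m
  have C: "closed (C m)" "C m \<subseteq> S" for m
  proof -
    show "closed (C m)" unfolding C_def by (intro closed_Compl open_UN) simp
    show "C m \<subseteq> S"
    proof (rule subsetI, rule ccontr)
      fix x assume "x \<in> C m" "x \<notin> S"
      moreover have "x \<in> ball x (1 / (real m + 1))" by simp
      ultimately show False unfolding C_def by blast
    qed
  qed
  have "openin skorokhod.mtopology (?D - A n m)" for n m
    unfolding skorokhod.openin_mtopology
  proof (intro conjI allI impI)
    fix \<gamma> assume "\<gamma> \<in> ?D - A n m"
    then obtain s0 where \<gamma>: "\<gamma> \<in> ?D" and s0: "s0 \<in> {0..1}" "t \<le> s0" "s0 < t + 1 / (real n + 1)" "\<gamma> s0 \<notin> C m"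
      by (auto simp: A_def)
    \<comment> \<open>A time change could carry s = t out of the window to the left. So s is taken
      strictly to the right of t, using right continuity and the closedness of \<open>C m\<close>,
      or it is the fixed point 1.\<close>
    have "\<exists>s\<in>{0..1}. t \<le> s \<and> s < t + 1 / (real n + 1) \<and> \<gamma> s \<notin> C m \<and> (s = 1 \<or> t < s)"
    proof (cases "s0 = 1 \<or> t < s0")
      case False
      then have s0': "0 \<le> s0" "s0 < 1" "s0 = t" using s0 by auto
      obtain r where r: "r > 0" "ball (\<gamma> s0) r \<subseteq> - C m"
        using C(1) s0(4) unfolding closed_def open_contains_ball by blast
      have "\<forall>\<^sub>F s in at_right s0. dist (\<gamma> s) (\<gamma> s0) < r"
        using r by (intro order_tendstoD(2)[OF cadlagD(2)[OF \<gamma> s0'(1,2)]])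
      then obtain b where b: "b > s0" "\<And>s. s0 < s \<Longrightarrow> s < b \<Longrightarrow> dist (\<gamma> s) (\<gamma> s0) < r"
        by (auto simp: eventually_at_right_field)
      obtain s where s: "s0 < s" "s < min b (min 1 (t + 1 / (real n + 1)))"
        using dense[of s0 "min b (min 1 (t + 1 / (real n + 1)))"] b(1) s0' s0(3) by auto
      then have "\<gamma> s \<in> ball (\<gamma> s0) r" using b(2)[of s] by (simp add: dist_commute)
      then show ?thesis using r(2) s s0' t by (intro bexI[of _ s]) auto
    qed (use s0 in auto)
    then obtain s where s: "s \<in> {0..1}" "t \<le> s" "s < t + 1 / (real n + 1)" "\<gamma> s \<notin> C m" "s = 1 \<or> t < s"
      by blast
    obtain r where r: "r > 0" "ball (\<gamma> s) r \<subseteq> - C m"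
      using C(1) s(4) unfolding closed_def open_contains_ball by blast
    \<comment> \<open>How far s may move without leaving the window. Time changes fix 1, so for s =
      1 any positive value serves.\<close>
    define \<delta> where "\<delta> = (if s = 1 then 1 else min (s - t) (t + 1 / (real n + 1) - s))"
    have \<delta>: "\<delta> > 0" using s by (auto simp: \<delta>_def)
    define e where "e = min r (ln (1 + \<delta> / 2))"
    have "0 < ln (1 + \<delta> / 2)" using \<delta> by (intro ln_gt_zero) simp
    then have e: "0 < e" using r(1) by (simp add: e_def)
    have "\<gamma>' \<in> ?D - A n m" if \<gamma>': "\<gamma>' \<in> ?D" "skorokhod_dist dist \<gamma> \<gamma>' < e" for \<gamma>'
    proof -
      obtain e' where e': "e' < e" "skorokhod_close \<gamma> \<gamma>' e'"
        by (rule skorokhod_dist_less[OF \<gamma> \<gamma>'])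
      then obtain \<theta> where \<theta>: "0 \<le> e'" "\<theta> \<in> time_changes" "log_slope \<theta> \<le> ennreal e'"
        "\<And>t. t \<in> {0..1} \<Longrightarrow> dist (\<gamma> t) (\<gamma>' (\<theta> t)) \<le> e'"
        by (auto simp: skorokhod_close_def)
      have "exp e' < exp (ln (1 + \<delta> / 2))" unfolding exp_less_cancel_iff using e'(1) by (simp add: e_def)
      also have "exp (ln (1 + \<delta> / 2)) = 1 + \<delta> / 2" using \<delta> by (intro exp_ln) (simp add: field_simps)
      finally have "exp e' - 1 < \<delta>" using \<delta> by simp
      then have disp: "\<bar>\<theta> s - s\<bar> < \<delta>"
        using time_change_displacement[OF \<theta>(2,3,1) s(1)] by linarith
      have "t \<le> \<theta> s" "\<theta> s < t + 1 / (real n + 1)"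
        using disp s time_changesD(4)[OF \<theta>(2)] by (auto simp: \<delta>_def split: if_splits)
      moreover have "\<gamma>' (\<theta> s) \<notin> C m"
        using \<theta>(4)[OF s(1)] e'(1) r(2) by (auto simp: e_def subset_eq)
      ultimately show ?thesis
        using \<gamma>'(1) time_changesD(5)[OF \<theta>(2) s(1)] by (auto simp: A_def)
    qed
    then show "\<exists>r>0. skorokhod.mball \<gamma> r \<subseteq> ?D - A n m" using e by (intro exI[of _ e]) auto
  qed auto
  then have "?D - A n m \<in> sets path_borel" for n m
    unfolding sets_path_borel by (intro sigma_sets.Basic) auto
  then have "space path_borel - (?D - A n m) \<in> sets path_borel" for n m by blast
  moreover have "space path_borel - (?D - A n m) = A n m" for n m by (auto simp: A_def)
  ultimately have A: "A n m \<in> sets path_borel" for n m by simp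
  have "(\<lambda>\<gamma>. \<gamma> t) -` S \<inter> space path_borel = (\<Union>n m. A n m)"
  proof (intro equalityI subsetI)
    fix \<gamma> assume "\<gamma> \<in> (\<Union>n m. A n m)"
    then show "\<gamma> \<in> (\<lambda>\<gamma>. \<gamma> t) -` S \<inter> space path_borel"
      using t C(2) by (force simp: A_def)
  next
    fix \<gamma> assume "\<gamma> \<in> (\<lambda>\<gamma>. \<gamma> t) -` S \<inter> space path_borel"
    then have \<gamma>: "\<gamma> \<in> ?D" "\<gamma> t \<in> S" by auto
    obtain r where r: "r > 0" "ball (\<gamma> t) r \<subseteq> S" using S \<gamma>(2) open_contains_ball by blast
    obtain m where m: "1 / (real m + 1) < r / 2"
      using reals_Archimedean[of "r / 2"] r(1) by (auto simp: inverse_eq_divide add.commute)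
    have inC: "x \<in> C m" if "dist x (\<gamma> t) < r / 2" for x
    proof -
      have "\<not> dist y x < 1 / (real m + 1)" if "y \<notin> S" for y
      proof
        assume "dist y x < 1 / (real m + 1)"
        then have "dist (\<gamma> t) y < r"
          using m \<open>dist x (\<gamma> t) < r / 2\<close> dist_triangle[of "\<gamma> t" y x] by (simp add: dist_commute)
        then show False using r(2) \<open>y \<notin> S\<close> by auto
      qed
      then show ?thesis by (auto simp: C_def)
    qed
    have "\<exists>b>t. \<forall>s\<in>{0..1}. t \<le> s \<and> s < b \<longrightarrow> dist (\<gamma> s) (\<gamma> t) < r / 2"
    proof (cases "t = 1")
      case True
      then show ?thesis using r(1) by (intro exI[of _ 2]) auto
    next
      case False
      then have t': "0 \<le> t" "t < 1" using t by auto
      have "\<forall>\<^sub>F s in at_right t. dist (\<gamma> s) (\<gamma> t) < r / 2"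
        using r by (intro order_tendstoD(2)[OF cadlagD(2)[OF \<gamma>(1) t']]) simp
      then obtain b where "b > t" "\<And>s. t < s \<Longrightarrow> s < b \<Longrightarrow> dist (\<gamma> s) (\<gamma> t) < r / 2"
        by (auto simp: eventually_at_right_field)
      then show ?thesis using r(1) by (intro exI[of _ b]) (auto simp: le_less)
    qed
    then obtain b where b: "b > t" "\<And>s. s \<in> {0..1} \<Longrightarrow> t \<le> s \<Longrightarrow> s < b \<Longrightarrow> dist (\<gamma> s) (\<gamma> t) < r / 2" by blast
    obtain n where "1 / (real n + 1) < b - t"
      using reals_Archimedean[of "b - t"] b(1) by (auto simp: inverse_eq_divide add.commute)
    then have "\<gamma> \<in> A n m" unfolding A_def using \<gamma>(1) b(2) inC by auto
    then show "\<gamma> \<in> (\<Union>n m. A n m)" by blast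
  qed
  then show "(\<lambda>\<gamma>. \<gamma> t) -` S \<inter> space path_borel \<in> sets path_borel" using A by auto
qed

subsection \<open>Approximation by step functions\<close>

text \<open>The cap at n - 1 puts t = 1 into the last cell, so that step paths have no jump at the
  terminal time.\<close>

definition grid_index :: "nat \<Rightarrow> real \<Rightarrow> nat" where
  "grid_index n t = min (nat \<lfloor>real n * t\<rfloor>) (n - 1)"

definition step_path :: "nat \<Rightarrow> (nat \<Rightarrow> 'a) \<Rightarrow> real \<Rightarrow> 'a" where
  "step_path n x = (\<lambda>t\<in>{0..1}. x (grid_index n t))"

lemma grid_index_eventually_at_right:
  assumes "0 \<le> t" "t < 1" "0 < n"
  shows "\<forall>\<^sub>F s in at_right t. s \<in> {0..1} \<and> grid_index n s = grid_index n t"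
proof -
  let ?k = "\<lfloor>real n * t\<rfloor>"
  have "real_of_int ?k \<le> real n * t" "real n * t < real_of_int ?k + 1" by linarith+
  then have k: "t < (real_of_int ?k + 1) / real n" using assms by (simp add: field_simps)
  have "grid_index n s = grid_index n t" if "t < s" "s < (real_of_int ?k + 1) / real n" for s
  proof -
    have "real n * t \<le> real n * s" using that assms by simp
    then have "real_of_int ?k \<le> real n * s" by linarith
    moreover have "real n * s < real_of_int ?k + 1" using that assms by (simp add: field_simps)
    ultimately have "\<lfloor>real n * s\<rfloor> = ?k" by linarith
    then show ?thesis by (simp add: grid_index_def)
  qed
  then show ?thesis
    using k assms by (auto simp: eventually_at_right_field intro!: exI[of _ "min 1 ((real_of_int ?k + 1) / real n)"])
qed

lemma grid_index_eventually_at_left: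
  assumes "0 < t" "t \<le> 1" "0 < n"
  shows "\<exists>k. (\<forall>\<^sub>F s in at_left t. s \<in> {0..1} \<and> grid_index n s = k) \<and> (t = 1 \<longrightarrow> k = grid_index n 1)"
proof -
  define k where "k = \<lceil>real n * t\<rceil> - 1"
  have k: "real_of_int k < real n * t" "real n * t \<le> real_of_int k + 1" unfolding k_def by linarith+
  have "grid_index n s = min (nat k) (n - 1)" if "real_of_int k / real n < s" "s < t" for s
  proof -
    have "real_of_int k \<le> real n * s" using that assms by (simp add: field_simps)
    moreover have "real n * s < real n * t" using that assms by simp
    then have "real n * s < real_of_int k + 1" using k by linarith
    ultimately have "\<lfloor>real n * s\<rfloor> = k" by linarith
    then show ?thesis by (simp add: grid_index_def)
  qed
  moreover have "real_of_int k / real n < t" using k assms by (simp add: field_simps)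
  ultimately have "\<forall>\<^sub>F s in at_left t. s \<in> {0..1} \<and> grid_index n s = min (nat k) (n - 1)"
    using assms by (auto simp: eventually_at_left_field intro!: exI[of _ "max 0 (real_of_int k / real n)"])
  moreover have "min (nat k) (n - 1) = grid_index n 1" if "t = 1"
    using that by (simp add: k_def grid_index_def nat_diff_distrib)
  ultimately show ?thesis by blast
qed

lemma step_path_cadlag:
  fixes x :: "nat \<Rightarrow> 'a::metric_space"
  assumes n: "0 < n"
  shows "step_path n x \<in> cadlag UNIV dist"
  unfolding cadlag_def
proof (intro CollectI conjI ballI)
  show "step_path n x \<in> {0..1} \<rightarrow>\<^sub>E UNIV" by (auto simp: step_path_def)
  show "((\<lambda>s. dist (step_path n x s) (step_path n x t)) \<longlongrightarrow> 0) (at_right t)" if "t \<in> {0..<1}" for t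
  proof (rule tendsto_eventually)
    have t: "0 \<le> t" "t < 1" using that by auto
    show "\<forall>\<^sub>F s in at_right t. dist (step_path n x s) (step_path n x t) = 0"
      using grid_index_eventually_at_right[OF t n]
      by eventually_elim (use t in \<open>auto simp: step_path_def\<close>)
  qed
  have left: "\<exists>k. ((\<lambda>s. dist (step_path n x s) (x k)) \<longlongrightarrow> 0) (at_left t) \<and> (t = 1 \<longrightarrow> k = grid_index n 1)"
    if t: "t \<in> {0<..1}" for t
  proof -
    obtain k where k: "\<forall>\<^sub>F s in at_left t. s \<in> {0..1} \<and> grid_index n s = k" "t = 1 \<longrightarrow> k = grid_index n 1"
      using grid_index_eventually_at_left[of t n] t n by (meson greaterThanAtMost_iff)
    have "\<forall>\<^sub>F s in at_left t. dist (step_path n x s) (x k) = 0"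
      using k(1) by eventually_elim (auto simp: step_path_def)
    then have "((\<lambda>s. dist (step_path n x s) (x k)) \<longlongrightarrow> 0) (at_left t)"
      by (rule tendsto_eventually)
    then show ?thesis using k(2) by blast
  qed
  then show "\<exists>l\<in>UNIV. ((\<lambda>s. dist (step_path n x s) l) \<longlongrightarrow> 0) (at_left t)" if "t \<in> {0<..1}" for t
    using that by blast
  show "((\<lambda>s. dist (step_path n x s) (step_path n x 1)) \<longlongrightarrow> 0) (at_left 1)"
    using left[of 1] by (auto simp: step_path_def)
qed

lemma tent_lipschitz:
  fixes s t p w :: real
  assumes "w > 0"
  shows "\<bar>max 0 (1 - \<bar>t - p\<bar> / w) - max 0 (1 - \<bar>s - p\<bar> / w)\<bar> \<le> \<bar>t - s\<bar> / w"
proof -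
  have "\<bar>max 0 (1 - a) - max 0 (1 - b)\<bar> \<le> \<bar>a - b\<bar>" for a b :: real by linarith
  then have "\<bar>max 0 (1 - \<bar>t - p\<bar> / w) - max 0 (1 - \<bar>s - p\<bar> / w)\<bar> \<le> \<bar>\<bar>t - p\<bar> / w - \<bar>s - p\<bar> / w\<bar>" .
  also have "\<dots> = \<bar>\<bar>t - p\<bar> - \<bar>s - p\<bar>\<bar> / w"
    using assms by (simp flip: diff_divide_distrib)
  also have "\<dots> \<le> \<bar>t - s\<bar> / w"
    using assms by (intro divide_right_mono) auto
  finally show ?thesis .
qed

lemma finite_separated:
  fixes F :: "real set"
  assumes "finite F"
  obtains w where "w > 0" "\<And>p q. p \<in> F \<Longrightarrow> q \<in> F \<Longrightarrow> p \<noteq> q \<Longrightarrow> w \<le> \<bar>p - q\<bar>"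
proof -
  define D where "D = insert 1 ((\<lambda>(p, q). \<bar>p - q\<bar>) ` {(p, q) \<in> F \<times> F. p \<noteq> q})"
  have "finite {(p, q) \<in> F \<times> F. p \<noteq> q}" using assms by (auto intro: finite_subset[of _ "F \<times> F"])
  then have D: "finite D" "D \<noteq> {}" by (auto simp: D_def)
  have "Min D \<in> D" using D by (rule Min_in)
  then have "Min D > 0" by (auto simp: D_def)
  moreover have "Min D \<le> \<bar>p - q\<bar>" if "p \<in> F" "q \<in> F" "p \<noteq> q" for p q
    by (rule Min_le[OF D(1)]) (use that in \<open>auto simp: D_def\<close>)
  ultimately show ?thesis using that by blast
qed

lemma small_slope:
  assumes "e > (0::real)"
  obtains \<eta> where "0 < \<eta>" "\<eta> < 1" "\<And>x. \<bar>x - 1\<bar> \<le> \<eta> \<Longrightarrow> \<bar>ln x\<bar> \<le> e"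
proof -
  have "isCont ln (1::real)" by (intro isCont_ln) simp
  then obtain d where d: "d > 0" "\<And>x. dist x 1 < d \<Longrightarrow> dist (ln x) (ln (1::real)) < e"
    using assms unfolding continuous_at_eps_delta by blast
  show ?thesis
  proof (rule that[of "min (d / 2) (1 / 2)"])
    fix x :: real assume "\<bar>x - 1\<bar> \<le> min (d / 2) (1 / 2)"
    then have "dist x 1 < d" using d(1) by (simp add: dist_real_def)
    then show "\<bar>ln x\<bar> \<le> e" using d(2)[of x] by (simp add: dist_real_def)
  qed (use d in auto)
qed

text \<open>A time change that moves each point of a finite set up to the next grid point, obtained by
  adding small tent functions to the identity.\<close>

lemma time_change_through_grid:
  fixes F :: "real set" and \<eta> :: real
  assumes F: "finite F" "F \<subseteq> {0..<1}" "0 \<in> F" and \<eta>: "0 < \<eta>" "\<eta> < 1"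
  shows "\<forall>\<^sub>F n in sequentially. \<exists>\<theta>\<in>time_changes.
    (\<forall>p\<in>F. \<theta> p = real_of_int \<lceil>real n * p\<rceil> / real n \<and> \<lceil>real n * p\<rceil> \<le> int n - 1) \<and>
    (\<forall>s t. 0 \<le> s \<and> s < t \<and> t \<le> 1 \<longrightarrow> \<bar>(\<theta> t - \<theta> s) / (t - s) - 1\<bar> \<le> \<eta>)"
proof -
  \<comment> \<open>Tents of half-width w around the points of F vanish at the other points of F and
    at 1, so the points move independently of each other and 1 stays fixed.\<close>
  obtain w where w: "w > 0" "\<And>p q. p \<in> insert 1 F \<Longrightarrow> q \<in> insert 1 F \<Longrightarrow> p \<noteq> q \<Longrightarrow> w \<le> \<bar>p - q\<bar>"
    using finite_separated[of "insert 1 F"] F(1) by auto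
  \<comment> \<open>Each tent has height at most 1/n and slope at most 1/(n w), so the first
    quantity bounds the total slope error. The second condition keeps the rounded points away from
    the grid point 1.\<close>
  have "(\<lambda>n. real (card F) / (real n * w)) \<longlonglongrightarrow> 0" "(\<lambda>n. 2 / real n) \<longlonglongrightarrow> 0"
    using w(1) by real_asymp+
  then have "\<forall>\<^sub>F n in sequentially. real (card F) / (real n * w) < \<eta>" "\<forall>\<^sub>F n in sequentially. 2 / real n < w"
    using \<eta>(1) w(1) by (auto intro: order_tendstoD)
  then show ?thesis using eventually_gt_at_top[of 0]
  proof eventually_elim
    case (elim n)
    define g where "g p = real_of_int \<lceil>real n * p\<rceil> / real n" for p
    define tent where "tent p t = max 0 (1 - \<bar>t - p\<bar> / w)" for p t
    define \<theta> where "\<theta> t = t + (\<Sum>p\<in>F. (g p - p) * tent p t)" for t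
    have g: "0 \<le> g p - p" "g p - p \<le> 1 / real n" for p
    proof -
      have a: "0 \<le> real_of_int \<lceil>real n * p\<rceil> - real n * p" "real_of_int \<lceil>real n * p\<rceil> - real n * p \<le> 1" by linarith+
      have "g p - p = (real_of_int \<lceil>real n * p\<rceil> - real n * p) / real n"
        using elim by (simp add: g_def diff_divide_distrib)
      then show "0 \<le> g p - p" "g p - p \<le> 1 / real n" using a(1) divide_right_mono[OF a(2), of "real n"] by auto
    qed
    have tent0: "tent p q = 0" if "p \<in> insert 1 F" "q \<in> insert 1 F" "p \<noteq> q" for p q
      using w(2)[OF that] w(1) by (simp add: tent_def abs_minus_commute max_def field_simps)
    have \<theta>F: "\<theta> q = g q" if "q \<in> F" for q
    proof -
      have "(\<Sum>p\<in>F. (g p - p) * tent p q) = (\<Sum>p\<in>F. if p = q then g q - q else 0)"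
        using tent0 that w(1) by (intro sum.cong) (auto simp: tent_def)
      then show ?thesis using that F(1) by (simp add: \<theta>_def)
    qed
    have \<theta>0: "\<theta> 0 = 0" using \<theta>F[OF F(3)] by (simp add: g_def)
    have "(\<Sum>p\<in>F. (g p - p) * tent p 1) = 0"
      using F(2) by (intro sum.neutral ballI) (auto intro!: tent0)
    then have \<theta>1: "\<theta> 1 = 1" by (simp add: \<theta>_def)
    have lip: "\<bar>(\<theta> t - \<theta> s) - (t - s)\<bar> \<le> \<eta> * \<bar>t - s\<bar>" for s t
    proof -
      have "(\<theta> t - \<theta> s) - (t - s) = (\<Sum>p\<in>F. (g p - p) * (tent p t - tent p s))"
        by (simp add: \<theta>_def sum_subtractf right_diff_distrib)
      also have "\<bar>\<dots>\<bar> \<le> (\<Sum>p\<in>F. (1 / real n) * (\<bar>t - s\<bar> / w))"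
      proof (rule order_trans[OF sum_abs sum_mono])
        fix p assume "p \<in> F"
        have "\<bar>(g p - p) * (tent p t - tent p s)\<bar> = (g p - p) * \<bar>tent p t - tent p s\<bar>"
          using g(1)[of p] by (simp add: abs_mult)
        also have "\<dots> \<le> (1 / real n) * (\<bar>t - s\<bar> / w)"
          using g[of p] tent_lipschitz[OF w(1), of t p s] by (intro mult_mono) (auto simp: tent_def)
        finally show "\<bar>(g p - p) * (tent p t - tent p s)\<bar> \<le> (1 / real n) * (\<bar>t - s\<bar> / w)" .
      qed
      also have "\<dots> = real (card F) / (real n * w) * \<bar>t - s\<bar>" by simp
      also have "\<dots> \<le> \<eta> * \<bar>t - s\<bar>" using elim by (intro mult_right_mono) auto
      finally show ?thesis .
    qed
    have slope: "\<bar>(\<theta> t - \<theta> s) / (t - s) - 1\<bar> \<le> \<eta>" if "s < t" for s t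
    proof -
      have "\<bar>(\<theta> t - \<theta> s) / (t - s) - 1\<bar> = \<bar>(\<theta> t - \<theta> s) - (t - s)\<bar> / (t - s)"
        using that by (simp add: divide_diff_eq_iff abs_divide)
      also have "\<dots> \<le> \<eta>" using lip[of t s] that by (simp add: divide_le_eq)
      finally show ?thesis .
    qed
    have mono: "\<theta> s < \<theta> t" if "s < t" for s t
    proof -
      have "\<eta> * (t - s) < 1 * (t - s)" using \<eta> that by (intro mult_strict_right_mono) auto
      moreover have "- ((\<theta> t - \<theta> s) - (t - s)) \<le> \<eta> * \<bar>t - s\<bar>" by (rule abs_le_D2[OF lip])
      moreover have "\<bar>t - s\<bar> = t - s" using that by simp
      ultimately show ?thesis by simp
    qed
    then have mono': "\<theta> s \<le> \<theta> t" if "s \<le> t" for s t using that by (cases "s = t") (auto intro: less_imp_le)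
    have cont: "continuous_on {0..1} \<theta>"
      unfolding \<theta>_def tent_def using w(1) by (intro continuous_intros) auto
    have img: "\<theta> ` {0..1} = {0..1}"
    proof
      show "\<theta> ` {0..1} \<subseteq> {0..1}" using mono'[of 0] mono'[of _ 1] \<theta>0 \<theta>1 by auto
      show "{0..1} \<subseteq> \<theta> ` {0..1}"
      proof
        fix y :: real assume "y \<in> {0..1}"
        then obtain x where "0 \<le> x" "x \<le> 1" "\<theta> x = y"
          using IVT'[of \<theta> 0 y 1] \<theta>0 \<theta>1 cont by auto
        then show "y \<in> \<theta> ` {0..1}" by auto
      qed
    qed
    have "inj_on \<theta> {0..1}" using mono by (metis inj_onI less_irrefl linorder_neqE_linordered_idom)
    then have "\<theta> \<in> time_changes"
      unfolding time_changes_def strict_mono_on_def using mono homeomorphism_compact[OF _ cont img] by auto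
    moreover have "\<lceil>real n * p\<rceil> \<le> int n - 1" if "p \<in> F" for p
    proof -
      have "w \<le> 1 - p" using w(2)[of 1 p] that F(2) by auto
      moreover have "2 \<le> real n * w" using elim by (simp add: field_simps)
      moreover have "real n * w \<le> real n * (1 - p)" using \<open>w \<le> 1 - p\<close> by (intro mult_left_mono) auto
      ultimately have "real n * p \<le> real n - 2" by (simp add: algebra_simps)
      then show ?thesis unfolding ceiling_le_iff by simp
    qed
    ultimately show ?case using \<theta>F slope by (intro bexI[of _ \<theta>]) (auto simp: g_def)
  qed
qed

text \<open>Rounding the jump times of the partition up to grid points aligns partition cells with
  grid cells. A time t and the left end \<sigma> of the grid cell of \<theta> t then lie in one
  partition cell, where \<gamma> oscillates by at most e.\<close>

lemma step_path_close:
  fixes \<gamma> :: "real \<Rightarrow> 'a::metric_space"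
  assumes \<gamma>: "\<gamma> \<in> cadlag UNIV dist" and e: "0 < e"
  shows "\<forall>\<^sub>F n in sequentially. skorokhod_close \<gamma> (step_path n (\<lambda>k. \<gamma> (real k / real n))) e"
proof -
  obtain F where F: "finite F" "F \<subseteq> {0..<1}" "0 \<in> F"
    "\<And>s t. 0 \<le> s \<Longrightarrow> s \<le> t \<Longrightarrow> t \<le> 1 \<Longrightarrow> F \<inter> {s<..t} = {} \<Longrightarrow> dist (\<gamma> s) (\<gamma> t) \<le> e"
    using cadlag_finite_partition[OF \<gamma> e] by blast
  obtain \<eta> where \<eta>: "0 < \<eta>" "\<eta> < 1" "\<And>x. \<bar>x - 1\<bar> \<le> \<eta> \<Longrightarrow> \<bar>ln x\<bar> \<le> e"
    using small_slope[OF e] by blast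
  from time_change_through_grid[OF F(1-3) \<eta>(1,2)] eventually_gt_at_top[of 0] show ?thesis
  proof eventually_elim
    case (elim n)
    then obtain \<theta> where \<theta>: "\<theta> \<in> time_changes"
      "\<And>p. p \<in> F \<Longrightarrow> \<theta> p = real_of_int \<lceil>real n * p\<rceil> / real n"
      "\<And>p. p \<in> F \<Longrightarrow> \<lceil>real n * p\<rceil> \<le> int n - 1"
      "\<And>s t. 0 \<le> s \<Longrightarrow> s < t \<Longrightarrow> t \<le> 1 \<Longrightarrow> \<bar>(\<theta> t - \<theta> s) / (t - s) - 1\<bar> \<le> \<eta>"
      by blast
    note T = time_changesD[OF \<theta>(1)]
    have n: "0 < n" using elim by simp
    show ?case
      unfolding skorokhod_close_def
    proof (intro conjI bexI[OF _ \<theta>(1)] ballI)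
      show "log_slope \<theta> \<le> ennreal e"
        using \<theta>(4) \<eta>(3) e by (subst log_slope_le_iff) auto
      fix t :: real assume t: "t \<in> {0..1}"
      define \<sigma> where "\<sigma> = real (grid_index n (\<theta> t)) / real n"
      have \<theta>t: "0 \<le> \<theta> t" "\<theta> t \<le> 1" using T(5)[OF t] by auto
      have "real (grid_index n (\<theta> t)) \<le> real n" by (simp add: grid_index_def)
      then have \<sigma>: "0 \<le> \<sigma>" "\<sigma> \<le> 1" using n by (auto simp: \<sigma>_def divide_le_eq)
      have n\<sigma>: "real n * \<sigma> = real_of_int (min \<lfloor>real n * \<theta> t\<rfloor> (int n - 1))"
        proof -
        have "int (grid_index n (\<theta> t)) = min \<lfloor>real n * \<theta> t\<rfloor> (int n - 1)"
          using n \<theta>t(1) by (simp add: grid_index_def of_nat_min of_nat_diff)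
        then have "real_of_int (int (grid_index n (\<theta> t))) = real_of_int (min \<lfloor>real n * \<theta> t\<rfloor> (int n - 1))"
          by (simp only:)
        then show ?thesis using n by (simp add: \<sigma>_def)
      qed
      \<comment> \<open>No partition point separates t from \<sigma>. This is a comparison of
        integers, since \<theta> q is n q rounded up, divided by n.\<close>
      have "q \<le> t \<longleftrightarrow> q \<le> \<sigma>" if q: "q \<in> F" for q
      proof -
        have q01: "q \<in> {0..1}" using q F(2) by auto
        have "q \<le> t \<longleftrightarrow> \<theta> q \<le> \<theta> t"
          using strict_mono_on_leD[OF T(1) q01 t] strict_mono_onD[OF T(1) t q01] by force
        also have "\<dots> \<longleftrightarrow> real_of_int \<lceil>real n * q\<rceil> \<le> real n * \<theta> t"
          using \<theta>(2)[OF q] n by (simp add: divide_le_eq mult.commute)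
        also have "\<dots> \<longleftrightarrow> \<lceil>real n * q\<rceil> \<le> \<lfloor>real n * \<theta> t\<rfloor>" by (simp add: le_floor_iff)
        also have "\<dots> \<longleftrightarrow> \<lceil>real n * q\<rceil> \<le> min \<lfloor>real n * \<theta> t\<rfloor> (int n - 1)" using \<theta>(3)[OF q] by simp
        also have "\<dots> \<longleftrightarrow> real n * q \<le> real n * \<sigma>" unfolding n\<sigma> ceiling_le_iff by (simp only:)
        also have "\<dots> \<longleftrightarrow> q \<le> \<sigma>" using n by simp
        finally show ?thesis .
      qed
      then have "F \<inter> {t<..\<sigma>} = {}" "F \<inter> {\<sigma><..t} = {}" by force+
      then have "dist (\<gamma> t) (\<gamma> \<sigma>) \<le> e"
        using F(4)[of t \<sigma>] F(4)[of \<sigma> t] t \<sigma> by (cases "t \<le> \<sigma>") (auto simp: dist_commute)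
      then show "dist (\<gamma> t) (step_path n (\<lambda>k. \<gamma> (real k / real n)) (\<theta> t)) \<le> e"
        using \<theta>t by (simp add: step_path_def \<sigma>_def)
    qed (use e in simp)
  qed
qed

lemma step_path_cong_close:
  assumes "\<And>k. k < n \<Longrightarrow> dist (x k) (y k) \<le> r" "0 < n" "0 \<le> r"
  shows "skorokhod_close (step_path n x) (step_path n y) r"
  unfolding skorokhod_close_def
proof (intro conjI bexI[OF _ id_in_time_changes] ballI)
  show "log_slope (\<lambda>x. x) \<le> ennreal r" using assms(3) by (subst log_slope_le_iff) auto
  fix t :: real assume "t \<in> {0..1}"
  moreover have "grid_index n t < n" using assms(2) by (auto simp: grid_index_def min_def)
  ultimately show "dist (step_path n x t) (step_path n y t) \<le> r"
    using assms(1) by (simp add: step_path_def)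
qed (rule assms(3))

section \<open>Measurability of path-valued maps\<close>

text \<open>The step paths through the grid values of \<Phi> converge to \<Phi> in the Skorokhod
  metric, and each depends on finitely many evaluations. Membership in an open set is thus a
  countable combination of events about step paths.\<close>

lemma measurable_path_borelI:
  fixes \<Phi> :: "'b \<Rightarrow> real \<Rightarrow> 'a::polish_space"
  assumes \<Phi>: "\<Phi> \<in> space N \<rightarrow> cadlag UNIV dist"
    and meas: "\<And>t. t \<in> {0..1} \<Longrightarrow> (\<lambda>\<omega>. \<Phi> \<omega> t) \<in> borel_measurable N"
  shows "\<Phi> \<in> measurable N path_borel"
proof -
  let ?D = "cadlag UNIV dist :: (real \<Rightarrow> 'a) set" and ?d = "skorokhod_dist dist :: (real \<Rightarrow> 'a) \<Rightarrow> _"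
  have "\<Phi> -` U \<inter> space N \<in> sets N" if U: "openin skorokhod.mtopology U" for U
  proof -
    \<comment> \<open>Paths with a ball of radius greater than 1/(m+1) inside U. The strict
      inequality leaves the slack that makes the condition open in the grid values.\<close>
    define V where "V m = {\<gamma>\<in>?D. \<exists>r>1 / (real m + 1). \<forall>y\<in>?D. ?d \<gamma> y < r \<longrightarrow> y \<in> U}" for m :: nat
    \<comment> \<open>Capping at 1 keeps all coordinates in I, so the whole sequence is measurable;
      coordinates beyond n do not enter \<open>step_path n\<close>.\<close>
    define X where "X n \<omega> = (\<lambda>k. \<Phi> \<omega> (min 1 (real k / real n)))" for n \<omega>
    have X: "X n \<in> borel_measurable N" for n
      unfolding X_def by (intro measurable_coordinatewise_then_product meas) auto
    have op: "open {x. step_path n x \<in> V m}" if n: "0 < n" for n m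
      unfolding open_subopen[of "{x. step_path n x \<in> V m}"]
    proof clarify
      fix x assume "step_path n x \<in> V m"
      then obtain r where r: "r > 1 / (real m + 1)" "\<And>y. y \<in> ?D \<Longrightarrow> ?d (step_path n x) y < r \<Longrightarrow> y \<in> U"
        by (auto simp: V_def)
      \<comment> \<open>Half of the slack in r > 1/(m+1): after a perturbation of size \<eta> the
        radius r - \<eta> still exceeds 1/(m+1).\<close>
      define \<eta> where "\<eta> = (r - 1 / (real m + 1)) / 2"
      have \<eta>: "\<eta> > 0" using r(1) by (simp add: \<eta>_def)
      define T where "T = (\<Inter>k\<in>{..<n}. (\<lambda>y. y k) -` ball (x k) \<eta>)"
      have "continuous_on UNIV (\<lambda>y :: nat \<Rightarrow> 'a. y k)" for k
        by (rule continuous_on_product_then_coordinatewise[OF continuous_on_id])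
      then have "open T"
        unfolding T_def by (intro open_INT ballI open_vimage open_ball) auto
      moreover have "x \<in> T" using \<eta> by (simp add: T_def)
      moreover have "T \<subseteq> {x. step_path n x \<in> V m}"
      proof clarify
        fix y assume "y \<in> T"
        then have "?d (step_path n x) (step_path n y) \<le> \<eta>"
          using n \<eta> by (intro skorokhod_dist_le step_path_cong_close) (auto simp: T_def less_imp_le)
        then have tr: "?d (step_path n x) z \<le> \<eta> + ?d (step_path n y) z" if "z \<in> ?D" for z
          using skorokhod.triangle[OF step_path_cadlag[OF n] step_path_cadlag[OF n] that, of x y] by linarith
        show "step_path n y \<in> V m"
          unfolding V_def
        proof (intro CollectI conjI exI[of _ "r - \<eta>"] ballI impI)
          show "1 / (real m + 1) < r - \<eta>" 
          proof -
            have "c < r - (r - c) / 2" if "c < r" for c using that by (simp add: field_simps)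
            from this[OF r(1)] show ?thesis unfolding \<eta>_def .
          qed
          fix z assume "z \<in> ?D" "?d (step_path n y) z < r - \<eta>"
          then show "z \<in> U" using tr[of z] by (intro r(2)) auto
        qed (rule step_path_cadlag[OF n])
      qed
      ultimately show "\<exists>T. open T \<and> x \<in> T \<and> T \<subseteq> {x. step_path n x \<in> V m}" by blast
    qed
    have conv: "\<forall>\<^sub>F n in sequentially. ?d (\<Phi> \<omega>) (step_path n (X n \<omega>)) \<le> e"
      if "\<omega> \<in> space N" "e > 0" for \<omega> e
    proof -
      have "\<Phi> \<omega> \<in> ?D" using \<Phi> that by auto
      from step_path_close[OF this that(2)] eventually_gt_at_top[of 0] show ?thesis
      proof eventually_elim
        case (elim n)
        have "step_path n (X n \<omega>) = step_path n (\<lambda>k. \<Phi> \<omega> (real k / real n))"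
          unfolding step_path_def X_def
        proof (intro restrict_ext)
          fix t :: real
          have "grid_index n t \<le> n" unfolding grid_index_def by linarith
          then have "real (grid_index n t) / real n \<le> 1" using elim by (simp add: divide_le_eq)
          then show "\<Phi> \<omega> (min 1 (real (grid_index n t) / real n)) = \<Phi> \<omega> (real (grid_index n t) / real n)"
            by simp
        qed
        then show ?case using skorokhod_dist_le elim by metis
      qed
    qed
    \<comment> \<open>A path in U has a ball in U, so its approximations end up in a common V m.
      Conversely, once the approximation error is at most 1/(m+1), membership of the step path in V
      m forces the path itself into U.\<close>
    have iff: "\<Phi> \<omega> \<in> U \<longleftrightarrow> (\<exists>m. \<exists>K. \<forall>n\<ge>K. step_path (Suc n) (X (Suc n) \<omega>) \<in> V m)" if \<omega>: "\<omega> \<in> space N" for \<omega>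
    proof
      assume "\<Phi> \<omega> \<in> U"
      then obtain r where r: "r > 0" "skorokhod.mball (\<Phi> \<omega>) r \<subseteq> U"
        using U unfolding skorokhod.openin_mtopology by blast
      have D: "\<Phi> \<omega> \<in> ?D" using \<Phi> \<omega> by auto
      obtain m where m: "1 / (real m + 1) < r / 2"
        using reals_Archimedean[of "r / 2"] r(1) by (auto simp: inverse_eq_divide add.commute)
      have r2: "r / 2 > 0" using r(1) by simp
      have "\<forall>\<^sub>F n in sequentially. step_path n (X n \<omega>) \<in> V m"
        using conv[OF \<omega> r2] eventually_gt_at_top[of 0]
      proof eventually_elim
        case (elim n)
        show ?case
          unfolding V_def
        proof (intro CollectI conjI exI[of _ "r / 2"] ballI impI)
          fix z assume z: "z \<in> ?D" "?d (step_path n (X n \<omega>)) z < r / 2"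
          have "?d (\<Phi> \<omega>) z \<le> ?d (\<Phi> \<omega>) (step_path n (X n \<omega>)) + ?d (step_path n (X n \<omega>)) z"
            using elim by (intro skorokhod.triangle[OF D step_path_cadlag z(1)]) simp
          then show "z \<in> U" using z elim D r by (intro subsetD[OF r(2)]) auto
        qed (use elim m r in \<open>auto intro: step_path_cadlag\<close>)
      qed
      then obtain K where "\<And>n. n \<ge> K \<Longrightarrow> step_path n (X n \<omega>) \<in> V m" by (auto simp: eventually_sequentially)
      then show "\<exists>m. \<exists>K. \<forall>n\<ge>K. step_path (Suc n) (X (Suc n) \<omega>) \<in> V m"
        by (intro exI[of _ m] exI[of _ K]) auto
    next
      assume "\<exists>m. \<exists>K. \<forall>n\<ge>K. step_path (Suc n) (X (Suc n) \<omega>) \<in> V m"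
      then obtain m K where mK: "\<And>n. n \<ge> K \<Longrightarrow> step_path (Suc n) (X (Suc n) \<omega>) \<in> V m" by blast
      have D: "\<Phi> \<omega> \<in> ?D" using \<Phi> \<omega> by auto
      obtain K' where K': "\<And>n. n \<ge> K' \<Longrightarrow> ?d (\<Phi> \<omega>) (step_path n (X n \<omega>)) \<le> 1 / (real m + 1)"
        using conv[OF \<omega>, of "1 / (real m + 1)"] by (auto simp: eventually_sequentially)
      define n where "n = Suc (max K K')"
      have "step_path n (X n \<omega>) \<in> V m" "?d (step_path n (X n \<omega>)) (\<Phi> \<omega>) \<le> 1 / (real m + 1)"
        using mK[of "max K K'"] K'[of n] by (auto simp: n_def skorokhod_dist_commute)
      then show "\<Phi> \<omega> \<in> U" unfolding V_def using D by (auto intro: le_less_trans)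
    qed
    have "\<omega> \<in> \<Phi> -` U \<inter> space N \<longleftrightarrow>
        \<omega> \<in> (\<Union>m K. \<Inter>n\<in>{K..}. X (Suc n) -` {x. step_path (Suc n) x \<in> V m} \<inter> space N)" for \<omega>
      by (cases "\<omega> \<in> space N") (auto simp only: iff Int_iff UN_iff INT_iff vimage_eq mem_Collect_eq atLeast_iff UNIV_I)
    then have "\<Phi> -` U \<inter> space N = (\<Union>m K. \<Inter>n\<in>{K..}. X (Suc n) -` {x. step_path (Suc n) x \<in> V m} \<inter> space N)"
      by blast
    also have "\<dots> \<in> sets N"
    proof -
      have "X (Suc n) -` {x. step_path (Suc n) x \<in> V m} \<inter> space N \<in> sets N" for n m
        by (rule measurable_sets[OF X borel_open[OF op]]) simp
      then show ?thesis by (intro sets.countable_UN'' sets.countable_INT') auto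
    qed
    finally show ?thesis .
  qed
  then show ?thesis
    unfolding skorokhod_borel_def using \<Phi>
    by (intro measurable_measure_of) (use openin_subset[of skorokhod.mtopology] in auto)
qed

section \<open>The Wasserstein distance\<close>

definition dense_seq :: "nat \<Rightarrow> 'a::polish_space" where
  "dense_seq = (SOME q. \<forall>x. \<forall>e>0. \<exists>k. dist x (q k) < e)"

text \<open>The fibres form a countable Borel partition of the space; two points of one fibre are
  less than 2 e apart.\<close>

definition code_index :: "real \<Rightarrow> 'a::polish_space \<Rightarrow> nat" where
  "code_index e x = (LEAST k. dist x (dense_seq k) < e)"

lemma dense_seq: "e > 0 \<Longrightarrow> \<exists>k. dist (x :: 'a::polish_space) (dense_seq k) < e"
proof -
  obtain D :: "'a set" where D: "countable D" "\<And>X. open X \<Longrightarrow> X \<noteq> {} \<Longrightarrow> \<exists>d\<in>D. d \<in> X"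
    using countable_dense_setE by blast
  have "D \<noteq> {}" using D(2)[of UNIV] by auto
  have "\<forall>x::'a. \<forall>e>0. \<exists>k. dist x (from_nat_into D k) < e"
  proof (intro allI impI)
    fix x :: 'a and e :: real assume "e > 0"
    then obtain d where "d \<in> D" "d \<in> ball x e" using D(2)[of "ball x e"] by auto
    then show "\<exists>k. dist x (from_nat_into D k) < e"
      using from_nat_into_surj[OF D(1) \<open>d \<in> D\<close>] by (auto simp: ball_def)
  qed
  then have "\<forall>x::'a. \<forall>e>0. \<exists>k. dist x (dense_seq k) < e"
    unfolding dense_seq_def by (rule someI[where P = "\<lambda>q. \<forall>x. \<forall>e>0. \<exists>k. dist x (q k) < e"])
  then show "e > 0 \<Longrightarrow> ?thesis" by blast
qed

lemma dist_code_index: "e > 0 \<Longrightarrow> dist x (dense_seq (code_index e x)) < e"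
  unfolding code_index_def using dense_seq by (rule LeastI_ex)

lemma measurable_code_index [measurable]: "code_index e \<in> measurable borel (count_space UNIV)"
  unfolding code_index_def by measurable

lemma space_prob_algebra_borelD:
  assumes "\<mu> \<in> space (prob_algebra borel)"
  shows "prob_space \<mu>" "sets \<mu> = sets borel" "space \<mu> = UNIV"
  using assms by (auto simp: space_prob_algebra sets_eq_imp_space_eq)

lemma distr_in_prob_algebra:
  assumes "prob_space P" "X \<in> measurable P borel"
  shows "distr P borel X \<in> space (prob_algebra borel)"
  using prob_space.prob_space_distr[OF assms] by (simp add: space_prob_algebra)

lemma measurable_borel_fst [measurable]: "fst \<in> borel_measurable (borel :: ('a::polish_space \<times> 'a) measure)"
  and measurable_borel_snd [measurable]: "snd \<in> borel_measurable (borel :: ('a::polish_space \<times> 'a) measure)"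
  by (simp_all add: borel_measurable_continuous_onI continuous_on_fst continuous_on_snd)

text \<open>Both measures are cut along a countable partition into sets of diameter less than \<open>e\<close>, on whose
  cells the two sides are glued independently. This replaces disintegration.\<close>

lemma approximate_gluing:
  fixes Y :: "'w \<Rightarrow> 'a::polish_space" and q :: "('a \<times> 'a) measure"
  assumes P: "prob_space P" and Y [measurable]: "Y \<in> borel_measurable P"
    and q: "q \<in> space (prob_algebra borel)"
    and marg: "distr P borel Y = distr q borel fst" and e: "e > 0"
  obtains R where "prob_space R" "sets R = sets (P \<Otimes>\<^sub>M borel)"
    "distr R P fst = P" "distr R borel snd = q"
    "AE w in R. dist (Y (fst w)) (fst (snd w)) < e"
proof -
  interpret P: prob_space P by fact
  interpret q: prob_space q using space_prob_algebra_borelD[OF q] by simp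
  interpret PQ: pair_sigma_finite P q ..
  have sq [measurable_cong]: "sets q = sets borel" using space_prob_algebra_borelD[OF q] by simp
  have spq [simp]: "space q = UNIV" using space_prob_algebra_borelD[OF q] by simp
  define i :: "'a \<Rightarrow> nat" where "i = code_index (e / 2)"
  have i [measurable]: "i \<in> measurable borel (count_space UNIV)" by (simp add: i_def)
  have fst_q [measurable]: "fst \<in> borel_measurable q"
    unfolding measurable_cong_sets[OF sq refl] by measurable
  have i_fst [measurable]: "(\<lambda>z. i (fst z)) \<in> measurable q (count_space UNIV)"
    by measurable
  have close: "dist x y < e" if "i x = i y" for x y
  proof -
    have "dist x (dense_seq (i x)) < e / 2" "dist y (dense_seq (i x)) < e / 2"
      using dist_code_index[of "e / 2" x] dist_code_index[of "e / 2" y] e that by (simp_all add: i_def)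
    then show ?thesis by (rule dist_triangle_half_l)
  qed
  define m where "m k = emeasure q {z. i (fst z) = k}" for k
  \<comment> \<open>Equal marginals give each cell the same mass on both sides, so one normalising
    constant serves both.\<close>
  have mP: "emeasure P {\<omega>\<in>space P. i (Y \<omega>) = k} = m k" for k
  proof -
    have "emeasure (distr P borel Y) {x. i x = k} = emeasure (distr q borel fst) {x. i x = k}"
      by (simp only: marg)
    moreover have "{x. i x = k} \<in> sets borel"
      using measurable_sets[OF i, of "{k}"] by (simp add: vimage_def)
    ultimately show ?thesis
      by (simp add: emeasure_distr m_def vimage_def Int_def conj_commute)
  qed
  have m_fin: "m k \<noteq> \<top>" for k unfolding m_def by simp
  have AE_P: "AE \<omega> in P. m (i (Y \<omega>)) \<noteq> 0"
  proof -
    have "AE \<omega> in P. i (Y \<omega>) = k \<longrightarrow> m k \<noteq> 0" for k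
    proof (cases "m k = 0")
      case True
      then have "emeasure P {\<omega>\<in>space P. i (Y \<omega>) = k} = 0" using mP by simp
      then have "AE \<omega> in P. i (Y \<omega>) \<noteq> k" by (subst AE_iff_measurable[OF _ refl]) auto
      then show ?thesis by eventually_elim simp
    qed auto
    then have "AE \<omega> in P. \<forall>k. i (Y \<omega>) = k \<longrightarrow> m k \<noteq> 0" unfolding AE_all_countable by blast
    then show ?thesis by eventually_elim blast
  qed
  have AE_q: "AE z in q. m (i (fst z)) \<noteq> 0"
  proof -
    have "AE z in q. i (fst z) = k \<longrightarrow> m k \<noteq> 0" for k
    proof (cases "m k = 0")
      case True
      then have "emeasure q {z\<in>space q. i (fst z) = k} = 0" by (simp add: m_def)
      then have "AE z in q. i (fst z) \<noteq> k" by (subst AE_iff_measurable[OF _ refl]) auto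
      then show ?thesis by eventually_elim simp
    qed auto
    then have "AE z in q. \<forall>k. i (fst z) = k \<longrightarrow> m k \<noteq> 0" unfolding AE_all_countable by blast
    then show ?thesis by eventually_elim blast
  qed
  \<comment> \<open>Density of the gluing with respect to the product: the value 1 / m k on pairs in
    a common cell k makes almost every section integrate to 1. Cells of mass 0, where the inverse is
    infinite, are avoided almost everywhere.\<close>
  define h :: "'w \<times> 'a \<times> 'a \<Rightarrow> ennreal" where
    "h w = (if i (Y (fst w)) = i (fst (snd w)) then inverse (m (i (Y (fst w)))) else 0)" for w
  have iY [measurable]: "(\<lambda>w. i (Y (fst w))) \<in> measurable (P \<Otimes>\<^sub>M q) (count_space UNIV)"
    and ifs [measurable]: "(\<lambda>w. i (fst (snd w))) \<in> measurable (P \<Otimes>\<^sub>M q) (count_space UNIV)"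
    by measurable
  have [measurable]: "(\<lambda>w. inverse (m (i (Y (fst w))))) \<in> borel_measurable (P \<Otimes>\<^sub>M q)"
    using measurable_compose[OF iY, of "\<lambda>k. inverse (m k)" borel] by simp
  have h [measurable]: "h \<in> borel_measurable (P \<Otimes>\<^sub>M q)"
  proof -
    have "(\<Union>k. ((\<lambda>w. i (Y (fst w))) -` {k} \<inter> space (P \<Otimes>\<^sub>M q)) \<inter>
        ((\<lambda>w. i (fst (snd w))) -` {k} \<inter> space (P \<Otimes>\<^sub>M q))) \<in> sets (P \<Otimes>\<^sub>M q)"
      by (intro sets.countable_UN'' sets.Int measurable_sets[OF iY] measurable_sets[OF ifs]) auto
    also have "(\<Union>k. ((\<lambda>w. i (Y (fst w))) -` {k} \<inter> space (P \<Otimes>\<^sub>M q)) \<inter>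
        ((\<lambda>w. i (fst (snd w))) -` {k} \<inter> space (P \<Otimes>\<^sub>M q))) =
        {w \<in> space (P \<Otimes>\<^sub>M q). i (Y (fst w)) = i (fst (snd w))}" by auto
    finally show ?thesis unfolding h_def by (intro measurable_If) auto
  qed
  define R where "R = density (P \<Otimes>\<^sub>M q) h"
  have sR: "sets R = sets (P \<Otimes>\<^sub>M q)" by (simp add: R_def)
  then have sR': "sets R = sets (P \<Otimes>\<^sub>M borel)" using sets_pair_measure_cong[OF refl sq] by simp
  have spR: "space R = space P \<times> UNIV" by (simp add: R_def space_pair_measure)
  have inv: "inverse (m k) * m k = 1" if "m k \<noteq> 0" for k
    using that m_fin[of k] by (metis ennreal_divide_self divide_ennreal_def mult.commute top.not_eq_extremum)
  have d1: "distr R P fst = P"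
  proof (rule measure_eqI)
    fix A assume "A \<in> sets (distr R P fst)"
    then have A [measurable]: "A \<in> sets P" by simp
    have "emeasure (distr R P fst) A = emeasure R (A \<times> UNIV)"
      using sets.sets_into_space[OF A] by (subst emeasure_distr) (auto simp: spR measurable_cong_sets[OF sR refl] intro!: arg_cong[where f = "emeasure R"])
    also have "\<dots> = (\<integral>\<^sup>+w. h w * indicator (A \<times> UNIV) w \<partial>(P \<Otimes>\<^sub>M q))"
      unfolding R_def using pair_measureI[OF A, of UNIV q] sets.top[of q] by (intro emeasure_density) auto
    also have "\<dots> = (\<integral>\<^sup>+\<omega>. (\<integral>\<^sup>+z. h (\<omega>, z) * indicator (A \<times> UNIV) (\<omega>, z) \<partial>q) \<partial>P)"
      using pair_measureI[OF A, of UNIV q] sets.top[of q] by (intro q.nn_integral_fst[symmetric]) auto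
    also have "\<dots> = (\<integral>\<^sup>+\<omega>. indicator A \<omega> \<partial>P)"
    proof (rule nn_integral_cong_AE, use AE_P in eventually_elim)
      case (elim \<omega>)
      have "(\<integral>\<^sup>+z. h (\<omega>, z) * indicator (A \<times> UNIV) (\<omega>, z) \<partial>q) =
          (\<integral>\<^sup>+z. (indicator A \<omega> * inverse (m (i (Y \<omega>)))) * indicator {z. i (fst z) = i (Y \<omega>)} z \<partial>q)"
        by (intro nn_integral_cong) (auto simp: h_def indicator_def)
      also have "\<dots> = (indicator A \<omega> * inverse (m (i (Y \<omega>)))) * m (i (Y \<omega>))"
        unfolding m_def
        by (intro nn_integral_cmult_indicator) (use measurable_sets[OF i_fst, of "{i (Y \<omega>)}"] in \<open>simp add: vimage_def\<close>)
      also have "\<dots> = indicator A \<omega>" using inv[OF elim] by (simp add: mult.assoc)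
      finally show ?case .
    qed
    also have "\<dots> = emeasure P A" by simp
    finally show "emeasure (distr R P fst) A = emeasure P A" .
  qed simp
  have d2: "distr R borel snd = q"
  proof (rule measure_eqI)
    fix A assume "A \<in> sets (distr R borel snd)"
    then have A [measurable]: "A \<in> sets q" by (simp add: sq)
    have PA: "space P \<times> A \<in> sets (P \<Otimes>\<^sub>M q)" by (intro pair_measureI) auto
    have "emeasure (distr R borel snd) A = emeasure R (space P \<times> A)"
      using A sq by (subst emeasure_distr) (auto simp: spR measurable_cong_sets[OF sR' refl] intro!: arg_cong[where f = "emeasure R"])
    also have "\<dots> = (\<integral>\<^sup>+w. h w * indicator (space P \<times> A) w \<partial>(P \<Otimes>\<^sub>M q))"
      unfolding R_def using PA by (intro emeasure_density) auto
    also have "\<dots> = (\<integral>\<^sup>+z. (\<integral>\<^sup>+\<omega>. h (\<omega>, z) * indicator (space P \<times> A) (\<omega>, z) \<partial>P) \<partial>q)"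
      using PA by (intro PQ.nn_integral_snd[symmetric]) auto
    also have "\<dots> = (\<integral>\<^sup>+z. indicator A z \<partial>q)"
    proof (rule nn_integral_cong_AE, use AE_q in eventually_elim)
      case (elim z)
      have "(\<integral>\<^sup>+\<omega>. h (\<omega>, z) * indicator (space P \<times> A) (\<omega>, z) \<partial>P) =
          (\<integral>\<^sup>+\<omega>. (indicator A z * inverse (m (i (fst z)))) * indicator {\<omega>\<in>space P. i (Y \<omega>) = i (fst z)} \<omega> \<partial>P)"
        by (intro nn_integral_cong) (auto simp: h_def indicator_def)
      also have "\<dots> = (indicator A z * inverse (m (i (fst z)))) * m (i (fst z))"
        unfolding mP[symmetric] by (intro nn_integral_cmult_indicator) measurable
      also have "\<dots> = indicator A z" using inv[OF elim] by (simp add: mult.assoc)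
      finally show ?case .
    qed
    also have "\<dots> = emeasure q A" by simp
    finally show "emeasure (distr R borel snd) A = emeasure q A" .
  qed (simp add: sq)
  have "prob_space (distr R P fst)" using d1 P by simp
  moreover have "fst \<in> measurable R P" unfolding measurable_cong_sets[OF sR refl] by (rule measurable_fst)
  ultimately have "prob_space R" by (metis prob_space_distrD)
  moreover have "AE w in R. dist (Y (fst w)) (fst (snd w)) < e"
    unfolding R_def AE_density[OF h] by (intro AE_I2) (auto simp: h_def intro: close split: if_splits)
  ultimately show ?thesis using that sR' d1 d2 by blast
qed

section \<open>Couplings and the triangle inequality for W_1\<close>

abbreviation coupling_cost :: "('a::polish_space \<times> 'a) measure \<Rightarrow> ennreal" where
  "coupling_cost p \<equiv> \<integral>\<^sup>+ z. ennreal (dist (fst z) (snd z)) \<partial>p"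

lemma couplingI:
  fixes X Y :: "'w \<Rightarrow> 'a::polish_space"
  assumes P: "prob_space P" and [measurable]: "X \<in> borel_measurable P" "Y \<in> borel_measurable P"
  shows "distr P borel (\<lambda>\<omega>. (X \<omega>, Y \<omega>)) \<in> couplings (distr P borel X) (distr P borel Y)"
    and "coupling_cost (distr P borel (\<lambda>\<omega>. (X \<omega>, Y \<omega>))) = (\<integral>\<^sup>+\<omega>. ennreal (dist (X \<omega>) (Y \<omega>)) \<partial>P)"
proof -
  have m [measurable]: "(\<lambda>\<omega>. (X \<omega>, Y \<omega>)) \<in> borel_measurable P" by measurable
  show "distr P borel (\<lambda>\<omega>. (X \<omega>, Y \<omega>)) \<in> couplings (distr P borel X) (distr P borel Y)"
    unfolding couplings_def
    using distr_distr[of fst borel borel "\<lambda>\<omega>. (X \<omega>, Y \<omega>)" P]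
      distr_distr[of snd borel borel "\<lambda>\<omega>. (X \<omega>, Y \<omega>)" P]
    by (simp add: distr_in_prob_algebra[OF P m] o_def)
  show "coupling_cost (distr P borel (\<lambda>\<omega>. (X \<omega>, Y \<omega>))) = (\<integral>\<^sup>+\<omega>. ennreal (dist (X \<omega>) (Y \<omega>)) \<partial>P)"
    by (subst nn_integral_distr[OF m]) simp_all
qed

lemma W1_distr_le:
  fixes X Y :: "'w \<Rightarrow> 'a::polish_space"
  assumes "prob_space P" "X \<in> borel_measurable P" "Y \<in> borel_measurable P"
  shows "W1 (distr P borel X) (distr P borel Y) \<le> (\<integral>\<^sup>+\<omega>. ennreal (dist (X \<omega>) (Y \<omega>)) \<partial>P)"
  unfolding couplingI(2)[OF assms, symmetric] W1_def by (rule INF_lower[OF couplingI(1)[OF assms]])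

lemma couplingsD:
  assumes "p \<in> couplings \<mu> \<nu>"
  shows "prob_space p" "sets p = sets borel" "distr p borel fst = \<mu>" "distr p borel snd = \<nu>"
    "fst \<in> borel_measurable p" "snd \<in> borel_measurable p" "p \<in> space (prob_algebra borel)"
proof -
  show *: "p \<in> space (prob_algebra borel)" "distr p borel fst = \<mu>" "distr p borel snd = \<nu>"
    using assms by (auto simp: couplings_def)
  show "prob_space p" and s: "sets p = sets borel" using space_prob_algebra_borelD[OF *(1)] by auto
  show "fst \<in> borel_measurable p" "snd \<in> borel_measurable p"
    unfolding measurable_cong_sets[OF s refl] by measurable
qed

lemma W1_lessE:
  assumes "W1 \<mu> \<nu> < c"
  obtains p where "p \<in> couplings \<mu> \<nu>" "coupling_cost p < c"
  using assms unfolding W1_def INF_less_iff by blast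

lemma W1_commute: "W1 \<mu> \<nu> = W1 \<nu> \<mu>"
proof -
  have "W1 \<nu> \<mu> \<le> W1 \<mu> \<nu>" for \<mu> \<nu> :: "'a measure"
    unfolding W1_def[of \<mu> \<nu>]
  proof (rule INF_greatest)
    fix p assume "p \<in> couplings \<mu> \<nu>"
    note p = couplingsD[OF this]
    show "W1 \<nu> \<mu> \<le> coupling_cost p"
      using W1_distr_le[OF p(1,6,5)] by (simp add: p(3,4) dist_commute)
  qed
  from this[of \<mu> \<nu>] this[of \<nu> \<mu>] show ?thesis by (rule antisym)
qed

lemma W1_refl:
  fixes \<mu> :: "'a::polish_space measure"
  assumes "\<mu> \<in> space (prob_algebra borel)"
  shows "W1 \<mu> \<mu> = 0"
proof -
  note \<mu> = space_prob_algebra_borelD[OF assms]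
  have id: "(\<lambda>x. x) \<in> borel_measurable \<mu>" using \<mu>(2) by (intro measurable_ident_sets)
  have "distr \<mu> borel (\<lambda>x. x) = \<mu>" using \<mu>(2) by (intro distr_id2) simp
  then show ?thesis using W1_distr_le[OF \<mu>(1) id id] by simp
qed

lemma ennreal_less_add_pos: "x < \<top> \<Longrightarrow> 0 < e \<Longrightarrow> x < x + ennreal e"
  by (cases x) (auto simp: ennreal_less_iff simp flip: ennreal_plus)

text \<open>Three errors of size e / 3: one for each nearly optimal coupling and one for the
  distance between the two glued middle points.\<close>

lemma W1_triangle:
  fixes \<mu> \<nu> \<rho> :: "'a::polish_space measure"
  shows "W1 \<mu> \<rho> \<le> W1 \<mu> \<nu> + W1 \<nu> \<rho>"
proof (rule ennreal_le_epsilon)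
  fix e :: real assume e: "e > 0" and fin: "W1 \<mu> \<nu> + W1 \<nu> \<rho> < \<top>"
  have less: "W1 \<mu> \<nu> < W1 \<mu> \<nu> + ennreal (e / 3)" "W1 \<nu> \<rho> < W1 \<nu> \<rho> + ennreal (e / 3)"
    using fin e by (auto intro!: ennreal_less_add_pos)
  obtain p where "p \<in> couplings \<mu> \<nu>" and cp: "coupling_cost p < W1 \<mu> \<nu> + ennreal (e / 3)"
    by (rule W1_lessE[OF less(1)])
  obtain q where "q \<in> couplings \<nu> \<rho>" and cq: "coupling_cost q < W1 \<nu> \<rho> + ennreal (e / 3)"
    by (rule W1_lessE[OF less(2)])
  note p = couplingsD[OF \<open>p \<in> _\<close>] and q = couplingsD[OF \<open>q \<in> _\<close>]
  have glue: "distr p borel snd = distr q borel fst" by (simp only: p(4) q(3))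
  have e3: "e / 3 > 0" using e by simp
  obtain R where R: "prob_space R" "sets R = sets (p \<Otimes>\<^sub>M borel)" "distr R p fst = p" "distr R borel snd = q"
    "AE w in R. dist (snd (fst w)) (fst (snd w)) < e / 3"
    by (rule approximate_gluing[OF p(1,6) q(7) glue e3])
  interpret R: prob_space R by fact
  have Rf [measurable]: "fst \<in> measurable R p" and Rs [measurable]: "snd \<in> borel_measurable R"
    unfolding measurable_cong_sets[OF R(2) refl] by measurable
  note [measurable] = p(5,6) q(5,6)
  have [measurable]: "(\<lambda>w. fst (fst w)) \<in> borel_measurable R" "(\<lambda>w. snd (fst w)) \<in> borel_measurable R"
    "(\<lambda>w. fst (snd w)) \<in> borel_measurable R" "(\<lambda>w. snd (snd w)) \<in> borel_measurable R"
    by measurable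
  have "distr R borel (\<lambda>w. fst (fst w)) = distr (distr R p fst) borel fst"
    by (simp add: distr_distr o_def)
  then have d1: "distr R borel (\<lambda>w. fst (fst w)) = \<mu>" by (simp add: R(3) p(3))
  have "distr R borel (\<lambda>w. snd (snd w)) = distr (distr R borel snd) borel snd"
    by (simp add: distr_distr o_def)
  then have d2: "distr R borel (\<lambda>w. snd (snd w)) = \<rho>" by (simp add: R(4) q(4))
  have "W1 \<mu> \<rho> \<le> (\<integral>\<^sup>+w. ennreal (dist (fst (fst w)) (snd (snd w))) \<partial>R)"
    using W1_distr_le[OF R(1), of "\<lambda>w. fst (fst w)" "\<lambda>w. snd (snd w)"] by (simp add: d1 d2)
  also have "\<dots> \<le> (\<integral>\<^sup>+w. (ennreal (dist (fst (fst w)) (snd (fst w))) + ennreal (e / 3)) +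
      ennreal (dist (fst (snd w)) (snd (snd w))) \<partial>R)"
  proof (rule nn_integral_mono_AE, use R(5) in eventually_elim)
    case (elim w)
    have "dist (fst (fst w)) (snd (snd w)) \<le> (dist (fst (fst w)) (snd (fst w)) + e / 3) + dist (fst (snd w)) (snd (snd w))"
      using dist_triangle[of "fst (fst w)" "snd (snd w)" "snd (fst w)"]
        dist_triangle[of "snd (fst w)" "snd (snd w)" "fst (snd w)"] elim by linarith
    then show ?case using e by (simp add: ennreal_leI flip: ennreal_plus)
  qed
  also have "\<dots> = (\<integral>\<^sup>+w. ennreal (dist (fst (fst w)) (snd (fst w))) \<partial>R) + ennreal (e / 3) +
      (\<integral>\<^sup>+w. ennreal (dist (fst (snd w)) (snd (snd w))) \<partial>R)"
    by (simp add: nn_integral_add R.emeasure_space_1)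
  also have "(\<integral>\<^sup>+w. ennreal (dist (fst (fst w)) (snd (fst w))) \<partial>R) = coupling_cost (distr R p fst)"
    by (subst nn_integral_distr) auto
  also have "(\<integral>\<^sup>+w. ennreal (dist (fst (snd w)) (snd (snd w))) \<partial>R) = coupling_cost (distr R borel snd)"
    by (subst nn_integral_distr) auto
  also have "coupling_cost (distr R p fst) + ennreal (e / 3) + coupling_cost (distr R borel snd) \<le>
      (W1 \<mu> \<nu> + ennreal (e / 3)) + ennreal (e / 3) + (W1 \<nu> \<rho> + ennreal (e / 3))"
    unfolding R(3,4) using cp cq by (intro add_mono order_refl less_imp_le)
  also have "\<dots> = W1 \<mu> \<nu> + W1 \<nu> \<rho> + (ennreal (e / 3) + ennreal (e / 3) + ennreal (e / 3))"
    by (simp add: add_ac)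
  also have "ennreal (e / 3) + ennreal (e / 3) + ennreal (e / 3) = ennreal e"
    using e by (simp flip: ennreal_plus)
  finally show "W1 \<mu> \<rho> \<le> W1 \<mu> \<nu> + W1 \<nu> \<rho> + ennreal e" .
qed

lemma W1_return_finite:
  fixes \<mu> :: "'a::polish_space measure"
  assumes "\<mu> \<in> P1"
  obtains x where "W1 \<mu> (return borel x) < \<infinity>"
proof -
  obtain x where x: "(\<integral>\<^sup>+ y. ennreal (dist y x) \<partial>\<mu>) < \<infinity>" and "\<mu> \<in> space (prob_algebra borel)"
    using assms by (auto simp: P1_def)
  note \<mu> = space_prob_algebra_borelD[OF this(2)]
  interpret prob_space \<mu> by fact
  have id: "(\<lambda>x. x) \<in> borel_measurable \<mu>" using \<mu>(2) by (intro measurable_ident_sets)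
  have "distr \<mu> borel (\<lambda>x. x) = \<mu>" using \<mu>(2) by (intro distr_id2) simp
  moreover have "distr \<mu> borel (\<lambda>_. x) = return borel x"
    by (rule measure_eqI) (auto simp: emeasure_distr emeasure_space_1 \<mu>(3) indicator_def)
  ultimately have "W1 \<mu> (return borel x) \<le> (\<integral>\<^sup>+ y. ennreal (dist y x) \<partial>\<mu>)"
    using W1_distr_le[OF \<mu>(1) id, of "\<lambda>_. x"] by simp
  then show ?thesis using x that by (meson le_less_trans)
qed

text \<open>The base points witnessing the two finite first moments may differ, so the triangle
  inequality passes through two Dirac measures.\<close>

lemma W1_finite:
  fixes \<mu> \<nu> :: "'a::polish_space measure"
  assumes "\<mu> \<in> P1" "\<nu> \<in> P1"
  shows "W1 \<mu> \<nu> < \<infinity>"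
proof -
  obtain x where x: "W1 \<mu> (return borel x) < \<infinity>" using W1_return_finite assms(1) .
  obtain y where y: "W1 \<nu> (return borel y) < \<infinity>" using W1_return_finite assms(2) .
  interpret prob_space "return borel x :: 'a measure" by (rule prob_space_return) simp
  have "distr (return borel x) borel (\<lambda>_. z) = return borel z" for z :: 'a
    by (rule measure_eqI) (auto simp: emeasure_distr emeasure_space_1 indicator_def)
  then have "W1 (return borel x) (return borel y) \<le> (\<integral>\<^sup>+_. ennreal (dist x y) \<partial>return borel x)"
    using W1_distr_le[of "return borel x" "\<lambda>_. x" "\<lambda>_. y"] prob_space_axioms by simp
  then have "W1 (return borel x) (return borel y) < \<infinity>"
    by (simp add: emeasure_space_1 le_less_trans[OF _ ennreal_less_top])
  moreover have "W1 \<mu> \<nu> \<le> W1 \<mu> (return borel x) + (W1 (return borel x) (return borel y) + W1 (return borel y) \<nu>)"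
    by (rule order_trans[OF W1_triangle add_left_mono[OF W1_triangle]])
  ultimately show ?thesis
    using x y by (auto simp: W1_commute[of "return borel y"] intro: le_less_trans)
qed

text \<open>A coupling of finite cost transports the finite first moment through the triangle
  inequality. This places every \<mu> t in \<open>P1\<close> when only \<mu> 0 is assumed to lie
  there.\<close>

lemma P1_of_W1_finite:
  fixes \<mu> \<nu> :: "'a::polish_space measure"
  assumes "\<mu> \<in> P1" "\<nu> \<in> space (prob_algebra borel)" "W1 \<mu> \<nu> < \<infinity>"
  shows "\<nu> \<in> P1"
proof -
  obtain x where x: "(\<integral>\<^sup>+ y. ennreal (dist y x) \<partial>\<mu>) < \<infinity>" using assms(1) by (auto simp: P1_def)
  obtain p where "p \<in> couplings \<mu> \<nu>" and c: "coupling_cost p < \<infinity>" using W1_lessE[OF assms(3)] .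
  note p = couplingsD[OF this(1)]
  note [measurable] = p(5,6)
  have "(\<integral>\<^sup>+ y. ennreal (dist y x) \<partial>\<nu>) = (\<integral>\<^sup>+ z. ennreal (dist (snd z) x) \<partial>p)"
    unfolding p(4)[symmetric] by (subst nn_integral_distr) auto
  also have "\<dots> \<le> (\<integral>\<^sup>+ z. ennreal (dist (fst z) (snd z)) + ennreal (dist (fst z) x) \<partial>p)"
  proof (rule nn_integral_mono)
    fix z
    show "ennreal (dist (snd z) x) \<le> ennreal (dist (fst z) (snd z)) + ennreal (dist (fst z) x)"
      using dist_triangle[of "snd z" x "fst z"] by (simp add: dist_commute ennreal_leI flip: ennreal_plus)
  qed
  also have "\<dots> = coupling_cost p + (\<integral>\<^sup>+ z. ennreal (dist (fst z) x) \<partial>p)" by (simp add: nn_integral_add)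
  also have "(\<integral>\<^sup>+ z. ennreal (dist (fst z) x) \<partial>p) = (\<integral>\<^sup>+ y. ennreal (dist y x) \<partial>\<mu>)"
    unfolding p(3)[symmetric] by (subst nn_integral_distr) auto
  finally have "(\<integral>\<^sup>+ y. ennreal (dist y x) \<partial>\<nu>) < \<infinity>" using c x by (auto intro: le_less_trans)
  then show ?thesis using assms(2) by (auto simp: P1_def)
qed

section \<open>Testing measures against Lipschitz functions\<close>

text \<open>The easy half of Kantorovich-Rubinstein duality; a coupling of cost below c takes the
  place of an optimal one.\<close>

lemma W1_Lipschitz:
  fixes f :: "'a::polish_space \<Rightarrow> real"
  assumes f [measurable]: "f \<in> borel_measurable borel" and B: "\<And>x. \<bar>f x\<bar> \<le> B" and L: "0 \<le> L"
    and lip: "\<And>x y. \<bar>f x - f y\<bar> \<le> L * dist x y" and c: "W1 \<mu> \<nu> < ennreal c"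
  shows "\<bar>(\<integral>x. f x \<partial>\<mu>) - (\<integral>x. f x \<partial>\<nu>)\<bar> \<le> L * c"
proof -
  obtain p where "p \<in> couplings \<mu> \<nu>" and cp: "coupling_cost p < ennreal c" using W1_lessE[OF c] .
  note p = couplingsD[OF this(1)]
  note [measurable] = p(5,6)
  interpret prob_space p by (rule p)
  have c0: "0 < c" using cp by (metis ennreal_neg not_less_zero not_less)
  have int: "integrable p (\<lambda>z. f (fst z))" "integrable p (\<lambda>z. f (snd z))"
    using B by (auto intro!: integrable_const_bound[of _ B])
  have intd: "integrable p (\<lambda>z. dist (fst z) (snd z))"
    using cp by (intro integrableI_nonneg) (auto intro: less_trans)
  have "(\<integral>x. f x \<partial>\<mu>) - (\<integral>x. f x \<partial>\<nu>) = (\<integral>z. f (fst z) \<partial>p) - (\<integral>z. f (snd z) \<partial>p)"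
    unfolding p(3,4)[symmetric] by (simp add: integral_distr)
  also have "\<dots> = (\<integral>z. f (fst z) - f (snd z) \<partial>p)" using int by simp
  also have "\<bar>\<dots>\<bar> \<le> (\<integral>z. \<bar>f (fst z) - f (snd z)\<bar> \<partial>p)" by (rule integral_abs_bound)
  also have "\<dots> \<le> (\<integral>z. L * dist (fst z) (snd z) \<partial>p)"
    using int intd lip by (intro integral_mono) auto
  also have "\<dots> = L * (\<integral>z. dist (fst z) (snd z) \<partial>p)" by simp
  also have "\<dots> \<le> L * c"
  proof (rule mult_left_mono[OF _ L])
    have "ennreal (\<integral>z. dist (fst z) (snd z) \<partial>p) = coupling_cost p"
      by (intro nn_integral_eq_integral[symmetric] intd) auto
    then have "ennreal (\<integral>z. dist (fst z) (snd z) \<partial>p) \<le> ennreal c" using cp by simp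
    then show "(\<integral>z. dist (fst z) (snd z) \<partial>p) \<le> c" using c0 by simp
  qed
  finally show ?thesis .
qed

text \<open>For nonempty closed C the Lipschitz functions
  \<open>max 0 (1 - real k * infdist x C)\<close> decrease to the indicator of C, and the closed
  sets are an intersection-stable generator of the Borel sets.\<close>

lemma measure_eqI_Lipschitz:
  fixes \<mu> \<nu> :: "'a::polish_space measure"
  assumes \<mu>: "\<mu> \<in> space (prob_algebra borel)" and \<nu>: "\<nu> \<in> space (prob_algebra borel)"
    and eq: "\<And>f L. (\<And>x. \<bar>f x\<bar> \<le> 1) \<Longrightarrow> 0 \<le> L \<Longrightarrow> (\<And>x y. \<bar>f x - f y\<bar> \<le> L * dist x y) \<Longrightarrow>
      f \<in> borel_measurable borel \<Longrightarrow> (\<integral>x. f x \<partial>\<mu>) = (\<integral>x. f x \<partial>\<nu>)"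
  shows "\<mu> = \<nu>"
proof -
  note m = space_prob_algebra_borelD[OF \<mu>] and n = space_prob_algebra_borelD[OF \<nu>]
  have "(\<lambda>k. \<integral>x. max 0 (1 - real k * infdist x C) \<partial>\<rho>) \<longlonglongrightarrow> measure \<rho> C"
    if C: "closed C" "C \<noteq> {}" and "\<rho> \<in> space (prob_algebra borel)" for C and \<rho> :: "'a measure"
  proof -
    note r = space_prob_algebra_borelD[OF \<open>\<rho> \<in> _\<close>]
    interpret prob_space \<rho> by fact
    have "(\<lambda>k. \<integral>x. max 0 (1 - real k * infdist x C) \<partial>\<rho>) \<longlonglongrightarrow> (\<integral>x. indicator C x \<partial>\<rho>)"
    proof (rule integral_dominated_convergence[where w = "\<lambda>_. 1"])
      show "(\<lambda>x. max 0 (1 - real k * infdist x C)) \<in> borel_measurable \<rho>" for k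
        unfolding measurable_cong_sets[OF r(2) refl]
        by (intro borel_measurable_continuous_onI continuous_intros)
      show "indicator C \<in> borel_measurable \<rho>"
        using C(1) r(2) by (intro borel_measurable_indicator) simp
      show "AE x in \<rho>. (\<lambda>k. max 0 (1 - real k * infdist x C)) \<longlonglongrightarrow> indicator C x"
      proof (intro AE_I2)
        fix x
        show "(\<lambda>k. max 0 (1 - real k * infdist x C)) \<longlonglongrightarrow> indicator C x"
        proof (cases "x \<in> C")
          case False
          then have pos: "infdist x C > 0" using in_closed_iff_infdist_zero[OF C, of x] infdist_nonneg[of x C] by (simp add: less_le)
          then have "\<forall>\<^sub>F k in sequentially. 1 / infdist x C < real k"
            using filterlim_real_sequentially by (auto simp: filterlim_at_top_dense)
          then have "\<forall>\<^sub>F k in sequentially. max 0 (1 - real k * infdist x C) = 0"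
            by eventually_elim (use pos in \<open>simp add: field_simps\<close>)
          then have "(\<lambda>k. max 0 (1 - real k * infdist x C)) \<longlonglongrightarrow> 0" by (rule tendsto_eventually)
          then show ?thesis using False by simp
        qed simp
      qed
      show "AE x in \<rho>. norm (max 0 (1 - real k * infdist x C)) \<le> 1" for k
        by (intro AE_I2) (auto simp: infdist_nonneg)
    qed simp
    then show ?thesis using C r(2) by simp
  qed
  note lim = this
  have meas: "measure \<mu> C = measure \<nu> C" if C: "closed C" for C
  proof (cases "C = {}")
    case False
    have "(\<integral>x. max 0 (1 - real k * infdist x C) \<partial>\<mu>) = (\<integral>x. max 0 (1 - real k * infdist x C) \<partial>\<nu>)" for k
    proof (rule eq[where L = "real k"])
      fix x y
      show "\<bar>max 0 (1 - real k * infdist x C)\<bar> \<le> 1" by (auto simp: infdist_nonneg)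
      have "\<bar>max 0 (1 - a) - max 0 (1 - b)\<bar> \<le> \<bar>a - b\<bar>" for a b :: real by linarith
      then have "\<bar>max 0 (1 - real k * infdist x C) - max 0 (1 - real k * infdist y C)\<bar> \<le>
          \<bar>real k * infdist x C - real k * infdist y C\<bar>" .
      also have "\<dots> = real k * \<bar>infdist x C - infdist y C\<bar>" by (simp add: abs_mult flip: right_diff_distrib)
      also have "\<dots> \<le> real k * dist x y" by (intro mult_left_mono infdist_triangle_abs) auto
      finally show "\<bar>max 0 (1 - real k * infdist x C) - max 0 (1 - real k * infdist y C)\<bar> \<le> real k * dist x y" .
    qed (auto intro!: borel_measurable_continuous_onI continuous_intros)
    then show ?thesis using lim[OF C False \<mu>] lim[OF C False \<nu>] LIMSEQ_unique by auto
  qed simp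
  interpret \<mu>: prob_space \<mu> by (rule m)
  interpret \<nu>: prob_space \<nu> by (rule n)
  show ?thesis
  proof (rule measure_eqI_generator_eq[where E = "Collect closed" and \<Omega> = UNIV and A = "\<lambda>_. UNIV"])
    show "Int_stable (Collect closed :: 'a set set)" by (auto simp: Int_stable_def)
    show "sets \<mu> = sigma_sets UNIV (Collect closed)" "sets \<nu> = sigma_sets UNIV (Collect closed)"
      using m(2) n(2) by (simp_all add: borel_eq_closed)
    show "emeasure \<mu> X = emeasure \<nu> X" if "X \<in> Collect closed" for X
      using meas[of X] that by (simp add: \<mu>.emeasure_eq_measure \<nu>.emeasure_eq_measure)
  qed auto
qed

lemma ennreal_W1_dist:
  assumes "\<mu> \<in> P1" "\<nu> \<in> P1"
  shows "ennreal (W1_dist \<mu> \<nu>) = W1 \<mu> \<nu>"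
  unfolding W1_dist_def using W1_finite[OF assms] by simp

lemma P1_prob_algebra: "\<mu> \<in> P1 \<Longrightarrow> \<mu> \<in> space (prob_algebra borel)"
  by (auto simp: P1_def)

lemma W1_zero_imp_eq:
  assumes \<mu>: "\<mu> \<in> space (prob_algebra borel)" "\<nu> \<in> space (prob_algebra borel)" and z: "W1 \<mu> \<nu> = 0"
  shows "\<mu> = \<nu>"
proof (rule measure_eqI_Lipschitz[OF \<mu>])
  fix f :: "'a \<Rightarrow> real" and L
  assume f: "\<And>x. \<bar>f x\<bar> \<le> 1" "0 \<le> L" "\<And>x y. \<bar>f x - f y\<bar> \<le> L * dist x y" "f \<in> borel_measurable borel"
  have "\<bar>(\<integral>x. f x \<partial>\<mu>) - (\<integral>x. f x \<partial>\<nu>)\<bar> \<le> 0 + e" if "e > 0" for e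
  proof -
    \<comment> \<open>L may be 0, hence the denominator L + 1.\<close>
    have "W1 \<mu> \<nu> < ennreal (e / (L + 1))" using z that f(2) by simp
    from W1_Lipschitz[OF f(4,1,2,3) this] have "\<bar>(\<integral>x. f x \<partial>\<mu>) - (\<integral>x. f x \<partial>\<nu>)\<bar> \<le> L * (e / (L + 1))" .
    also have "\<dots> \<le> e" using that f(2) by (simp add: field_simps)
    finally show ?thesis by simp
  qed
  then have "\<bar>(\<integral>x. f x \<partial>\<mu>) - (\<integral>x. f x \<partial>\<nu>)\<bar> \<le> 0" by (rule field_le_epsilon)
  then show "(\<integral>x. f x \<partial>\<mu>) = (\<integral>x. f x \<partial>\<nu>)" by simp
qed

lemma Metric_space_W1: "Metric_space (P1 :: 'a::polish_space measure set) W1_dist"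
proof
  fix \<mu> \<nu> \<rho> :: "'a measure"
  show "0 \<le> W1_dist \<mu> \<nu>" by (simp add: W1_dist_def)
  show "W1_dist \<mu> \<nu> = W1_dist \<nu> \<mu>" by (simp add: W1_dist_def W1_commute)
  assume *: "\<mu> \<in> P1" "\<nu> \<in> P1"
  show "W1_dist \<mu> \<nu> = 0 \<longleftrightarrow> \<mu> = \<nu>"
  proof
    assume "W1_dist \<mu> \<nu> = 0"
    then have "W1 \<mu> \<nu> = 0" using ennreal_W1_dist[OF *] by simp
    then show "\<mu> = \<nu>" by (intro W1_zero_imp_eq P1_prob_algebra *)
  next
    assume "\<mu> = \<nu>"
    then show "W1_dist \<mu> \<nu> = 0" using W1_refl[OF P1_prob_algebra[OF *(2)]] by (simp add: W1_dist_def)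
  qed
  assume "\<rho> \<in> P1"
  with * have "ennreal (W1_dist \<mu> \<rho>) \<le> ennreal (W1_dist \<mu> \<nu>) + ennreal (W1_dist \<nu> \<rho>)"
    by (simp add: ennreal_W1_dist W1_triangle)
  then show "W1_dist \<mu> \<rho> \<le> W1_dist \<mu> \<nu> + W1_dist \<nu> \<rho>"
    by (simp add: W1_dist_def flip: ennreal_plus)
qed

interpretation W1: Metric_space "P1 :: 'a::polish_space measure set" W1_dist
  by (rule Metric_space_W1)

section \<open>Limits of joint laws with prescribed marginals\<close>

text \<open>Words are stored with the most recent letter first. A consistent family \<open>c\<close> of word
  probabilities is realised on the unit interval: the words of a given length correspond to consecutive
  intervals of length \<open>c w\<close>, refined as the words grow.\<close>

primrec word_start :: "(bool list \<Rightarrow> real) \<Rightarrow> bool list \<Rightarrow> real" where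
  "word_start c [] = 0"
| "word_start c (b # w) = word_start c w + (if b then c (False # w) else 0)"

primrec word_at :: "(bool list \<Rightarrow> real) \<Rightarrow> nat \<Rightarrow> real \<Rightarrow> bool list" where
  "word_at c 0 x = []"
| "word_at c (Suc n) x =
    (word_start c (word_at c n x) + c (False # word_at c n x) \<le> x) # word_at c n x"

abbreviation unit_interval :: "real measure" where
  "unit_interval \<equiv> restrict_space lborel {0..<1}"

lemma prob_space_unit_interval: "prob_space unit_interval"
  by standard (simp add: emeasure_restrict_space space_restrict_space)

text \<open>A new letter splits the interval of a word at
  \<open>word_start c w + c (False # w)\<close>: False takes the left part, True the right
  one.\<close>

lemma word_at_eq_iff:
  assumes "\<And>w. 0 \<le> c w" "\<And>w. c (False # w) + c (True # w) = c w" "c [] = 1"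
    and "x \<in> {0..<1}"
  shows "word_at c (length w) x = w \<longleftrightarrow> word_start c w \<le> x \<and> x < word_start c w + c w"
proof (induction w)
  case Nil
  then show ?case using assms by simp
next
  case (Cons b w)
  have "0 \<le> c (False # w)" "0 \<le> c (True # w)" "c (False # w) + c (True # w) = c w"
    using assms by auto
  moreover have "word_at c (length (b # w)) x = b # w \<longleftrightarrow>
      word_at c (length w) x = w \<and> (b \<longleftrightarrow> word_start c w + c (False # w) \<le> x)"
    by auto
  ultimately show ?case using Cons by (cases b) auto
qed

lemma word_start_bounds:
  assumes "\<And>w. 0 \<le> c w" "\<And>w. c (False # w) + c (True # w) = c w" "c [] = 1"
  shows "0 \<le> word_start c w \<and> word_start c w + c w \<le> 1"
proof (induction w)
  case (Cons b w)
  have "0 \<le> c (False # w)" "0 \<le> c (True # w)" "c (False # w) + c (True # w) = c w"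
    using assms by auto
  then show ?case using Cons by (cases b) auto
qed (use assms in auto)

lemma word_at_length [simp]: "length (word_at c n x) = n"
  by (induction n) auto

lemma word_at_law:
  assumes c: "\<And>w. 0 \<le> c w" "\<And>w. c (False # w) + c (True # w) = c w" "c [] = 1"
  shows "{x \<in> space unit_interval. word_at c (length w) x = w} \<in> sets unit_interval"
    and "measure unit_interval {x \<in> space unit_interval. word_at c (length w) x = w} = c w"
proof -
  have eq: "{x \<in> space unit_interval. word_at c (length w) x = w} = {word_start c w..<word_start c w + c w}"
    using word_at_eq_iff[where c = c, OF c] word_start_bounds[where c = c and w = w, OF c]
    by (auto simp: space_restrict_space)
  have sub: "{word_start c w..<word_start c w + c w} \<subseteq> {0..<1}"
    using word_start_bounds[where c = c and w = w, OF c] by auto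
  show "{x \<in> space unit_interval. word_at c (length w) x = w} \<in> sets unit_interval"
    unfolding eq using sub by (auto simp: sets_restrict_space_iff)
  show "measure unit_interval {x \<in> space unit_interval. word_at c (length w) x = w} = c w"
    unfolding eq using sub c(1)[of w] by (simp add: measure_restrict_space)
qed

lemma measurable_word_at:
  assumes c: "\<And>w. 0 \<le> c w" "\<And>w. c (False # w) + c (True # w) = c w" "c [] = 1"
  shows "word_at c n \<in> measurable unit_interval (count_space UNIV)"
  unfolding measurable_count_space_eq2_countable
proof (intro conjI ballI)
  fix w
  show "word_at c n -` {w} \<inter> space unit_interval \<in> sets unit_interval"
  proof (cases "length w = n")
    case True
    have "word_at c n -` {w} \<inter> space unit_interval = {x \<in> space unit_interval. word_at c (length w) x = w}"
      using True by auto
    then show ?thesis using word_at_law(1)[where c = c, OF c] by simp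
  next
    case False
    then have "word_at c n -` {w} \<inter> space unit_interval = {}" by auto
    then show ?thesis by (simp only: sets.empty_sets)
  qed
qed auto

section \<open>Diagonal extraction of a limit process\<close>

lemma diagonal_convergent_subsequence:
  fixes C :: "nat \<Rightarrow> 'k::countable \<Rightarrow> real"
  assumes "\<And>n k. \<bar>C n k\<bar> \<le> B"
  obtains r where "strict_mono (r :: nat \<Rightarrow> nat)" "\<And>k. convergent (\<lambda>n. C (r n) k)"
proof -
  interpret subseqs "\<lambda>k s. convergent (\<lambda>n. C (s n) (from_nat k))"
  proof
    fix k and s :: "nat \<Rightarrow> nat"
    have "bounded (range (\<lambda>n. C (s n) (from_nat k)))"
      using assms by (auto simp: bounded_iff)
    then obtain l r where "strict_mono r" "((\<lambda>n. C (s n) (from_nat k)) \<circ> r) \<longlonglongrightarrow> l"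
      using bounded_imp_convergent_subsequence by blast
    then show "\<exists>r'. strict_mono r' \<and> convergent (\<lambda>n. C ((s \<circ> r') n) (from_nat k))"
      by (auto simp: convergent_def o_def)
  qed
  have "convergent (\<lambda>n. C (diagseq n) k)" for k
  proof -
    have "convergent (\<lambda>n. C ((diagseq \<circ> ((+) (Suc (to_nat k)))) n) (from_nat (to_nat k)))"
    proof (rule diagseq_holds)
      fix r s :: "nat \<Rightarrow> nat" and n
      assume "strict_mono r" "convergent (\<lambda>m. C (s m) (from_nat n))"
      then show "convergent (\<lambda>m. C ((s \<circ> r) m) (from_nat n))"
        using LIMSEQ_subseq_LIMSEQ[of "\<lambda>m. C (s m) (from_nat n)" _ r] by (auto simp: convergent_def o_def)
    qed
    then obtain l where "(\<lambda>n. C (diagseq (n + Suc (to_nat k))) k) \<longlonglongrightarrow> l"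
      by (auto simp: convergent_def add.commute)
    then have "(\<lambda>n. C (diagseq n) k) \<longlonglongrightarrow> l" by (rule LIMSEQ_offset)
    then show ?thesis by (auto simp: convergent_def)
  qed
  then show ?thesis using that subseq_diagseq by blast
qed

text \<open>The first N bits in the reversed order of \<open>word_at\<close>; bit j therefore sits
  at position N - Suc j.\<close>

primrec word_of :: "(nat \<Rightarrow> bool) \<Rightarrow> nat \<Rightarrow> bool list" where
  "word_of b 0 = []"
| "word_of b (Suc N) = b N # word_of b N"

lemma word_of_length [simp]: "length (word_of b N) = N"
  by (induction N) auto

lemma word_of_nth: "j < N \<Longrightarrow> word_of b N ! (N - Suc j) = b j"
  by (induction N) (auto simp: nth_Cons' less_Suc_eq)

lemma word_at_eq_word_of: "word_at c N x = word_of (\<lambda>j. hd (word_at c (Suc j) x)) N"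
  by (induction N) auto

text \<open>There are countably many words, so their probabilities converge along one subsequence.
  The limits are again consistent and are realised by the interval construction. An event about the
  first N bits is a finite union of words, hence its probability converges too.\<close>

lemma limit_bit_process:
  fixes P :: "nat \<Rightarrow> 'w measure" and e :: "nat \<Rightarrow> nat \<Rightarrow> 'w \<Rightarrow> bool"
  assumes P: "\<And>n. prob_space (P n)"
    and e [measurable]: "\<And>n j. e n j \<in> measurable (P n) (count_space UNIV)"
  obtains r b where "strict_mono (r :: nat \<Rightarrow> nat)" "\<And>j. b j \<in> measurable unit_interval (count_space UNIV)"
    "\<And>N \<Phi>. (\<lambda>n. measure (P (r n)) {\<omega> \<in> space (P (r n)). \<Phi> (word_of (\<lambda>j. e (r n) j \<omega>) N)}) \<longlonglongrightarrow>
      measure unit_interval {x \<in> space unit_interval. \<Phi> (word_of (\<lambda>j. b j x) N)}"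
proof -
  interpret U: prob_space unit_interval by (rule prob_space_unit_interval)
  define W where "W n N \<omega> = word_of (\<lambda>j. e n j \<omega>) N" for n N \<omega>
  have W [measurable]: "W n N \<in> measurable (P n) (count_space UNIV)" for n N
  proof (induction N)
    case (Suc N)
    have "(\<lambda>\<omega>. e n N \<omega> # W n N \<omega>) \<in> measurable (P n) (count_space UNIV)"
      by (rule measurable_compose_countable[OF measurable_compose[OF e] Suc]) simp
    then show ?case by (simp add: W_def[abs_def])
  qed (simp add: W_def[abs_def])
  define C where "C n w = measure (P n) {\<omega> \<in> space (P n). W n (length w) \<omega> = w}" for n w
  have C_meas: "{\<omega> \<in> space (P n). W n N \<omega> = w} \<in> sets (P n)" for n N w
    by measurable
  obtain r where r: "strict_mono r" "\<And>w. convergent (\<lambda>n. C (r n) w)"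
  proof (rule diagonal_convergent_subsequence[where C = C and B = 1])
    show "\<bar>C n w\<bar> \<le> 1" for n w
      using prob_space.prob_le_1[OF P] by (simp add: C_def)
  qed blast
  define c where "c w = lim (\<lambda>n. C (r n) w)" for w
  have c_lim: "(\<lambda>n. C (r n) w) \<longlonglongrightarrow> c w" for w
    using r(2) by (simp add: c_def convergent_LIMSEQ_iff)
  have c1: "0 \<le> c w" for w
    by (rule LIMSEQ_le_const[OF c_lim]) (auto simp: C_def)
  have "C n (False # w) + C n (True # w) = C n w" for n w
  proof -
    interpret prob_space "P n" by (rule P)
    have "C n w = measure (P n) ({\<omega> \<in> space (P n). W n (length (False # w)) \<omega> = False # w} \<union>
        {\<omega> \<in> space (P n). W n (length (True # w)) \<omega> = True # w})"
      unfolding C_def by (intro arg_cong[where f = "measure (P n)"]) (auto simp: W_def)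
    also have "\<dots> = C n (False # w) + C n (True # w)"
      unfolding C_def by (intro finite_measure_Union C_meas) auto
    finally show ?thesis by simp
  qed
  then have c2: "c (False # w) + c (True # w) = c w" for w
    using LIMSEQ_unique[OF tendsto_add[OF c_lim c_lim, of "False # w" "True # w"]] c_lim[of w] by simp
  have "C n [] = 1" for n
    using prob_space.prob_space[OF P] by (simp add: C_def W_def)
  then have c3: "c [] = 1" using LIMSEQ_unique[OF c_lim[of "[]"]] by simp
  define b where "b j x = hd (word_at c (Suc j) x)" for j x
  show ?thesis
  proof (rule that[OF r(1)])
    show "b j \<in> measurable unit_interval (count_space UNIV)" for j
      unfolding b_def by (rule measurable_compose[OF measurable_word_at[where c = c, OF c1 c2 c3]]) simp
    fix N and \<Phi> :: "bool list \<Rightarrow> bool"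
    let ?S = "{w. length w = N \<and> \<Phi> w}"
    have fin: "finite ?S"
    proof (rule finite_subset[of _ "{w :: bool list. set w \<subseteq> UNIV \<and> length w = N}"])
      show "finite {w :: bool list. set w \<subseteq> UNIV \<and> length w = N}"
        by (rule finite_lists_length_eq) simp
    qed auto
    have "measure (P n) {\<omega> \<in> space (P n). \<Phi> (W n N \<omega>)} = (\<Sum>w\<in>?S. C n w)" for n
    proof -
      interpret prob_space "P n" by (rule P)
      have "measure (P n) (\<Union>w\<in>?S. {\<omega> \<in> space (P n). W n N \<omega> = w}) =
          (\<Sum>w\<in>?S. measure (P n) {\<omega> \<in> space (P n). W n N \<omega> = w})"
        using C_meas by (intro finite_measure_finite_Union fin) (auto simp: disjoint_family_on_def)
      moreover have "(\<Union>w\<in>?S. {\<omega> \<in> space (P n). W n N \<omega> = w}) = {\<omega> \<in> space (P n). \<Phi> (W n N \<omega>)}"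
        by (auto simp: W_def)
      ultimately show ?thesis by (simp add: C_def)
    qed
    moreover have "measure unit_interval {x \<in> space unit_interval. \<Phi> (word_at c N x)} = (\<Sum>w\<in>?S. c w)"
    proof -
      have A: "measure unit_interval (\<Union>w\<in>?S. {x \<in> space unit_interval. word_at c (length w) x = w}) =
          (\<Sum>w\<in>?S. measure unit_interval {x \<in> space unit_interval. word_at c (length w) x = w})"
        using word_at_law(1)[where c = c, OF c1 c2 c3]
        by (intro U.finite_measure_finite_Union fin) (auto simp: disjoint_family_on_def)
      have B: "(\<Union>w\<in>?S. {x \<in> space unit_interval. word_at c (length w) x = w}) =
          {x \<in> space unit_interval. \<Phi> (word_at c N x)}"
        by auto
      show ?thesis unfolding B[symmetric] A by (rule sum.cong[OF refl word_at_law(2)[where c = c, OF c1 c2 c3]])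
    qed
    ultimately show "(\<lambda>n. measure (P (r n)) {\<omega> \<in> space (P (r n)). \<Phi> (word_of (\<lambda>j. e (r n) j \<omega>) N)}) \<longlonglongrightarrow>
        measure unit_interval {x \<in> space unit_interval. \<Phi> (word_of (\<lambda>j. b j x) N)}"
      using tendsto_sum[of ?S "\<lambda>w n. C (r n) w" c sequentially, OF c_lim]
      unfolding W_def[symmetric] b_def word_at_eq_word_of[of c N, symmetric] by simp
  qed
qed

text \<open>Natural-number variables are reduced to bits. The only danger is that mass escapes to
  infinity in the limit, and this is what the tightness hypothesis excludes.\<close>

lemma limit_discrete_process:
  fixes P :: "nat \<Rightarrow> 'w measure" and \<kappa> :: "nat \<Rightarrow> nat \<Rightarrow> 'w \<Rightarrow> nat"
  assumes P: "\<And>n. prob_space (P n)"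
    and \<kappa> [measurable]: "\<And>n l. \<kappa> n l \<in> measurable (P n) (count_space UNIV)"
    and tight: "\<And>l e. e > 0 \<Longrightarrow> \<exists>K. \<forall>\<^sub>F n in sequentially. measure (P n) {\<omega> \<in> space (P n). K < \<kappa> n l \<omega>} \<le> e"
  obtains r \<kappa>' where "strict_mono (r :: nat \<Rightarrow> nat)"
    "\<And>l. \<kappa>' l \<in> measurable unit_interval (count_space UNIV)"
    "\<And>l l' a a'. (\<lambda>n. measure (P (r n)) {\<omega> \<in> space (P (r n)). \<kappa> (r n) l \<omega> = a \<and> \<kappa> (r n) l' \<omega> = a'}) \<longlonglongrightarrow>
      measure unit_interval {x \<in> space unit_interval. \<kappa>' l x = a \<and> \<kappa>' l' x = a'}"
proof -
  interpret U: prob_space unit_interval by (rule prob_space_unit_interval)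
  \<comment> \<open>Bit j, decoded as (l, a), asks whether variable l takes the value a; the whole
    family becomes a single bit sequence.\<close>
  define e where "e n j \<omega> \<longleftrightarrow> \<kappa> n (fst (prod_decode j)) \<omega> = snd (prod_decode j)" for n j \<omega>
  have e: "e n j \<in> measurable (P n) (count_space UNIV)" for n j
    unfolding e_def by measurable
  obtain r b where r: "strict_mono r" and b [measurable]: "\<And>j. b j \<in> measurable unit_interval (count_space UNIV)"
    and lim: "\<And>N \<Phi>. (\<lambda>n. measure (P (r n)) {\<omega> \<in> space (P (r n)). \<Phi> (word_of (\<lambda>j. e (r n) j \<omega>) N)}) \<longlonglongrightarrow>
      measure unit_interval {x \<in> space unit_interval. \<Phi> (word_of (\<lambda>j. b j x) N)}"
    by (rule limit_bit_process[of P e, OF P e]) blast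
  define \<beta> where "\<beta> l a x = b (prod_encode (l, a)) x" for l a x
  have \<beta> [measurable]: "\<beta> l a \<in> measurable unit_interval (count_space UNIV)" for l a
    unfolding \<beta>_def by measurable
  have pair: "(\<lambda>n. measure (P (r n)) {\<omega> \<in> space (P (r n)). \<kappa> (r n) l \<omega> = a \<and> \<kappa> (r n) l' \<omega> = a'}) \<longlonglongrightarrow>
      measure unit_interval {x \<in> space unit_interval. \<beta> l a x \<and> \<beta> l' a' x}" for l l' a a'
  proof -
    define j where "j = prod_encode (l, a)"
    define j' where "j' = prod_encode (l', a')"
    define N where "N = Suc (max j j')"
    have "j < N" "j' < N" by (auto simp: N_def)
    then show ?thesis
      using lim[of "\<lambda>w. w ! (N - Suc j) \<and> w ! (N - Suc j')" N]
      by (simp add: word_of_nth e_def \<beta>_def j_def j'_def)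
  qed
  \<comment> \<open>A value above K means that the K + 1 bits for the values up to K are all False,
    an event about finitely many bits.\<close>
  have none: "(\<lambda>n. measure (P (r n)) {\<omega> \<in> space (P (r n)). K < \<kappa> (r n) l \<omega>}) \<longlonglongrightarrow>
      measure unit_interval {x \<in> space unit_interval. \<forall>a\<le>K. \<not> \<beta> l a x}" for l K
  proof -
    define N where "N = Suc (\<Sum>a\<le>K. prod_encode (l, a))"
    have N: "prod_encode (l, a) < N" if "a \<le> K" for a
      unfolding N_def less_Suc_eq_le by (rule member_le_sum) (use that in auto)
    have eq: "(\<forall>a\<le>K. \<not> word_of f N ! (N - Suc (prod_encode (l, a)))) \<longleftrightarrow> (\<forall>a\<le>K. \<not> f (prod_encode (l, a)))" for f
      using N word_of_nth by blast
    have "(\<forall>a\<le>K. k \<noteq> a) \<longleftrightarrow> K < k" for k by (auto simp: not_le[symmetric])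
    then show ?thesis
      using lim[of "\<lambda>w. \<forall>a\<le>K. \<not> w ! (N - Suc (prod_encode (l, a)))" N]
      unfolding eq by (simp add: e_def \<beta>_def)
  qed
  \<comment> \<open>In the limit, almost surely some bit of l is True, by tightness, and no two are;
    so the least index with a True bit is almost surely the only one.\<close>
  define \<kappa>' where "\<kappa>' l x = (LEAST a. \<beta> l a x)" for l x
  have \<kappa>' [measurable]: "\<kappa>' l \<in> measurable unit_interval (count_space UNIV)" for l
    unfolding \<kappa>'_def by measurable
  have ex: "AE x in unit_interval. \<exists>a. \<beta> l a x" for l
  proof -
    let ?N = "{x \<in> space unit_interval. \<forall>a. \<not> \<beta> l a x}"
    have sets: "?N \<in> sets unit_interval" by measurable
    have "measure unit_interval ?N \<le> 0 + \<epsilon>" if \<epsilon>: "\<epsilon> > 0" for \<epsilon>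
    proof -
      obtain K where "\<forall>\<^sub>F n in sequentially. measure (P n) {\<omega> \<in> space (P n). K < \<kappa> n l \<omega>} \<le> \<epsilon>"
        using tight[OF \<epsilon>] by blast
      then have "\<forall>\<^sub>F n in sequentially. measure (P (r n)) {\<omega> \<in> space (P (r n)). K < \<kappa> (r n) l \<omega>} \<le> \<epsilon>"
        by (rule eventually_subseq[OF r])
      then have "measure unit_interval {x \<in> space unit_interval. \<forall>a\<le>K. \<not> \<beta> l a x} \<le> \<epsilon>"
        by (intro tendsto_upperbound[OF none]) auto
      moreover have "measure unit_interval ?N \<le> measure unit_interval {x \<in> space unit_interval. \<forall>a\<le>K. \<not> \<beta> l a x}"
      proof (rule U.finite_measure_mono)
        show "{x \<in> space unit_interval. \<forall>a\<le>K. \<not> \<beta> l a x} \<in> sets unit_interval" by measurable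
      qed auto
      ultimately show ?thesis by simp
    qed
    then have "measure unit_interval ?N \<le> 0" by (rule field_le_epsilon)
    then have "measure unit_interval ?N = 0" by (rule antisym[OF _ measure_nonneg])
    then have "emeasure unit_interval ?N = 0" unfolding U.emeasure_eq_measure by simp
    then show ?thesis by (subst AE_iff_measurable[OF sets]) auto
  qed
  have unique: "AE x in unit_interval. \<not> (\<beta> l a x \<and> \<beta> l a' x)" if "a \<noteq> a'" for l a a'
  proof -
    have "(\<lambda>n. 0) \<longlonglongrightarrow> measure unit_interval {x \<in> space unit_interval. \<beta> l a x \<and> \<beta> l a' x}"
      using pair[of l a l a'] that by (auto cong: conj_cong)
    then have "measure unit_interval {x \<in> space unit_interval. \<beta> l a x \<and> \<beta> l a' x} = 0"
      by (rule LIMSEQ_unique[OF _ tendsto_const])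
    then have "emeasure unit_interval {x \<in> space unit_interval. \<beta> l a x \<and> \<beta> l a' x} = 0"
      unfolding U.emeasure_eq_measure by simp
    moreover have "{x \<in> space unit_interval. \<beta> l a x \<and> \<beta> l a' x} \<in> sets unit_interval" by measurable
    ultimately show ?thesis by (subst AE_iff_measurable) auto
  qed
  have iff: "AE x in unit_interval. \<forall>a. \<beta> l a x \<longleftrightarrow> \<kappa>' l x = a" for l
  proof -
    have "AE x in unit_interval. \<forall>a a'. a \<noteq> a' \<longrightarrow> \<not> (\<beta> l a x \<and> \<beta> l a' x)"
      unfolding AE_all_countable using unique by (metis (mono_tags, lifting) AE_I2 AE_mp)
    then show ?thesis using ex[of l]
    proof eventually_elim
      case (elim x)
      then have "\<beta> l (\<kappa>' l x) x" unfolding \<kappa>'_def by (auto intro: LeastI)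
      then show ?case using elim(1) by metis
    qed
  qed
  show ?thesis
  proof (rule that[OF r \<kappa>'])
    fix l l' a a'
    have "measure unit_interval {x \<in> space unit_interval. \<beta> l a x \<and> \<beta> l' a' x} =
        measure unit_interval {x \<in> space unit_interval. \<kappa>' l x = a \<and> \<kappa>' l' x = a'}"
    proof (rule U.finite_measure_eq_AE)
      show "AE x in unit_interval. x \<in> {x \<in> space unit_interval. \<beta> l a x \<and> \<beta> l' a' x} \<longleftrightarrow>
          x \<in> {x \<in> space unit_interval. \<kappa>' l x = a \<and> \<kappa>' l' x = a'}"
        using iff[of l] iff[of l'] by eventually_elim auto
    qed measurable
    then show "(\<lambda>n. measure (P (r n)) {\<omega> \<in> space (P (r n)). \<kappa> (r n) l \<omega> = a \<and> \<kappa> (r n) l' \<omega> = a'}) \<longlonglongrightarrow>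
      measure unit_interval {x \<in> space unit_interval. \<kappa>' l x = a \<and> \<kappa>' l' x = a'}"
      using pair[of l a l' a'] by simp
  qed
qed

section \<open>From limits of codes to limits of points\<close>

lemma dist_dense_seq_code_index:
  fixes x y :: "'a::polish_space"
  assumes e: "0 < e" "0 < e'"
  shows "dist (dense_seq (code_index e x) :: 'a) (dense_seq (code_index e' y)) \<le> dist x y + (e + e')"
    and "dist x y \<le> dist (dense_seq (code_index e x) :: 'a) (dense_seq (code_index e' y)) + (e + e')"
proof -
  let ?a = "dense_seq (code_index e x) :: 'a" and ?b = "dense_seq (code_index e' y) :: 'a"
  have "dist x ?a < e" "dist y ?b < e'" using dist_code_index e by auto
  moreover have "dist ?a ?b \<le> dist x ?a + dist x y + dist y ?b" "dist x y \<le> dist x ?a + dist ?a ?b + dist y ?b"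
    by metric+
  ultimately show "dist ?a ?b \<le> dist x y + (e + e')" "dist x y \<le> dist ?a ?b + (e + e')"
    by linarith+
qed

text \<open>As K grows, these sets decrease to the empty set, and continuity from above
  applies.\<close>

lemma code_index_tight:
  fixes \<nu> :: "'a::polish_space measure"
  assumes \<nu>: "\<nu> \<in> space (prob_algebra borel)" and \<epsilon>: "0 < \<epsilon>"
  shows "\<exists>K. measure \<nu> {x. K < code_index e x} \<le> \<epsilon>"
proof -
  note n = space_prob_algebra_borelD[OF \<nu>]
  interpret prob_space \<nu> by (rule n)
  have [measurable]: "code_index e \<in> measurable \<nu> (count_space UNIV)"
    unfolding measurable_cong_sets[OF n(2) refl] by measurable
  have "{x \<in> space \<nu>. K < code_index e x} \<in> sets \<nu>" for K by measurable
  then have sets: "{x. K < code_index e x} \<in> sets \<nu>" for K by (simp add: n(3))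
  have "(\<lambda>K. measure \<nu> {x. K < code_index e x}) \<longlonglongrightarrow> measure \<nu> (\<Inter>K. {x. K < code_index e x})"
    using sets by (intro finite_Lim_measure_decseq) (auto simp: decseq_def)
  also have "(\<Inter>K. {x :: 'a. K < code_index e x}) = {}" by auto
  finally have "\<forall>\<^sub>F K in sequentially. measure \<nu> {x. K < code_index e x} < \<epsilon>"
    using \<epsilon> by (intro order_tendstoD(2)) auto
  then show ?thesis by (auto simp: eventually_sequentially intro: less_imp_le)
qed

text \<open>Reduces an integral over bounded codes to a finite sum of joint probabilities, the
  quantities that converge in \<open>limit_discrete_process\<close>.\<close>

lemma nn_integral_two_codes:
  fixes u v :: "'c \<Rightarrow> nat" and K :: nat
  assumes "prob_space M" and [measurable]: "u \<in> measurable M (count_space UNIV)" "v \<in> measurable M (count_space UNIV)"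
  shows "(\<integral>\<^sup>+x. g (u x) (v x) * indicator {x \<in> space M. u x \<le> K \<and> v x \<le> K} x \<partial>M) =
    (\<Sum>a\<le>K. \<Sum>b\<le>K. g a b * ennreal (measure M {x \<in> space M. u x = a \<and> v x = b}))"
proof -
  interpret prob_space M by fact
  have "(\<integral>\<^sup>+x. g (u x) (v x) * indicator {x \<in> space M. u x \<le> K \<and> v x \<le> K} x \<partial>M) =
      (\<integral>\<^sup>+x. (\<Sum>a\<le>K. \<Sum>b\<le>K. g a b * indicator {x \<in> space M. u x = a \<and> v x = b} x) \<partial>M)"
  proof (rule nn_integral_cong)
    fix x assume x: "x \<in> space M"
    have "(\<Sum>a\<le>K. \<Sum>b\<le>K. g a b * indicator {x \<in> space M. u x = a \<and> v x = b} x) =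
        (\<Sum>a\<le>K. if u x = a then (\<Sum>b\<le>K. if v x = b then g a b else 0) else 0)"
    proof (intro sum.cong refl)
      fix a
      show "(\<Sum>b\<le>K. g a b * indicator {x \<in> space M. u x = a \<and> v x = b} x) =
          (if u x = a then (\<Sum>b\<le>K. if v x = b then g a b else 0) else 0)"
        using x by (cases "u x = a") (auto intro!: sum.cong simp: indicator_def)
    qed
    also have "\<dots> = g (u x) (v x) * indicator {x \<in> space M. u x \<le> K \<and> v x \<le> K} x"
      using x by (simp add: sum.delta' indicator_def)
    finally show "g (u x) (v x) * indicator {x \<in> space M. u x \<le> K \<and> v x \<le> K} x =
        (\<Sum>a\<le>K. \<Sum>b\<le>K. g a b * indicator {x \<in> space M. u x = a \<and> v x = b} x)" by simp
  qed
  also have "\<dots> = (\<Sum>a\<le>K. \<integral>\<^sup>+x. (\<Sum>b\<le>K. g a b * indicator {x \<in> space M. u x = a \<and> v x = b} x) \<partial>M)"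
    by (rule nn_integral_sum) measurable
  also have "\<dots> = (\<Sum>a\<le>K. \<Sum>b\<le>K. \<integral>\<^sup>+x. g a b * indicator {x \<in> space M. u x = a \<and> v x = b} x \<partial>M)"
    by (intro sum.cong refl nn_integral_sum) measurable
  also have "\<dots> = (\<Sum>a\<le>K. \<Sum>b\<le>K. g a b * emeasure M {x \<in> space M. u x = a \<and> v x = b})"
    by (intro sum.cong refl nn_integral_cmult_indicator) measurable
  finally show ?thesis by (simp add: emeasure_eq_measure)
qed

text \<open>Each variable is recorded through its codes at all precisions. The marginals are
  eventually fixed, so the codes are tight and have limits on the unit interval. The limit codes
  name dense points that almost surely form a Cauchy sequence, and \<open>Y j\<close> is their
  limit. Of the mean distances only upper bounds are carried over.\<close>

lemma limit_of_random_variables: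
  fixes P :: "nat \<Rightarrow> 'w measure" and X :: "nat \<Rightarrow> nat \<Rightarrow> 'w \<Rightarrow> 'a::polish_space"
  assumes P: "\<And>n. prob_space (P n)"
    and X [measurable]: "\<And>n j. X n j \<in> borel_measurable (P n)"
    and \<nu>: "\<And>j. \<nu> j \<in> space (prob_algebra borel)"
    and law: "\<And>j. \<forall>\<^sub>F n in sequentially. distr (P n) borel (X n j) = \<nu> j"
  obtains Y :: "nat \<Rightarrow> real \<Rightarrow> 'a" where "\<And>j. Y j \<in> borel_measurable unit_interval"
    "\<And>j. distr unit_interval borel (Y j) = \<nu> j"
    "\<And>i j B. (\<And>e. e > 0 \<Longrightarrow>
        \<forall>\<^sub>F n in sequentially. (\<integral>\<^sup>+\<omega>. ennreal (dist (X n i \<omega>) (X n j \<omega>)) \<partial>P n) \<le> B + ennreal e) \<Longrightarrow>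
      (\<integral>\<^sup>+x. ennreal (dist (Y i x) (Y j x)) \<partial>unit_interval) \<le> B"
proof -
  interpret U: prob_space unit_interval by (rule prob_space_unit_interval)
  define \<epsilon> where "\<epsilon> m = 1 / (real m + 1)" for m :: nat
  have \<epsilon>: "0 < \<epsilon> m" for m by (simp add: \<epsilon>_def)
  have \<epsilon>_lim: "\<epsilon> \<longlonglongrightarrow> 0" unfolding \<epsilon>_def by real_asymp
  \<comment> \<open>One index l stands for a variable j together with a precision m.\<close>
  define \<kappa> where "\<kappa> n l \<omega> = (case prod_decode l of (j, m) \<Rightarrow> code_index (\<epsilon> m) (X n j \<omega>))" for n l \<omega>
  have \<kappa>: "\<kappa> n l \<in> measurable (P n) (count_space UNIV)" for n l
    unfolding \<kappa>_def by (cases "prod_decode l") simp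
  have code_law: "\<forall>\<^sub>F n in sequentially. \<forall>A. measure (P n) {\<omega> \<in> space (P n). code_index (\<epsilon> m) (X n j \<omega>) \<in> A} =
      measure (\<nu> j) {x. code_index (\<epsilon> m) x \<in> A}" for j m
    using law[of j]
  proof eventually_elim
    case (elim n)
    have "measure (distr (P n) borel (X n j)) (code_index (\<epsilon> m) -` A) =
        measure (P n) {\<omega> \<in> space (P n). code_index (\<epsilon> m) (X n j \<omega>) \<in> A}" for A
      using measurable_sets[OF measurable_code_index[of "\<epsilon> m"], of A, where 'a1 = 'a]
      by (subst measure_distr) (auto intro!: arg_cong[where f = "measure (P n)"])
    then show ?case unfolding elim by (simp add: vimage_def)
  qed
  have tight: "\<exists>K. \<forall>\<^sub>F n in sequentially. measure (P n) {\<omega> \<in> space (P n). K < \<kappa> n l \<omega>} \<le> e" if e: "e > 0" for l e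
  proof -
    obtain j m where l: "prod_decode l = (j, m)" by fastforce
    obtain K where K: "measure (\<nu> j) {x. K < code_index (\<epsilon> m) x} \<le> e"
      using code_index_tight[OF \<nu> e] by blast
    have "\<forall>\<^sub>F n in sequentially. measure (P n) {\<omega> \<in> space (P n). K < \<kappa> n l \<omega>} \<le> e"
      using code_law[of m j] by eventually_elim (drule spec[of _ "{K<..}"], use K in \<open>simp add: \<kappa>_def l\<close>)
    then show ?thesis by blast
  qed
  obtain r \<kappa>' where r: "strict_mono (r :: nat \<Rightarrow> nat)"
    and \<kappa>' [measurable]: "\<And>l. \<kappa>' l \<in> measurable unit_interval (count_space UNIV)"
    and lim: "\<And>l l' a a'. (\<lambda>n. measure (P (r n)) {\<omega> \<in> space (P (r n)). \<kappa> (r n) l \<omega> = a \<and> \<kappa> (r n) l' \<omega> = a'}) \<longlonglongrightarrow>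
      measure unit_interval {x \<in> space unit_interval. \<kappa>' l x = a \<and> \<kappa>' l' x = a'}"
    by (rule limit_discrete_process[of P \<kappa>, OF P \<kappa> tight], assumption, rule that)
  define k where "k j m x = \<kappa>' (prod_encode (j, m)) x" for j m x
  have k [measurable]: "k j m \<in> measurable unit_interval (count_space UNIV)" for j m
    unfolding k_def by measurable
  have klim: "(\<lambda>n. measure (P (r n)) {\<omega> \<in> space (P (r n)). code_index (\<epsilon> m) (X (r n) j \<omega>) = a \<and> code_index (\<epsilon> m') (X (r n) j' \<omega>) = a'})
      \<longlonglongrightarrow> measure unit_interval {x \<in> space unit_interval. k j m x = a \<and> k j' m' x = a'}" for j m j' m' a a'
    using lim[of "prod_encode (j, m)" a "prod_encode (j', m')" a'] by (simp add: \<kappa>_def k_def)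
  define y :: "nat \<Rightarrow> nat \<Rightarrow> real \<Rightarrow> 'a" where "y j m x = dense_seq (k j m x)" for j m x
  have y [measurable]: "y j m \<in> borel_measurable unit_interval" for j m
    unfolding y_def using measurable_compose[OF k, of dense_seq borel] by simp
  \<comment> \<open>Two codes of one point name dense points at most \<epsilon> m + \<epsilon> m'
    apart. Pairs of codes that violate this have probability 0 for every n, hence also in the
    limit.\<close>
  have close: "AE x in unit_interval. dist (y j m x) (y j m' x) \<le> \<epsilon> m + \<epsilon> m'" for j m m'
  proof -
    have "AE x in unit_interval. \<not> (k j m x = a \<and> k j m' x = a')"
      if far: "\<not> dist (dense_seq a :: 'a) (dense_seq a') \<le> \<epsilon> m + \<epsilon> m'" for a a'
    proof -
      have "{\<omega> \<in> space (P (r n)). code_index (\<epsilon> m) (X (r n) j \<omega>) = a \<and> code_index (\<epsilon> m') (X (r n) j \<omega>) = a'} = {}" for n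
      proof -
        have False if "code_index (\<epsilon> m) (X (r n) j \<omega>) = a" "code_index (\<epsilon> m') (X (r n) j \<omega>) = a'" for \<omega>
          using far dist_dense_seq_code_index(1)[OF \<epsilon>[of m] \<epsilon>[of m'], of "X (r n) j \<omega>" "X (r n) j \<omega>"] that by simp
        then show ?thesis by blast
      qed
      then have "(\<lambda>n. 0) \<longlonglongrightarrow> measure unit_interval {x \<in> space unit_interval. k j m x = a \<and> k j m' x = a'}"
        using klim[of m j a m' j a'] by (simp only: measure_empty)
      then have "measure unit_interval {x \<in> space unit_interval. k j m x = a \<and> k j m' x = a'} = 0"
        by (rule LIMSEQ_unique[OF _ tendsto_const])
      then have "emeasure unit_interval {x \<in> space unit_interval. k j m x = a \<and> k j m' x = a'} = 0"
        unfolding U.emeasure_eq_measure by simp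
      moreover have "{x \<in> space unit_interval. k j m x = a \<and> k j m' x = a'} \<in> sets unit_interval" by measurable
      ultimately show ?thesis by (subst AE_iff_measurable) auto
    qed
    then have "AE x in unit_interval. dist (dense_seq a :: 'a) (dense_seq a') \<le> \<epsilon> m + \<epsilon> m' \<or> \<not> (k j m x = a \<and> k j m' x = a')" for a a'
      by (cases "dist (dense_seq a :: 'a) (dense_seq a') \<le> \<epsilon> m + \<epsilon> m'") auto
    then have "AE x in unit_interval. \<forall>a a'. dist (dense_seq a :: 'a) (dense_seq a') \<le> \<epsilon> m + \<epsilon> m' \<or> \<not> (k j m x = a \<and> k j m' x = a')"
      unfolding AE_all_countable by blast
    then show ?thesis by eventually_elim (auto simp: y_def)
  qed
  define good where "good j x \<longleftrightarrow> (\<forall>m m'. dist (y j m x) (y j m' x) \<le> \<epsilon> m + \<epsilon> m')" for j x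
  have good [measurable]: "Measurable.pred unit_interval (good j)" for j
    unfolding good_def by measurable
  have AE_good: "AE x in unit_interval. good j x" for j
    unfolding good_def AE_all_countable using close by blast
  \<comment> \<open>Replacing the approximations by a constant off the good set makes them Cauchy at
    every sample, so the pointwise limit is measurable.\<close>
  define z where "z j m x = (if good j x then y j m x else dense_seq 0)" for j m x
  have z [measurable]: "z j m \<in> borel_measurable unit_interval" for j m
    unfolding z_def by measurable
  have z_close: "dist (z j m x) (z j m' x) \<le> \<epsilon> m + \<epsilon> m'" for j m m' x
    using \<epsilon>[of m] \<epsilon>[of m'] by (auto simp: z_def good_def)
  have "Cauchy (\<lambda>m. z j m x)" for j x
  proof (rule metric_CauchyI)
    fix e :: real assume "e > 0"
    then have "\<forall>\<^sub>F m in sequentially. \<epsilon> m < e / 2" using \<epsilon>_lim by (intro order_tendstoD(2)) auto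
    then obtain M where M: "\<And>m. m \<ge> M \<Longrightarrow> \<epsilon> m < e / 2" by (auto simp: eventually_sequentially)
    have "dist (z j m x) (z j m' x) < e" if "m \<ge> M" "m' \<ge> M" for m m'
      using z_close[of j m x m'] M[OF that(1)] M[OF that(2)] by linarith
    then show "\<exists>M. \<forall>m\<ge>M. \<forall>n\<ge>M. dist (z j m x) (z j n x) < e" by blast
  qed
  then have "\<exists>l. (\<lambda>m. z j m x) \<longlonglongrightarrow> l" for j x
    unfolding convergent_def[symmetric] by (rule Cauchy_convergent)
  then obtain Y where Y_lim: "\<And>j x. (\<lambda>m. z j m x) \<longlonglongrightarrow> Y j x" by metis
  have Y [measurable]: "Y j \<in> borel_measurable unit_interval" for j
    by (rule borel_measurable_LIMSEQ_metric[OF z Y_lim])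
  have zY: "dist (z j m x) (Y j x) \<le> \<epsilon> m" for j m x
  proof -
    have A: "(\<lambda>m'. dist (z j m x) (z j m' x)) \<longlonglongrightarrow> dist (z j m x) (Y j x)"
      by (intro tendsto_intros Y_lim)
    have B: "(\<lambda>m'. \<epsilon> m + \<epsilon> m') \<longlonglongrightarrow> \<epsilon> m + 0" by (intro tendsto_intros \<epsilon>_lim)
    show ?thesis using LIMSEQ_le[OF A B] z_close by simp
  qed
  have yY: "AE x in unit_interval. dist (y j m x) (Y j x) \<le> \<epsilon> m" for j m
    using AE_good[of j]
  proof eventually_elim
    case (elim x)
    then show ?case using zY[of j m x] by (simp add: z_def)
  qed
  have k_law: "distr unit_interval (count_space UNIV) (k j m) = distr (\<nu> j) (count_space UNIV) (code_index (\<epsilon> m))" for j m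
  proof -
    note n = space_prob_algebra_borelD[OF \<nu>[of j]]
    interpret N: prob_space "\<nu> j" by (rule n)
    have [measurable]: "code_index (\<epsilon> m) \<in> measurable (\<nu> j) (count_space UNIV)"
      unfolding measurable_cong_sets[OF n(2) refl] by measurable
    show ?thesis
    proof (rule measure_eqI_countable[where A = UNIV])
      fix a
      have ev: "\<forall>\<^sub>F n in sequentially. measure (P (r n)) {\<omega> \<in> space (P (r n)). code_index (\<epsilon> m) (X (r n) j \<omega>) = a} =
          measure (\<nu> j) {x. code_index (\<epsilon> m) x = a}"
        using eventually_subseq[OF r code_law[of m j]]
        by eventually_elim (drule spec[of _ "{a}"], simp)
      have "measure unit_interval {x \<in> space unit_interval. k j m x = a} = measure (\<nu> j) {x. code_index (\<epsilon> m) x = a}"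
        using klim[of m j a m j a] tendsto_eventually[OF ev] by (auto intro: LIMSEQ_unique)
      moreover have "emeasure (distr unit_interval (count_space UNIV) (k j m)) {a} =
          emeasure unit_interval {x \<in> space unit_interval. k j m x = a}"
        by (subst emeasure_distr) (auto intro!: arg_cong[where f = "emeasure unit_interval"])
      moreover have "emeasure (distr (\<nu> j) (count_space UNIV) (code_index (\<epsilon> m))) {a} =
          emeasure (\<nu> j) {x. code_index (\<epsilon> m) x = a}"
        by (subst emeasure_distr) (auto simp: n(3) intro!: arg_cong[where f = "emeasure (\<nu> j)"])
      ultimately show "emeasure (distr unit_interval (count_space UNIV) (k j m)) {a} =
          emeasure (distr (\<nu> j) (count_space UNIV) (code_index (\<epsilon> m))) {a}"
        by (simp only: U.emeasure_eq_measure N.emeasure_eq_measure)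
    qed auto
  qed
  have law_Y: "distr unit_interval borel (Y j) = \<nu> j" for j
  proof (rule measure_eqI_Lipschitz[OF distr_in_prob_algebra[OF prob_space_unit_interval Y] \<nu>])
    fix f :: "'a \<Rightarrow> real" and L
    assume f: "\<And>x. \<bar>f x\<bar> \<le> 1" "0 \<le> L" "\<And>x y. \<bar>f x - f y\<bar> \<le> L * dist x y"
      and [measurable]: "f \<in> borel_measurable borel"
    note n = space_prob_algebra_borelD[OF \<nu>[of j]]
    interpret N: prob_space "\<nu> j" by (rule n)
    have cN [measurable]: "code_index (\<epsilon> m) \<in> measurable (\<nu> j) (count_space UNIV)" for m
      unfolding measurable_cong_sets[OF n(2) refl] by measurable
    have fN [measurable]: "f \<in> borel_measurable (\<nu> j)"
      unfolding measurable_cong_sets[OF n(2) refl] by measurable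
    have dN [measurable]: "(\<lambda>x. f (dense_seq (code_index (\<epsilon> m) x))) \<in> borel_measurable (\<nu> j)" for m
      using measurable_compose[OF cN, of "\<lambda>a. f (dense_seq a)" borel] by simp
    \<comment> \<open>One error L * \<epsilon> m comes from discretising \<open>Y j\<close>, the
      other from discretising a point distributed according to \<nu> j. The two discretised
      integrals agree by \<open>k_law\<close>.\<close>
    have bound: "\<bar>(\<integral>x. f (Y j x) \<partial>unit_interval) - (\<integral>x. f x \<partial>\<nu> j)\<bar> \<le> L * \<epsilon> m + L * \<epsilon> m" for m
    proof -
      have "(\<integral>x. f (y j m x) \<partial>unit_interval) = (\<integral>a. f (dense_seq a) \<partial>distr unit_interval (count_space UNIV) (k j m))"
        unfolding y_def by (subst integral_distr) auto
      also have "\<dots> = (\<integral>x. f (dense_seq (code_index (\<epsilon> m) x)) \<partial>\<nu> j)"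
        unfolding k_law by (subst integral_distr) auto
      finally have eq: "(\<integral>x. f (y j m x) \<partial>unit_interval) = (\<integral>x. f (dense_seq (code_index (\<epsilon> m) x)) \<partial>\<nu> j)" .
      have "\<bar>(\<integral>x. f (Y j x) \<partial>unit_interval) - (\<integral>x. f (y j m x) \<partial>unit_interval)\<bar> =
          \<bar>\<integral>x. f (Y j x) - f (y j m x) \<partial>unit_interval\<bar>"
        using f(1) by (subst Bochner_Integration.integral_diff) (auto intro!: U.integrable_const_bound[where B = 1])
      also have "\<dots> \<le> (\<integral>x. L * \<epsilon> m \<partial>unit_interval)"
      proof (rule order_trans[OF integral_abs_bound integral_mono_AE])
        show "AE x in unit_interval. \<bar>f (Y j x) - f (y j m x)\<bar> \<le> L * \<epsilon> m"
          using yY[of j m]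
        proof eventually_elim
          case (elim x)
          have "\<bar>f (Y j x) - f (y j m x)\<bar> \<le> L * dist (Y j x) (y j m x)" by (rule f(3))
          also have "\<dots> \<le> L * \<epsilon> m" using elim f(2) by (intro mult_left_mono) (auto simp: dist_commute)
          finally show ?case .
        qed
        show "integrable unit_interval (\<lambda>x. \<bar>f (Y j x) - f (y j m x)\<bar>)"
          using f(1) by (intro integrable_abs Bochner_Integration.integrable_diff) (auto intro!: U.integrable_const_bound[where B = 1])
      qed simp
      also have "\<dots> = L * \<epsilon> m" by (simp only: lebesgue_integral_const U.prob_space scaleR_one)
      finally have 1: "\<bar>(\<integral>x. f (Y j x) \<partial>unit_interval) - (\<integral>x. f (y j m x) \<partial>unit_interval)\<bar> \<le> L * \<epsilon> m" .
      have "\<bar>(\<integral>x. f (dense_seq (code_index (\<epsilon> m) x)) \<partial>\<nu> j) - (\<integral>x. f x \<partial>\<nu> j)\<bar> =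
          \<bar>\<integral>x. f (dense_seq (code_index (\<epsilon> m) x)) - f x \<partial>\<nu> j\<bar>"
        using f(1) by (subst Bochner_Integration.integral_diff) (auto intro!: N.integrable_const_bound[where B = 1])
      also have "\<dots> \<le> (\<integral>x. L * \<epsilon> m \<partial>\<nu> j)"
      proof (rule order_trans[OF integral_abs_bound integral_mono_AE])
        show "AE x in \<nu> j. \<bar>f (dense_seq (code_index (\<epsilon> m) x)) - f x\<bar> \<le> L * \<epsilon> m"
        proof (rule AE_I2)
          fix x
          have "\<bar>f (dense_seq (code_index (\<epsilon> m) x)) - f x\<bar> \<le> L * dist (dense_seq (code_index (\<epsilon> m) x)) x" by (rule f(3))
          also have "\<dots> \<le> L * \<epsilon> m"
            using dist_code_index[OF \<epsilon>[of m], of x] f(2) by (intro mult_left_mono) (auto simp: dist_commute)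
          finally show "\<bar>f (dense_seq (code_index (\<epsilon> m) x)) - f x\<bar> \<le> L * \<epsilon> m" .
        qed
        show "integrable (\<nu> j) (\<lambda>x. \<bar>f (dense_seq (code_index (\<epsilon> m) x)) - f x\<bar>)"
          using f(1) by (intro integrable_abs Bochner_Integration.integrable_diff) (auto intro!: N.integrable_const_bound[where B = 1])
      qed simp
      also have "\<dots> = L * \<epsilon> m" by (simp only: lebesgue_integral_const N.prob_space scaleR_one)
      finally show ?thesis using 1 eq by linarith
    qed
    have lim: "(\<lambda>m. L * \<epsilon> m + L * \<epsilon> m) \<longlonglongrightarrow> L * 0 + L * 0" by (intro tendsto_intros \<epsilon>_lim)
    have "\<bar>(\<integral>x. f (Y j x) \<partial>unit_interval) - (\<integral>x. f x \<partial>\<nu> j)\<bar> \<le> L * 0 + L * 0"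
      by (rule LIMSEQ_le_const[OF lim]) (use bound in blast)
    then show "(\<integral>x. f x \<partial>distr unit_interval borel (Y j)) = (\<integral>x. f x \<partial>\<nu> j)"
      by (subst integral_distr) auto
  qed
  have pair_Y: "(\<integral>\<^sup>+x. ennreal (dist (Y i x) (Y j x)) \<partial>unit_interval) \<le> B"
    if B: "\<And>e. e > 0 \<Longrightarrow>
        \<forall>\<^sub>F n in sequentially. (\<integral>\<^sup>+\<omega>. ennreal (dist (X n i \<omega>) (X n j \<omega>)) \<partial>P n) \<le> B + ennreal e" for i j B
  proof -
    \<comment> \<open>Half of 4 * \<epsilon> m undoes the subtraction in g; the other half replaces
      the two dense approximations by their limits.\<close>
    have bound: "(\<integral>\<^sup>+x. ennreal (dist (Y i x) (Y j x)) \<partial>unit_interval) \<le> B + ennreal (4 * \<epsilon> m)" for m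
    proof -
      \<comment> \<open>With 2 * \<epsilon> m subtracted, g of the codes is at most the true
        distance, so its integral inherits the assumed bound at each level.\<close>
      define g where "g a b = ennreal (max 0 (dist (dense_seq a :: 'a) (dense_seq b) - 2 * \<epsilon> m))" for a b
      have "(\<lambda>x. g (k i m x) b) \<in> borel_measurable unit_interval" for b
        using measurable_compose[OF k[of i m], of "\<lambda>a. g a b" borel] by simp
      from measurable_compose_countable[OF this k[of j m]]
      have gm [measurable]: "(\<lambda>x. g (k i m x) (k j m x)) \<in> borel_measurable unit_interval" .
      \<comment> \<open>Restricting to codes up to K leaves a finite sum, which passes to the limit;
        K is removed afterwards by monotone convergence.\<close>
      have part: "(\<integral>\<^sup>+x. g (k i m x) (k j m x) * indicator {x \<in> space unit_interval. k i m x \<le> K \<and> k j m x \<le> K} x \<partial>unit_interval) \<le> B" for K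
      proof -
        have le: "\<forall>\<^sub>F n in sequentially. (\<Sum>a\<le>K. \<Sum>b\<le>K. g a b * ennreal (measure (P (r n)) {\<omega> \<in> space (P (r n)).
            code_index (\<epsilon> m) (X (r n) i \<omega>) = a \<and> code_index (\<epsilon> m) (X (r n) j \<omega>) = b})) \<le> B + ennreal e" if "e > 0" for e
          using eventually_subseq[OF r B[OF that]]
        proof eventually_elim
          case (elim n)
          have "(\<Sum>a\<le>K. \<Sum>b\<le>K. g a b * ennreal (measure (P (r n)) {\<omega> \<in> space (P (r n)).
              code_index (\<epsilon> m) (X (r n) i \<omega>) = a \<and> code_index (\<epsilon> m) (X (r n) j \<omega>) = b})) =
            (\<integral>\<^sup>+\<omega>. g (code_index (\<epsilon> m) (X (r n) i \<omega>)) (code_index (\<epsilon> m) (X (r n) j \<omega>)) *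
              indicator {\<omega> \<in> space (P (r n)). code_index (\<epsilon> m) (X (r n) i \<omega>) \<le> K \<and> code_index (\<epsilon> m) (X (r n) j \<omega>) \<le> K} \<omega> \<partial>P (r n))"
            by (rule nn_integral_two_codes[OF P, symmetric]) measurable
          also have "\<dots> \<le> (\<integral>\<^sup>+\<omega>. ennreal (dist (X (r n) i \<omega>) (X (r n) j \<omega>)) \<partial>P (r n))"
          proof (rule nn_integral_mono)
            fix \<omega>
            have "dist (dense_seq (code_index (\<epsilon> m) (X (r n) i \<omega>)) :: 'a) (dense_seq (code_index (\<epsilon> m) (X (r n) j \<omega>))) - 2 * \<epsilon> m
                \<le> dist (X (r n) i \<omega>) (X (r n) j \<omega>)"
              using dist_dense_seq_code_index(1)[OF \<epsilon>[of m] \<epsilon>[of m], of "X (r n) i \<omega>" "X (r n) j \<omega>"] by linarith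
            then have "g (code_index (\<epsilon> m) (X (r n) i \<omega>)) (code_index (\<epsilon> m) (X (r n) j \<omega>)) \<le> ennreal (dist (X (r n) i \<omega>) (X (r n) j \<omega>))"
              unfolding g_def by (intro ennreal_leI) simp
            then show "g (code_index (\<epsilon> m) (X (r n) i \<omega>)) (code_index (\<epsilon> m) (X (r n) j \<omega>)) *
              indicator {\<omega> \<in> space (P (r n)). code_index (\<epsilon> m) (X (r n) i \<omega>) \<le> K \<and> code_index (\<epsilon> m) (X (r n) j \<omega>) \<le> K} \<omega>
              \<le> ennreal (dist (X (r n) i \<omega>) (X (r n) j \<omega>))"
              by (auto simp: indicator_def)
          qed
          finally show ?case using elim by (rule order_trans)
        qed
        have "(\<Sum>a\<le>K. \<Sum>b\<le>K. g a b * ennreal (measure unit_interval {x \<in> space unit_interval. k i m x = a \<and> k j m x = b})) \<le> B"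
        proof (rule ennreal_le_epsilon)
          fix e :: real assume "0 < e"
          have "(\<lambda>n. \<Sum>a\<le>K. \<Sum>b\<le>K. g a b * ennreal (measure (P (r n)) {\<omega> \<in> space (P (r n)).
              code_index (\<epsilon> m) (X (r n) i \<omega>) = a \<and> code_index (\<epsilon> m) (X (r n) j \<omega>) = b})) \<longlonglongrightarrow>
              (\<Sum>a\<le>K. \<Sum>b\<le>K. g a b * ennreal (measure unit_interval {x \<in> space unit_interval. k i m x = a \<and> k j m x = b}))"
            by (intro tendsto_sum ennreal_tendsto_cmult tendsto_ennrealI klim) (simp add: g_def)
          then show "(\<Sum>a\<le>K. \<Sum>b\<le>K. g a b * ennreal (measure unit_interval {x \<in> space unit_interval. k i m x = a \<and> k j m x = b})) \<le> B + ennreal e"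
            by (rule tendsto_upperbound[OF _ le[OF \<open>0 < e\<close>]]) simp
        qed
        then show ?thesis unfolding nn_integral_two_codes[OF prob_space_unit_interval k k] .
      qed
      have "(\<lambda>K. \<integral>\<^sup>+x. g (k i m x) (k j m x) * indicator {x \<in> space unit_interval. k i m x \<le> K \<and> k j m x \<le> K} x \<partial>unit_interval)
          \<longlonglongrightarrow> (\<integral>\<^sup>+x. g (k i m x) (k j m x) * indicator (space unit_interval) x \<partial>unit_interval)"
      proof (rule nn_integral_LIMSEQ)
        show "incseq (\<lambda>K x. g (k i m x) (k j m x) * indicator {x \<in> space unit_interval. k i m x \<le> K \<and> k j m x \<le> K} x)"
          by (auto simp: incseq_def le_fun_def indicator_def)
        show "(\<lambda>x. g (k i m x) (k j m x) * indicator {x \<in> space unit_interval. k i m x \<le> K \<and> k j m x \<le> K} x) \<in> borel_measurable unit_interval" for K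
          by measurable
        fix x
        have "\<forall>\<^sub>F K in sequentially. g (k i m x) (k j m x) * indicator {x \<in> space unit_interval. k i m x \<le> K \<and> k j m x \<le> K} x =
            g (k i m x) (k j m x) * indicator (space unit_interval) x"
          using eventually_ge_at_top[of "max (k i m x) (k j m x)"] by eventually_elim (auto simp: indicator_def)
        then show "(\<lambda>K. g (k i m x) (k j m x) * indicator {x \<in> space unit_interval. k i m x \<le> K \<and> k j m x \<le> K} x)
            \<longlonglongrightarrow> g (k i m x) (k j m x) * indicator (space unit_interval) x"
          by (rule tendsto_eventually)
      qed
      then have "(\<integral>\<^sup>+x. g (k i m x) (k j m x) * indicator (space unit_interval) x \<partial>unit_interval) \<le> B"
        by (rule LIMSEQ_le_const2) (use part in auto)
      then have g_le: "(\<integral>\<^sup>+x. g (k i m x) (k j m x) \<partial>unit_interval) \<le> B"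
        by (subst nn_integral_cong[of _ _ "\<lambda>x. g (k i m x) (k j m x) * indicator (space unit_interval) x"])
          (auto simp: indicator_def)
      have "(\<integral>\<^sup>+x. ennreal (dist (Y i x) (Y j x)) \<partial>unit_interval) \<le> (\<integral>\<^sup>+x. g (k i m x) (k j m x) + ennreal (4 * \<epsilon> m) \<partial>unit_interval)"
      proof (rule nn_integral_mono_AE, use yY[of i m] yY[of j m] in eventually_elim)
        case (elim x)
        have "dist (Y i x) (Y j x) \<le> dist (y i m x) (Y i x) + dist (y i m x) (y j m x) + dist (y j m x) (Y j x)"
          by metric
        then have "dist (Y i x) (Y j x) \<le> max 0 (dist (y i m x) (y j m x) - 2 * \<epsilon> m) + 4 * \<epsilon> m"
          using elim by linarith
        then have "ennreal (dist (Y i x) (Y j x)) \<le> ennreal (max 0 (dist (y i m x) (y j m x) - 2 * \<epsilon> m) + 4 * \<epsilon> m)"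
          by (rule ennreal_leI)
        also have "\<dots> = ennreal (max 0 (dist (y i m x) (y j m x) - 2 * \<epsilon> m)) + ennreal (4 * \<epsilon> m)"
          using less_imp_le[OF \<epsilon>[of m]] by (intro ennreal_plus) auto
        finally show ?case unfolding g_def y_def .
      qed
      also have "\<dots> = (\<integral>\<^sup>+x. g (k i m x) (k j m x) \<partial>unit_interval) + ennreal (4 * \<epsilon> m)"
      proof -
        have "(\<integral>\<^sup>+x. ennreal (4 * \<epsilon> m) \<partial>unit_interval) = ennreal (4 * \<epsilon> m)"
          by (simp only: nn_integral_const U.emeasure_space_1 mult_1_right)
        then show ?thesis using gm by (simp add: nn_integral_add)
      qed
      also have "\<dots> \<le> B + ennreal (4 * \<epsilon> m)" using g_le by (intro add_right_mono)
      finally show ?thesis .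
    qed
    have lim: "(\<lambda>m. B + ennreal (4 * \<epsilon> m)) \<longlonglongrightarrow> B + ennreal (4 * 0)"
      by (intro tendsto_add tendsto_const tendsto_ennrealI tendsto_mult \<epsilon>_lim)
    have "(\<integral>\<^sup>+x. ennreal (dist (Y i x) (Y j x)) \<partial>unit_interval) \<le> B + ennreal (4 * 0)"
      by (rule LIMSEQ_le_const[OF lim]) (use bound in blast)
    then show ?thesis by simp
  qed
  show ?thesis by (rule that[OF Y law_Y pair_Y])
qed

section \<open>Optimal couplings along the dyadic times\<close>

lemma borel_measurable_coordinate [measurable]:
  "(\<lambda>\<omega> :: nat \<Rightarrow> 'a::polish_space. \<omega> i) \<in> borel_measurable borel"
  by (rule borel_measurable_continuous_onI, rule continuous_on_product_then_coordinatewise[OF continuous_on_id])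

lemma borel_measurable_dist_coordinate:
  "(\<lambda>\<omega> :: nat \<Rightarrow> 'a::polish_space. ennreal (dist (\<omega> i) (\<omega> j))) \<in> borel_measurable borel"
  using borel_measurable_dist[OF borel_measurable_coordinate borel_measurable_coordinate]
  by (rule measurable_compose[OF _ measurable_ennreal])

section \<open>Chains of nearly optimal couplings\<close>

text \<open>Each step glues one more coupling at the current end of the chain. Half of \<delta> pays
  for its near optimality, half for the gluing error. Laws on infinite sequences allow one space for
  all lengths; coordinates beyond the chain are unconstrained.\<close>

lemma chain_coupling:
  fixes m :: "nat \<Rightarrow> 'a::polish_space measure"
  assumes m: "\<And>j. m j \<in> P1" and \<delta>: "0 < \<delta>"
  shows "\<exists>P :: (nat \<Rightarrow> 'a) measure. prob_space P \<and> sets P = sets borel \<and>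
    (\<forall>j\<le>k. distr P borel (\<lambda>\<omega>. \<omega> j) = m j) \<and>
    (\<forall>j<k. (\<integral>\<^sup>+\<omega>. ennreal (dist (\<omega> j) (\<omega> (Suc j))) \<partial>P) \<le> W1 (m j) (m (Suc j)) + ennreal \<delta>)"
proof (induction k)
  case 0
  note m0 = space_prob_algebra_borelD[OF P1_prob_algebra[OF m[of 0]]]
  have c: "(\<lambda>x (_ :: nat). x) \<in> borel_measurable (m 0)"
    unfolding measurable_cong_sets[OF m0(2) refl] by (intro measurable_coordinatewise_then_product) simp
  have "distr (distr (m 0) borel (\<lambda>x (_ :: nat). x)) borel (\<lambda>\<omega>. \<omega> 0) = distr (m 0) borel (\<lambda>x. x)"
    by (subst distr_distr[OF borel_measurable_coordinate c]) (simp add: o_def)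
  also have "\<dots> = m 0" by (rule distr_id2) (simp add: m0(2))
  finally show ?case
    using prob_space.prob_space_distr[OF m0(1) c]
    by (intro exI[of _ "distr (m 0) borel (\<lambda>x (_ :: nat). x)"]) simp
next
  case (Suc k)
  then obtain P :: "(nat \<Rightarrow> 'a) measure" where P0: "prob_space P \<and> sets P = sets borel \<and>
    (\<forall>j\<le>k. distr P borel (\<lambda>\<omega>. \<omega> j) = m j) \<and>
    (\<forall>j<k. (\<integral>\<^sup>+\<omega>. ennreal (dist (\<omega> j) (\<omega> (Suc j))) \<partial>P) \<le> W1 (m j) (m (Suc j)) + ennreal \<delta>)" ..
  then have P: "prob_space P" "sets P = sets borel"
    "\<And>j. j \<le> k \<Longrightarrow> distr P borel (\<lambda>\<omega>. \<omega> j) = m j"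
    "\<And>j. j < k \<Longrightarrow> (\<integral>\<^sup>+\<omega>. ennreal (dist (\<omega> j) (\<omega> (Suc j))) \<partial>P) \<le> W1 (m j) (m (Suc j)) + ennreal \<delta>"
    by blast+
  have "W1 (m k) (m (Suc k)) < W1 (m k) (m (Suc k)) + ennreal (\<delta> / 2)"
    using W1_finite[OF m m] \<delta> by (intro ennreal_less_add_pos) auto
  then obtain q where "q \<in> couplings (m k) (m (Suc k))"
    and cq: "coupling_cost q < W1 (m k) (m (Suc k)) + ennreal (\<delta> / 2)"
    by (rule W1_lessE)
  note q = couplingsD[OF this(1)]
  have coord: "(\<lambda>\<omega>. \<omega> j) \<in> borel_measurable P" for j
    unfolding measurable_cong_sets[OF P(2) refl] by measurable
  have glue: "distr P borel (\<lambda>\<omega>. \<omega> k) = distr q borel fst" by (simp only: P(3)[OF order_refl] q(3))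
  have \<delta>2: "\<delta> / 2 > 0" using \<delta> by simp
  obtain R where R: "prob_space R" "sets R = sets (P \<Otimes>\<^sub>M borel)" "distr R P fst = P" "distr R borel snd = q"
    "AE w in R. dist (fst w k) (fst (snd w)) < \<delta> / 2"
    by (rule approximate_gluing[OF P(1) coord q(7) glue \<delta>2])
  interpret R: prob_space R by fact
  have Rf [measurable]: "fst \<in> measurable R P" and Rs [measurable]: "snd \<in> borel_measurable R"
    unfolding measurable_cong_sets[OF R(2) refl] by measurable
  note [measurable] = q(5,6) coord
  have fj [measurable]: "(\<lambda>w. fst w j) \<in> borel_measurable R" for j
    using measurable_compose[OF Rf coord] .
  have fs [measurable]: "(\<lambda>w. fst (snd w)) \<in> borel_measurable R"
    using measurable_compose[OF Rs measurable_borel_fst] .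
  have ss [measurable]: "(\<lambda>w. snd (snd w)) \<in> borel_measurable R"
    using measurable_compose[OF Rs measurable_borel_snd] .
  \<comment> \<open>The second point of q becomes coordinate k + 1. Its first point, which is within
    \<delta> / 2 of coordinate k, is dropped.\<close>
  define G where "G w = (fst w)(Suc k := snd (snd w))" for w :: "(nat \<Rightarrow> 'a) \<times> ('a \<times> 'a)"
  have G [measurable]: "G \<in> borel_measurable R"
  proof (rule measurable_coordinatewise_then_product)
    show "(\<lambda>w. G w i) \<in> borel_measurable R" for i
    proof (cases "i = Suc k")
      case True
      then have "(\<lambda>w. G w i) = (\<lambda>w. snd (snd w))" by (simp add: G_def fun_eq_iff)
      then show ?thesis using ss by (simp only:)
    next
      case False
      then have "(\<lambda>w. G w i) = (\<lambda>w. fst w i)" by (simp add: G_def fun_eq_iff)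
      then show ?thesis using fj by (simp only:)
    qed
  qed
  have fst_int: "(\<integral>\<^sup>+w. f (fst w) \<partial>R) = (\<integral>\<^sup>+\<omega>. f \<omega> \<partial>P)" if "f \<in> borel_measurable P" for f
    using that nn_integral_distr[OF Rf, of f] by (simp add: R(3))
  have snd_int: "(\<integral>\<^sup>+w. ennreal (dist (fst (snd w)) (snd (snd w))) \<partial>R) = coupling_cost q"
    unfolding R(4)[symmetric] by (subst nn_integral_distr) auto
  have G_int: "(\<integral>\<^sup>+\<omega>. ennreal (dist (\<omega> i) (\<omega> j)) \<partial>distr R borel G) = (\<integral>\<^sup>+w. ennreal (dist (G w i) (G w j)) \<partial>R)" for i j
    by (subst nn_integral_distr[OF G]) (simp_all add: borel_measurable_dist_coordinate)
  have "distr (distr R borel G) borel (\<lambda>\<omega>. \<omega> j) = m j" if j: "j \<le> Suc k" for j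
  proof (cases "j = Suc k")
    case True
    have "distr (distr R borel G) borel (\<lambda>\<omega>. \<omega> j) = distr R borel (\<lambda>w. snd (snd w))"
      by (subst distr_distr[OF borel_measurable_coordinate G]) (simp add: o_def G_def True)
    also have "\<dots> = distr (distr R borel snd) borel snd" by (subst distr_distr[OF measurable_borel_snd Rs]) (simp add: o_def)
    finally show ?thesis by (simp only: R(4) q(4) True)
  next
    case False
    have "distr (distr R borel G) borel (\<lambda>\<omega>. \<omega> j) = distr R borel (\<lambda>w. fst w j)"
      using False by (subst distr_distr[OF borel_measurable_coordinate G]) (simp add: o_def G_def)
    also have "\<dots> = distr (distr R P fst) borel (\<lambda>\<omega>. \<omega> j)" by (subst distr_distr[OF coord Rf]) (simp add: o_def)
    finally show ?thesis using P(3)[of j] j False by (simp add: R(3))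
  qed
  moreover have "(\<integral>\<^sup>+\<omega>. ennreal (dist (\<omega> j) (\<omega> (Suc j))) \<partial>distr R borel G) \<le> W1 (m j) (m (Suc j)) + ennreal \<delta>"
    if j: "j < Suc k" for j
  proof (cases "j = k")
    case True
    have "(\<integral>\<^sup>+w. ennreal (dist (G w k) (G w (Suc k))) \<partial>R) \<le>
        (\<integral>\<^sup>+w. ennreal (\<delta> / 2) + ennreal (dist (fst (snd w)) (snd (snd w))) \<partial>R)"
    proof (rule nn_integral_mono_AE, use R(5) in eventually_elim)
      case (elim w)
      then have "dist (G w k) (G w (Suc k)) \<le> \<delta> / 2 + dist (fst (snd w)) (snd (snd w))"
        using dist_triangle[of "fst w k" "snd (snd w)" "fst (snd w)"] by (simp add: G_def)
      then show ?case using \<delta> by (simp add: ennreal_leI flip: ennreal_plus)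
    qed
    also have "\<dots> = ennreal (\<delta> / 2) + coupling_cost q"
      unfolding snd_int[symmetric]
      using measurable_compose[OF borel_measurable_dist[OF fs ss] measurable_ennreal]
      by (subst nn_integral_add) (simp_all add: R.emeasure_space_1)
    also have "\<dots> \<le> ennreal (\<delta> / 2) + (W1 (m k) (m (Suc k)) + ennreal (\<delta> / 2))"
      using cq by (intro add_left_mono less_imp_le)
    also have "\<dots> = W1 (m k) (m (Suc k)) + (ennreal (\<delta> / 2) + ennreal (\<delta> / 2))"
      by (simp only: ac_simps)
    also have "ennreal (\<delta> / 2) + ennreal (\<delta> / 2) = ennreal \<delta>"
      using \<delta> by (simp flip: ennreal_plus)
    finally show ?thesis unfolding G_int True .
  next
    case False
    then have "(\<integral>\<^sup>+w. ennreal (dist (G w j) (G w (Suc j))) \<partial>R) = (\<integral>\<^sup>+w. ennreal (dist (fst w j) (fst w (Suc j))) \<partial>R)"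
      using j by (intro nn_integral_cong) (simp add: G_def)
    also have "\<dots> = (\<integral>\<^sup>+\<omega>. ennreal (dist (\<omega> j) (\<omega> (Suc j))) \<partial>P)"
      by (rule fst_int) (unfold measurable_cong_sets[OF P(2) refl], rule borel_measurable_dist_coordinate)
    finally show ?thesis unfolding G_int using P(4)[of j] j False by simp
  qed
  ultimately show ?case
    using R.prob_space_distr[OF G] by (intro exI[of _ "distr R borel G"]) simp
qed

text \<open>Summing along the chain loses at most \<delta> per link, and by alignment the distances
  of consecutive marginals add up without loss.\<close>

lemma chain_coupling_aligned:
  fixes m :: "nat \<Rightarrow> 'a::polish_space measure"
  assumes m: "\<And>j. m j \<in> P1" and \<delta>: "0 < \<delta>"
    and al: "\<And>i j. i \<le> j \<Longrightarrow> j < k \<Longrightarrow> W1 (m i) (m j) + W1 (m j) (m (Suc j)) = W1 (m i) (m (Suc j))"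
  obtains P :: "(nat \<Rightarrow> 'a) measure" where "prob_space P" "sets P = sets borel"
    "\<And>j. j \<le> k \<Longrightarrow> distr P borel (\<lambda>\<omega>. \<omega> j) = m j"
    "\<And>i j. i \<le> j \<Longrightarrow> j \<le> k \<Longrightarrow> (\<integral>\<^sup>+\<omega>. ennreal (dist (\<omega> i) (\<omega> j)) \<partial>P) \<le> W1 (m i) (m j) + ennreal (real k * \<delta>)"
proof -
  from chain_coupling[OF m \<delta>, of k] obtain P :: "(nat \<Rightarrow> 'a) measure"
    where P0: "prob_space P \<and> sets P = sets borel \<and> (\<forall>j\<le>k. distr P borel (\<lambda>\<omega>. \<omega> j) = m j) \<and>
    (\<forall>j<k. (\<integral>\<^sup>+\<omega>. ennreal (dist (\<omega> j) (\<omega> (Suc j))) \<partial>P) \<le> W1 (m j) (m (Suc j)) + ennreal \<delta>)" ..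
  then have P: "prob_space P" "sets P = sets borel"
    "\<And>j. j \<le> k \<Longrightarrow> distr P borel (\<lambda>\<omega>. \<omega> j) = m j"
    "\<And>j. j < k \<Longrightarrow> (\<integral>\<^sup>+\<omega>. ennreal (dist (\<omega> j) (\<omega> (Suc j))) \<partial>P) \<le> W1 (m j) (m (Suc j)) + ennreal \<delta>"
    by blast+
  have dm: "(\<lambda>\<omega>. ennreal (dist (\<omega> i) (\<omega> j))) \<in> borel_measurable P" for i j
    unfolding measurable_cong_sets[OF P(2) refl] by (rule borel_measurable_dist_coordinate)
  have *: "(\<integral>\<^sup>+\<omega>. ennreal (dist (\<omega> i) (\<omega> j)) \<partial>P) \<le> W1 (m i) (m j) + ennreal (real (j - i) * \<delta>)"
    if "i \<le> j" "j \<le> k" for i j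
    using that
  proof (induction j rule: dec_induct)
    case (step j)
    have "(\<integral>\<^sup>+\<omega>. ennreal (dist (\<omega> i) (\<omega> (Suc j))) \<partial>P) \<le>
        (\<integral>\<^sup>+\<omega>. ennreal (dist (\<omega> i) (\<omega> j)) + ennreal (dist (\<omega> j) (\<omega> (Suc j))) \<partial>P)"
      by (intro nn_integral_mono) (simp add: ennreal_leI dist_triangle flip: ennreal_plus)
    also have "\<dots> = (\<integral>\<^sup>+\<omega>. ennreal (dist (\<omega> i) (\<omega> j)) \<partial>P) + (\<integral>\<^sup>+\<omega>. ennreal (dist (\<omega> j) (\<omega> (Suc j))) \<partial>P)"
      by (rule nn_integral_add[OF dm dm])
    also have "\<dots> \<le> (W1 (m i) (m j) + ennreal (real (j - i) * \<delta>)) + (W1 (m j) (m (Suc j)) + ennreal \<delta>)"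
      using step P(4)[of j] by (intro add_mono) auto
    also have "\<dots> = (W1 (m i) (m j) + W1 (m j) (m (Suc j))) + (ennreal (real (j - i) * \<delta>) + ennreal \<delta>)"
      by (simp only: ac_simps)
    also have "W1 (m i) (m j) + W1 (m j) (m (Suc j)) = W1 (m i) (m (Suc j))" using step al by simp
    also have "ennreal (real (j - i) * \<delta>) + ennreal \<delta> = ennreal (real (Suc j - i) * \<delta>)"
      using \<delta> step by (simp add: Suc_diff_le distrib_right flip: ennreal_plus)
    finally show ?case .
  qed simp
  show ?thesis
  proof (rule that[OF P(1-3)])
    fix i j assume ij: "i \<le> j" "j \<le> k"
    have "ennreal (real (j - i) * \<delta>) \<le> ennreal (real k * \<delta>)"
      using ij \<delta> by (intro ennreal_leI mult_right_mono) auto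
    then show "(\<integral>\<^sup>+\<omega>. ennreal (dist (\<omega> i) (\<omega> j)) \<partial>P) \<le> W1 (m i) (m j) + ennreal (real k * \<delta>)"
      using *[OF ij] by (meson add_left_mono order_trans)
  qed simp
qed

section \<open>Joint laws at all dyadic times\<close>

text \<open>The cap at 1 lets every pair of naturals name a dyadic time in I, so the set is
  enumerated directly, with repetitions.\<close>

definition dyadic :: "real set" where
  "dyadic = (\<lambda>(a, p). min 1 (real a / 2 ^ p)) ` (UNIV :: (nat \<times> nat) set)"

definition dyadic_enum :: "nat \<Rightarrow> real" where
  "dyadic_enum j = (case prod_decode j of (a, p) \<Rightarrow> min 1 (real a / 2 ^ p))"

lemma dyadic_enum_range: "range dyadic_enum = dyadic"
proof -
  have "dyadic_enum = (\<lambda>(a, p). min 1 (real a / 2 ^ p)) \<circ> prod_decode" by (auto simp: dyadic_enum_def)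
  then show ?thesis unfolding dyadic_def by (metis image_comp surj_prod_decode)
qed

lemma dyadic_subset: "dyadic \<subseteq> {0..1}"
  by (auto simp: dyadic_def)

lemma dyadicI: "t = min 1 (real a / 2 ^ p) \<Longrightarrow> t \<in> dyadic"
  by (auto simp: dyadic_def)

text \<open>A dyadic time of level p belongs to the grid of every level n \<ge> p. The index is
  given by a floor so that the coordinate to read is defined at every level, even where it is not
  yet the right one.\<close>

lemma dyadic_enum_on_grid:
  "\<forall>\<^sub>F n in sequentially. \<exists>l\<le>2 ^ n. dyadic_enum j = real l / 2 ^ n \<and> l = nat \<lfloor>2 ^ n * dyadic_enum j\<rfloor>"
proof -
  obtain a p where ap: "prod_decode j = (a, p)" by fastforce
  have "\<exists>l\<le>2 ^ n. dyadic_enum j = real l / 2 ^ n \<and> l = nat \<lfloor>2 ^ n * dyadic_enum j\<rfloor>" if "p \<le> n" for n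
  proof -
    define l where "l = min (2 ^ n) (a * 2 ^ (n - p))"
    have "real (a * 2 ^ (n - p)) / 2 ^ n = real a / 2 ^ p"
      using that by (simp add: field_simps flip: power_add)
    then have "dyadic_enum j = real l / 2 ^ n"
      by (simp add: dyadic_enum_def ap l_def of_nat_min min_divide_distrib_right)
    moreover from this have "l = nat \<lfloor>2 ^ n * dyadic_enum j\<rfloor>" by simp
    ultimately show ?thesis by (intro exI[of _ l]) (simp add: l_def)
  qed
  then show ?thesis unfolding eventually_sequentially by blast
qed

lemma dyadic_coupling:
  fixes u :: "real \<Rightarrow> 'a::polish_space measure"
  assumes u: "\<And>t. t \<in> {0..1} \<Longrightarrow> u t \<in> P1"
    and al: "\<And>s t r. 0 \<le> s \<Longrightarrow> s \<le> t \<Longrightarrow> t \<le> r \<Longrightarrow> r \<le> 1 \<Longrightarrow> W1 (u s) (u t) + W1 (u t) (u r) = W1 (u s) (u r)"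
  obtains Z :: "real \<Rightarrow> real \<Rightarrow> 'a" where
    "\<And>t. t \<in> dyadic \<Longrightarrow> Z t \<in> borel_measurable unit_interval"
    "\<And>t. t \<in> dyadic \<Longrightarrow> distr unit_interval borel (Z t) = u t"
    "\<And>s t. s \<in> dyadic \<Longrightarrow> t \<in> dyadic \<Longrightarrow> (\<integral>\<^sup>+x. ennreal (dist (Z s x) (Z t x)) \<partial>unit_interval) = W1 (u s) (u t)"
proof -
  define grid where "grid n l = u (min 1 (real l / 2 ^ n))" for n l :: nat
  have grid_P1: "grid n l \<in> P1" for n l unfolding grid_def by (intro u) auto
  define \<Psi> where "\<Psi> n P \<longleftrightarrow> prob_space P \<and> sets P = sets borel \<and>
      (\<forall>j\<le>2 ^ n. distr P borel (\<lambda>\<omega>. \<omega> j) = grid n j) \<and>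
      (\<forall>i j. i \<le> j \<longrightarrow> j \<le> 2 ^ n \<longrightarrow> (\<integral>\<^sup>+\<omega>. ennreal (dist (\<omega> i) (\<omega> j)) \<partial>P) \<le> W1 (grid n i) (grid n j) + ennreal (1 / 2 ^ n))"
    for n and P :: "(nat \<Rightarrow> 'a) measure"
  have ex: "\<exists>P. \<Psi> n P" for n
  proof -
    have alg: "W1 (grid n i) (grid n j) + W1 (grid n j) (grid n (Suc j)) = W1 (grid n i) (grid n (Suc j))"
      if "i \<le> j" "j < 2 ^ n" for i j
      unfolding grid_def using that by (intro al) (auto intro!: min.mono divide_right_mono)
    \<comment> \<open>The chain at level n has 2 ^ n links, so this error per link adds up to 1 / 2
      ^ n, which tends to 0.\<close>
    have d0: "(0::real) < 1 / (2 ^ n * 2 ^ n)" by simp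
    obtain P :: "(nat \<Rightarrow> 'a) measure" where P: "prob_space P" "sets P = sets borel"
      "\<And>j. j \<le> 2 ^ n \<Longrightarrow> distr P borel (\<lambda>\<omega>. \<omega> j) = grid n j"
      "\<And>i j. i \<le> j \<Longrightarrow> j \<le> 2 ^ n \<Longrightarrow> (\<integral>\<^sup>+\<omega>. ennreal (dist (\<omega> i) (\<omega> j)) \<partial>P) \<le>
        W1 (grid n i) (grid n j) + ennreal (real (2 ^ n) * (1 / (2 ^ n * 2 ^ n)))"
      by (rule chain_coupling_aligned[of "grid n" _ "2 ^ n", OF grid_P1 d0 alg], assumption+, rule that)
    have "real (2 ^ n) * (1 / (2 ^ n * 2 ^ n)) = 1 / 2 ^ n" by simp
    from P(4)[unfolded this] P(1-3) have "\<Psi> n P" unfolding \<Psi>_def by (intro conjI allI impI)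
    then show ?thesis ..
  qed
  define P where "P n = (SOME P. \<Psi> n P)" for n
  have "\<Psi> n (P n)" for n unfolding P_def by (rule someI_ex[OF ex])
  then have P: "\<And>n. prob_space (P n)" "\<And>n. sets (P n) = sets borel"
    "\<And>n j. j \<le> 2 ^ n \<Longrightarrow> distr (P n) borel (\<lambda>\<omega>. \<omega> j) = grid n j"
    "\<And>n i j. i \<le> j \<Longrightarrow> j \<le> 2 ^ n \<Longrightarrow> (\<integral>\<^sup>+\<omega>. ennreal (dist (\<omega> i) (\<omega> j)) \<partial>P n) \<le> W1 (grid n i) (grid n j) + ennreal (1 / 2 ^ n)"
    unfolding \<Psi>_def by simp_all
  have P4: "(\<integral>\<^sup>+\<omega>. ennreal (dist (\<omega> i) (\<omega> j)) \<partial>P n) \<le> W1 (grid n i) (grid n j) + ennreal (1 / 2 ^ n)"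
    if "i \<le> 2 ^ n" "j \<le> 2 ^ n" for n i j
  proof (cases "i \<le> j")
    case True
    then show ?thesis using that by (intro P(4))
  next
    case False
    then have "(\<integral>\<^sup>+\<omega>. ennreal (dist (\<omega> j) (\<omega> i)) \<partial>P n) \<le> W1 (grid n j) (grid n i) + ennreal (1 / 2 ^ n)"
      using that by (intro P(4)) auto
    then show ?thesis unfolding W1_commute[of "grid n j"] dist_commute[of "_ j"] .
  qed
  \<comment> \<open>On coarse levels this reads the coordinate just before the wanted time; from the
    level of that time on it reads the correct one.\<close>
  define X where "X n j \<omega> = \<omega> (nat \<lfloor>2 ^ n * dyadic_enum j\<rfloor>)" for n j and \<omega> :: "nat \<Rightarrow> 'a"
  have X: "X n j \<in> borel_measurable (P n)" for n j
    unfolding X_def measurable_cong_sets[OF P(2) refl] by (rule borel_measurable_coordinate)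
  have enum01: "dyadic_enum j \<in> {0..1}" for j by (auto simp: dyadic_enum_def split: prod.split)
  have law: "\<forall>\<^sub>F n in sequentially. distr (P n) borel (X n j) = u (dyadic_enum j)" for j
    using dyadic_enum_on_grid[of j]
  proof eventually_elim
    case (elim n)
    then obtain l where l: "l \<le> 2 ^ n" "dyadic_enum j = real l / 2 ^ n" "l = nat \<lfloor>2 ^ n * dyadic_enum j\<rfloor>" by blast
    have "X n j = (\<lambda>\<omega>. \<omega> l)" unfolding X_def l(3)[symmetric] ..
    moreover have "grid n l = u (dyadic_enum j)" using enum01[of j] l(2) by (simp add: grid_def)
    ultimately show ?case using P(3)[OF l(1)] by simp
  qed
  have pair: "\<forall>\<^sub>F n in sequentially. (\<integral>\<^sup>+\<omega>. ennreal (dist (X n i \<omega>) (X n j \<omega>)) \<partial>P n) \<le>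
      W1 (u (dyadic_enum i)) (u (dyadic_enum j)) + ennreal e" if e: "e > 0" for i j e
  proof -
    have "(\<lambda>n. 1 / 2 ^ n :: real) \<longlonglongrightarrow> 0" by real_asymp
    then have "\<forall>\<^sub>F n in sequentially. 1 / 2 ^ n < e" using e by (rule order_tendstoD)
    then show ?thesis using dyadic_enum_on_grid[of i] dyadic_enum_on_grid[of j]
    proof eventually_elim
      case (elim n)
      then obtain l l' where l: "l \<le> 2 ^ n" "dyadic_enum i = real l / 2 ^ n" "l = nat \<lfloor>2 ^ n * dyadic_enum i\<rfloor>"
        and l': "l' \<le> 2 ^ n" "dyadic_enum j = real l' / 2 ^ n" "l' = nat \<lfloor>2 ^ n * dyadic_enum j\<rfloor>" by blast
      have "grid n l = u (dyadic_enum i)" "grid n l' = u (dyadic_enum j)"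
        using enum01[of i] enum01[of j] l(2) l'(2) by (simp_all add: grid_def)
      moreover have "X n i \<omega> = \<omega> l" "X n j \<omega> = \<omega> l'" for \<omega>
        unfolding X_def l(3)[symmetric] l'(3)[symmetric] by simp_all
      ultimately have "(\<integral>\<^sup>+\<omega>. ennreal (dist (X n i \<omega>) (X n j \<omega>)) \<partial>P n) \<le>
          W1 (u (dyadic_enum i)) (u (dyadic_enum j)) + ennreal (1 / 2 ^ n)"
        using P4[OF l(1) l'(1)] by simp
      also have "\<dots> \<le> W1 (u (dyadic_enum i)) (u (dyadic_enum j)) + ennreal e"
        using elim(1) by (intro add_left_mono ennreal_leI) simp
      finally show ?case .
    qed
  qed
  obtain Y :: "nat \<Rightarrow> real \<Rightarrow> 'a" where Y: "\<And>j. Y j \<in> borel_measurable unit_interval"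
    "\<And>j. distr unit_interval borel (Y j) = u (dyadic_enum j)"
    and le: "\<And>i j B. (\<And>e. e > 0 \<Longrightarrow>
        \<forall>\<^sub>F n in sequentially. (\<integral>\<^sup>+\<omega>. ennreal (dist (X n i \<omega>) (X n j \<omega>)) \<partial>P n) \<le> B + ennreal e) \<Longrightarrow>
      (\<integral>\<^sup>+x. ennreal (dist (Y i x) (Y j x)) \<partial>unit_interval) \<le> B"
  proof (rule limit_of_random_variables[of P X "\<lambda>j. u (dyadic_enum j)", OF P(1) X P1_prob_algebra[OF u[OF enum01]] law])
    fix Y :: "nat \<Rightarrow> real \<Rightarrow> 'a"
    assume A: "\<And>j. Y j \<in> borel_measurable unit_interval" "\<And>j. distr unit_interval borel (Y j) = u (dyadic_enum j)"
      "\<And>i j B. (\<And>e. e > 0 \<Longrightarrow>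
        \<forall>\<^sub>F n in sequentially. (\<integral>\<^sup>+\<omega>. ennreal (dist (X n i \<omega>) (X n j \<omega>)) \<partial>P n) \<le> B + ennreal e) \<Longrightarrow>
      (\<integral>\<^sup>+x. ennreal (dist (Y i x) (Y j x)) \<partial>unit_interval) \<le> B"
    show thesis by (rule that[OF A(1) A(2) A(3)])
  qed
  \<comment> \<open>The enumeration repeats its values, so one index is fixed for each time.\<close>
  define J where "J t = (SOME j. dyadic_enum j = t)" for t
  have J: "dyadic_enum (J t) = t" if "t \<in> dyadic" for t
    unfolding J_def by (rule someI_ex) (use that in \<open>auto simp flip: dyadic_enum_range\<close>)
  show ?thesis
  proof (rule that[of "\<lambda>t. Y (J t)"])
    show "Y (J t) \<in> borel_measurable unit_interval" for t by (rule Y)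
    show "distr unit_interval borel (Y (J t)) = u t" if "t \<in> dyadic" for t using Y(2)[of "J t"] J[OF that] by simp
    fix s t assume st: "s \<in> dyadic" "t \<in> dyadic"
    show "(\<integral>\<^sup>+x. ennreal (dist (Y (J s) x) (Y (J t) x)) \<partial>unit_interval) = W1 (u s) (u t)"
    proof (rule antisym)
      show "(\<integral>\<^sup>+x. ennreal (dist (Y (J s) x) (Y (J t) x)) \<partial>unit_interval) \<le> W1 (u s) (u t)"
        using le[OF pair, of "J s" "J t"] J st by simp
      show "W1 (u s) (u t) \<le> (\<integral>\<^sup>+x. ennreal (dist (Y (J s) x) (Y (J t) x)) \<partial>unit_interval)"
        using W1_distr_le[OF prob_space_unit_interval Y(1) Y(1), of "J s" "J t"] Y(2) J st by simp
    qed
  qed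
qed

section \<open>From dyadic times to paths\<close>

text \<open>For t < 1 this is the first grid time of level n strictly after t, even when t is
  dyadic. Values along it probe the right limit and not the value at t.\<close>

definition next_dyadic :: "nat \<Rightarrow> real \<Rightarrow> real" where
  "next_dyadic n t = min 1 ((real_of_int \<lfloor>2 ^ n * t\<rfloor> + 1) / 2 ^ n)"

lemma next_dyadic_in: "0 \<le> t \<Longrightarrow> next_dyadic n t \<in> dyadic"
  by (rule dyadicI[of _ "nat (\<lfloor>2 ^ n * t\<rfloor> + 1)" n]) (simp add: next_dyadic_def)

lemma next_dyadic_bounds:
  shows "t \<le> 1 \<Longrightarrow> t \<le> next_dyadic n t" "t < 1 \<Longrightarrow> t < next_dyadic n t" "next_dyadic n t \<le> 1"
    "next_dyadic n t \<le> t + 1 / 2 ^ n"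
proof -
  have "2 ^ n * t < real_of_int \<lfloor>2 ^ n * t\<rfloor> + 1" by linarith
  then have *: "t < (real_of_int \<lfloor>2 ^ n * t\<rfloor> + 1) / 2 ^ n" by (simp add: field_simps)
  have "real_of_int \<lfloor>2 ^ n * t\<rfloor> + 1 \<le> 2 ^ n * t + 1" by linarith
  then have "(real_of_int \<lfloor>2 ^ n * t\<rfloor> + 1) / 2 ^ n \<le> (2 ^ n * t + 1) / 2 ^ n" by (intro divide_right_mono) auto
  also have "\<dots> = t + 1 / 2 ^ n" by (simp add: field_simps)
  finally show "next_dyadic n t \<le> t + 1 / 2 ^ n" by (simp add: next_dyadic_def min_le_iff_disj)
  show "t \<le> 1 \<Longrightarrow> t \<le> next_dyadic n t" "t < 1 \<Longrightarrow> t < next_dyadic n t" "next_dyadic n t \<le> 1"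
    using * by (auto simp: next_dyadic_def)
qed

lemma next_dyadic_mono: "s \<le> t \<Longrightarrow> next_dyadic n s \<le> next_dyadic n t"
  unfolding next_dyadic_def by (intro min.mono divide_right_mono add_right_mono) (auto intro!: floor_mono)

lemma next_dyadic_tendsto:
  assumes "t \<le> 1"
  shows "(\<lambda>n. next_dyadic n t) \<longlonglongrightarrow> t"
proof (rule tendsto_sandwich[OF _ _ tendsto_const])
  show "\<forall>\<^sub>F n in sequentially. t \<le> next_dyadic n t" using next_dyadic_bounds(1)[OF assms] by simp
  show "\<forall>\<^sub>F n in sequentially. next_dyadic n t \<le> t + 1 / 2 ^ n" using next_dyadic_bounds(4) by simp
  show "(\<lambda>n. t + 1 / 2 ^ n) \<longlonglongrightarrow> t" by real_asymp
qed

lemma next_dyadic_1: "next_dyadic n 1 = 1"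
proof -
  have "\<lfloor>2 ^ n :: real\<rfloor> = 2 ^ n" by simp
  then show ?thesis by (simp add: next_dyadic_def min_absorb1)
qed

lemma dyadic_0: "0 \<in> dyadic" and dyadic_1: "1 \<in> dyadic"
  by (rule dyadicI[of _ 0 0], simp) (rule dyadicI[of _ 1 0], simp)

lemma dyadic_before_1: "1 - 1 / 2 ^ n \<in> dyadic"
proof (rule dyadicI[of _ "2 ^ n - 1" n])
  have "real (2 ^ n - 1) / 2 ^ n = 1 - 1 / 2 ^ n" by (simp add: of_nat_diff field_simps)
  then show "1 - 1 / 2 ^ n = min 1 (real (2 ^ n - 1) / 2 ^ n)" by simp
qed

section \<open>Right limits of an aligned sample\<close>

definition dyadic_aligned :: "(real \<Rightarrow> 'a::metric_space) \<Rightarrow> bool" where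
  "dyadic_aligned y \<longleftrightarrow> (\<forall>s\<in>dyadic. \<forall>t\<in>dyadic. \<forall>r\<in>dyadic. s \<le> t \<longrightarrow> t \<le> r \<longrightarrow>
     dist (y s) (y t) + dist (y t) (y r) = dist (y s) (y r))"

lemma tendsto_dist_zeroI:
  "(\<And>e. 0 < e \<Longrightarrow> \<forall>\<^sub>F s in F. dist (f s) l < e) \<Longrightarrow> ((\<lambda>s. dist (f s) l) \<longlongrightarrow> 0) F"
  by (rule tendstoI) (simp add: dist_real_def)

text \<open>At a dyadic t < 1 the path may differ from the sample at that time; at t = 1 the
  sequence is constant and the sample value is kept.\<close>

definition right_limit_path :: "(real \<Rightarrow> 'a::metric_space) \<Rightarrow> real \<Rightarrow> 'a" where
  "right_limit_path y = (\<lambda>t\<in>{0..1}. lim (\<lambda>n. y (next_dyadic n t)))"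

context
  fixes y :: "real \<Rightarrow> 'a::polish_space"
  assumes y: "dyadic_aligned y"
begin

text \<open>An aligned sample is turned into a monotone real function with the same distances, so
  that limits of points reduce to limits of monotone reals.\<close>

definition travelled :: "real \<Rightarrow> real" where "travelled t = dist (y 0) (y t)"

lemma dist_dyadic:
  assumes "s \<in> dyadic" "t \<in> dyadic" "s \<le> t"
  shows "dist (y s) (y t) = travelled t - travelled s"
proof -
  have "0 \<le> s" using assms(1) dyadic_subset by auto
  then have "dist (y 0) (y s) + dist (y s) (y t) = dist (y 0) (y t)"
    using y assms dyadic_0 unfolding dyadic_aligned_def by blast
  then show ?thesis by (simp add: travelled_def)
qed

lemma dist_dyadic_abs: "s \<in> dyadic \<Longrightarrow> t \<in> dyadic \<Longrightarrow> dist (y s) (y t) = \<bar>travelled t - travelled s\<bar>"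
  using dist_dyadic[of s t] dist_dyadic[of t s] zero_le_dist[of "y s" "y t"]
  by (cases "s \<le> t") (auto simp: dist_commute)

lemma travelled_mono: "s \<in> dyadic \<Longrightarrow> t \<in> dyadic \<Longrightarrow> s \<le> t \<Longrightarrow> travelled s \<le> travelled t"
  using dist_dyadic[of s t] zero_le_dist[of "y s" "y t"] by linarith

text \<open>Before 1 the limit is the infimum over later dyadic times, by monotonicity. At 1 there
  are no later times and the sequence is constant.\<close>

lemma travelled_limit:
  assumes t: "t \<in> {0..1}"
  obtains g where "(\<lambda>n. travelled (next_dyadic n t)) \<longlonglongrightarrow> g"
    "\<And>s. s \<in> dyadic \<Longrightarrow> s \<le> t \<Longrightarrow> travelled s \<le> g"
    "\<And>s. s \<in> dyadic \<Longrightarrow> t < s \<Longrightarrow> g \<le> travelled s"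
proof (cases "t = 1")
  case True
  show ?thesis
  proof (rule that)
    show "(\<lambda>n. travelled (next_dyadic n t)) \<longlonglongrightarrow> travelled 1" by (simp add: True next_dyadic_1)
    show "travelled s \<le> travelled 1" if "s \<in> dyadic" "s \<le> t" for s
      using travelled_mono[of s 1] that True dyadic_1 by auto
    show "travelled 1 \<le> travelled s" if "s \<in> dyadic" "t < s" for s
      using that True dyadic_subset by force
  qed
next
  case False
  then have t: "0 \<le> t" "t < 1" using t by auto
  define A where "A = travelled ` {s \<in> dyadic. t < s}"
  have A: "A \<noteq> {}" "bdd_below A"
    using t dyadic_1 by (auto simp: A_def travelled_def intro!: bdd_belowI[of _ 0])
  have low: "Inf A \<le> travelled s" if "s \<in> dyadic" "t < s" for s
    using that A by (intro cInf_lower) (auto simp: A_def)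
  show ?thesis
  proof (rule that)
    show "(\<lambda>n. travelled (next_dyadic n t)) \<longlonglongrightarrow> Inf A"
    proof (rule order_tendstoI)
      fix a assume "a < Inf A"
      then show "\<forall>\<^sub>F n in sequentially. a < travelled (next_dyadic n t)"
        by (intro always_eventually allI) (rule less_le_trans[OF _ low[OF next_dyadic_in[OF t(1)] next_dyadic_bounds(2)[OF t(2)]]])
    next
      fix a assume "Inf A < a"
      then obtain s where s: "s \<in> dyadic" "t < s" "travelled s < a"
        using cInf_less_iff[OF A] by (auto simp: A_def)
      have "\<forall>\<^sub>F n in sequentially. next_dyadic n t < s"
        using next_dyadic_tendsto[of t] t s by (intro order_tendstoD(2)) auto
      then show "\<forall>\<^sub>F n in sequentially. travelled (next_dyadic n t) < a"
      proof eventually_elim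
        case (elim n)
        have "travelled (next_dyadic n t) \<le> travelled s"
          using elim s(1) next_dyadic_in[OF t(1)] by (intro travelled_mono) auto
        then show ?case using s(3) by simp
      qed
    qed
    show "travelled s \<le> Inf A" if "s \<in> dyadic" "s \<le> t" for s
      using A(1) that by (intro cInf_greatest) (auto simp: A_def intro!: travelled_mono)
  qed (rule low)
qed

definition right_travelled :: "real \<Rightarrow> real" where
  "right_travelled t = lim (\<lambda>n. travelled (next_dyadic n t))"

lemma right_travelled:
  assumes t: "t \<in> {0..1}"
  shows "(\<lambda>n. travelled (next_dyadic n t)) \<longlonglongrightarrow> right_travelled t"
    "\<And>s. s \<in> dyadic \<Longrightarrow> s \<le> t \<Longrightarrow> travelled s \<le> right_travelled t"
    "\<And>s. s \<in> dyadic \<Longrightarrow> t < s \<Longrightarrow> right_travelled t \<le> travelled s"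
proof -
  obtain g where g: "(\<lambda>n. travelled (next_dyadic n t)) \<longlonglongrightarrow> g"
    "\<And>s. s \<in> dyadic \<Longrightarrow> s \<le> t \<Longrightarrow> travelled s \<le> g"
    "\<And>s. s \<in> dyadic \<Longrightarrow> t < s \<Longrightarrow> g \<le> travelled s"
    using travelled_limit[OF t] by blast
  moreover have "right_travelled t = g" unfolding right_travelled_def using g(1) by (rule limI)
  ultimately show "(\<lambda>n. travelled (next_dyadic n t)) \<longlonglongrightarrow> right_travelled t"
    "\<And>s. s \<in> dyadic \<Longrightarrow> s \<le> t \<Longrightarrow> travelled s \<le> right_travelled t"
    "\<And>s. s \<in> dyadic \<Longrightarrow> t < s \<Longrightarrow> right_travelled t \<le> travelled s" by auto
qed

text \<open>Distances along the sequence are differences of \<open>travelled\<close>, so the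
  convergent real sequence makes the sample Cauchy, and the space is complete.\<close>

lemma right_limit_path_tendsto:
  assumes t: "t \<in> {0..1}"
  shows "(\<lambda>n. y (next_dyadic n t)) \<longlonglongrightarrow> right_limit_path y t"
proof -
  have "Cauchy (\<lambda>n. travelled (next_dyadic n t))" using right_travelled(1)[OF t] by (rule LIMSEQ_imp_Cauchy)
  then have "Cauchy (\<lambda>n. y (next_dyadic n t))"
    unfolding Cauchy_def using t dist_dyadic_abs[OF next_dyadic_in next_dyadic_in, of t t]
    by (simp add: dist_real_def abs_minus_commute)
  then have "convergent (\<lambda>n. y (next_dyadic n t))" by (rule Cauchy_convergent)
  then show ?thesis using t by (simp add: right_limit_path_def convergent_LIMSEQ_iff)
qed

lemma dist_right_limit_path:
  assumes "s \<in> {0..1}" "t \<in> {0..1}"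
  shows "dist (right_limit_path y s) (right_limit_path y t) = \<bar>right_travelled t - right_travelled s\<bar>"
proof (rule LIMSEQ_unique)
  show "(\<lambda>n. dist (y (next_dyadic n s)) (y (next_dyadic n t))) \<longlonglongrightarrow>
      dist (right_limit_path y s) (right_limit_path y t)"
    by (intro tendsto_dist right_limit_path_tendsto assms)
  have "(\<lambda>n. \<bar>travelled (next_dyadic n t) - travelled (next_dyadic n s)\<bar>) \<longlonglongrightarrow>
      \<bar>right_travelled t - right_travelled s\<bar>"
    by (intro tendsto_rabs tendsto_diff right_travelled assms)
  then show "(\<lambda>n. dist (y (next_dyadic n s)) (y (next_dyadic n t))) \<longlonglongrightarrow> \<bar>right_travelled t - right_travelled s\<bar>"
    using assms by (simp add: dist_dyadic_abs next_dyadic_in)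
qed

lemma right_travelled_mono:
  assumes "0 \<le> s" "s \<le> t" "t \<le> 1"
  shows "right_travelled s \<le> right_travelled t"
  using assms next_dyadic_mono[OF assms(2)] next_dyadic_in
  by (intro LIMSEQ_le[OF right_travelled(1) right_travelled(1)]) (auto intro!: travelled_mono)

lemma right_limit_path_aligned: "aligned dist (right_limit_path y)"
  unfolding aligned_def using right_travelled_mono by (simp add: dist_right_limit_path)

text \<open>An inequality only, since the sample may jump right after 0. For the lift, equality in
  the mean comes from W_1 as a lower bound.\<close>

lemma right_limit_path_0_1: "dist (right_limit_path y 0) (right_limit_path y 1) \<le> dist (y 0) (y 1)"
proof -
  have "(\<lambda>n. travelled (next_dyadic n 1)) \<longlonglongrightarrow> right_travelled 1" by (rule right_travelled) simp
  then have "right_travelled 1 = travelled 1" by (simp add: next_dyadic_1 LIMSEQ_const_iff)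
  moreover have "0 \<le> right_travelled 0" using right_travelled(2)[of 0 0] dyadic_0 by (simp add: travelled_def)
  moreover have "right_travelled 0 \<le> right_travelled 1" by (rule right_travelled_mono) auto
  ultimately show ?thesis by (simp add: dist_right_limit_path travelled_def)
qed

text \<open>Right continuity and left limits come from the monotone \<open>right_travelled\<close>.
  Monotonicity does not exclude a jump at 1, hence the hypothesis; one nearby time per e is enough,
  since the distance to y 1 decreases along the sample.\<close>

lemma right_limit_path_cadlag:
  assumes left: "\<And>e. e > 0 \<Longrightarrow> \<exists>n. dist (y (1 - 1 / 2 ^ n)) (y 1) < e"
  shows "right_limit_path y \<in> cadlag UNIV dist"
  unfolding cadlag_def
proof (intro CollectI conjI ballI)
  let ?\<gamma> = "right_limit_path y" and ?G = right_travelled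
  show "?\<gamma> \<in> {0..1} \<rightarrow>\<^sub>E UNIV" by (auto simp: right_limit_path_def)
  show "((\<lambda>s. dist (?\<gamma> s) (?\<gamma> t)) \<longlongrightarrow> 0) (at_right t)" if t: "t \<in> {0..<1}" for t
  proof (rule tendsto_dist_zeroI)
    fix a :: real assume "0 < a"
    have t': "t \<in> {0..1}" "0 \<le> t" "t < 1" using t by auto
    have "\<forall>\<^sub>F n in sequentially. travelled (next_dyadic n t) < ?G t + a"
      using right_travelled(1)[OF t'(1)] \<open>0 < a\<close> by (intro order_tendstoD(2)) auto
    then obtain n where n: "travelled (next_dyadic n t) < ?G t + a" by (auto simp: eventually_sequentially)
    have "dist (?\<gamma> s) (?\<gamma> t) < a" if s: "t < s" "s < next_dyadic n t" for s
    proof -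
      have s': "s \<in> {0..1}" using s t' next_dyadic_bounds(3)[of n t] by auto
      have "?G s \<le> travelled (next_dyadic n t)" using s next_dyadic_in[OF t'(2)] by (intro right_travelled(3)[OF s'])
      moreover have "?G t \<le> ?G s" using s s' t' by (intro right_travelled_mono) auto
      ultimately show ?thesis using n dist_right_limit_path[OF s' t'(1)] by linarith
    qed
    then show "\<forall>\<^sub>F s in at_right t. dist (?\<gamma> s) (?\<gamma> t) < a"
      using next_dyadic_bounds(2)[OF t'(3), of n] by (auto simp: eventually_at_right_field)
  qed
  show "\<exists>l\<in>UNIV. ((\<lambda>s. dist (?\<gamma> s) l) \<longlongrightarrow> 0) (at_left t)" if t: "t \<in> {0<..1}" for t
  proof -
    define a where "a k = t - t / (real k + 2)" for k :: nat
    have t': "0 < t" "t \<le> 1" using t by auto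
    have a: "0 \<le> a k" "a k < t" "a k \<in> {0..1}" for k
    proof -
      have "t / (real k + 2) \<le> t / 1" using t' by (intro divide_left_mono) auto
      then show "0 \<le> a k" by (simp add: a_def)
      show "a k < t" using t' by (simp add: a_def)
      then show "a k \<in> {0..1}" using \<open>0 \<le> a k\<close> t' by auto
    qed
    have a_inc: "a k \<le> a k'" if "k \<le> k'" for k k'
      using that t' by (auto simp: a_def intro!: divide_left_mono)
    have a_lim: "a \<longlonglongrightarrow> t" unfolding a_def by real_asymp
    have G_inc: "incseq (\<lambda>k. ?G (a k))"
      unfolding incseq_def using a a_inc by (auto intro!: right_travelled_mono)
    have "bdd_above (range (\<lambda>k. ?G (a k)))"
      using a by (intro bdd_aboveI[of _ "?G 1"]) (auto intro!: right_travelled_mono)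
    then obtain L where L: "(\<lambda>k. ?G (a k)) \<longlonglongrightarrow> L"
      using LIMSEQ_incseq_SUP[OF _ G_inc] by blast
    have "Cauchy (\<lambda>k. ?\<gamma> (a k))"
      using LIMSEQ_imp_Cauchy[OF L] unfolding Cauchy_def
      by (simp add: dist_right_limit_path[OF a(3) a(3)] dist_real_def abs_minus_commute)
    then obtain l where l: "(\<lambda>k. ?\<gamma> (a k)) \<longlonglongrightarrow> l"
      using Cauchy_convergent convergent_def by blast
    \<comment> \<open>The left limit l inherits the real description of distances, with the limit L
      of \<open>right_travelled\<close> as its coordinate.\<close>
    have dl: "dist (?\<gamma> s) l = \<bar>L - ?G s\<bar>" if s: "s \<in> {0..1}" for s
    proof (rule LIMSEQ_unique)
      show "(\<lambda>k. dist (?\<gamma> s) (?\<gamma> (a k))) \<longlonglongrightarrow> dist (?\<gamma> s) l" by (intro tendsto_dist tendsto_const l)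
      have "(\<lambda>k. \<bar>?G (a k) - ?G s\<bar>) \<longlonglongrightarrow> \<bar>L - ?G s\<bar>" by (intro tendsto_rabs tendsto_diff L tendsto_const)
      then show "(\<lambda>k. dist (?\<gamma> s) (?\<gamma> (a k))) \<longlonglongrightarrow> \<bar>L - ?G s\<bar>" unfolding dist_right_limit_path[OF s a(3)] .
    qed
    have "((\<lambda>s. dist (?\<gamma> s) l) \<longlongrightarrow> 0) (at_left t)"
    proof (rule tendsto_dist_zeroI)
      fix e :: real assume "0 < e"
      have "\<forall>\<^sub>F k in sequentially. L - e < ?G (a k)" using L \<open>0 < e\<close> by (intro order_tendstoD(1)) auto
      then obtain k where k: "L - e < ?G (a k)" by (auto simp: eventually_sequentially)
      have "dist (?\<gamma> s) l < e" if s: "a k < s" "s < t" for s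
      proof -
        have s': "s \<in> {0..1}" using s a(1)[of k] t' by auto
        have "?G (a k) \<le> ?G s" using s s' a(1)[of k] by (intro right_travelled_mono) auto
        moreover have "?G s \<le> L"
        proof (rule tendsto_lowerbound[OF L])
          have "\<forall>\<^sub>F j in sequentially. s < a j" using a_lim s(2) by (rule order_tendstoD)
          then show "\<forall>\<^sub>F j in sequentially. ?G s \<le> ?G (a j)"
            by eventually_elim (use s' a(2) t' in \<open>auto intro!: right_travelled_mono intro: less_imp_le less_le_trans\<close>)
        qed simp
        ultimately show ?thesis using k dl[OF s'] by linarith
      qed
      then show "\<forall>\<^sub>F s in at_left t. dist (?\<gamma> s) l < e"
        using a(2)[of k] by (auto simp: eventually_at_left_field)
    qed
    then show ?thesis by blast
  qed
  show "((\<lambda>s. dist (?\<gamma> s) (?\<gamma> 1)) \<longlongrightarrow> 0) (at_left 1)"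
  proof (rule tendsto_dist_zeroI)
    fix e :: real assume "0 < e"
    then obtain n where n: "dist (y (1 - 1 / 2 ^ n)) (y 1) < e" using left by blast
    have "(\<lambda>n. travelled (next_dyadic n 1)) \<longlonglongrightarrow> ?G 1" by (rule right_travelled) simp
    then have G1: "?G 1 = travelled 1" by (simp add: next_dyadic_1 LIMSEQ_const_iff)
    have "dist (?\<gamma> s) (?\<gamma> 1) < e" if s: "1 - 1 / 2 ^ n < s" "s < 1" for s
    proof -
      have "(0::real) \<le> 1 - 1 / 2 ^ n" by simp
      then have "0 \<le> s" using less_imp_le[OF s(1)] by (rule order_trans)
      then have s': "s \<in> {0..1}" using s(2) by simp
      have "travelled (1 - 1 / 2 ^ n) \<le> ?G s" using s dyadic_before_1 by (intro right_travelled(2)[OF s']) auto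
      moreover have "?G s \<le> ?G 1" using s' by (intro right_travelled_mono) auto
      moreover have "dist (y (1 - 1 / 2 ^ n)) (y 1) = travelled 1 - travelled (1 - 1 / 2 ^ n)"
        by (intro dist_dyadic dyadic_before_1 dyadic_1) simp
      ultimately show ?thesis using n dist_right_limit_path[OF s', of 1] G1 by simp
    qed
    then show "\<forall>\<^sub>F s in at_left 1. dist (?\<gamma> s) (?\<gamma> 1) < e"
      by (auto simp: eventually_at_left_field intro!: exI[of _ "1 - 1 / 2 ^ n"])
  qed
qed

end

section \<open>Existence of a lift\<close>

lemma W1_Lipschitz_dist:
  fixes f :: "'a::polish_space \<Rightarrow> real"
  assumes f: "f \<in> borel_measurable borel" "\<And>x. \<bar>f x\<bar> \<le> B" "0 \<le> L" "\<And>x y. \<bar>f x - f y\<bar> \<le> L * dist x y"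
    and \<mu>: "\<mu> \<in> P1" "\<nu> \<in> P1"
  shows "\<bar>(\<integral>x. f x \<partial>\<mu>) - (\<integral>x. f x \<partial>\<nu>)\<bar> \<le> L * W1_dist \<mu> \<nu>"
proof (rule field_le_epsilon)
  fix e :: real assume e: "0 < e"
  have "ennreal (W1_dist \<mu> \<nu>) < ennreal (W1_dist \<mu> \<nu> + e / (L + 1))"
    using e f(3) by (intro ennreal_lessI) (auto simp: add_nonneg_pos W1_dist_def)
  then have "W1 \<mu> \<nu> < ennreal (W1_dist \<mu> \<nu> + e / (L + 1))" by (simp add: ennreal_W1_dist \<mu>)
  then have "\<bar>(\<integral>x. f x \<partial>\<mu>) - (\<integral>x. f x \<partial>\<nu>)\<bar> \<le> L * (W1_dist \<mu> \<nu> + e / (L + 1))"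
    by (rule W1_Lipschitz[OF f])
  also have "\<dots> = L * W1_dist \<mu> \<nu> + L * (e / (L + 1))" by (simp add: distrib_left)
  also have "L * (e / (L + 1)) \<le> e" using e f(3) by (simp add: field_simps)
  finally show "\<bar>(\<integral>x. f x \<partial>\<mu>) - (\<integral>x. f x \<partial>\<nu>)\<bar> \<le> L * W1_dist \<mu> \<nu> + e" by simp
qed

lemma aligned_W1:
  assumes u: "u \<in> {0..1} \<rightarrow> P1" and al: "aligned W1_dist u" and str: "0 \<le> s" "s \<le> t" "t \<le> r" "r \<le> 1"
  shows "W1 (u s) (u t) + W1 (u t) (u r) = W1 (u s) (u r)"
proof -
  have m: "u s \<in> P1" "u t \<in> P1" "u r \<in> P1" using u str by auto
  have "ennreal (W1_dist (u s) (u t)) + ennreal (W1_dist (u t) (u r)) = ennreal (W1_dist (u s) (u r))"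
    using alignedD[OF al str] by (simp add: W1_dist_def flip: ennreal_plus)
  then show ?thesis by (simp only: ennreal_W1_dist m)
qed

text \<open>The defect in the triangle inequality is nonnegative and has integral 0; finiteness
  makes the subtraction of the integrals legitimate.\<close>

lemma AE_triangle_equality:
  fixes X Y Z :: "'w \<Rightarrow> 'a::polish_space"
  assumes [measurable]: "X \<in> borel_measurable M" "Y \<in> borel_measurable M" "Z \<in> borel_measurable M"
    and eq: "(\<integral>\<^sup>+x. ennreal (dist (X x) (Y x)) \<partial>M) + (\<integral>\<^sup>+x. ennreal (dist (Y x) (Z x)) \<partial>M) = (\<integral>\<^sup>+x. ennreal (dist (X x) (Z x)) \<partial>M)"
    and fin: "(\<integral>\<^sup>+x. ennreal (dist (X x) (Z x)) \<partial>M) < \<infinity>"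
  shows "AE x in M. dist (X x) (Y x) + dist (Y x) (Z x) = dist (X x) (Z x)"
proof -
  have "(\<integral>\<^sup>+x. ennreal (dist (X x) (Y x)) \<partial>M) \<le> (\<integral>\<^sup>+x. ennreal (dist (X x) (Z x)) \<partial>M)"
    "(\<integral>\<^sup>+x. ennreal (dist (Y x) (Z x)) \<partial>M) \<le> (\<integral>\<^sup>+x. ennreal (dist (X x) (Z x)) \<partial>M)"
    unfolding eq[symmetric] by simp_all
  note fin' = le_less_trans[OF this(1) fin] le_less_trans[OF this(2) fin]
  have int1: "integrable M (\<lambda>x. dist (X x) (Y x))"
    by (rule integrableI_nonneg[OF borel_measurable_dist[OF assms(1) assms(2)] _ fin'(1)]) (rule AE_I2, rule zero_le_dist)
  have int2: "integrable M (\<lambda>x. dist (Y x) (Z x))"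
    by (rule integrableI_nonneg[OF borel_measurable_dist[OF assms(2) assms(3)] _ fin'(2)]) (rule AE_I2, rule zero_le_dist)
  have int3: "integrable M (\<lambda>x. dist (X x) (Z x))"
    by (rule integrableI_nonneg[OF borel_measurable_dist[OF assms(1) assms(3)] _ fin]) (rule AE_I2, rule zero_le_dist)
  note int = int1 int2 int3
  have "(\<integral>x. dist (X x) (Y x) \<partial>M) + (\<integral>x. dist (Y x) (Z x) \<partial>M) = (\<integral>x. dist (X x) (Z x) \<partial>M)"
  proof -
    have "(\<integral>x. dist (X x) (Y x) \<partial>M) = enn2real (\<integral>\<^sup>+x. ennreal (dist (X x) (Y x)) \<partial>M)"
      by (rule integral_eq_nn_integral[OF borel_measurable_dist[OF assms(1) assms(2)]]) (rule AE_I2, rule zero_le_dist)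
    moreover have "(\<integral>x. dist (Y x) (Z x) \<partial>M) = enn2real (\<integral>\<^sup>+x. ennreal (dist (Y x) (Z x)) \<partial>M)"
      by (rule integral_eq_nn_integral[OF borel_measurable_dist[OF assms(2) assms(3)]]) (rule AE_I2, rule zero_le_dist)
    moreover have "(\<integral>x. dist (X x) (Z x) \<partial>M) = enn2real (\<integral>\<^sup>+x. ennreal (dist (X x) (Z x)) \<partial>M)"
      by (rule integral_eq_nn_integral[OF borel_measurable_dist[OF assms(1) assms(3)]]) (rule AE_I2, rule zero_le_dist)
    ultimately show ?thesis
      unfolding eq[symmetric] using enn2real_plus[OF fin'[unfolded infinity_ennreal_def]] by simp
  qed
  then have "(\<integral>x. dist (X x) (Y x) + dist (Y x) (Z x) - dist (X x) (Z x) \<partial>M) = 0"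
    using int by simp
  then have "AE x in M. dist (X x) (Y x) + dist (Y x) (Z x) - dist (X x) (Z x) = 0"
    using int by (subst (asm) integral_nonneg_eq_0_iff_AE) (auto simp: dist_triangle)
  then show ?thesis by eventually_elim simp
qed

lemma measurable_pred_eq:
  fixes f g :: "'w \<Rightarrow> 'b::{second_countable_topology, linorder_topology}"
  assumes "f \<in> borel_measurable M" "g \<in> borel_measurable M"
  shows "Measurable.pred M (\<lambda>x. f x = g x)"
  unfolding pred_def using borel_measurable_eq[OF assms] .

lemma dyadic_aligned_enum:
  "dyadic_aligned y \<longleftrightarrow> (\<forall>i j l. dyadic_enum i \<le> dyadic_enum j \<longrightarrow> dyadic_enum j \<le> dyadic_enum l \<longrightarrow>
    dist (y (dyadic_enum i)) (y (dyadic_enum j)) + dist (y (dyadic_enum j)) (y (dyadic_enum l)) =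
    dist (y (dyadic_enum i)) (y (dyadic_enum l)))"
  unfolding dyadic_aligned_def dyadic_enum_range[symmetric] by simp

lemma measurable_dyadic_aligned:
  fixes Y :: "'w \<Rightarrow> real \<Rightarrow> 'a::polish_space"
  assumes "\<And>j. (\<lambda>x. Y x (dyadic_enum j)) \<in> borel_measurable M"
  shows "Measurable.pred M (\<lambda>x. dyadic_aligned (Y x))"
  unfolding dyadic_aligned_enum
  by (intro pred_intros_countable pred_intros_logic(4) measurable_const measurable_pred_eq
      borel_measurable_add borel_measurable_dist assms) simp_all

lemma dyadic_enum_in: "dyadic_enum j \<in> dyadic" "dyadic_enum j \<in> {0..1}"
  using dyadic_enum_range dyadic_subset by blast+

lemma cadlag_next_dyadic:
  assumes u: "u \<in> cadlag M d" and d: "\<And>x. x \<in> M \<Longrightarrow> d x x = 0" and t: "t \<in> {0..1}"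
  shows "(\<lambda>n. d (u (next_dyadic n t)) (u t)) \<longlonglongrightarrow> 0"
proof (cases "t = 1")
  case True
  then show ?thesis using d[OF cadlagD(1)[OF u t]] by (simp add: next_dyadic_1)
next
  case False
  then have t: "0 \<le> t" "t < 1" using t by auto
  have "filterlim (\<lambda>n. next_dyadic n t) (at_right t) sequentially"
    using next_dyadic_tendsto[of t] next_dyadic_bounds(2)[OF t(2)] t
    by (auto simp: filterlim_at less_imp_neq[THEN not_sym] intro!: always_eventually)
  then show ?thesis by (rule filterlim_compose[OF cadlagD(2)[OF u t]])
qed

text \<open>Alignment of a cadlag path is decided at countably many times, by right continuity. This
  gives a measurable event through which almost sure alignment can be pushed forward.\<close>

lemma aligned_if_dyadic_aligned:
  fixes \<gamma> :: "real \<Rightarrow> 'a::metric_space"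
  assumes \<gamma>: "\<gamma> \<in> cadlag UNIV dist" and dy: "dyadic_aligned \<gamma>"
  shows "aligned dist \<gamma>"
  unfolding aligned_def
proof (intro allI impI)
  fix s t r :: real assume str: "0 \<le> s" "s \<le> t" "t \<le> r" "r \<le> 1"
  have lim: "(\<lambda>n. \<gamma> (next_dyadic n x)) \<longlonglongrightarrow> \<gamma> x" if "0 \<le> x" "x \<le> 1" for x
    unfolding tendsto_dist_iff[of "\<lambda>n. \<gamma> (next_dyadic n x)"]
    by (rule cadlag_next_dyadic[OF \<gamma>]) (use that in auto)
  have "(\<lambda>n. dist (\<gamma> (next_dyadic n s)) (\<gamma> (next_dyadic n t)) + dist (\<gamma> (next_dyadic n t)) (\<gamma> (next_dyadic n r))) \<longlonglongrightarrow>
      dist (\<gamma> s) (\<gamma> t) + dist (\<gamma> t) (\<gamma> r)"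
    using str by (intro tendsto_add tendsto_dist lim) auto
  moreover have "dist (\<gamma> (next_dyadic n s)) (\<gamma> (next_dyadic n t)) + dist (\<gamma> (next_dyadic n t)) (\<gamma> (next_dyadic n r)) =
      dist (\<gamma> (next_dyadic n s)) (\<gamma> (next_dyadic n r))" for n
    using dy str unfolding dyadic_aligned_def by (simp add: next_dyadic_in next_dyadic_mono)
  ultimately have "(\<lambda>n. dist (\<gamma> (next_dyadic n s)) (\<gamma> (next_dyadic n r))) \<longlonglongrightarrow> dist (\<gamma> s) (\<gamma> t) + dist (\<gamma> t) (\<gamma> r)"
    by simp
  moreover have "(\<lambda>n. dist (\<gamma> (next_dyadic n s)) (\<gamma> (next_dyadic n r))) \<longlonglongrightarrow> dist (\<gamma> s) (\<gamma> r)"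
    using str by (intro tendsto_dist lim) auto
  ultimately show "dist (\<gamma> s) (\<gamma> t) + dist (\<gamma> t) (\<gamma> r) = dist (\<gamma> s) (\<gamma> r)" by (rule LIMSEQ_unique)
qed

lemma constant_path_cadlag: "(\<lambda>t\<in>{0..1}. a) \<in> cadlag UNIV (dist :: 'a::metric_space \<Rightarrow> _)"
  using step_path_cadlag[of 1 "\<lambda>_. a"] by (simp add: step_path_def)

lemma geodesic_lift_exists:
  fixes u :: "real \<Rightarrow> 'a::polish_space measure"
  assumes u: "u \<in> cadlag P1 W1_dist" and al: "aligned W1_dist u"
  obtains \<pi> where "\<pi> \<in> space (prob_algebra path_borel)" "geodesic_lift u \<pi>"
proof -
  interpret U: prob_space unit_interval by (rule prob_space_unit_interval)
  have uP: "u t \<in> P1" if "t \<in> {0..1}" for t using cadlagD(1)[OF u that] .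
  have W1_al: "W1 (u s) (u t) + W1 (u t) (u r) = W1 (u s) (u r)" if "0 \<le> s" "s \<le> t" "t \<le> r" "r \<le> 1" for s t r
    using aligned_W1[OF _ al that] uP by auto
  obtain Z :: "real \<Rightarrow> real \<Rightarrow> 'a" where Zm: "\<And>t. t \<in> dyadic \<Longrightarrow> Z t \<in> borel_measurable unit_interval"
    and Zlaw: "\<And>t. t \<in> dyadic \<Longrightarrow> distr unit_interval borel (Z t) = u t"
    and ZW: "\<And>s t. s \<in> dyadic \<Longrightarrow> t \<in> dyadic \<Longrightarrow> (\<integral>\<^sup>+x. ennreal (dist (Z s x) (Z t x)) \<partial>unit_interval) = W1 (u s) (u t)"
  proof (rule dyadic_coupling[OF uP W1_al])
    fix Z :: "real \<Rightarrow> real \<Rightarrow> 'a"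
    assume A: "\<And>t. t \<in> dyadic \<Longrightarrow> Z t \<in> borel_measurable unit_interval"
      "\<And>t. t \<in> dyadic \<Longrightarrow> distr unit_interval borel (Z t) = u t"
      "\<And>s t. s \<in> dyadic \<Longrightarrow> t \<in> dyadic \<Longrightarrow> (\<integral>\<^sup>+x. ennreal (dist (Z s x) (Z t x)) \<partial>unit_interval) = W1 (u s) (u t)"
    show thesis by (rule that[OF A(1) A(2) A(3)])
  qed
  have Ze [measurable]: "Z (dyadic_enum j) \<in> borel_measurable unit_interval" for j
    by (rule Zm[OF dyadic_enum_in(1)])
  have Zb [measurable]: "Z (1 - 1 / 2 ^ n) \<in> borel_measurable unit_interval" for n
    by (rule Zm[OF dyadic_before_1])
  have Z1 [measurable]: "Z 1 \<in> borel_measurable unit_interval" by (rule Zm[OF dyadic_1])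
  have AE_al: "AE x in unit_interval. dyadic_aligned (\<lambda>t. Z t x)"
    unfolding dyadic_aligned_enum AE_all_countable
  proof (intro allI)
    fix i j l
    show "AE x in unit_interval. dyadic_enum i \<le> dyadic_enum j \<longrightarrow> dyadic_enum j \<le> dyadic_enum l \<longrightarrow>
      dist (Z (dyadic_enum i) x) (Z (dyadic_enum j) x) + dist (Z (dyadic_enum j) x) (Z (dyadic_enum l) x) =
      dist (Z (dyadic_enum i) x) (Z (dyadic_enum l) x)"
    proof (cases "dyadic_enum i \<le> dyadic_enum j \<and> dyadic_enum j \<le> dyadic_enum l")
      case True
      have "AE x in unit_interval. dist (Z (dyadic_enum i) x) (Z (dyadic_enum j) x) + dist (Z (dyadic_enum j) x) (Z (dyadic_enum l) x) =
          dist (Z (dyadic_enum i) x) (Z (dyadic_enum l) x)"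
      proof (rule AE_triangle_equality[OF Ze Ze Ze])
        show "(\<integral>\<^sup>+x. ennreal (dist (Z (dyadic_enum i) x) (Z (dyadic_enum j) x)) \<partial>unit_interval) +
            (\<integral>\<^sup>+x. ennreal (dist (Z (dyadic_enum j) x) (Z (dyadic_enum l) x)) \<partial>unit_interval) =
            (\<integral>\<^sup>+x. ennreal (dist (Z (dyadic_enum i) x) (Z (dyadic_enum l) x)) \<partial>unit_interval)"
          unfolding ZW[OF dyadic_enum_in(1) dyadic_enum_in(1)]
          using True dyadic_enum_in(2)[of i] dyadic_enum_in(2)[of l] by (intro W1_al) auto
        show "(\<integral>\<^sup>+x. ennreal (dist (Z (dyadic_enum i) x) (Z (dyadic_enum l) x)) \<partial>unit_interval) < \<infinity>"
          unfolding ZW[OF dyadic_enum_in(1) dyadic_enum_in(1)] by (intro W1_finite uP dyadic_enum_in(2))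
      qed
      then show ?thesis by eventually_elim simp
    qed auto
  qed
  have INF_meas: "(\<lambda>x. INF n. ennreal (dist (Z (1 - 1 / 2 ^ n) x) (Z 1 x))) \<in> borel_measurable unit_interval"
    by (rule borel_measurable_INF[OF countableI_type measurable_compose[OF borel_measurable_dist[OF Zb Z1] measurable_ennreal]])
  \<comment> \<open>The mean of the infimum is at most the W_1 distance from u (1 - 1 / 2 ^ n) to u
    1 for every n, and this tends to 0. An infimum equal to 0 is exactly what
    \<open>right_limit_path_cadlag\<close> requires.\<close>
  have AE_left: "AE x in unit_interval. (INF n. ennreal (dist (Z (1 - 1 / 2 ^ n) x) (Z 1 x))) = 0"
  proof -
    have "(\<lambda>n. W1_dist (u (1 - 1 / 2 ^ n)) (u 1)) \<longlonglongrightarrow> 0"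
    proof (rule filterlim_compose[OF cadlagD(4)[OF u]])
      show "filterlim (\<lambda>n. 1 - 1 / 2 ^ n) (at_left (1 :: real)) sequentially" by real_asymp
    qed
    then have lim: "(\<lambda>n. ennreal (W1_dist (u (1 - 1 / 2 ^ n)) (u 1))) \<longlonglongrightarrow> ennreal 0" by (rule tendsto_ennrealI)
    have "(\<integral>\<^sup>+x. (INF n. ennreal (dist (Z (1 - 1 / 2 ^ n) x) (Z 1 x))) \<partial>unit_interval) \<le> ennreal (W1_dist (u (1 - 1 / 2 ^ n)) (u 1))" for n
    proof -
      have "(\<integral>\<^sup>+x. (INF n. ennreal (dist (Z (1 - 1 / 2 ^ n) x) (Z 1 x))) \<partial>unit_interval) \<le>
          (\<integral>\<^sup>+x. ennreal (dist (Z (1 - 1 / 2 ^ n) x) (Z 1 x)) \<partial>unit_interval)"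
        by (intro nn_integral_mono INF_lower) simp
      also have "\<dots> = W1 (u (1 - 1 / 2 ^ n)) (u 1)" by (rule ZW[OF dyadic_before_1 dyadic_1])
      also have "\<dots> = ennreal (W1_dist (u (1 - 1 / 2 ^ n)) (u 1))"
        by (rule ennreal_W1_dist[symmetric]) (auto intro!: uP)
      finally show ?thesis .
    qed
    then have "(\<integral>\<^sup>+x. (INF n. ennreal (dist (Z (1 - 1 / 2 ^ n) x) (Z 1 x))) \<partial>unit_interval) \<le> ennreal 0"
      by (intro LIMSEQ_le_const[OF lim]) auto
    then have eq0: "(\<integral>\<^sup>+x. (INF n. ennreal (dist (Z (1 - 1 / 2 ^ n) x) (Z 1 x))) \<partial>unit_interval) = 0"
      by (simp only: ennreal_0 le_zero_eq)
    from nn_integral_0_iff_AE[OF INF_meas] eq0 show ?thesis by (rule iffD1)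
  qed
  define good where "good x \<longleftrightarrow> dyadic_aligned (\<lambda>t. Z t x) \<and> (INF n. ennreal (dist (Z (1 - 1 / 2 ^ n) x) (Z 1 x))) = 0" for x
  have good [measurable]: "Measurable.pred unit_interval good"
  proof -
    have "Measurable.pred unit_interval (\<lambda>x. dyadic_aligned (\<lambda>t. Z t x))"
      by (rule measurable_dyadic_aligned) (rule Ze)
    moreover have "Measurable.pred unit_interval (\<lambda>x. (INF n. ennreal (dist (Z (1 - 1 / 2 ^ n) x) (Z 1 x))) = 0)"
      by (rule measurable_pred_eq[OF INF_meas borel_measurable_const])
    ultimately show ?thesis unfolding good_def by (rule pred_intros_logic(3))
  qed
  have AE_good: "AE x in unit_interval. good x"
    using AE_al AE_left by eventually_elim (simp add: good_def)
  \<comment> \<open>A constant path on the exceptional null set makes \<Phi> cadlag at every sample,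
    as measurability into the path space demands.\<close>
  define \<Phi> where "\<Phi> x = (if good x then right_limit_path (\<lambda>t. Z t x) else (\<lambda>t\<in>{0..1}. dense_seq 0))" for x
  have good_left: "\<exists>n. dist (Z (1 - 1 / 2 ^ n) x) (Z 1 x) < e" if "good x" "e > 0" for x e
  proof -
    have "(INF n. ennreal (dist (Z (1 - 1 / 2 ^ n) x) (Z 1 x))) < ennreal e" using that by (simp add: good_def)
    then show ?thesis by (auto simp: INF_less_iff ennreal_less_iff)
  qed
  have \<Phi>_cadlag: "\<Phi> x \<in> cadlag UNIV dist" for x
    using good_left[of x] unfolding \<Phi>_def
    by (auto intro!: constant_path_cadlag right_limit_path_cadlag simp: good_def)
  have \<Phi>_aligned: "aligned dist (\<Phi> x)" for x
    unfolding \<Phi>_def by (auto intro!: right_limit_path_aligned simp: good_def) (auto simp: aligned_def)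
  have \<Phi>_lim: "(\<lambda>n. if good x then Z (next_dyadic n t) x else dense_seq 0) \<longlonglongrightarrow> \<Phi> x t" if "t \<in> {0..1}" for x t
    using right_limit_path_tendsto[of "\<lambda>t. Z t x" t] that by (auto simp: \<Phi>_def good_def)
  have Zn [measurable]: "Z (next_dyadic n t) \<in> borel_measurable unit_interval" if "t \<in> {0..1}" for n t
    using that by (intro Zm next_dyadic_in) auto
  have \<Phi>_meas [measurable]: "(\<lambda>x. \<Phi> x t) \<in> borel_measurable unit_interval" if t: "t \<in> {0..1}" for t
  proof (rule borel_measurable_LIMSEQ_metric[OF _ \<Phi>_lim[OF t]])
    show "(\<lambda>x. if good x then Z (next_dyadic n t) x else dense_seq 0) \<in> borel_measurable unit_interval" for n
      using Zn[OF t] by measurable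
  qed
  have \<Phi> [measurable]: "\<Phi> \<in> measurable unit_interval path_borel"
    by (rule measurable_path_borelI[OF funcsetI[OF \<Phi>_cadlag] \<Phi>_meas])
  \<comment> \<open>Even at a dyadic t the path value is a right limit and not Z t. Along
    \<open>next_dyadic n t\<close> the samples converge almost surely to \<Phi> x t, while their
    laws converge in W_1 to u t by right continuity; bounded Lipschitz functions identify the two
    limits.\<close>
  have law: "distr unit_interval borel (\<lambda>x. \<Phi> x t) = u t" if t: "t \<in> {0..1}" for t
  proof (rule measure_eqI_Lipschitz[OF distr_in_prob_algebra[OF prob_space_unit_interval \<Phi>_meas[OF t]] P1_prob_algebra[OF uP[OF t]]])
    fix f :: "'a \<Rightarrow> real" and L
    assume f: "\<And>x. \<bar>f x\<bar> \<le> 1" "0 \<le> L" "\<And>x y. \<bar>f x - f y\<bar> \<le> L * dist x y"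
      and fm [measurable]: "f \<in> borel_measurable borel"
    have nd: "next_dyadic n t \<in> dyadic" for n using t by (intro next_dyadic_in) simp
    have "(\<lambda>n. \<integral>x. f (Z (next_dyadic n t) x) \<partial>unit_interval) \<longlonglongrightarrow> (\<integral>x. f (\<Phi> x t) \<partial>unit_interval)"
    proof (rule integral_dominated_convergence[where w = "\<lambda>_. 1"])
      show "(\<lambda>x. f (\<Phi> x t)) \<in> borel_measurable unit_interval"
        using measurable_compose[OF \<Phi>_meas[OF t] fm] .
      show "(\<lambda>x. f (Z (next_dyadic n t) x)) \<in> borel_measurable unit_interval" for n
        using measurable_compose[OF Zm[OF nd] fm] .
      show "AE x in unit_interval. (\<lambda>n. f (Z (next_dyadic n t) x)) \<longlonglongrightarrow> f (\<Phi> x t)"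
        using AE_good
      proof eventually_elim
        case (elim x)
        then have "(\<lambda>n. Z (next_dyadic n t) x) \<longlonglongrightarrow> \<Phi> x t" using \<Phi>_lim[OF t, of x] by simp
        then have "(\<lambda>n. dist (Z (next_dyadic n t) x) (\<Phi> x t)) \<longlonglongrightarrow> 0" by (simp add: tendsto_dist_iff[symmetric])
        then have "(\<lambda>n. f (Z (next_dyadic n t) x) - f (\<Phi> x t)) \<longlonglongrightarrow> 0"
          by (rule tendsto_0_le[where K = L]) (use f(3) in \<open>simp add: mult.commute\<close>)
        then show ?case by (rule LIM_zero_cancel)
      qed
      show "AE x in unit_interval. norm (f (Z (next_dyadic n t) x)) \<le> 1" for n using f(1) by simp
    qed (rule U.integrable_const)
    also have "(\<lambda>n. \<integral>x. f (Z (next_dyadic n t) x) \<partial>unit_interval) = (\<lambda>n. \<integral>x. f x \<partial>u (next_dyadic n t))"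
      unfolding Zlaw[OF nd, symmetric] by (simp add: integral_distr[OF Zm[OF nd] fm])
    finally have 1: "(\<lambda>n. \<integral>x. f x \<partial>u (next_dyadic n t)) \<longlonglongrightarrow> (\<integral>x. f (\<Phi> x t) \<partial>unit_interval)" .
    have "(\<lambda>n. W1_dist (u (next_dyadic n t)) (u t)) \<longlonglongrightarrow> 0"
      by (rule cadlag_next_dyadic[OF u _ t]) (rule W1.mdist_zero)
    then have "(\<lambda>n. (\<integral>x. f x \<partial>u (next_dyadic n t)) - (\<integral>x. f x \<partial>u t)) \<longlonglongrightarrow> 0"
    proof (rule tendsto_0_le[where K = L], intro always_eventually allI)
      fix n
      have "\<bar>(\<integral>x. f x \<partial>u (next_dyadic n t)) - (\<integral>x. f x \<partial>u t)\<bar> \<le> L * W1_dist (u (next_dyadic n t)) (u t)"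
        by (intro W1_Lipschitz_dist[OF fm f(1) f(2) f(3)] uP t subsetD[OF dyadic_subset nd])
      then show "norm ((\<integral>x. f x \<partial>u (next_dyadic n t)) - (\<integral>x. f x \<partial>u t)) \<le> norm (W1_dist (u (next_dyadic n t)) (u t)) * L"
        by (simp add: mult.commute)
    qed
    then have "(\<lambda>n. \<integral>x. f x \<partial>u (next_dyadic n t)) \<longlonglongrightarrow> (\<integral>x. f x \<partial>u t)" by (rule LIM_zero_cancel)
    with 1 have "(\<integral>x. f (\<Phi> x t) \<partial>unit_interval) = (\<integral>x. f x \<partial>u t)" by (rule LIMSEQ_unique)
    then show "(\<integral>x. f x \<partial>distr unit_interval borel (\<lambda>x. \<Phi> x t)) = (\<integral>x. f x \<partial>u t)"
      by (simp add: integral_distr[OF \<Phi>_meas[OF t] fm])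
  qed
  define \<pi> where "\<pi> = distr unit_interval path_borel \<Phi>"
  have \<pi>: "\<pi> \<in> space (prob_algebra path_borel)"
    unfolding \<pi>_def using U.prob_space_distr[OF \<Phi>] by (simp add: space_prob_algebra)
  have law\<pi>: "distr \<pi> borel (\<lambda>\<gamma>. \<gamma> t) = u t" if t: "t \<in> {0..1}" for t
    unfolding \<pi>_def using law[OF t] distr_distr[OF measurable_path_borel_eval[OF t] \<Phi>] by (simp add: o_def)
  have ev: "(\<lambda>\<gamma>. \<gamma> t) \<in> borel_measurable (\<pi> :: (real \<Rightarrow> 'a) measure)" if t: "t \<in> {0..1}" for t
    unfolding \<pi>_def measurable_distr_eq1 by (rule measurable_path_borel_eval[OF t])
  have d01: "(\<lambda>\<gamma>. ennreal (dist (\<gamma> 0) (\<gamma> 1))) \<in> borel_measurable (path_borel :: (real \<Rightarrow> 'a) measure)"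
    by (intro measurable_compose[OF _ measurable_ennreal] borel_measurable_dist measurable_path_borel_eval) auto
  have cost: "(\<integral>\<^sup>+\<gamma>. ennreal (dist (\<gamma> 0) (\<gamma> 1)) \<partial>\<pi>) = W1 (u 0) (u 1)"
  proof (rule antisym)
    have "(\<integral>\<^sup>+\<gamma>. ennreal (dist (\<gamma> 0) (\<gamma> 1)) \<partial>\<pi>) = (\<integral>\<^sup>+x. ennreal (dist (\<Phi> x 0) (\<Phi> x 1)) \<partial>unit_interval)"
      unfolding \<pi>_def using d01 by (intro nn_integral_distr[OF \<Phi>]) simp
    also have "\<dots> \<le> (\<integral>\<^sup>+x. ennreal (dist (Z 0 x) (Z 1 x)) \<partial>unit_interval)"
    proof (rule nn_integral_mono_AE, use AE_good in eventually_elim)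
      case (elim x)
      then show ?case using right_limit_path_0_1[of "\<lambda>t. Z t x"] by (simp add: \<Phi>_def good_def ennreal_leI)
    qed
    also have "\<dots> = W1 (u 0) (u 1)" by (rule ZW[OF dyadic_0 dyadic_1])
    finally show "(\<integral>\<^sup>+\<gamma>. ennreal (dist (\<gamma> 0) (\<gamma> 1)) \<partial>\<pi>) \<le> W1 (u 0) (u 1)" .
    have "prob_space \<pi>" using \<pi> by (simp add: space_prob_algebra)
    from W1_distr_le[OF this ev ev, of 0 1]
    show "W1 (u 0) (u 1) \<le> (\<integral>\<^sup>+\<gamma>. ennreal (dist (\<gamma> 0) (\<gamma> 1)) \<partial>\<pi>)" by (simp add: law\<pi>)
  qed
  \<comment> \<open>\<open>AE_distr_iff\<close> requires a measurable event, hence the detour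
    through dyadic alignment.\<close>
  have "AE \<gamma> in \<pi>. dyadic_aligned \<gamma>"
  proof -
    have "Measurable.pred (path_borel :: (real \<Rightarrow> 'a) measure) dyadic_aligned"
      by (rule measurable_dyadic_aligned) (rule measurable_path_borel_eval[OF dyadic_enum_in(2)])
    then have "{\<gamma> \<in> space path_borel. dyadic_aligned \<gamma>} \<in> sets (path_borel :: (real \<Rightarrow> 'a) measure)"
      by (simp only: pred_def)
    moreover have "AE x in unit_interval. dyadic_aligned (\<Phi> x)"
      using \<Phi>_aligned dyadic_subset unfolding aligned_def dyadic_aligned_def by (intro AE_I2) (auto simp: subset_eq)
    ultimately show ?thesis unfolding \<pi>_def by (subst AE_distr_iff[OF \<Phi>])
  qed
  moreover have "AE \<gamma> in \<pi>. \<gamma> \<in> cadlag UNIV dist"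
    by (rule AE_I2) (simp add: \<pi>_def)
  ultimately have "AE \<gamma> in \<pi>. BV_geodesic UNIV dist \<gamma>"
    by eventually_elim (simp add: Met_TC.BV_geodesic_iff_aligned aligned_if_dyadic_aligned)
  then have "geodesic_lift u \<pi>"
    unfolding geodesic_lift_def using law\<pi> cost W1_finite[OF uP uP, of 0 1] by simp
  then show ?thesis using that[OF \<pi>] by blast
qed

section \<open>Properties of a lifted curve\<close>

locale lifted_curve =
  fixes \<mu> :: "real \<Rightarrow> 'a::polish_space measure" and \<pi> :: "(real \<Rightarrow> 'a) measure"
  assumes \<mu>_0: "\<mu> 0 \<in> P1" and \<pi>: "\<pi> \<in> space (prob_algebra path_borel)" and lift: "geodesic_lift \<mu> \<pi>"
begin

definition cost :: "real \<Rightarrow> real \<Rightarrow> ennreal" where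
  "cost s t = (\<integral>\<^sup>+\<gamma>. ennreal (dist (\<gamma> s) (\<gamma> t)) \<partial>\<pi>)"

lemma prob: "prob_space \<pi>" and sets_\<pi>: "sets \<pi> = sets path_borel"
  using \<pi> by (auto simp: space_prob_algebra)

lemma space_\<pi>: "space \<pi> = cadlag UNIV dist"
  using sets_eq_imp_space_eq[OF sets_\<pi>] by simp

lemma measurable_eval: "t \<in> {0..1} \<Longrightarrow> (\<lambda>\<gamma>. \<gamma> t) \<in> borel_measurable \<pi>"
  unfolding measurable_cong_sets[OF sets_\<pi> refl] by (rule measurable_path_borel_eval)

lemma measurable_cost: "X \<in> borel_measurable \<pi> \<Longrightarrow> Y \<in> borel_measurable \<pi> \<Longrightarrow>
    (\<lambda>\<gamma>. ennreal (dist (X \<gamma>) (Y \<gamma> :: 'a))) \<in> borel_measurable \<pi>"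
  by (rule measurable_compose[OF borel_measurable_dist measurable_ennreal])

lemma AE_aligned: "AE \<gamma> in \<pi>. \<gamma> \<in> cadlag UNIV dist \<and> aligned dist \<gamma>"
  using lift by (simp add: geodesic_lift_def Met_TC.BV_geodesic_iff_aligned)

lemma law: "t \<in> {0..1} \<Longrightarrow> distr \<pi> borel (\<lambda>\<gamma>. \<gamma> t) = \<mu> t"
  using lift by (simp add: geodesic_lift_def)

lemma cost_01: "cost 0 1 = W1 (\<mu> 0) (\<mu> 1)" "cost 0 1 < \<infinity>"
  using lift by (simp_all add: geodesic_lift_def cost_def)

lemma W1_le_cost: "s \<in> {0..1} \<Longrightarrow> t \<in> {0..1} \<Longrightarrow> W1 (\<mu> s) (\<mu> t) \<le> cost s t"
  using W1_distr_le[OF prob measurable_eval measurable_eval, of s t] by (simp only: law cost_def)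

lemma cost_add:
  assumes str: "0 \<le> s" "s \<le> t" "t \<le> r" "r \<le> 1"
  shows "cost s t + cost t r = cost s r"
proof -
  have "cost s t + cost t r = (\<integral>\<^sup>+\<gamma>. ennreal (dist (\<gamma> s) (\<gamma> t)) + ennreal (dist (\<gamma> t) (\<gamma> r)) \<partial>\<pi>)"
    unfolding cost_def using str
    by (intro nn_integral_add[symmetric] measurable_cost measurable_eval) auto
  also have "\<dots> = cost s r"
    unfolding cost_def
  proof (rule nn_integral_cong_AE, use AE_aligned in eventually_elim)
    case (elim \<gamma>)
    then have "dist (\<gamma> s) (\<gamma> t) + dist (\<gamma> t) (\<gamma> r) = dist (\<gamma> s) (\<gamma> r)" using alignedD[OF _ str] by blast
    then show ?case by (simp flip: ennreal_plus)
  qed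
  finally show ?thesis .
qed

lemma cost_finite: "0 \<le> s \<Longrightarrow> s \<le> t \<Longrightarrow> t \<le> 1 \<Longrightarrow> cost s t < \<infinity>"
proof (rule le_less_trans[OF _ cost_01(2)])
  assume st: "0 \<le> s" "s \<le> t" "t \<le> 1"
  have "cost s t \<le> cost 0 s + cost s t" by simp
  also have "\<dots> = cost 0 t" using st by (intro cost_add) auto
  also have "\<dots> \<le> cost 0 t + cost t 1" by simp
  also have "\<dots> = cost 0 1" using st by (intro cost_add) auto
  finally show "cost s t \<le> cost 0 1" .
qed

lemma \<mu>_P1: assumes t: "t \<in> {0..1}" shows "\<mu> t \<in> P1"
proof (rule P1_of_W1_finite[OF \<mu>_0])
  show "\<mu> t \<in> space (prob_algebra borel)"
    unfolding law[OF t, symmetric] by (rule distr_in_prob_algebra[OF prob measurable_eval[OF t]])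
  show "W1 (\<mu> 0) (\<mu> t) < \<infinity>"
    using t by (intro le_less_trans[OF W1_le_cost cost_finite]) auto
qed

lemma W1_eq_cost: assumes st: "0 \<le> s" "s \<le> t" "t \<le> 1" shows "W1 (\<mu> s) (\<mu> t) = cost s t"
proof (rule antisym)
  show "W1 (\<mu> s) (\<mu> t) \<le> cost s t" using st by (intro W1_le_cost) auto
  \<comment> \<open>Finiteness of the outer costs is what allows them to be cancelled in
    \<open>ennreal\<close> at the end.\<close>
  have fin: "cost 0 s \<noteq> \<infinity>" "cost t 1 \<noteq> \<infinity>"
    using cost_finite[of 0 s] cost_finite[of t 1] st by auto
  have "cost 0 s + (cost s t + cost t 1) = cost 0 s + cost s 1"
    using st by (subst cost_add) auto
  also have "\<dots> = cost 0 1" using st by (intro cost_add) auto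
  also have "\<dots> = W1 (\<mu> 0) (\<mu> 1)" by (rule cost_01)
  also have "\<dots> \<le> W1 (\<mu> 0) (\<mu> s) + W1 (\<mu> s) (\<mu> 1)" by (rule W1_triangle)
  also have "\<dots> \<le> cost 0 s + (W1 (\<mu> s) (\<mu> t) + W1 (\<mu> t) (\<mu> 1))"
    using st by (intro add_mono W1_triangle W1_le_cost) auto
  also have "\<dots> \<le> cost 0 s + (W1 (\<mu> s) (\<mu> t) + cost t 1)"
    using st by (intro add_left_mono W1_le_cost) auto
  finally have "cost s t + cost t 1 \<le> W1 (\<mu> s) (\<mu> t) + cost t 1"
    using fin(1) unfolding ennreal_add_left_cancel_le by blast
  then show "cost s t \<le> W1 (\<mu> s) (\<mu> t)"
    using fin(2) unfolding add.commute[of _ "cost t 1"] ennreal_add_left_cancel_le by blast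
qed

lemma W1_dist_eq_cost: "0 \<le> s \<Longrightarrow> s \<le> t \<Longrightarrow> t \<le> 1 \<Longrightarrow> ennreal (W1_dist (\<mu> s) (\<mu> t)) = cost s t"
  by (subst ennreal_W1_dist) (auto intro: \<mu>_P1 W1_eq_cost)

lemma aligned_\<mu>: "aligned W1_dist \<mu>"
  unfolding aligned_def
proof (intro allI impI)
  fix s t r :: real assume str: "0 \<le> s" "s \<le> t" "t \<le> r" "r \<le> 1"
  then have "ennreal (W1_dist (\<mu> s) (\<mu> t)) + ennreal (W1_dist (\<mu> t) (\<mu> r)) = ennreal (W1_dist (\<mu> s) (\<mu> r))"
    by (simp add: W1_dist_eq_cost cost_add)
  then have "ennreal (W1_dist (\<mu> s) (\<mu> t) + W1_dist (\<mu> t) (\<mu> r)) = ennreal (W1_dist (\<mu> s) (\<mu> r))"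
    by (subst ennreal_plus) (auto simp: W1.nonneg)
  then show "W1_dist (\<mu> s) (\<mu> t) + W1_dist (\<mu> t) (\<mu> r) = W1_dist (\<mu> s) (\<mu> r)"
    by (subst (asm) ennreal_inj) auto
qed

lemma dist_le_01:
  assumes al: "aligned dist \<gamma>" and st: "s \<in> {0..1}" "t \<in> {0..1}"
  shows "dist (\<gamma> s) (\<gamma> t) \<le> dist (\<gamma> 0) (\<gamma> (1 :: real) :: 'a)"
proof -
  have *: "dist (\<gamma> s) (\<gamma> t) \<le> dist (\<gamma> 0) (\<gamma> 1)" if "0 \<le> s" "s \<le> t" "t \<le> 1" for s t
    using alignedD[OF al, of 0 s t] alignedD[OF al, of 0 t 1] that
      zero_le_dist[of "\<gamma> 0" "\<gamma> s"] zero_le_dist[of "\<gamma> t" "\<gamma> 1"] by linarith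
  show ?thesis
    using *[of s t] *[of t s] st by (cases "s \<le> t") (auto simp: dist_commute)
qed

text \<open>The limit X is an arbitrary random point, so one statement covers right continuity,
  where X is the value at t, left limits, and the terminal time.\<close>

lemma W1_law_tendsto:
  assumes S: "\<And>n. S n \<in> {0..1}" and X: "X \<in> borel_measurable \<pi>"
    and lim: "\<And>\<gamma>. \<gamma> \<in> cadlag UNIV dist \<Longrightarrow> (\<lambda>n. dist (\<gamma> (S n)) (X \<gamma>)) \<longlonglongrightarrow> 0"
  shows "(\<lambda>n. W1 (\<mu> (S n)) (distr \<pi> borel X)) \<longlonglongrightarrow> 0"
proof -
  have "(\<lambda>n. \<integral>\<^sup>+\<gamma>. ennreal (dist (\<gamma> (S n)) (X \<gamma>)) \<partial>\<pi>) \<longlonglongrightarrow> (\<integral>\<^sup>+\<gamma>. 0 \<partial>\<pi>)"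
  proof (rule nn_integral_dominated_convergence[where w = "\<lambda>\<gamma>. ennreal (dist (\<gamma> 0) (\<gamma> 1))"])
    show "(\<lambda>\<gamma>. ennreal (dist (\<gamma> (S n)) (X \<gamma>))) \<in> borel_measurable \<pi>" for n
      by (rule measurable_cost[OF measurable_eval[OF S] X])
    show "(\<lambda>\<gamma>. ennreal (dist (\<gamma> 0) (\<gamma> 1))) \<in> borel_measurable \<pi>"
      by (intro measurable_cost measurable_eval) auto
    show "AE \<gamma> in \<pi>. ennreal (dist (\<gamma> (S j)) (X \<gamma>)) \<le> ennreal (dist (\<gamma> 0) (\<gamma> 1))" for j
      using AE_aligned
    proof eventually_elim
      case (elim \<gamma>)
      then have l: "(\<lambda>n. dist (\<gamma> (S n)) (X \<gamma>)) \<longlonglongrightarrow> 0" and al: "aligned dist \<gamma>" by (auto intro: lim)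
      from l have "(\<lambda>n. dist (\<gamma> 0) (\<gamma> 1) + dist (\<gamma> (S n)) (X \<gamma>)) \<longlonglongrightarrow> dist (\<gamma> 0) (\<gamma> 1) + 0"
        by (intro tendsto_add tendsto_const)
      moreover have "dist (\<gamma> (S j)) (X \<gamma>) \<le> dist (\<gamma> 0) (\<gamma> 1) + dist (\<gamma> (S n)) (X \<gamma>)" for n
        using dist_le_01[OF al S S, of j n] dist_triangle[of "\<gamma> (S j)" "X \<gamma>" "\<gamma> (S n)"] by simp
      ultimately have "dist (\<gamma> (S j)) (X \<gamma>) \<le> dist (\<gamma> 0) (\<gamma> 1) + 0"
        by (intro LIMSEQ_le_const) auto
      then show ?case by (intro ennreal_leI) simp
    qed
    show "(\<integral>\<^sup>+\<gamma>. ennreal (dist (\<gamma> 0) (\<gamma> 1)) \<partial>\<pi>) < \<infinity>" using cost_01(2) by (simp only: cost_def)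
    show "AE \<gamma> in \<pi>. (\<lambda>n. ennreal (dist (\<gamma> (S n)) (X \<gamma>))) \<longlonglongrightarrow> 0"
      using AE_aligned
    proof eventually_elim
      case (elim \<gamma>)
      then show ?case using tendsto_ennrealI[OF lim[of \<gamma>]] by simp
    qed
  qed simp
  then have *: "(\<lambda>n. \<integral>\<^sup>+\<gamma>. ennreal (dist (\<gamma> (S n)) (X \<gamma>)) \<partial>\<pi>) \<longlonglongrightarrow> 0" by simp
  have "W1 (\<mu> (S n)) (distr \<pi> borel X) \<le> (\<integral>\<^sup>+\<gamma>. ennreal (dist (\<gamma> (S n)) (X \<gamma>)) \<partial>\<pi>)" for n
    using W1_distr_le[OF prob measurable_eval[OF S] X] by (simp only: law[OF S])
  then show ?thesis by (intro tendsto_sandwich[OF _ _ tendsto_const *]) auto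
qed

lemma W1_dist_law_tendsto:
  assumes "\<And>n. S n \<in> {0..1}" "X \<in> borel_measurable \<pi>"
    and "\<And>\<gamma>. \<gamma> \<in> cadlag UNIV dist \<Longrightarrow> (\<lambda>n. dist (\<gamma> (S n)) (X \<gamma>)) \<longlonglongrightarrow> 0"
  shows "(\<lambda>n. W1_dist (\<mu> (S n)) (distr \<pi> borel X)) \<longlonglongrightarrow> 0"
  unfolding W1_dist_def using W1_law_tendsto[OF assms] by (intro tendsto_enn2real) auto

lemma right_continuous_\<mu>:
  assumes t: "0 \<le> t" "t < 1"
  shows "((\<lambda>s. W1_dist (\<mu> s) (\<mu> t)) \<longlongrightarrow> 0) (at_right t)"
proof (rule tendsto_at_right_sequentially[OF t(2)])
  fix S :: "nat \<Rightarrow> real" assume S: "\<And>n. t < S n" "\<And>n. S n < 1" "S \<longlonglongrightarrow> t"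
  have S': "filterlim S (at_right t) sequentially"
    using S by (auto simp: filterlim_at less_imp_neq[THEN not_sym] intro!: always_eventually)
  have "(\<lambda>n. W1_dist (\<mu> (S n)) (distr \<pi> borel (\<lambda>\<gamma>. \<gamma> t))) \<longlonglongrightarrow> 0"
  proof (rule W1_dist_law_tendsto)
    show "S n \<in> {0..1}" for n using S(1,2)[of n] t by simp
    show "(\<lambda>\<gamma>. \<gamma> t) \<in> borel_measurable \<pi>" using t by (intro measurable_eval) auto
    show "(\<lambda>n. dist (\<gamma> (S n)) (\<gamma> t)) \<longlonglongrightarrow> 0" if "\<gamma> \<in> cadlag UNIV dist" for \<gamma>
      by (rule filterlim_compose[OF cadlagD(2)[OF that t] S'])
  qed
  then show "(\<lambda>n. W1_dist (\<mu> (S n)) (\<mu> t)) \<longlonglongrightarrow> 0" using law[of t] t by simp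
qed

lemma left_limit_\<mu>:
  assumes t: "0 < t" "t \<le> 1" and X: "X \<in> borel_measurable \<pi>"
    and lim: "\<And>\<gamma>. \<gamma> \<in> cadlag UNIV dist \<Longrightarrow> ((\<lambda>s. dist (\<gamma> s) (X \<gamma>)) \<longlongrightarrow> 0) (at_left t)"
  shows "((\<lambda>s. W1_dist (\<mu> s) (distr \<pi> borel X)) \<longlongrightarrow> 0) (at_left t)"
proof (rule tendsto_at_left_sequentially[OF t(1)])
  fix S :: "nat \<Rightarrow> real" assume S: "\<And>n. S n < t" "\<And>n. 0 < S n" "S \<longlonglongrightarrow> t"
  have S': "filterlim S (at_left t) sequentially"
    using S by (auto simp: filterlim_at less_imp_neq intro!: always_eventually)
  show "(\<lambda>n. W1_dist (\<mu> (S n)) (distr \<pi> borel X)) \<longlonglongrightarrow> 0"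
  proof (rule W1_dist_law_tendsto[OF _ X])
    show "S n \<in> {0..1}" for n using S(1,2)[of n] t by simp
    show "(\<lambda>n. dist (\<gamma> (S n)) (X \<gamma>)) \<longlonglongrightarrow> 0" if "\<gamma> \<in> cadlag UNIV dist" for \<gamma>
      by (rule filterlim_compose[OF lim[OF that] S'])
  qed
qed

text \<open>The left limit of the measures is the law of the left limit of the paths. Taking it
  along one fixed sequence makes it measurable, and its law lies in \<open>P1\<close> because it is
  at finite W_1 distance from some \<mu> (S n).\<close>

lemma left_limit_\<mu>_exists:
  assumes t: "0 < t" "t \<le> 1"
  shows "\<exists>l\<in>P1. ((\<lambda>s. W1_dist (\<mu> s) l) \<longlongrightarrow> 0) (at_left t)"
proof -
  define S where "S n = t - t / (real n + 2)" for n
  have S: "0 < S n" "S n < t" "S n \<in> {0..1}" for n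
  proof -
    have "t / (real n + 2) < t / 1" using t by (intro divide_strict_left_mono) auto
    then show "0 < S n" "S n < t" "S n \<in> {0..1}" using t by (auto simp: S_def) (smt (verit) divide_pos_pos of_nat_0_le_iff)
  qed
  have "S \<longlonglongrightarrow> t" unfolding S_def by real_asymp
  then have S': "filterlim S (at_left t) sequentially"
    using S by (auto simp: filterlim_at less_imp_neq intro!: always_eventually)
  define X where "X \<gamma> = lim (\<lambda>n. \<gamma> (S n) :: 'a)" for \<gamma>
  have lim: "((\<lambda>s. dist (\<gamma> s) (X \<gamma>)) \<longlongrightarrow> 0) (at_left t)" if \<gamma>: "\<gamma> \<in> cadlag UNIV dist" for \<gamma> :: "real \<Rightarrow> 'a"
  proof -
    obtain l where l: "((\<lambda>s. dist (\<gamma> s) l) \<longlongrightarrow> 0) (at_left t)" using cadlagD(3)[OF \<gamma> t] by blast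
    then have "(\<lambda>n. dist (\<gamma> (S n)) l) \<longlonglongrightarrow> 0" by (rule filterlim_compose[OF _ S'])
    then have "(\<lambda>n. \<gamma> (S n)) \<longlonglongrightarrow> l" by (simp only: tendsto_dist_iff[symmetric])
    then have "X \<gamma> = l" unfolding X_def by (rule limI)
    with l show ?thesis by simp
  qed
  have X: "X \<in> borel_measurable \<pi>"
  proof (rule borel_measurable_LIMSEQ_metric[where f = "\<lambda>n \<gamma>. \<gamma> (S n)"])
    show "(\<lambda>\<gamma>. \<gamma> (S n)) \<in> borel_measurable \<pi>" for n by (rule measurable_eval[OF S(3)])
    fix \<gamma> assume "\<gamma> \<in> space \<pi>"
    then have "\<gamma> \<in> cadlag UNIV dist" by (simp only: space_\<pi>)
    from filterlim_compose[OF lim[OF this] S']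
    show "(\<lambda>n. \<gamma> (S n)) \<longlonglongrightarrow> X \<gamma>" by (simp only: tendsto_dist_iff[symmetric])
  qed
  have "(\<lambda>n. W1 (\<mu> (S n)) (distr \<pi> borel X)) \<longlonglongrightarrow> 0"
    by (rule W1_law_tendsto[OF S(3) X filterlim_compose[OF lim S']])
  then have "\<forall>\<^sub>F n in sequentially. W1 (\<mu> (S n)) (distr \<pi> borel X) < \<infinity>"
    by (rule order_tendstoD(2)) simp
  then obtain n where "W1 (\<mu> (S n)) (distr \<pi> borel X) < \<infinity>"
    by (rule eventually_happens'[OF sequentially_bot, THEN exE])
  then have "distr \<pi> borel X \<in> P1"
    by (rule P1_of_W1_finite[OF \<mu>_P1[OF S(3)] distr_in_prob_algebra[OF prob X]])
  then show ?thesis using left_limit_\<mu>[OF t X lim] by blast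
qed

lemma cadlag_\<mu>: "restrict \<mu> {0..1} \<in> cadlag P1 W1_dist"
proof -
  let ?u = "restrict \<mu> {0..1}"
  have right: "((\<lambda>s. W1_dist (?u s) l) \<longlongrightarrow> 0) (at_right t)"
    if "((\<lambda>s. W1_dist (\<mu> s) l) \<longlongrightarrow> 0) (at_right t)" "0 \<le> t" "t < 1" for t l
    by (rule Lim_transform_eventually[OF that(1)])
      (use that in \<open>auto simp: eventually_at_right_field intro!: exI[of _ 1]\<close>)
  have left: "((\<lambda>s. W1_dist (?u s) l) \<longlongrightarrow> 0) (at_left t)"
    if "((\<lambda>s. W1_dist (\<mu> s) l) \<longlongrightarrow> 0) (at_left t)" "0 < t" "t \<le> 1" for t l
    by (rule Lim_transform_eventually[OF that(1)])
      (use that in \<open>auto simp: eventually_at_left_field intro!: exI[of _ 0]\<close>)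
  have end1: "((\<lambda>s. W1_dist (\<mu> s) (distr \<pi> borel (\<lambda>\<gamma>. \<gamma> 1))) \<longlongrightarrow> 0) (at_left 1)"
  proof (rule left_limit_\<mu>)
    show "(\<lambda>\<gamma>. \<gamma> 1) \<in> borel_measurable \<pi>" by (rule measurable_eval) simp
    show "((\<lambda>s. dist (\<gamma> s) (\<gamma> 1)) \<longlongrightarrow> 0) (at_left 1)" if "\<gamma> \<in> cadlag UNIV dist" for \<gamma> :: "real \<Rightarrow> 'a"
      by (rule cadlagD(4)[OF that])
  qed simp_all
  show ?thesis
    unfolding cadlag_def
  proof (intro CollectI conjI ballI)
    show "?u \<in> {0..1} \<rightarrow>\<^sub>E P1" by (auto intro: \<mu>_P1)
  next
    fix t :: real assume t: "t \<in> {0..<1}"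
    show "((\<lambda>s. W1_dist (?u s) (?u t)) \<longlongrightarrow> 0) (at_right t)"
      using right[OF right_continuous_\<mu>] t by simp
  next
    fix t :: real assume t: "t \<in> {0<..1}"
    then show "\<exists>l\<in>P1. ((\<lambda>s. W1_dist (?u s) l) \<longlongrightarrow> 0) (at_left t)"
      using left_limit_\<mu>_exists[of t] left by auto
  next
    show "((\<lambda>s. W1_dist (?u s) (?u 1)) \<longlongrightarrow> 0) (at_left 1)"
      using left[OF end1] law[of 1] by simp
  qed
qed

section \<open>Jumps and difference quotients of the lifted curve\<close>

text \<open>For almost every path the mass at t is the limit of its distances from slightly earlier
  times to t. The means of these distances are the W_1 distances of the measures, so the mean jump
  of the paths is the jump of the curve.\<close>

lemma W1_dist_tendsto_jump:
  assumes t: "t \<in> {0..1}"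
  shows "(\<lambda>n. ennreal (W1_dist (\<mu> (max 0 (t - 1 / (real n + 1)))) (\<mu> t))) \<longlonglongrightarrow>
    (\<integral>\<^sup>+\<gamma>. emeasure (curve_measure \<gamma>) {t} \<partial>\<pi>)"
proof -
  define S where "S n = max 0 (t - 1 / (real n + 1))" for n
  have S: "0 \<le> S n" "S n \<le> t" "S n \<in> {0..1}" for n
  proof -
    have "t - 1 / (real n + 1) \<le> t" by simp
    then show "0 \<le> S n" "S n \<le> t" using t by (auto simp: S_def)
    then show "S n \<in> {0..1}" using t by simp
  qed
  \<comment> \<open>A measurable representative of the jump: the point mass of
    \<open>curve_measure \<gamma>\<close> is only identified almost everywhere, through this
    limit.\<close>
  define J where "J \<gamma> = liminf (\<lambda>n. ennreal (dist (\<gamma> (S n)) (\<gamma> t :: 'a)))" for \<gamma>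
  have meas: "(\<lambda>\<gamma>. ennreal (dist (\<gamma> (S n)) (\<gamma> t))) \<in> borel_measurable \<pi>" for n
    by (intro measurable_cost measurable_eval S t)
  have lim: "AE \<gamma> in \<pi>. (\<lambda>n. ennreal (dist (\<gamma> (S n)) (\<gamma> t))) \<longlonglongrightarrow> emeasure (curve_measure \<gamma>) {t}"
    using AE_aligned
  proof eventually_elim
    case (elim \<gamma>)
    then show ?case
      unfolding S_def
      using Met_TC.aligned_variation_measure_Icc[of \<gamma> t t] t by simp
  qed
  then have J: "AE \<gamma> in \<pi>. J \<gamma> = emeasure (curve_measure \<gamma>) {t}"
    by eventually_elim (auto simp: J_def intro!: lim_imp_Liminf)
  have "(\<lambda>n. \<integral>\<^sup>+\<gamma>. ennreal (dist (\<gamma> (S n)) (\<gamma> t)) \<partial>\<pi>) \<longlonglongrightarrow> (\<integral>\<^sup>+\<gamma>. J \<gamma> \<partial>\<pi>)"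
  proof (rule nn_integral_dominated_convergence[where w = "\<lambda>\<gamma>. ennreal (dist (\<gamma> 0) (\<gamma> 1))", OF meas])
    show "J \<in> borel_measurable \<pi>" unfolding J_def[abs_def] by (rule borel_measurable_liminf[OF meas])
    show "(\<lambda>\<gamma>. ennreal (dist (\<gamma> 0) (\<gamma> 1))) \<in> borel_measurable \<pi>"
      by (intro measurable_cost measurable_eval) auto
    show "AE \<gamma> in \<pi>. ennreal (dist (\<gamma> (S n)) (\<gamma> t)) \<le> ennreal (dist (\<gamma> 0) (\<gamma> 1))" for n
      using AE_aligned by eventually_elim (intro ennreal_leI dist_le_01 S t; simp)
    show "(\<integral>\<^sup>+\<gamma>. ennreal (dist (\<gamma> 0) (\<gamma> 1)) \<partial>\<pi>) < \<infinity>" using cost_01(2) by (simp only: cost_def)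
    show "AE \<gamma> in \<pi>. (\<lambda>n. ennreal (dist (\<gamma> (S n)) (\<gamma> t))) \<longlonglongrightarrow> J \<gamma>"
      using lim J by eventually_elim simp
  qed
  also have "(\<integral>\<^sup>+\<gamma>. J \<gamma> \<partial>\<pi>) = (\<integral>\<^sup>+\<gamma>. emeasure (curve_measure \<gamma>) {t} \<partial>\<pi>)"
    by (rule nn_integral_cong_AE[OF J])
  also have "(\<lambda>n. \<integral>\<^sup>+\<gamma>. ennreal (dist (\<gamma> (S n)) (\<gamma> t)) \<partial>\<pi>) = (\<lambda>n. ennreal (W1_dist (\<mu> (S n)) (\<mu> t)))"
    using t by (subst W1_dist_eq_cost[OF S(1,2)]) (auto simp: cost_def)
  finally show ?thesis unfolding S_def .
qed

text \<open>Turns condition (v) into a statement about the curve of measures alone, for both signs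
  of h.\<close>

lemma difference_quotient:
  assumes t: "t \<in> {0..1}" "t + h \<in> {0..1}"
  shows "(\<integral>\<^sup>+\<gamma>. ennreal (dist (\<gamma> t) (\<gamma> (t + h)) / \<bar>h\<bar>) \<partial>\<pi>) = ennreal (W1_dist (\<mu> t) (\<mu> (t + h)) / \<bar>h\<bar>)"
proof -
  have eq: "(\<integral>\<^sup>+\<gamma>. ennreal (dist (\<gamma> t) (\<gamma> (t + h))) \<partial>\<pi>) = ennreal (W1_dist (\<mu> t) (\<mu> (t + h)))"
  proof (cases "0 \<le> h")
    case True
    then show ?thesis using W1_dist_eq_cost[of t "t + h"] t by (simp add: cost_def)
  next
    case False
    then show ?thesis
      using W1_dist_eq_cost[of "t + h" t] t by (simp add: cost_def dist_commute W1.commute[of "\<mu> t"])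
  qed
  have div: "ennreal (x / \<bar>h\<bar>) = ennreal (1 / \<bar>h\<bar>) * ennreal x" if "0 \<le> x" for x
    using that by (simp add: ennreal_mult[symmetric])
  have "(\<integral>\<^sup>+\<gamma>. ennreal (dist (\<gamma> t) (\<gamma> (t + h)) / \<bar>h\<bar>) \<partial>\<pi>) =
      (\<integral>\<^sup>+\<gamma>. ennreal (1 / \<bar>h\<bar>) * ennreal (dist (\<gamma> t) (\<gamma> (t + h))) \<partial>\<pi>)"
    by (simp only: div[OF zero_le_dist])
  also have "\<dots> = ennreal (1 / \<bar>h\<bar>) * ennreal (W1_dist (\<mu> t) (\<mu> (t + h)))"
    unfolding eq[symmetric] by (intro nn_integral_cmult measurable_cost measurable_eval t)
  also have "\<dots> = ennreal (W1_dist (\<mu> t) (\<mu> (t + h)) / \<bar>h\<bar>)"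
    by (rule div[symmetric]) (rule W1.nonneg)
  finally show ?thesis .
qed

end

section \<open>Monotone functions with prescribed derivative\<close>

text \<open>Fatou's lemma, applied to the difference quotients; their integrals telescope.\<close>

lemma mono_derivative_le:
  fixes w :: "real \<Rightarrow> real"
  assumes w: "mono w" and right: "(w \<longlongrightarrow> w t) (at_right t)" and D: "0 \<le> D" and st: "s \<le> t"
    and deriv: "AE x in lborel. s < x \<longrightarrow> x < t \<longrightarrow>
      (\<lambda>n. ennreal ((w (x + 1 / (real n + 1)) - w x) / (1 / (real n + 1)))) \<longlonglongrightarrow> ennreal D"
  shows "D * (t - s) \<le> w t - w s"
proof -
  define \<delta> where "\<delta> n = 1 / (real n + 1)" for n
  have \<delta>: "0 < \<delta> n" for n by (simp add: \<delta>_def)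
  have w_meas: "w \<in> borel_measurable borel" by (rule borel_measurable_mono[OF w])
  define q where "q n x = (if x \<in> {s..t} then (w (x + \<delta> n) - w x) / \<delta> n else 0)" for n x
  have q: "q n \<in> borel_measurable borel" for n
    unfolding q_def
    by (intro measurable_If_set borel_measurable_divide borel_measurable_diff measurable_compose[OF _ w_meas] w_meas) simp_all
  have q_nonneg: "0 \<le> q n x" for n x
    using monoD[OF w, of x "x + \<delta> n"] \<delta>[of n] by (simp add: q_def)
  have w_int: "w integrable_on {a..b}" for a b
    using w by (intro integrable_on_mono_on) (auto simp: mono_on_def mono_def)
  have q_int: "(\<integral>\<^sup>+x. ennreal (q n x) \<partial>lborel) \<le> ennreal (w (t + \<delta> n) - w s)" for n
  proof -
    have shift: "((\<lambda>x. w (x + \<delta> n)) has_integral integral {s + \<delta> n..t + \<delta> n} w) {s..t}"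
      using integrable_integral[OF w_int[of "s + \<delta> n" "t + \<delta> n"]]
      unfolding has_integral_shift_Icc_real[symmetric] by (simp add: o_def add.commute)
    define I where "I = (integral {s + \<delta> n..t + \<delta> n} w - integral {s..t} w) / \<delta> n"
    have "((\<lambda>x. (w (x + \<delta> n) - w x) / \<delta> n) has_integral I) {s..t}"
      unfolding I_def by (intro has_integral_divide has_integral_diff shift integrable_integral w_int)
    then have "(q n has_integral I) UNIV"
      unfolding q_def[abs_def] by (simp only: has_integral_restrict_UNIV)
    then have "(\<integral>\<^sup>+x. ennreal (q n x) \<partial>lborel) = ennreal I"
      by (rule nn_integral_has_integral_lborel[OF q q_nonneg])
    also have "I \<le> w (t + \<delta> n) - w s"
    proof -
      \<comment> \<open>The two integrals share their middle part. What remains is one short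
        integral at each end, bounded by monotonicity.\<close>
      have "integral {s..s + \<delta> n} w + integral {s + \<delta> n..t + \<delta> n} w = integral {s..t + \<delta> n} w"
        "integral {s..t} w + integral {t..t + \<delta> n} w = integral {s..t + \<delta> n} w"
        using \<delta>[of n] st by (intro Henstock_Kurzweil_Integration.integral_combine w_int; simp)+
      then have "integral {s + \<delta> n..t + \<delta> n} w - integral {s..t} w = integral {t..t + \<delta> n} w - integral {s..s + \<delta> n} w"
        by linarith
      also have "integral {t..t + \<delta> n} w \<le> integral {t..t + \<delta> n} (\<lambda>_. w (t + \<delta> n))"
        using w by (intro integral_le w_int) (auto dest: monoD)
      also have "integral {t..t + \<delta> n} (\<lambda>_. w (t + \<delta> n)) = \<delta> n * w (t + \<delta> n)" using \<delta>[of n] by simp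
      also have "integral {s..s + \<delta> n} (\<lambda>_. w s) \<le> integral {s..s + \<delta> n} w"
        using w by (intro integral_le w_int) (auto dest: monoD)
      then have "\<delta> n * w (t + \<delta> n) - integral {s..s + \<delta> n} w \<le> \<delta> n * w (t + \<delta> n) - \<delta> n * w s"
        using \<delta>[of n] by simp
      finally have "integral {s + \<delta> n..t + \<delta> n} w - integral {s..t} w \<le> (w (t + \<delta> n) - w s) * \<delta> n"
        by (simp add: algebra_simps)
      then show ?thesis unfolding I_def using \<delta>[of n] by (simp add: pos_divide_le_eq)
    qed
    finally show ?thesis by (simp add: ennreal_leI)
  qed
  have "ennreal (D * (t - s)) = (\<integral>\<^sup>+x. ennreal D * indicator {s<..<t} x \<partial>lborel)"
    using st D by (simp add: nn_integral_cmult_indicator ennreal_mult)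
  also have "\<dots> \<le> (\<integral>\<^sup>+x. liminf (\<lambda>n. ennreal (q n x)) \<partial>lborel)"
  proof (rule nn_integral_mono_AE, use deriv in eventually_elim)
    case (elim x)
    show ?case
    proof (cases "x \<in> {s<..<t}")
      case True
      then have "(\<lambda>n. ennreal (q n x)) \<longlonglongrightarrow> ennreal D" using elim by (simp add: q_def \<delta>_def)
      then have "liminf (\<lambda>n. ennreal (q n x)) = ennreal D" by (intro lim_imp_Liminf) simp_all
      then show ?thesis using True by simp
    qed simp
  qed
  also have "\<dots> \<le> liminf (\<lambda>n. \<integral>\<^sup>+x. ennreal (q n x) \<partial>lborel)"
    by (rule nn_integral_liminf) (subst measurable_cong_sets[OF sets_lborel refl], rule measurable_compose[OF q measurable_ennreal])
  also have "\<dots> \<le> liminf (\<lambda>n. ennreal (w (t + \<delta> n) - w s))"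
    by (rule Liminf_mono[OF always_eventually[OF allI[OF q_int]]])
  \<comment> \<open>Right continuity at t enters here: the upper estimate involves w just after
    t.\<close>
  also have "\<dots> = ennreal (w t - w s)"
  proof (rule lim_imp_Liminf)
    have "(\<lambda>n. t + \<delta> n) \<longlonglongrightarrow> t" unfolding \<delta>_def by real_asymp
    then have "filterlim (\<lambda>n. t + \<delta> n) (at_right t) sequentially"
      unfolding filterlim_at using \<delta> by (simp add: less_imp_neq[THEN not_sym])
    from filterlim_compose[OF right this]
    show "(\<lambda>n. ennreal (w (t + \<delta> n) - w s)) \<longlonglongrightarrow> ennreal (w t - w s)"
      by (intro tendsto_ennrealI tendsto_diff tendsto_const)
  qed simp
  finally show ?thesis
    using monoD[OF w st] by (subst (asm) ennreal_le_iff) simp_all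
qed

section \<open>Distance travelled by the curve of measures\<close>

context lifted_curve
begin

text \<open>Clamping extends the distance travelled to a monotone function on all reals, as
  \<open>mono_derivative_le\<close> expects.\<close>

definition travelled :: "real \<Rightarrow> real" where
  "travelled x = W1_dist (\<mu> 0) (\<mu> (max 0 (min 1 x)))"

lemma travelled_eq: "0 \<le> x \<Longrightarrow> x \<le> 1 \<Longrightarrow> travelled x = W1_dist (\<mu> 0) (\<mu> x)"
  by (simp add: travelled_def)

lemma travelled_diff:
  assumes "0 \<le> s" "s \<le> t" "t \<le> 1"
  shows "travelled t - travelled s = W1_dist (\<mu> s) (\<mu> t)"
  using alignedD[OF aligned_\<mu>, of 0 s t] travelled_eq[of s] travelled_eq[of t] assms by simp

lemma mono_travelled: "mono travelled"
proof (rule monoI)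
  fix x y :: real assume "x \<le> y"
  then have le: "max 0 (min 1 x) \<le> max 0 (min 1 y)" "max 0 (min 1 y) \<le> 1" by auto
  have "travelled (max 0 (min 1 x)) \<le> travelled (max 0 (min 1 y))"
    using travelled_diff[OF max.cobounded1 le] W1.nonneg[of "\<mu> (max 0 (min 1 x))" "\<mu> (max 0 (min 1 y))"]
    by linarith
  moreover have "travelled (max 0 (min 1 x)) = travelled x" "travelled (max 0 (min 1 y)) = travelled y"
    by (simp_all add: travelled_def)
  ultimately show "travelled x \<le> travelled y" by (simp only:)
qed

lemma right_continuous_travelled:
  assumes t: "0 \<le> t" "t \<le> 1"
  shows "(travelled \<longlongrightarrow> travelled t) (at_right t)"
proof (cases "t = 1")
  case True
  have "travelled t = travelled s" if "s \<in> {t<..}" for s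
    using that by (simp add: travelled_def True)
  then have "\<forall>\<^sub>F s in at_right t. travelled t = travelled s"
    unfolding eventually_at_filter by (intro always_eventually allI impI)
  then show ?thesis by (rule Lim_transform_eventually[OF tendsto_const])
next
  case False
  then have t1: "t < 1" using t by simp
  have "((\<lambda>s. travelled t + W1_dist (\<mu> s) (\<mu> t)) \<longlongrightarrow> travelled t + 0) (at_right t)"
    by (intro tendsto_add tendsto_const right_continuous_\<mu> t t1)
  moreover have "\<forall>\<^sub>F s in at_right t. travelled t + W1_dist (\<mu> s) (\<mu> t) = travelled s"
    unfolding eventually_at_right_field
  proof (intro exI[of _ 1] conjI allI impI t1)
    fix s assume s: "t < s" "s < 1"
    have "travelled s - travelled t = W1_dist (\<mu> s) (\<mu> t)"
      unfolding W1.commute[of "\<mu> s" "\<mu> t"] using s t by (intro travelled_diff) simp_all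
    then show "travelled t + W1_dist (\<mu> s) (\<mu> t) = travelled s" by linarith
  qed
  ultimately have "(travelled \<longlongrightarrow> travelled t + 0) (at_right t)" by (rule Lim_transform_eventually)
  then show ?thesis by (simp only: add_0_right)
qed

lemma difference_quotient_travelled:
  assumes h: "0 < h" and x: "0 \<le> x" "x + h \<le> 1"
  shows "(\<integral>\<^sup>+ \<gamma>. ennreal (dist (\<gamma> x) (\<gamma> (x + h)) / \<bar>h\<bar>) \<partial>\<pi>) = ennreal ((travelled (x + h) - travelled x) / h)"
proof -
  have "x \<in> {0..1}" "x + h \<in> {0..1}" using assms by simp_all
  moreover have "travelled (x + h) - travelled x = W1_dist (\<mu> x) (\<mu> (x + h))"
    using assms by (intro travelled_diff) simp_all
  ultimately show ?thesis using difference_quotient[of x h] h by (simp only: abs_of_pos)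
qed

lemma travelled_derivative:
  assumes x: "0 < x" "x < 1"
    and lim: "((\<lambda>h. \<integral>\<^sup>+ \<gamma>. ennreal (dist (\<gamma> x) (\<gamma> (x + h)) / \<bar>h\<bar>) \<partial>\<pi>) \<longlongrightarrow> D) (at 0 within {h. x + h \<in> {0..1}})"
  shows "(\<lambda>n. ennreal ((travelled (x + 1 / (real n + 1)) - travelled x) / (1 / (real n + 1)))) \<longlonglongrightarrow> D"
proof -
  define h where "h n = 1 / (real n + 1)" for n
  have h: "0 < h n" for n by (simp add: h_def)
  have h0: "h \<longlonglongrightarrow> 0" unfolding h_def by real_asymp
  then have ev: "\<forall>\<^sub>F n in sequentially. h n < 1 - x"
    by (rule order_tendstoD(2)) (use x in simp)
  have "\<forall>\<^sub>F n in sequentially. h n \<in> {h. x + h \<in> {0..1}} \<and> h n \<noteq> 0"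
    using ev
  proof eventually_elim
    case (elim n)
    then show ?case using h[of n] x by simp
  qed
  then have "filterlim h (at 0 within {h. x + h \<in> {0..1}}) sequentially"
    using h0 unfolding filterlim_at by (intro conjI)
  from filterlim_compose[OF lim this]
  have "(\<lambda>n. \<integral>\<^sup>+ \<gamma>. ennreal (dist (\<gamma> x) (\<gamma> (x + h n)) / \<bar>h n\<bar>) \<partial>\<pi>) \<longlonglongrightarrow> D" .
  moreover have "\<forall>\<^sub>F n in sequentially. (\<integral>\<^sup>+ \<gamma>. ennreal (dist (\<gamma> x) (\<gamma> (x + h n)) / \<bar>h n\<bar>) \<partial>\<pi>) =
      ennreal ((travelled (x + h n) - travelled x) / h n)"
    using ev
  proof eventually_elim
    case (elim n)
    show ?case by (rule difference_quotient_travelled[OF h]) (use x elim in simp_all)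
  qed
  ultimately show ?thesis unfolding h_def by (rule Lim_transform_eventually)
qed

end

section \<open>Curves of measures\<close>

text \<open>Members of \<open>cadlag\<close> are \<open>undefined\<close> outside I, whereas \<mu>
  is arbitrary there; lifts see only the times in I.\<close>

lemma geodesic_lift_restrict: "geodesic_lift (restrict \<mu> {0..1}) \<pi> \<longleftrightarrow> geodesic_lift \<mu> \<pi>"
  unfolding geodesic_lift_def by simp

lemma aligned_restrict: "aligned d (restrict u {0..1}) \<longleftrightarrow> aligned d u"
  unfolding aligned_def by simp

lemma continuous_curve_cadlag:
  assumes u: "continuous_curve M d u"
  shows "restrict u {0..1} \<in> cadlag M d"
proof -
  let ?u = "restrict u {0..1}"
  have M: "u \<in> {0..1} \<rightarrow> M" and lim: "t \<in> {0..1} \<Longrightarrow> ((\<lambda>s. d (u s) (u t)) \<longlongrightarrow> 0) (at t within {0..1})" for t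
    using u by (auto simp: continuous_curve_def)
  have right: "((\<lambda>s. d (?u s) (?u t)) \<longlongrightarrow> 0) (at_right t)" if t: "0 \<le> t" "t < 1" for t
  proof (rule Lim_transform_eventually)
    show "((\<lambda>s. d (u s) (u t)) \<longlongrightarrow> 0) (at_right t)"
      using tendsto_within_subset[OF lim[of t], of "{t..1}"] t by (simp add: at_within_Icc_at_right)
    show "\<forall>\<^sub>F s in at_right t. d (u s) (u t) = d (?u s) (?u t)"
      using t by (auto simp: eventually_at_right_field intro!: exI[of _ 1])
  qed
  have left: "((\<lambda>s. d (?u s) (?u t)) \<longlongrightarrow> 0) (at_left t)" if t: "0 < t" "t \<le> 1" for t
  proof (rule Lim_transform_eventually)
    show "((\<lambda>s. d (u s) (u t)) \<longlongrightarrow> 0) (at_left t)"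
      using tendsto_within_subset[OF lim[of t], of "{0..t}"] t by (simp add: at_within_Icc_at_left)
    show "\<forall>\<^sub>F s in at_left t. d (u s) (u t) = d (?u s) (?u t)"
      using t by (auto simp: eventually_at_left_field intro!: exI[of _ 0])
  qed
  show ?thesis
    unfolding cadlag_def
  proof (intro CollectI conjI ballI)
    show "?u \<in> {0..1} \<rightarrow>\<^sub>E M" using M by auto
    show "((\<lambda>s. d (?u s) (?u t)) \<longlongrightarrow> 0) (at_right t)" if "t \<in> {0..<1}" for t
      using right[of t] that by simp
    show "\<exists>l\<in>M. ((\<lambda>s. d (?u s) l) \<longlongrightarrow> 0) (at_left t)" if "t \<in> {0<..1}" for t
      using left[of t] that M by (intro bexI[of _ "?u t"]) auto
    show "((\<lambda>s. d (?u s) (?u 1)) \<longlongrightarrow> 0) (at_left 1)" by (rule left) simp_all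
  qed
qed

text \<open>By alignment the distance to u t does not increase as s approaches t from the left, so
  one small term of the sequence bounds all later times.\<close>

lemma aligned_left_continuous:
  assumes al: "aligned d u" and nonneg: "\<And>x y. 0 \<le> d x y" and t: "0 < t" "t \<le> 1"
    and lim: "(\<lambda>n. d (u (max 0 (t - 1 / (real n + 1)))) (u t)) \<longlonglongrightarrow> 0"
  shows "((\<lambda>s. d (u s) (u t)) \<longlongrightarrow> 0) (at_left t)"
proof (rule tendstoI)
  fix e :: real assume "0 < e"
  with lim have "\<forall>\<^sub>F n in sequentially. d (u (max 0 (t - 1 / (real n + 1)))) (u t) < e"
    by (rule order_tendstoD(2))
  then obtain n where n: "d (u (max 0 (t - 1 / (real n + 1)))) (u t) < e"
    by (rule eventually_happens'[OF sequentially_bot, THEN exE])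
  define r where "r = max 0 (t - 1 / (real n + 1))"
  have r: "0 \<le> r" "r < t" using t by (auto simp: r_def)
  have "dist (d (u s) (u t)) 0 < e" if s: "r < s" "s < t" for s
  proof -
    have "d (u r) (u s) + d (u s) (u t) = d (u r) (u t)" using alignedD[OF al, of r s t] r s t by simp
    then have "d (u s) (u t) \<le> d (u r) (u t)" using nonneg[of "u r" "u s"] by linarith
    also have "\<dots> < e" using n by (simp only: r_def)
    finally show ?thesis using nonneg[of "u s" "u t"] by simp
  qed
  then show "\<forall>\<^sub>F s in at_left t. dist (d (u s) (u t)) 0 < e"
    using r(2) by (auto simp: eventually_at_left_field)
qed

lemma geodesic_lift_exists_of_continuous:
  fixes \<mu> :: "real \<Rightarrow> 'a::polish_space measure"
  assumes "continuous_curve P1 W1_dist \<mu>" "aligned W1_dist \<mu>"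
  obtains \<pi> where "\<pi> \<in> space (prob_algebra path_borel)" "geodesic_lift \<mu> \<pi>"
proof (rule geodesic_lift_exists[OF continuous_curve_cadlag[OF assms(1)]])
  show "aligned W1_dist (restrict \<mu> {0..1})" unfolding aligned_restrict by (rule assms(2))
  fix \<pi> :: "(real \<Rightarrow> 'a) measure"
  assume "\<pi> \<in> space (prob_algebra path_borel)" "geodesic_lift (restrict \<mu> {0..1}) \<pi>"
  then show thesis using that[of \<pi>] unfolding geodesic_lift_restrict by blast
qed

lemma BV_geodesic_iff_lift:
  fixes \<mu> :: "real \<Rightarrow> 'a::polish_space measure"
  assumes \<mu>: "\<mu> 0 \<in> P1"
  shows "BV_geodesic P1 W1_dist (restrict \<mu> {0..1}) \<longleftrightarrow>
    (\<exists>\<pi>\<in>space (prob_algebra path_borel). geodesic_lift \<mu> \<pi>)"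
proof
  assume "BV_geodesic P1 W1_dist (restrict \<mu> {0..1})"
  then have "restrict \<mu> {0..1} \<in> cadlag P1 W1_dist" "aligned W1_dist (restrict \<mu> {0..1})"
    by (simp_all only: Metric_space.BV_geodesic_iff_aligned[OF Metric_space_W1])
  then show "\<exists>\<pi>\<in>space (prob_algebra path_borel). geodesic_lift \<mu> \<pi>"
  proof (rule geodesic_lift_exists)
    fix \<pi> :: "(real \<Rightarrow> 'a) measure"
    assume "\<pi> \<in> space (prob_algebra path_borel)" "geodesic_lift (restrict \<mu> {0..1}) \<pi>"
    then show ?thesis unfolding geodesic_lift_restrict by (intro bexI)
  qed
next
  assume "\<exists>\<pi>\<in>space (prob_algebra path_borel). geodesic_lift \<mu> \<pi>"
  then obtain \<pi> :: "(real \<Rightarrow> 'a) measure" where \<pi>': "\<pi> \<in> space (prob_algebra path_borel)" "geodesic_lift \<mu> \<pi>"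
    by (elim bexE)
  interpret lifted_curve \<mu> \<pi> using \<mu> \<pi>' by unfold_locales
  show "BV_geodesic P1 W1_dist (restrict \<mu> {0..1})"
    unfolding Metric_space.BV_geodesic_iff_aligned[OF Metric_space_W1] aligned_restrict by (rule conjI[OF cadlag_\<mu> aligned_\<mu>])
qed

lemma continuous_length_minimising_iff_lift:
  fixes \<mu> :: "real \<Rightarrow> 'a::polish_space measure"
  assumes \<mu>: "\<mu> 0 \<in> P1"
  shows "continuous_curve P1 W1_dist \<mu> \<and> length_minimising W1_dist \<mu> \<longleftrightarrow>
    (\<exists>\<pi>\<in>space (prob_algebra path_borel). geodesic_lift \<mu> \<pi> \<and>
      (\<forall>t\<in>{0..1}. (\<integral>\<^sup>+ \<gamma>. emeasure (curve_measure \<gamma>) {t} \<partial>\<pi>) = 0))"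
proof
  assume *: "continuous_curve P1 W1_dist \<mu> \<and> length_minimising W1_dist \<mu>"
  note cont = conjunct1[OF *, unfolded continuous_curve_def]
  note P1 = conjunct1[OF cont] and lim = bspec[OF conjunct2[OF cont]]
  have al: "aligned W1_dist \<mu>"
    by (rule iffD1[OF Metric_space.length_minimising_iff_aligned[OF Metric_space_W1 P1] conjunct2[OF *]])
  obtain \<pi> :: "(real \<Rightarrow> 'a) measure"
    where \<pi>': "\<pi> \<in> space (prob_algebra path_borel)" "geodesic_lift \<mu> \<pi>"
  proof (rule geodesic_lift_exists_of_continuous[OF conjunct1[OF *] al])
    fix \<pi> :: "(real \<Rightarrow> 'a) measure"
    assume *: "\<pi> \<in> space (prob_algebra path_borel)" "geodesic_lift \<mu> \<pi>"
    show thesis by (rule that[OF *])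
  qed
  interpret lifted_curve \<mu> \<pi> using \<mu> \<pi>' by unfold_locales
  have "(\<integral>\<^sup>+ \<gamma>. emeasure (curve_measure \<gamma>) {t} \<partial>\<pi>) = 0" if t: "t \<in> {0..1}" for t
  proof -
    have zero: "W1_dist (\<mu> t) (\<mu> t) = 0" by (rule W1.mdist_zero) (rule \<mu>_P1[OF t])
    have 1: "continuous (at t within {0..1}) (\<lambda>s. W1_dist (\<mu> s) (\<mu> t))"
      unfolding continuous_within zero by (rule lim[OF t])
    have 2: "max 0 (t - 1 / (real n + 1)) \<in> {0..1}" for n
    proof -
      have "t - 1 / (real n + 1) \<le> t" by simp
      also have "t \<le> 1" using t by simp
      finally show ?thesis by simp
    qed
    have 3: "(\<lambda>n. max 0 (t - 1 / (real n + 1))) \<longlonglongrightarrow> t"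
    proof -
      have "(\<lambda>n. t - 1 / (real n + 1)) \<longlonglongrightarrow> t" by real_asymp
      from tendsto_max[OF tendsto_const this, of 0] show ?thesis using t by simp
    qed
    have "((\<lambda>s. W1_dist (\<mu> s) (\<mu> t)) \<circ> (\<lambda>n. max 0 (t - 1 / (real n + 1)))) \<longlonglongrightarrow> W1_dist (\<mu> t) (\<mu> t)"
      by (rule 1[unfolded continuous_within_sequentially, rule_format]) (intro conjI allI 2 3)
    then have "(\<lambda>n. W1_dist (\<mu> (max 0 (t - 1 / (real n + 1)))) (\<mu> t)) \<longlonglongrightarrow> 0"
      by (simp only: o_def zero)
    from LIMSEQ_unique[OF W1_dist_tendsto_jump[OF t] tendsto_ennrealI[OF this]] show ?thesis
      by (simp only: ennreal_0)
  qed
  then show "\<exists>\<pi>\<in>space (prob_algebra path_borel). geodesic_lift \<mu> \<pi> \<and>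
      (\<forall>t\<in>{0..1}. (\<integral>\<^sup>+ \<gamma>. emeasure (curve_measure \<gamma>) {t} \<partial>\<pi>) = 0)"
    by (intro bexI[OF _ \<pi>'(1)] conjI \<pi>'(2) ballI)
next
  assume "\<exists>\<pi>\<in>space (prob_algebra path_borel). geodesic_lift \<mu> \<pi> \<and>
      (\<forall>t\<in>{0..1}. (\<integral>\<^sup>+ \<gamma>. emeasure (curve_measure \<gamma>) {t} \<partial>\<pi>) = 0)"
  then obtain \<pi> :: "(real \<Rightarrow> 'a) measure" where \<pi>': "\<pi> \<in> space (prob_algebra path_borel)" "geodesic_lift \<mu> \<pi>"
    and all_jump: "\<forall>t\<in>{0..1}. (\<integral>\<^sup>+ \<gamma>. emeasure (curve_measure \<gamma>) {t} \<partial>\<pi>) = 0"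
    by (elim bexE conjE)
  interpret lifted_curve \<mu> \<pi> using \<mu> \<pi>' by unfold_locales
  note jump = bspec[OF all_jump]
  have P1: "\<mu> \<in> {0..1} \<rightarrow> P1" using \<mu>_P1 by blast
  \<comment> \<open>Right continuity holds for every lifted curve; the vanishing of the mean jump
    supplies continuity from the left.\<close>
  have left: "((\<lambda>s. W1_dist (\<mu> s) (\<mu> t)) \<longlongrightarrow> 0) (at_left t)" if t: "0 < t" "t \<le> 1" for t
  proof (rule aligned_left_continuous[OF aligned_\<mu> W1.nonneg t])
    have "t \<in> {0..1}" using t by simp
    then have "(\<lambda>n. ennreal (W1_dist (\<mu> (max 0 (t - 1 / (real n + 1)))) (\<mu> t))) \<longlonglongrightarrow> 0"
      using W1_dist_tendsto_jump[of t] by (simp only: jump)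
    then show "(\<lambda>n. W1_dist (\<mu> (max 0 (t - 1 / (real n + 1)))) (\<mu> t)) \<longlonglongrightarrow> 0"
      by (subst (asm) ennreal_tendsto_0_iff) (rule W1.nonneg)
  qed
  have "((\<lambda>s. W1_dist (\<mu> s) (\<mu> t)) \<longlongrightarrow> 0) (at t within {0..1})" if t: "t \<in> {0..1}" for t
  proof -
    consider "t = 0" | "t = 1" | "0 < t" "t < 1" using t by force
    then show ?thesis
    proof cases
      case 1
      then show ?thesis using right_continuous_\<mu>[of 0] by (simp only: at_within_Icc_at_right zero_less_one order_refl)
    next
      case 2
      then show ?thesis using left[of 1] by (simp only: at_within_Icc_at_left zero_less_one order_refl)
    next
      case 3
      then show ?thesis
        unfolding at_within_Icc_at[OF 3] filterlim_at_split
        by (intro conjI left right_continuous_\<mu>) simp_all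
    qed
  qed
  then have "continuous_curve P1 W1_dist \<mu>"
    unfolding continuous_curve_def by (intro conjI ballI P1)
  moreover have "length_minimising W1_dist \<mu>"
    by (rule iffD2[OF Metric_space.length_minimising_iff_aligned[OF Metric_space_W1 P1] aligned_\<mu>])
  ultimately show "continuous_curve P1 W1_dist \<mu> \<and> length_minimising W1_dist \<mu>" by (rule conjI)
qed

lemma constant_speed_geodesic_iff_lift:
  fixes \<mu> :: "real \<Rightarrow> 'a::polish_space measure"
  assumes \<mu>: "\<mu> 0 \<in> P1"
  shows "constant_speed_geodesic P1 W1_dist \<mu> \<longleftrightarrow>
    (\<exists>\<pi>\<in>space (prob_algebra path_borel). geodesic_lift \<mu> \<pi> \<and>
      (AE t in lborel. t \<in> {0..1} \<longrightarrow>
        ((\<lambda>h. \<integral>\<^sup>+ \<gamma>. ennreal (dist (\<gamma> t) (\<gamma> (t + h)) / \<bar>h\<bar>) \<partial>\<pi>)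
          \<longlongrightarrow> W1 (\<mu> 0) (\<mu> 1)) (at 0 within {h. t + h \<in> {0..1}})))"
proof
  define D where "D = W1_dist (\<mu> 0) (\<mu> 1)"
  assume "constant_speed_geodesic P1 W1_dist \<mu>"
  note * = this[unfolded constant_speed_geodesic_def, folded D_def]
  note P1 = conjunct1[OF *] and speed = bspec[OF bspec[OF conjunct2[OF *]]]
  have al: "aligned W1_dist \<mu>" unfolding aligned_def by (auto simp: speed algebra_simps)
  have "((\<lambda>s. W1_dist (\<mu> s) (\<mu> t)) \<longlongrightarrow> 0) (at t within {0..1})" if t: "t \<in> {0..1}" for t
  proof (rule Lim_transform_eventually)
    have "((\<lambda>s. \<bar>t - s\<bar> * D) \<longlongrightarrow> \<bar>t - t\<bar> * D) (at t within {0..1})" by (intro tendsto_intros)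
    then show "((\<lambda>s. \<bar>t - s\<bar> * D) \<longlongrightarrow> 0) (at t within {0..1})" by simp
    show "\<forall>\<^sub>F s in at t within {0..1}. \<bar>t - s\<bar> * D = W1_dist (\<mu> s) (\<mu> t)"
      unfolding eventually_at_filter by (intro always_eventually) (simp add: speed[OF _ t])
  qed
  then have cont: "continuous_curve P1 W1_dist \<mu>"
    unfolding continuous_curve_def by (intro conjI ballI P1)
  obtain \<pi> :: "(real \<Rightarrow> 'a) measure"
    where \<pi>': "\<pi> \<in> space (prob_algebra path_borel)" "geodesic_lift \<mu> \<pi>"
  proof (rule geodesic_lift_exists_of_continuous[OF cont al])
    fix \<pi> :: "(real \<Rightarrow> 'a) measure"
    assume *: "\<pi> \<in> space (prob_algebra path_borel)" "geodesic_lift \<mu> \<pi>"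
    show thesis by (rule that[OF *])
  qed
  interpret lifted_curve \<mu> \<pi> using \<mu> \<pi>' by unfold_locales
  have W1: "W1 (\<mu> 0) (\<mu> 1) = ennreal D" unfolding D_def by (subst ennreal_W1_dist) (auto intro: \<mu>_P1)
  have "((\<lambda>h. \<integral>\<^sup>+ \<gamma>. ennreal (dist (\<gamma> t) (\<gamma> (t + h)) / \<bar>h\<bar>) \<partial>\<pi>) \<longlongrightarrow> ennreal D)
      (at 0 within {h. t + h \<in> {0..1}})" if t: "t \<in> {0..1}" for t
  proof (rule Lim_transform_eventually[OF tendsto_const])
    have "ennreal D = (\<integral>\<^sup>+ \<gamma>. ennreal (dist (\<gamma> t) (\<gamma> (t + h)) / \<bar>h\<bar>) \<partial>\<pi>)"
      if h: "h \<noteq> 0" "t + h \<in> {0..1}" for h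
      unfolding difference_quotient[OF t h(2)] speed[OF t h(2)] using h(1) by simp
    then show "\<forall>\<^sub>F h in at 0 within {h. t + h \<in> {0..1}}.
        ennreal D = (\<integral>\<^sup>+ \<gamma>. ennreal (dist (\<gamma> t) (\<gamma> (t + h)) / \<bar>h\<bar>) \<partial>\<pi>)"
      unfolding eventually_at_filter mem_Collect_eq by (intro always_eventually allI impI)
  qed
  then show "\<exists>\<pi>\<in>space (prob_algebra path_borel). geodesic_lift \<mu> \<pi> \<and>
      (AE t in lborel. t \<in> {0..1} \<longrightarrow>
        ((\<lambda>h. \<integral>\<^sup>+ \<gamma>. ennreal (dist (\<gamma> t) (\<gamma> (t + h)) / \<bar>h\<bar>) \<partial>\<pi>)
          \<longlongrightarrow> W1 (\<mu> 0) (\<mu> 1)) (at 0 within {h. t + h \<in> {0..1}}))"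
    unfolding W1 by (intro bexI[OF _ \<pi>'(1)] conjI \<pi>'(2) AE_I2 impI)
next
  assume "\<exists>\<pi>\<in>space (prob_algebra path_borel). geodesic_lift \<mu> \<pi> \<and>
      (AE t in lborel. t \<in> {0..1} \<longrightarrow>
        ((\<lambda>h. \<integral>\<^sup>+ \<gamma>. ennreal (dist (\<gamma> t) (\<gamma> (t + h)) / \<bar>h\<bar>) \<partial>\<pi>)
          \<longlongrightarrow> W1 (\<mu> 0) (\<mu> 1)) (at 0 within {h. t + h \<in> {0..1}}))"
  then obtain \<pi> :: "(real \<Rightarrow> 'a) measure" where \<pi>': "\<pi> \<in> space (prob_algebra path_borel)" "geodesic_lift \<mu> \<pi>"
    and speed: "AE t in lborel. t \<in> {0..1} \<longrightarrow>
        ((\<lambda>h. \<integral>\<^sup>+ \<gamma>. ennreal (dist (\<gamma> t) (\<gamma> (t + h)) / \<bar>h\<bar>) \<partial>\<pi>)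
          \<longlongrightarrow> W1 (\<mu> 0) (\<mu> 1)) (at 0 within {h. t + h \<in> {0..1}})"
    by (elim bexE conjE)
  interpret lifted_curve \<mu> \<pi> using \<mu> \<pi>' by unfold_locales
  define D where "D = W1_dist (\<mu> 0) (\<mu> 1)"
  have W1: "W1 (\<mu> 0) (\<mu> 1) = ennreal D" unfolding D_def by (subst ennreal_W1_dist) (auto intro: \<mu>_P1)
  have travelled_01: "travelled 1 - travelled 0 = D" unfolding D_def by (rule travelled_diff) simp_all
  have deriv: "AE x in lborel. 0 < x \<longrightarrow> x < 1 \<longrightarrow>
      (\<lambda>n. ennreal ((travelled (x + 1 / (real n + 1)) - travelled x) / (1 / (real n + 1)))) \<longlonglongrightarrow> ennreal D"
    using speed
  proof eventually_elim
    case (elim x)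
    show ?case
    proof (intro impI travelled_derivative)
      assume "0 < x" "x < 1"
      then have "x \<in> {0..1}" by simp
      from elim[THEN mp, OF this]
      show "((\<lambda>h. \<integral>\<^sup>+ \<gamma>. ennreal (dist (\<gamma> x) (\<gamma> (x + h)) / \<bar>h\<bar>) \<partial>\<pi>) \<longlongrightarrow> ennreal D)
          (at 0 within {h. x + h \<in> {0..1}})" by (simp only: W1)
    qed
  qed
  have le: "D * (t - s) \<le> travelled t - travelled s" if st: "0 \<le> s" "s \<le> t" "t \<le> 1" for s t
  proof (rule mono_derivative_le[OF mono_travelled right_continuous_travelled _ st(2)])
    show "AE x in lborel. s < x \<longrightarrow> x < t \<longrightarrow>
        (\<lambda>n. ennreal ((travelled (x + 1 / (real n + 1)) - travelled x) / (1 / (real n + 1)))) \<longlonglongrightarrow> ennreal D"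
      using deriv
    proof eventually_elim
      case (elim x)
      show ?case by (intro impI elim[rule_format]) (use st in simp_all)
    qed
    show "0 \<le> D" unfolding D_def by (rule W1.nonneg)
  qed (use st in simp_all)
  \<comment> \<open>The lower bounds on [0, s], [s, t] and [t, 1] add up to D, which is the total
    distance travelled; hence each of them is an equality.\<close>
  have eq: "W1_dist (\<mu> s) (\<mu> t) = (t - s) * D" if st: "0 \<le> s" "s \<le> t" "t \<le> 1" for s t
  proof (rule antisym)
    have "D * (s - 0) \<le> travelled s - travelled 0" "D * (1 - t) \<le> travelled 1 - travelled t"
      using st by (intro le; simp)+
    then have "D * s + D * (1 - t) \<le> D - (travelled t - travelled s)" using travelled_01 by simp
    then show "W1_dist (\<mu> s) (\<mu> t) \<le> (t - s) * D"
      unfolding travelled_diff[OF st] by (simp add: algebra_simps)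
    show "(t - s) * D \<le> W1_dist (\<mu> s) (\<mu> t)"
      using le[OF st] unfolding travelled_diff[OF st] by (simp only: mult.commute)
  qed
  show "constant_speed_geodesic P1 W1_dist \<mu>"
    unfolding constant_speed_geodesic_def D_def[symmetric]
  proof (intro conjI ballI)
    show "\<mu> \<in> {0..1} \<rightarrow> P1" using \<mu>_P1 by blast
    fix s t :: real assume "s \<in> {0..1}" "t \<in> {0..1}"
    then show "W1_dist (\<mu> s) (\<mu> t) = \<bar>t - s\<bar> * D"
      using eq[of s t] eq[of t s] W1.commute[of "\<mu> s" "\<mu> t"] by (cases "s \<le> t") simp_all
  qed
qed

theorem theorem4p5:
  fixes \<mu> :: "real \<Rightarrow> 'a::polish_space measure"
  assumes "\<forall>t\<in>{0..1}. \<mu> t \<in> space (prob_algebra borel)"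
    and "\<mu> 0 \<in> P1"
  shows
    "(BV_geodesic P1 W1_dist (restrict \<mu> {0..1}) \<longleftrightarrow>
       (\<exists>\<pi>\<in>space (prob_algebra path_borel). geodesic_lift \<mu> \<pi>)) \<and>
     (continuous_curve P1 W1_dist \<mu> \<and> length_minimising W1_dist \<mu> \<longleftrightarrow>
       (\<exists>\<pi>\<in>space (prob_algebra path_borel). geodesic_lift \<mu> \<pi> \<and>
          (\<forall>t\<in>{0..1}. (\<integral>\<^sup>+ \<gamma>. emeasure (curve_measure \<gamma>) {t} \<partial>\<pi>) = 0))) \<and>
     (constant_speed_geodesic P1 W1_dist \<mu> \<longleftrightarrow>
       (\<exists>\<pi>\<in>space (prob_algebra path_borel). geodesic_lift \<mu> \<pi> \<and>
          (AE t in lborel. t \<in> {0..1} \<longrightarrow>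
             ((\<lambda>h. \<integral>\<^sup>+ \<gamma>. ennreal (dist (\<gamma> t) (\<gamma> (t + h)) / \<bar>h\<bar>) \<partial>\<pi>)
                \<longlongrightarrow> W1 (\<mu> 0) (\<mu> 1)) (at 0 within {h. t + h \<in> {0..1}}))))"
  using BV_geodesic_iff_lift[of \<mu>, OF assms(2)]
    continuous_length_minimising_iff_lift[of \<mu>, OF assms(2)]
    constant_speed_geodesic_iff_lift[of \<mu>, OF assms(2)]
  by (intro conjI)

end
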